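(* Let $1<p<\infty$ and let $(a,b)\in L^\infty\times L^\infty$ be a Fredholm $\alpha$-matching pair (with respect to $H^p$) with subordinated pair $(c,d)$, $c=ab^{-1}$, $d=ba_\alpha^{-1}$; put $\kappa_1:=\operatorname{ind}T(c)$, $\kappa_2:=\operatorname{ind}T(d)$ on $H^p$. Assume $\kappa_1\le-1$ and $\kappa_2\ge1$, and let $n\in\mathbb N$ be the unique number with $0\le 2n+\kappa_1\le1$. Let $\varphi_\alpha^\pm:=\varphi^\pm_{\alpha;(a\chi^{-n},\,b\chi^n)}$. Consider $T(a)\pm H_\alpha(b)$ on $H^p$. Then: (i) If $\kappa_1$ is odd and $c=c_-t^{-\kappa_1}c_+$ is the Wiener–Hopf factorization of $c$ in $H^p$, then $$\ker(T(a)\pm H_\alpha(b))=T(\chi^{-n})\left(\left\{\frac{1\mp\boldsymbol\sigma_\alpha(c)}2\,c_+^{-1}\mathbb C\dotplus\varphi_\alpha^\pm(\operatorname{im}\mathbf P_\alpha^\pm(d))\right\}\cap\operatorname{im}T(\chi^n)\right).$$ (ii) If $\kappa_1$ is even, then $$\ker(T(a)\pm H_\alpha(b))=T(\chi^{-n})\left(\varphi_\alpha^\pm(\operatorname{im}\mathbf P_\alpha^\pm(d))\cap\operatorname{im}T(\chi^n)\right).$$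
   Context: $\mathbb T$ is the unit circle, $L^p=L^p(\mathbb T)$, $1/p+1/q=1$. For $1\le p\le\infty$, $H^p=\{f\in L^p:\widehat f_n=0,\ n<0\}$, $\overline{H^p}=\{f\in L^p:\widehat f_n=0,\ n>0\}$; elements of $H^p$ are identified with their analytic extensions to the open unit disc, and for $f\in\overline{H^p}$, $f(\infty):=\widehat f_0$. For $1<p<\infty$, $P:\sum_{n\in\mathbb Z}\widehat f_nt^n\mapsto\sum_{n\ge0}\widehat f_nt^n$ on $L^p$, $Q=I-P$. Fix $\beta\in\mathbb C$, $|\beta|>1$, $\lambda:=i\sqrt{|\beta|^2-1}$, $\alpha(t)=\dfrac{t-\beta}{\overline\beta t-1}$ (a map of $\mathbb T$ onto itself, $\alpha\circ\alpha=\mathrm{id}$), $a_\alpha:=a\circ\alpha$, $\chi(t):=(\overline\beta t-1)/\lambda$ (so $\chi\chi_\alpha=1$), and $J_\alpha\varphi(t):=\chi(t)^{-1}\varphi(\alpha(t))$. For $a\in L^\infty$, on $H^p$: $T(a)\varphi=P(a\varphi)$, $H_\alpha(a)\varphi=P(aQJ_\alpha\varphi)$. An operator $A$ is Fredholm if its range is closed and $\ker A$, $\operatorname{coker}A:=\ker A^*$ are finite-dimensional; $\operatorname{ind}A=\dim\ker A-\dim\operatorname{coker}A$. $(a,b)\in L^\infty\times L^\infty$ is an $\alpha$-matching pair if $a$ is invertible in $L^\infty$ and $aa_\alpha=bb_\alpha$ (so $b$ is invertible too). Its subordinated pair is $(c,d)$, $c=ab^{-1}$, $d=ba_\alpha^{-1}$;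 then $cc_\alpha=dd_\alpha=1$. The pair $(a,b)$ is Fredholm if $T(c),T(d)$ are Fredholm on $H^p$. The pair $(a\chi^{-n},b\chi^n)$ is then $\alpha$-matching with subordinated pair $(c\chi^{-2n},d)$. For $g\in L^\infty$ with $gg_\alpha=1$: $\mathbf P_\alpha(g):=J_\alpha QgP|_{\ker T(g)}$ maps $\ker T(g)$ to itself with square $I$, and $\mathbf P_\alpha^\pm(g):=\frac12(I\pm\mathbf P_\alpha(g))$ are complementary projections on $\ker T(g)$. Wiener–Hopf factorization of $g$ in $H^p$, where $T(g)$ is Fredholm on $H^p$ with index $n$: $g=g_-t^{-n}g_+$, $g_-(\infty)=1$, $g_+\in H^q$, $g_+^{-1}\in H^p$, $g_-\in\overline{H^p}$, $g_-^{-1}\in\overline{H^q}$, and $g_+^{-1}Pg_-^{-1}I$, defined on $\operatorname{span}\{t^k:k\ge0\}$, extends to a bounded operator on $H^p$ (it exists and is unique). If also $gg_\alpha=1$, the $\alpha$-signature is $\boldsymbol\sigma_\alpha(g):=(\lambda/\overline\beta)^n\,g_+^{-1}(1/\overline\beta)\in\{-1,1\}$. If $T(g)$ is Fredholm with index $\kappa\ge0$, $T_r^{-1}(g):=T^{-1}(gt^{\kappa})T(t^{\kappa})$, a right inverse of $T(g)$. For an $\alpha$-matching pair $(a',b')$ with subordinated pair $(c',d')$, $T(c')$ Fredholm of non-negative index, and $s\in\ker T(d')$: $$2\varphi^\pm_{\alpha;(a',b')}(s):=T_r^{-1}(c')T((a'_\alpha)^{-1})s\mp J_\alpha Qc'P\,T_r^{-1}(c')T((a'_\alpha)^{-1})s\pm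 J_\alpha Q(a'_\alpha)^{-1}s.$$ $\dotplus$ denotes direct sum, and $z f\,\mathbb C:=\{z w f:w\in\mathbb C\}$. *)

theory Defs
  imports "HOL-Probability.Probability" "HOL-Library.Function_Algebras"
begin

section \<open>Measurable functions on the unit circle modulo null sets\<close>

text \<open>Normalized arc length measure on the unit circle, regarded as a Borel measure on \<open>\<complex>\<close>.\<close>

definition circle_measure :: "complex measure" where
  "circle_measure = distr (uniform_measure lborel {0..2*pi}) borel cis"

lemma sets_circle_measure [measurable_cong, simp]: "sets circle_measure = sets borel"
  by (simp add: circle_measure_def)

lemma space_circle_measure [simp]: "space circle_measure = UNIV"
  by (simp add: circle_measure_def)

lemma cis_borel [measurable]: "cis \<in> borel_measurable borel"
  by (intro borel_measurable_continuous_onI continuous_intros)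

lemma prob_space_circle_measure: "prob_space circle_measure"
  unfolding circle_measure_def
  by (intro prob_space.prob_space_distr prob_space_uniform_measure) auto

lemma AE_circle_measure_False: "\<not> (AE t in circle_measure. False)"
  using prob_space.AE_False[OF prob_space_circle_measure] by simp

text \<open>
  The elements of all the spaces \<open>L\<^sup>p\<close> live in one type: classes of Borel functions modulo equality
  almost everywhere on the circle. (Values off the unit circle are irrelevant, and every Lebesgue
  measurable function on the circle is almost everywhere equal to a Borel function.)
\<close>

definition eq_ae :: "(complex \<Rightarrow> complex) \<Rightarrow> (complex \<Rightarrow> complex) \<Rightarrow> bool" where
  "eq_ae f g \<longleftrightarrow> f \<in> borel_measurable borel \<and> g \<in> borel_measurable borel
     \<and> (AE t in circle_measure. f t = g t)"

lemma part_equivp_eq_ae: "part_equivp eq_ae"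
proof (rule part_equivpI)
  show "\<exists>x. eq_ae x x"
    by (rule exI[of _ "\<lambda>_. 0"]) (simp add: eq_ae_def)
  show "symp eq_ae"
    by (auto simp: eq_ae_def symp_def)
  show "transp eq_ae"
  proof (rule transpI)
    fix f g h assume fg: "eq_ae f g" and gh: "eq_ae g h"
    have "AE t in circle_measure. f t = g t" "AE t in circle_measure. g t = h t"
      using fg gh by (auto simp: eq_ae_def)
    then have "AE t in circle_measure. f t = h t"
      by eventually_elim simp
    then show "eq_ae f h" using fg gh by (simp add: eq_ae_def)
  qed
qed

quotient_type circ_fun = "complex \<Rightarrow> complex" / partial: eq_ae
  by (rule part_equivp_eq_ae)

instantiation circ_fun :: comm_ring_1
begin

lift_definition zero_circ_fun :: circ_fun is "\<lambda>_. 0" by (simp add: eq_ae_def)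
lift_definition one_circ_fun :: circ_fun is "\<lambda>_. 1" by (simp add: eq_ae_def)
lift_definition plus_circ_fun :: "circ_fun \<Rightarrow> circ_fun \<Rightarrow> circ_fun" is "\<lambda>f g t. f t + g t"
  by (auto simp: eq_ae_def)
lift_definition minus_circ_fun :: "circ_fun \<Rightarrow> circ_fun \<Rightarrow> circ_fun" is "\<lambda>f g t. f t - g t"
  by (auto simp: eq_ae_def)
lift_definition uminus_circ_fun :: "circ_fun \<Rightarrow> circ_fun" is "\<lambda>f t. - f t"
  by (auto simp: eq_ae_def)
lift_definition times_circ_fun :: "circ_fun \<Rightarrow> circ_fun \<Rightarrow> circ_fun" is "\<lambda>f g t. f t * g t"
  by (auto simp: eq_ae_def)

instance
  by standard
    (transfer, auto simp: eq_ae_def algebra_simps AE_circle_measure_False)+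

end

text \<open>The inverse is taken pointwise. It is a genuine inverse of \<open>f\<close> iff \<open>f \<noteq> 0\<close> almost everywhere, i.e.
  iff \<open>f dvd 1\<close>. With this instance \<open>power_int\<close> provides integer powers.\<close>

instantiation circ_fun :: inverse
begin

lift_definition inverse_circ_fun :: "circ_fun \<Rightarrow> circ_fun" is "\<lambda>f t. inverse (f t)"
  by (auto simp: eq_ae_def)
definition divide_circ_fun :: "circ_fun \<Rightarrow> circ_fun \<Rightarrow> circ_fun" where
  "divide_circ_fun f g = f * inverse g"
instance ..

end

lift_definition scaleC :: "complex \<Rightarrow> circ_fun \<Rightarrow> circ_fun"  (infixr "*\<^sub>C" 75)
  is "\<lambda>z f t. z * f t"
  by (auto simp: eq_ae_def)

interpretation circ: vector_space scaleC
  by standard (transfer, auto simp: eq_ae_def algebra_simps)+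

lift_definition tvar :: circ_fun is "\<lambda>t. t"
  by (simp add: eq_ae_def)

text \<open>\<open>\<integral> \<bar>f\<bar>\<^sup>p\<close> is finite.\<close>

lift_definition in_Lp :: "real \<Rightarrow> circ_fun \<Rightarrow> bool"
  is "\<lambda>p f. integrable circle_measure (\<lambda>t. norm (f t) powr p)"
proof -
  fix p f g assume *: "eq_ae f g"
  then have [measurable]: "f \<in> borel_measurable borel" "g \<in> borel_measurable borel"
    by (auto simp: eq_ae_def)
  show "integrable circle_measure (\<lambda>t. norm (f t) powr p)
      = integrable circle_measure (\<lambda>t. norm (g t) powr p)"
    using * by (intro integrable_cong_AE) (auto simp: eq_ae_def)
qed

lift_definition Lp_norm :: "real \<Rightarrow> circ_fun \<Rightarrow> real"
  is "\<lambda>p f. (integral\<^sup>L circle_measure (\<lambda>t. norm (f t) powr p)) powr (1 / p)"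
proof -
  fix p f g assume *: "eq_ae f g"
  then have [measurable]: "f \<in> borel_measurable borel" "g \<in> borel_measurable borel"
    by (auto simp: eq_ae_def)
  have "integral\<^sup>L circle_measure (\<lambda>t. norm (f t) powr p)
      = integral\<^sup>L circle_measure (\<lambda>t. norm (g t) powr p)"
    using * by (intro integral_cong_AE) (auto simp: eq_ae_def)
  then show "(integral\<^sup>L circle_measure (\<lambda>t. norm (f t) powr p)) powr (1 / p)
      = (integral\<^sup>L circle_measure (\<lambda>t. norm (g t) powr p)) powr (1 / p)"
    by simp
qed

lift_definition in_Linf :: "circ_fun \<Rightarrow> bool"
  is "\<lambda>f. \<exists>C. AE t in circle_measure. norm (f t) \<le> C"
proof -
  fix f g assume "eq_ae f g"
  then have "AE t in circle_measure. f t = g t"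
    by (simp add: eq_ae_def)
  then have "(AE t in circle_measure. norm (f t) \<le> C) \<longleftrightarrow> (AE t in circle_measure. norm (g t) \<le> C)" for C
    by (rule eventually_subst[OF eventually_mono]) simp
  then show "(\<exists>C. AE t in circle_measure. norm (f t) \<le> C)
      = (\<exists>C. AE t in circle_measure. norm (g t) \<le> C)"
    by simp
qed

definition Lp :: "real \<Rightarrow> circ_fun set" where
  "Lp p = {f. in_Lp p f}"

definition Linf :: "circ_fun set" where
  "Linf = {f. in_Linf f}"

definition Linf_invertible :: "circ_fun \<Rightarrow> bool" where
  "Linf_invertible f \<longleftrightarrow> f \<in> Linf \<and> (\<exists>g\<in>Linf. f * g = 1)"

lift_definition fourier :: "circ_fun \<Rightarrow> int \<Rightarrow> complex"
  is "\<lambda>f n. integral\<^sup>L circle_measure (\<lambda>t. f t * t powi (- n))"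
proof -
  fix f g assume *: "eq_ae f g"
  then have [measurable]: "f \<in> borel_measurable borel" "g \<in> borel_measurable borel"
    by (auto simp: eq_ae_def)
  have [measurable]: "(\<lambda>t::complex. t powi k) \<in> borel_measurable borel" for k
    unfolding power_int_def by simp
  have "integral\<^sup>L circle_measure (\<lambda>t. f t * t powi (- n))
      = integral\<^sup>L circle_measure (\<lambda>t. g t * t powi (- n))" for n
    using * by (intro integral_cong_AE) (auto simp: eq_ae_def)
  then show "(\<lambda>n. integral\<^sup>L circle_measure (\<lambda>t. f t * t powi (- n)))
      = (\<lambda>n. integral\<^sup>L circle_measure (\<lambda>t. g t * t powi (- n)))"
    by simp
qed

section \<open>Hardy spaces and the analytic projection\<close>

definition Hp :: "real \<Rightarrow> circ_fun set" where
  "Hp p = {f \<in> Lp p. \<forall>n<0. fourier f n = 0}"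

definition Hp_bar :: "real \<Rightarrow> circ_fun set" where
  "Hp_bar p = {f \<in> Lp p. \<forall>n>0. fourier f n = 0}"

text \<open>The analytic extension of an element of a Hardy space to the open unit disc.\<close>

definition disc_ext :: "circ_fun \<Rightarrow> complex \<Rightarrow> complex" where
  "disc_ext f z = (\<Sum>n. fourier f (int n) * z ^ n)"

definition conj_exponent :: "real \<Rightarrow> real" where
  "conj_exponent p = p / (p - 1)"

text \<open>For \<open>f \<in> L\<^sup>p\<close>, \<open>1 < p < \<infinity>\<close>, the element described here exists by M. Riesz's theorem, and it is
  determined by its Fourier coefficients.\<close>

definition proj_P :: "real \<Rightarrow> circ_fun \<Rightarrow> circ_fun" where
  "proj_P p f = (THE g. g \<in> Lp p \<and> (\<forall>n. fourier g n = (if n \<ge> 0 then fourier f n else 0)))"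

definition proj_Q :: "real \<Rightarrow> circ_fun \<Rightarrow> circ_fun" where
  "proj_Q p f = f - proj_P p f"

section \<open>The shift\<close>

definition alpha :: "complex \<Rightarrow> complex \<Rightarrow> complex" where
  "alpha \<beta> t = (t - \<beta>) / (cnj \<beta> * t - 1)"

definition lam :: "complex \<Rightarrow> complex" where
  "lam \<beta> = \<i> * complex_of_real (sqrt ((norm \<beta>)\<^sup>2 - 1))"

lift_definition chi :: "complex \<Rightarrow> circ_fun" is "\<lambda>\<beta> t. (cnj \<beta> * t - 1) / lam \<beta>"
  by (simp add: eq_ae_def)

text \<open>Composition with \<open>alpha \<beta>\<close>. For \<open>\<bar>\<beta>\<bar> > 1\<close> the choice of the representative does not matter, see
  the lemma \<open>comp_alpha_abs\<close> below.\<close>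

definition comp_alpha :: "complex \<Rightarrow> circ_fun \<Rightarrow> circ_fun" where
  "comp_alpha \<beta> f = abs_circ_fun (\<lambda>t. rep_circ_fun f (alpha \<beta> t))"

lemma alpha_borel [measurable]: "alpha \<beta> \<in> borel_measurable borel"
  unfolding alpha_def by measurable

lemma alpha_denom_nonzero:
  assumes "1 < norm \<beta>" "norm t = 1"
  shows "cnj \<beta> * t - 1 \<noteq> 0"
proof
  assume "cnj \<beta> * t - 1 = 0"
  then have "cnj \<beta> * t = 1" by simp
  then have "norm (cnj \<beta> * t) = 1" by simp
  then show False using assms by (simp add: norm_mult)
qed

lemma norm_alpha:
  assumes "1 < norm \<beta>" "norm t = 1"
  shows "norm (alpha \<beta> t) = 1"
proof -
  have tt: "t * cnj t = 1" using assms by (simp add: complex_norm_square[symmetric])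
  have "t - \<beta> = - (t * cnj (cnj \<beta> * t - 1))"
    using tt by (simp add: algebra_simps)
  then have "norm (t - \<beta>) = norm (cnj \<beta> * t - 1)"
    using assms by (metis complex_mod_cnj mult_1 norm_minus_cancel norm_mult)
  then show ?thesis
    using alpha_denom_nonzero[OF assms] by (simp add: alpha_def norm_divide)
qed

lemma alpha_alpha:
  assumes "1 < norm \<beta>" "norm t = 1"
  shows "alpha \<beta> (alpha \<beta> t) = t"
proof -
  let ?d = "cnj \<beta> * t - 1"
  have d: "?d \<noteq> 0" by (rule alpha_denom_nonzero[OF assms])
  have d': "cnj \<beta> * alpha \<beta> t - 1 \<noteq> 0"
    by (rule alpha_denom_nonzero[OF assms(1) norm_alpha[OF assms]])
  have ad: "alpha \<beta> t * ?d = t - \<beta>"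
    using d by (simp add: alpha_def)
  have "(alpha \<beta> t - \<beta>) * ?d = t * (cnj \<beta> * alpha \<beta> t - 1) * ?d"
    using ad by algebra
  then have "alpha \<beta> t - \<beta> = t * (cnj \<beta> * alpha \<beta> t - 1)"
    using d by simp
  then show ?thesis
    using d' by (simp add: alpha_def[of \<beta> "alpha \<beta> t"])
qed

lemma null_sets_circle_measure_iff:
  assumes [measurable]: "N \<in> sets borel"
  shows "N \<in> null_sets circle_measure \<longleftrightarrow> negligible (cis -` N \<inter> {0..2*pi})"
proof -
  have m: "cis -` N \<in> sets borel"
    using measurable_sets[OF cis_borel assms] by simp
  have "emeasure circle_measure N = emeasure lborel ({0..2*pi} \<inter> cis -` N) / ennreal (2*pi)"
    using m by (simp add: circle_measure_def emeasure_distr)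
  then have "N \<in> null_sets circle_measure \<longleftrightarrow> emeasure lborel ({0..2*pi} \<inter> cis -` N) = 0"
    using assms by (auto simp: null_sets_def ennreal_divide_eq_0_iff)
  also have "\<dots> \<longleftrightarrow> {0..2*pi} \<inter> cis -` N \<in> null_sets lborel"
    using m by (auto simp: null_sets_def)
  also have "\<dots> \<longleftrightarrow> negligible (cis -` N \<inter> {0..2*pi})"
    using m by (subst negligible_iff_null_sets)
      (auto simp: null_sets_def Int_commute)
  finally show ?thesis .
qed

lemma alpha_vimage_null:
  assumes \<beta>: "1 < norm \<beta>" and N: "N \<in> null_sets circle_measure"
  shows "alpha \<beta> -` N \<in> null_sets circle_measure"
proof -
  have Nb [measurable]: "N \<in> sets borel" using N by auto
  have Ab: "alpha \<beta> -` N \<in> sets borel"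
    using measurable_sets[OF alpha_borel Nb] by simp
  define S where "S = {x \<in> cis -` N \<inter> {0..2*pi}. - alpha \<beta> (cis x) \<notin> \<real>\<^sub>\<le>\<^sub>0}"
  define g where "g x = Im (Ln (- alpha \<beta> (cis x))) + pi" for x
  have negS: "negligible S"
    by (rule negligible_subset[OF N[unfolded null_sets_circle_measure_iff[OF Nb]]])
       (auto simp: S_def)
  have cisd: "(cis has_derivative (\<lambda>h. h *\<^sub>R (\<i> * cis x))) (at x)" for x
    by (rule has_derivative_cis[OF has_derivative_ident])
  have "g differentiable (at x)" if "x \<in> S" for x
  proof -
    let ?F = "\<lambda>z. Ln (- alpha \<beta> z)"
    have "(\<lambda>z. - alpha \<beta> z) field_differentiable (at (cis x))"
      using alpha_denom_nonzero[OF \<beta>, of "cis x"] unfolding alpha_def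
      by (intro derivative_intros) auto
    moreover have "Ln field_differentiable (at (- alpha \<beta> (cis x)))"
      using that by (intro field_differentiable_at_Ln) (simp add: S_def)
    ultimately have "?F field_differentiable (at (cis x))"
      using field_differentiable_compose[of "\<lambda>z. - alpha \<beta> z" "cis x" Ln] by (simp add: o_def)
    then have "?F differentiable (at (cis x))"
      by (rule field_differentiable_imp_differentiable)
    moreover have "cis differentiable (at x)"
      using cisd differentiable_def by blast
    ultimately have "(?F \<circ> cis) differentiable (at x)"
      by (intro differentiable_chain_at)
    then have "(\<lambda>x. ?F (cis x)) differentiable (at x)" by (simp add: o_def)
    then obtain D where "((\<lambda>x. ?F (cis x)) has_derivative D) (at x)"
      by (auto simp: differentiable_def)
    then have "(g has_derivative (\<lambda>h. Im (D h))) (at x)"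
      unfolding g_def by (auto intro!: derivative_eq_intros)
    then show ?thesis by (auto simp: differentiable_def)
  qed
  then have "g differentiable_on S"
    by (simp add: differentiable_at_imp_differentiable_on)
  then have neg: "negligible (g ` S \<union> {0, 2*pi})"
    using negligible_differentiable_image_negligible[OF order_refl negS, of g] by simp
  have "cis -` (alpha \<beta> -` N) \<inter> {0..2*pi} \<subseteq> g ` S \<union> {0, 2*pi}"
  proof
    fix y assume y: "y \<in> cis -` (alpha \<beta> -` N) \<inter> {0..2*pi}"
    show "y \<in> g ` S \<union> {0, 2*pi}"
    proof (cases "y = 0 \<or> y = 2*pi")
      case False
      with y have y': "0 < y" "y < 2*pi" "alpha \<beta> (cis y) \<in> N" by auto
      obtain x where x: "0 \<le> x" "x < 2*pi" "alpha \<beta> (cis y) = cis x"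
        using norm_alpha[OF \<beta>, of "cis y"] Arg2pi_ge_0 Arg2pi_lt_2pi
        by (metis complex_norm_eq_1_exp cis_conv_exp norm_cis)
      have ax: "alpha \<beta> (cis x) = cis y"
        using alpha_alpha[OF \<beta>, of "cis y"] x by simp
      have mcis: "- cis y = cis (y - pi)" by (simp add: complex_eq_iff)
      have Ln: "Ln (- cis y) = complex_of_real (y - pi) * \<i>"
        unfolding mcis using y' by (intro Ln_cis) auto
      have "- cis y \<notin> \<real>\<^sub>\<le>\<^sub>0"
      proof
        assume "- cis y \<in> \<real>\<^sub>\<le>\<^sub>0"
        then have r: "sin y = 0" "cos y \<ge> 0"
          by (auto simp: complex_nonpos_Reals_iff)
        have "y = pi"
        proof (rule ccontr)
          assume "y \<noteq> pi"
          then consider "y < pi" | "y > pi" by linarith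
          then show False
          proof cases
            case 1 then show False using sin_gt_zero[of y] y' r by simp
          next
            case 2 then show False using sin_lt_zero[of y] y' r by simp
          qed
        qed
        with r show False by simp
      qed
      then have "x \<in> S" using x y' ax by (auto simp: S_def)
      moreover have "g x = y" by (simp add: g_def ax Ln)
      ultimately show ?thesis by blast
    qed auto
  qed
  then have "negligible (cis -` (alpha \<beta> -` N) \<inter> {0..2*pi})"
    by (rule negligible_subset[OF neg])
  then show ?thesis by (simp add: null_sets_circle_measure_iff[OF Ab])
qed

lemma comp_alpha_abs:
  assumes "1 < norm \<beta>" and f [measurable]: "f \<in> borel_measurable borel"
  shows "comp_alpha \<beta> (abs_circ_fun f) = abs_circ_fun (\<lambda>t. f (alpha \<beta> t))"
proof -
  let ?r = "rep_circ_fun (abs_circ_fun f)"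
  have "eq_ae f f" by (simp add: eq_ae_def)
  then have r: "eq_ae ?r f"
    by (metis Quotient3_circ_fun Quotient3_def)
  then have [measurable]: "?r \<in> borel_measurable borel" by (simp add: eq_ae_def)
  have "{t. ?r t \<noteq> f t} \<in> null_sets circle_measure"
    using r by (intro AE_iff_null_sets[THEN iffD2])
      (auto simp: eq_ae_def)
  from alpha_vimage_null[OF assms(1) this]
  have "AE t in circle_measure. ?r (alpha \<beta> t) = f (alpha \<beta> t)"
    by (auto dest!: AE_not_in)
  then have "eq_ae (\<lambda>t. ?r (alpha \<beta> t)) (\<lambda>t. f (alpha \<beta> t))"
    by (simp add: eq_ae_def)
  then show ?thesis
    unfolding comp_alpha_def by (metis Quotient3_circ_fun Quotient3_rel_abs)
qed

definition J_alpha :: "complex \<Rightarrow> circ_fun \<Rightarrow> circ_fun" where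
  "J_alpha \<beta> f = inverse (chi \<beta>) * comp_alpha \<beta> f"

section \<open>Toeplitz and Hankel operators, Fredholmness\<close>

text \<open>Operators on \<open>H\<^sup>p\<close> are maps on \<^typ>\<open>circ_fun\<close> of which only the values on \<open>Hp p\<close> matter.\<close>

definition toeplitz :: "real \<Rightarrow> circ_fun \<Rightarrow> circ_fun \<Rightarrow> circ_fun" where
  "toeplitz p a f = proj_P p (a * f)"

definition hankel :: "real \<Rightarrow> complex \<Rightarrow> circ_fun \<Rightarrow> circ_fun \<Rightarrow> circ_fun" where
  "hankel p \<beta> a f = proj_P p (a * proj_Q p (J_alpha \<beta> f))"

definition ker_Hp :: "real \<Rightarrow> (circ_fun \<Rightarrow> circ_fun) \<Rightarrow> circ_fun set" where
  "ker_Hp p A = {f \<in> Hp p. A f = 0}"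

definition bounded_op_Hp :: "real \<Rightarrow> (circ_fun \<Rightarrow> circ_fun) \<Rightarrow> bool" where
  "bounded_op_Hp p A \<longleftrightarrow>
     (\<forall>f\<in>Hp p. A f \<in> Hp p)
   \<and> (\<forall>f\<in>Hp p. \<forall>g\<in>Hp p. A (f + g) = A f + A g)
   \<and> (\<forall>z. \<forall>f\<in>Hp p. A (z *\<^sub>C f) = z *\<^sub>C A f)
   \<and> (\<exists>C. \<forall>f\<in>Hp p. Lp_norm p (A f) \<le> C * Lp_norm p f)"

text \<open>The Banach space dual of \<open>H\<^sup>p\<close>; functionals are extended by \<open>0\<close> outside \<open>Hp p\<close> to make them
  unique. The adjoint acts on this dual.\<close>

definition Hp_dual :: "real \<Rightarrow> (circ_fun \<Rightarrow> complex) set" where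
  "Hp_dual p = {l.
     (\<forall>f\<in>Hp p. \<forall>g\<in>Hp p. l (f + g) = l f + l g)
   \<and> (\<forall>z. \<forall>f\<in>Hp p. l (z *\<^sub>C f) = z * l f)
   \<and> (\<exists>C. \<forall>f\<in>Hp p. norm (l f) \<le> C * Lp_norm p f)
   \<and> (\<forall>f. f \<notin> Hp p \<longrightarrow> l f = 0)}"

definition adjoint_Hp :: "real \<Rightarrow> (circ_fun \<Rightarrow> circ_fun) \<Rightarrow> (circ_fun \<Rightarrow> complex) \<Rightarrow> (circ_fun \<Rightarrow> complex)" where
  "adjoint_Hp p A l = (\<lambda>f. if f \<in> Hp p then l (A f) else 0)"

definition coker_Hp :: "real \<Rightarrow> (circ_fun \<Rightarrow> circ_fun) \<Rightarrow> (circ_fun \<Rightarrow> complex) set" where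
  "coker_Hp p A = {l \<in> Hp_dual p. adjoint_Hp p A l = 0}"

definition scaleF :: "complex \<Rightarrow> (circ_fun \<Rightarrow> complex) \<Rightarrow> (circ_fun \<Rightarrow> complex)" where
  "scaleF z l = (\<lambda>f. z * l f)"

interpretation funct: vector_space scaleF
  by standard (auto simp: scaleF_def fun_eq_iff algebra_simps)

definition fredholm_Hp :: "real \<Rightarrow> (circ_fun \<Rightarrow> circ_fun) \<Rightarrow> bool" where
  "fredholm_Hp p A \<longleftrightarrow>
     closedin (Metric_space.mtopology (Hp p) (\<lambda>f g. Lp_norm p (f - g))) (A ` Hp p)
   \<and> (\<exists>B. finite B \<and> ker_Hp p A \<subseteq> circ.span B)
   \<and> (\<exists>B. finite B \<and> coker_Hp p A \<subseteq> funct.span B)"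

definition index_Hp :: "real \<Rightarrow> (circ_fun \<Rightarrow> circ_fun) \<Rightarrow> int" where
  "index_Hp p A = int (circ.dim (ker_Hp p A)) - int (funct.dim (coker_Hp p A))"

section \<open>Matching pairs\<close>

definition matching_pair :: "complex \<Rightarrow> circ_fun \<Rightarrow> circ_fun \<Rightarrow> bool" where
  "matching_pair \<beta> a b \<longleftrightarrow>
     a \<in> Linf \<and> b \<in> Linf \<and> Linf_invertible a \<and> a * comp_alpha \<beta> a = b * comp_alpha \<beta> b"

definition sub_c :: "circ_fun \<Rightarrow> circ_fun \<Rightarrow> circ_fun" where
  "sub_c a b = a * inverse b"

definition sub_d :: "complex \<Rightarrow> circ_fun \<Rightarrow> circ_fun \<Rightarrow> circ_fun" where
  "sub_d \<beta> a b = b * inverse (comp_alpha \<beta> a)"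

definition fredholm_matching_pair :: "real \<Rightarrow> complex \<Rightarrow> circ_fun \<Rightarrow> circ_fun \<Rightarrow> bool" where
  "fredholm_matching_pair p \<beta> a b \<longleftrightarrow> matching_pair \<beta> a b
     \<and> fredholm_Hp p (toeplitz p (sub_c a b)) \<and> fredholm_Hp p (toeplitz p (sub_d \<beta> a b))"

text \<open>In what follows \<open>\<epsilon>\<close> is \<open>1\<close> or \<open>-1\<close> and encodes the upper or the lower sign.\<close>

definition P_alpha :: "real \<Rightarrow> complex \<Rightarrow> circ_fun \<Rightarrow> circ_fun \<Rightarrow> circ_fun" where
  "P_alpha p \<beta> g f = J_alpha \<beta> (proj_Q p (g * proj_P p f))"

definition P_alpha_sign :: "real \<Rightarrow> complex \<Rightarrow> complex \<Rightarrow> circ_fun \<Rightarrow> circ_fun \<Rightarrow> circ_fun" where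
  "P_alpha_sign p \<beta> \<epsilon> g f = (1/2) *\<^sub>C (f + \<epsilon> *\<^sub>C P_alpha p \<beta> g f)"

definition im_P_alpha_sign :: "real \<Rightarrow> complex \<Rightarrow> complex \<Rightarrow> circ_fun \<Rightarrow> circ_fun set" where
  "im_P_alpha_sign p \<beta> \<epsilon> g = P_alpha_sign p \<beta> \<epsilon> g ` ker_Hp p (toeplitz p g)"

section \<open>Wiener--Hopf factorization\<close>

definition wiener_hopf :: "real \<Rightarrow> circ_fun \<Rightarrow> circ_fun \<Rightarrow> circ_fun \<Rightarrow> bool" where
  "wiener_hopf p g gm gp \<longleftrightarrow> (let q = conj_exponent p in
     fredholm_Hp p (toeplitz p g)
   \<and> gm dvd 1 \<and> gp dvd 1
   \<and> g = gm * tvar powi (- index_Hp p (toeplitz p g)) * gp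
   \<and> fourier gm 0 = 1
   \<and> gp \<in> Hp q \<and> inverse gp \<in> Hp p
   \<and> gm \<in> Hp_bar p \<and> inverse gm \<in> Hp_bar q
   \<and> (\<exists>B. bounded_op_Hp p B
        \<and> (\<forall>f \<in> circ.span (range (\<lambda>k::nat. tvar ^ k)).
             B f = inverse gp * proj_P q (inverse gm * f))))"

definition alpha_signature :: "real \<Rightarrow> complex \<Rightarrow> circ_fun \<Rightarrow> complex" where
  "alpha_signature p \<beta> g = (THE \<sigma>. \<exists>gm gp. wiener_hopf p g gm gp
     \<and> \<sigma> = (lam \<beta> / cnj \<beta>) powi index_Hp p (toeplitz p g) * disc_ext (inverse gp) (1 / cnj \<beta>))"

section \<open>The right inverse and the maps \<open>\<phi>\<^sub>\<alpha>\<close>\<close>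

text \<open>Used only for Toeplitz operators \<open>T(g)\<close> of index \<open>\<ge> 0\<close>; then \<open>T(g t\<^sup>\<kappa>)\<close> is invertible on \<open>H\<^sup>p\<close>.\<close>

definition toeplitz_rinv :: "real \<Rightarrow> circ_fun \<Rightarrow> circ_fun \<Rightarrow> circ_fun" where
  "toeplitz_rinv p g f = (let \<kappa> = index_Hp p (toeplitz p g) in
     inv_into (Hp p) (toeplitz p (g * tvar powi \<kappa>)) (toeplitz p (tvar powi \<kappa>) f))"

definition phi_alpha :: "real \<Rightarrow> complex \<Rightarrow> complex \<Rightarrow> circ_fun \<Rightarrow> circ_fun \<Rightarrow> circ_fun \<Rightarrow> circ_fun" where
  "phi_alpha p \<beta> \<epsilon> a b s = (let
       c = sub_c a b;
       e = inverse (comp_alpha \<beta> a);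
       h = toeplitz_rinv p c (toeplitz p e s)
     in (1/2) *\<^sub>C (h - \<epsilon> *\<^sub>C J_alpha \<beta> (proj_Q p (c * proj_P p h)) + \<epsilon> *\<^sub>C J_alpha \<beta> (proj_Q p (e * s))))"

end

theory Submission imports Defs "HOL-Complex_Analysis.Complex_Analysis"
begin

text \<open>
  Since \<open>J\<^sub>\<alpha>\<close> interchanges \<open>H\<^sup>p\<close> and its complement \<open>Q L\<^sup>p\<close>, multiplication by \<open>\<chi>\<^sup>n\<close> intertwines the operators
  of the pairs \<open>(a, b)\<close> and \<open>(a', b') = (a \<chi>\<^sup>-\<^sup>n, b \<chi>\<^sup>n)\<close>. An element \<open>f\<close> of \<open>H\<^sup>p\<close> lies in the kernel for
  \<open>(a', b')\<close> iff \<open>c' f + \<epsilon> J\<^sub>\<alpha> f = s / a'\<^sub>\<alpha>\<close> for some \<open>s \<in> H\<^sup>p\<close> with \<open>d s = \<epsilon> J\<^sub>\<alpha> s\<close>. These \<open>s\<close> form the image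
  of \<open>P\<^sub>\<alpha>\<^sup>\<epsilon>(d)\<close>, the map \<open>\<phi>\<close> gives one solution \<open>f\<close> for every \<open>s\<close> as soon as \<open>T(c')\<close> is onto, and the solutions of the
  homogeneous equation form the image of \<open>P\<^sub>\<alpha>\<^sup>-\<^sup>\<epsilon>(c')\<close>, a subspace of \<open>ker T(c')\<close>.

  If \<open>T(c)\<close> is Fredholm of index \<open>-m < 0\<close>, then \<open>T(t\<^sup>-\<^sup>m c)\<close> is bijective: the monomials \<open>1, \<dots>, t\<^sup>m\<^sup>-\<^sup>1\<close> span
  a complement of the range of \<open>T(c)\<close>, because a nonzero element of the range of least possible degree \<open>j\<close> generates, after
  multiplication of its preimage by powers of \<open>t\<close>, all polynomials modulo those of degree less than \<open>j\<close>; the Hahn--Banach theorem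
  identifies \<open>j\<close> with \<open>m\<close>. Hence \<open>ker T(c')\<close> is trivial or spanned by \<open>c\<^sub>+\<^sup>-\<^sup>1\<close>. In the second case
  \<open>c' c\<^sub>+\<^sup>-\<^sup>1 = \<sigma> J\<^sub>\<alpha> c\<^sub>+\<^sup>-\<^sup>1\<close> with \<open>\<sigma>\<^sup>2 = 1\<close>, and evaluation at \<open>1 / cnj \<beta>\<close> shows that \<open>\<sigma>\<close> is the signature; as the kernel is a line,
  \<open>\<sigma>\<close> does not depend on the factorization.

  The existence of the projection \<open>P\<close> is M. Riesz's theorem. For \<open>1 < p \<le> 2\<close> it is proved for positive trigonometric polynomials
  by integrating \<open>\<bar>F\<bar>\<^sup>p \<le> A (Re F)\<^sup>p - B Re (F\<^sup>p)\<close>, and for \<open>p > 2\<close> it follows by duality.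
\<close>

section \<open>The circle measure and trigonometric polynomials\<close>

text \<open>The number \<open>n\<close> is chosen so that \<open>k = 2 * n - m\<close> is 0 or 1.
  The symbols \<open>c' * t ^ k\<close> and \<open>t ^ (- m) * c\<close> differ by the factor
  \<open>(t / chi) ^ (2 * n)\<close>, and \<open>t / chi\<close> and its inverse are bounded and
  have non-positive frequencies only. Multiplication by them preserves the complement of
  \<open>Hp p\<close>, so bijectivity passes from one Toeplitz operator to the other, and
  \<open>T(c')\<close> has index \<open>k\<close>. As \<open>chi\<close> has its zero inside the
  disc, \<open>chi ^ n * Hp p\<close> is in general smaller than \<open>Hp p\<close>; this is why
  the kernel of the modified operator is cut down to the image of \<open>T(chi ^ n)\<close>. The
  index counts functionals, so a numerical index becomes useful only after enough functionals
  vanishing on the range have been produced. Since all spaces share one type,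
  \<open>Lp_norm p\<close> is merely a function on a subspace of it, which calls for a Hahn--Banach
  theorem for seminorms on a subspace; the seminorm is the distance to the range. That
  \<open>J_alpha\<close> exchanges the two summands of \<open>Lp p\<close> is read off from Fourier
  coefficients after the substitution \<open>alpha\<close>, and the substitution rule comes from the
  fact that a measure on the circle is determined by its moments.\<close>

abbreviation "\<mu> \<equiv> circle_measure"

interpretation circle: prob_space circle_measure
  by (rule prob_space_circle_measure)

lemma measurable_circle_eq [simp]: "measurable \<mu> N = measurable borel N"
  by (rule measurable_cong_sets) simp_all

lemma AE_circle_norm: "AE t in \<mu>. norm t = 1"
proof -
  have "AE x in uniform_measure lborel {0..2*pi::real}. norm (cis x) = 1"
    by simp
  then show ?thesis
    unfolding circle_measure_def by (subst AE_distr_iff) auto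
qed

lemma AE_circle_nonzero: "AE t in \<mu>. t \<noteq> 0"
  using AE_circle_norm by eventually_elim auto

lemma borel_measurable_powi [measurable]: "(\<lambda>t::complex. t powi k) \<in> borel_measurable borel"
  unfolding power_int_def by simp

lemma borel_measurable_cnj [measurable]: "cnj \<in> borel_measurable borel"
  by (intro borel_measurable_continuous_onI continuous_intros)

lemma continuous_on_circle_integrable:
  fixes f :: "complex \<Rightarrow> 'a::{banach,second_countable_topology}"
  assumes [measurable]: "f \<in> borel_measurable borel" and "continuous_on (sphere 0 1) f"
  shows "integrable \<mu> f"
proof -
  have "compact (f ` sphere 0 1)"
    by (intro compact_continuous_image assms) auto
  then obtain B where B: "\<And>t. t \<in> sphere 0 1 \<Longrightarrow> norm (f t) \<le> B"
    by (meson bounded_iff compact_imp_bounded image_eqI)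
  show ?thesis
  proof (rule circle.integrable_const_bound[where B = B])
    show "AE t in \<mu>. norm (f t) \<le> B"
      using AE_circle_norm by eventually_elim (auto intro: B)
  qed simp
qed

text \<open>The interval from 0 to 1 is the parameter interval of \<open>circlepath\<close>, so that
  Cauchy's integral formula can be applied.\<close>

lemma integral_circle_measure:
  fixes f :: "complex \<Rightarrow> complex"
  assumes [measurable]: "f \<in> borel_measurable borel" and f: "continuous_on (sphere 0 1) f"
  shows "integral\<^sup>L \<mu> f = integral {0..1} (\<lambda>x. f (cis (2 * pi * x)))"
proof -
  have cont: "continuous_on {0..2*pi} (\<lambda>x. f (cis x))"
    by (rule continuous_on_compose2[OF f]) (auto intro!: continuous_intros)
  have "integral\<^sup>L \<mu> f = integral\<^sup>L (uniform_measure lborel {0..2*pi}) (\<lambda>x. f (cis x))"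
    unfolding circle_measure_def by (subst integral_distr) auto
  also have "\<dots> = integral\<^sup>L (density lborel (\<lambda>x. ennreal (indicator {0..2*pi} x / (2*pi)))) (\<lambda>x. f (cis x))"
  proof -
    have "uniform_measure lborel {0..2*pi} = density lborel (\<lambda>x. ennreal (indicator {0..2*pi} x / (2*pi)))"
      unfolding uniform_measure_def
      by (intro density_cong AE_I2) (auto simp: indicator_def divide_ennreal[symmetric] ennreal_1[symmetric] simp del: ennreal_1)
    then show ?thesis by simp
  qed
  also have "\<dots> = (LBINT x. (indicator {0..2*pi} x / (2*pi)) *\<^sub>R f (cis x))"
    by (subst integral_density) auto
  also have "\<dots> = (LBINT x. (1 / (2*pi)) *\<^sub>R (indicator {0..2*pi} x *\<^sub>R f (cis x)))"
    by (simp add: field_simps)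
  also have "\<dots> = (1/(2*pi)) *\<^sub>R (LBINT x:{0..2*pi}. f (cis x))"
    unfolding set_lebesgue_integral_def by (rule integral_scaleR_right)
  also have "(LBINT x:{0..2*pi}. f (cis x)) = integral {0..2*pi} (\<lambda>x. f (cis x))"
    by (intro set_borel_integral_eq_integral borel_integrable_atLeastAtMost')
      (rule cont)
  also have "(1/(2*pi)) *\<^sub>R integral {0..2*pi} (\<lambda>x. f (cis x)) = integral {0..1} (\<lambda>x. f (cis (2 * pi * x)))"
  proof -
    have "((\<lambda>x. f (cis x)) has_integral integral {0..2*pi} (\<lambda>x. f (cis x))) (cbox 0 (2*pi))"
      using cont using integrable_continuous[of 0 "2*pi" "\<lambda>x. f (cis x)"] by (simp add: integrable_integral)
    from has_integral_affinity[OF this, of "2*pi" 0]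
    have "((\<lambda>x. f (cis (2*pi*x))) has_integral (1/(2*pi)) *\<^sub>R integral {0..2*pi} (\<lambda>x. f (cis x))) {0..1}"
      by (simp add: image_divide_atLeastAtMost field_simps)
    then show ?thesis by (simp add: integral_unique)
  qed
  finally show ?thesis .
qed

text \<open>Cauchy's integral formula at the centre: the kernel \<open>1 / t\<close> cancels against
  the derivative \<open>2 * pi * \<i> * t\<close> of the path.\<close>

lemma circle_mean_value:
  assumes [measurable]: "h \<in> borel_measurable borel"
    and c: "continuous_on (cball 0 1) h" and h: "h holomorphic_on ball 0 1"
  shows "integral\<^sup>L \<mu> h = h 0"
proof -
  have "((\<lambda>u. h u / (u - 0)) has_contour_integral (2 * of_real pi * \<i> * h 0)) (circlepath 0 1)"
    by (rule Cauchy_integral_circlepath[OF c h]) simp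
  then have "((\<lambda>x. h (cis (2*pi*x)) / cis (2*pi*x) * (2 * of_real pi * \<i> * cis (2*pi*x))) has_integral (2 * of_real pi * \<i> * h 0)) {0..1}"
    unfolding has_contour_integral_def
  proof (rule has_integral_eq[rotated])
    fix x :: real assume x: "x \<in> {0..1}"
    have cp: "circlepath 0 1 x = cis (2*pi*x)"
      by (simp add: circlepath cis_conv_exp mult_ac)
    have "vector_derivative (circlepath 0 1) (at x within {0..1}) = 2 * of_real pi * \<i> * cis (2*pi*x)"
      using x by (subst vector_derivative_circlepath01) (auto simp: cis_conv_exp mult_ac)
    then show "h (circlepath 0 1 x) / (circlepath 0 1 x - 0) * vector_derivative (circlepath 0 1) (at x within {0..1})
        = h (cis (2*pi*x)) / cis (2*pi*x) * (2 * of_real pi * \<i> * cis (2*pi*x))"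
      by (simp add: cp)
  qed
  then have "((\<lambda>x. (2 * of_real pi * \<i>) * h (cis (2*pi*x))) has_integral (2 * of_real pi * \<i> * h 0)) {0..1}"
    by (simp add: mult_ac)
  from has_integral_mult_right[OF this, of "inverse (2 * of_real pi * \<i>)"]
  have "((\<lambda>x. (inverse (2 * of_real pi * \<i>) * (2 * of_real pi * \<i>)) * h (cis (2*pi*x))) has_integral
      (inverse (2 * of_real pi * \<i>) * (2 * of_real pi * \<i>)) * h 0) {0..1}"
    by (simp only: mult.assoc)
  moreover have "inverse (2 * of_real pi * \<i>) * (2 * of_real pi * \<i>) = 1"
    by (rule left_inverse) simp
  ultimately have "((\<lambda>x. h (cis (2*pi*x))) has_integral h 0) {0..1}"
    by (simp only: mult_1)
  then show ?thesis
    by (subst integral_circle_measure)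
       (auto intro: continuous_on_subset[OF c] integral_unique)
qed

lemma continuous_on_powi_sphere: "continuous_on (sphere 0 1) (\<lambda>t::complex. t powi k)"
  by (rule continuous_on_power_int) auto

lemma inverse_circle: "norm t = 1 \<Longrightarrow> inverse t = cnj t"
  by (metis complex_cnj_inverse complex_div_cnj inverse_eq_divide inverse_unique mult.commute mult_1 of_real_1 complex_norm_square one_power2)

text \<open>For non-negative exponents this is the mean value property; a negative power is the
  conjugate of a positive one on the circle.\<close>

lemma integral_powi: "integral\<^sup>L \<mu> (\<lambda>t. t powi k) = (if k = 0 then 1 else 0)"
proof -
  have pos: "integral\<^sup>L \<mu> (\<lambda>t. t ^ n) = (if n = 0 then 1 else 0)" for n
    by (subst circle_mean_value) (auto intro!: holomorphic_intros continuous_intros)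
  show ?thesis
  proof (cases "k \<ge> 0")
    case True
    then show ?thesis using pos[of "nat k"] by (simp add: power_int_def)
  next
    case False
    have "integral\<^sup>L \<mu> (\<lambda>t. t powi k) = integral\<^sup>L \<mu> (\<lambda>t. cnj (t ^ nat (- k)))"
    proof (rule integral_cong_AE)
      show "AE t in \<mu>. t powi k = cnj (t ^ nat (- k))"
        using AE_circle_norm
      proof eventually_elim
        case (elim t)
        then show ?case using False inverse_circle[of t] by (simp add: power_int_def)
      qed
    qed auto
    also have "\<dots> = cnj (integral\<^sup>L \<mu> (\<lambda>t. t ^ nat (- k)))"
      by (rule Bochner_Integration.integral_cnj)
    finally show ?thesis using False pos[of "nat (-k)"] by simp
  qed
qed

section \<open>Trigonometric polynomials and uniform approximation\<close>

definition tpoly :: "int set \<Rightarrow> (int \<Rightarrow> complex) \<Rightarrow> complex \<Rightarrow> complex" where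
  "tpoly I c t = (\<Sum>k\<in>I. c k * t powi k)"

lemma tpoly_borel [measurable]: "tpoly I c \<in> borel_measurable borel"
  unfolding tpoly_def
  by (intro borel_measurable_sum borel_measurable_times borel_measurable_powi borel_measurable_const)

lemma continuous_on_tpoly: "continuous_on (sphere 0 1) (tpoly I c)"
  unfolding tpoly_def
  by (intro continuous_on_sum continuous_on_mult continuous_on_const continuous_on_powi_sphere)

lemma tpoly_extend:
  assumes "finite J" "I \<subseteq> J"
  shows "tpoly I c = tpoly J (\<lambda>k. if k \<in> I then c k else 0)"
  unfolding tpoly_def fun_eq_iff using assms
  by (auto intro!: sum.mono_neutral_cong_left)

lemma tpoly_add:
  assumes "finite I" "finite J"
  shows "\<exists>K e. finite K \<and> tpoly K e = (\<lambda>t. tpoly I c t + tpoly J d t)"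
proof -
  have "tpoly I c = tpoly (I \<union> J) (\<lambda>k. if k \<in> I then c k else 0)"
    and "tpoly J d = tpoly (I \<union> J) (\<lambda>k. if k \<in> J then d k else 0)"
    using assms by (intro tpoly_extend; auto)+
  then have "(\<lambda>t. tpoly I c t + tpoly J d t)
      = tpoly (I \<union> J) (\<lambda>k. (if k \<in> I then c k else 0) + (if k \<in> J then d k else 0))"
    by (auto simp: tpoly_def fun_eq_iff algebra_simps sum.distrib)
  then show ?thesis using assms by (metis finite_UnI)
qed

lemma tpoly_scale: "z * tpoly I c t = tpoly I (\<lambda>k. z * c k) t"
  by (simp add: tpoly_def sum_distrib_left mult_ac)

text \<open>Only values on the circle count, because there \<open>cnj t\<close> is the monomial
  \<open>t powi (-1)\<close> and real coordinates become trigonometric polynomials.\<close>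

definition circ_trig :: "(complex \<Rightarrow> complex) \<Rightarrow> bool" where
  "circ_trig r \<longleftrightarrow> (\<exists>I c. finite I \<and> (\<forall>t\<in>sphere 0 1. r t = tpoly I c t))"

lemma circ_trig_add: "circ_trig r \<Longrightarrow> circ_trig s \<Longrightarrow> circ_trig (\<lambda>t. r t + s t)"
  unfolding circ_trig_def
proof safe
  fix I c J d
  assume *: "finite I" "\<forall>t\<in>sphere 0 1. r t = tpoly I c t" "finite J" "\<forall>t\<in>sphere 0 1. s t = tpoly J d t"
  obtain K e where "finite K" "tpoly K e = (\<lambda>t. tpoly I c t + tpoly J d t)"
    using tpoly_add[OF *(1,3)] by blast
  then show "\<exists>I c. finite I \<and> (\<forall>t\<in>sphere 0 1. r t + s t = tpoly I c t)"
    using *(2,4) by (intro exI[of _ K] exI[of _ e]) auto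
qed

lemma circ_trig_monom: "circ_trig (\<lambda>t. z * t powi k)"
  unfolding circ_trig_def by (rule exI[of _ "{k}"], rule exI[of _ "\<lambda>_. z"]) (simp add: tpoly_def)

lemma circ_trig_const: "circ_trig (\<lambda>t. z)"
  using circ_trig_monom[of z 0] by simp

lemma circ_trig_cong: "circ_trig r \<Longrightarrow> (\<And>t. norm t = 1 \<Longrightarrow> r t = s t) \<Longrightarrow> circ_trig s"
  unfolding circ_trig_def by auto

lemma circ_trig_sum: "(\<And>i. i \<in> A \<Longrightarrow> circ_trig (f i)) \<Longrightarrow> circ_trig (\<lambda>t. \<Sum>i\<in>A. f i t)"
  by (induction A rule: infinite_finite_induct) (auto intro: circ_trig_add circ_trig_const)

lemma circ_trig_mult:
  assumes "circ_trig r" "circ_trig s"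
  shows "circ_trig (\<lambda>t. r t * s t)"
proof -
  obtain I c J d where *: "\<forall>t\<in>sphere 0 1. r t = tpoly I c t" "\<forall>t\<in>sphere 0 1. s t = tpoly J d t"
    using assms by (auto simp: circ_trig_def)
  have "circ_trig (\<lambda>t. \<Sum>i\<in>I. \<Sum>j\<in>J. (c i * d j) * t powi (i + j))"
    by (intro circ_trig_sum circ_trig_monom)
  then show ?thesis
  proof (rule circ_trig_cong)
    fix t :: complex assume t: "norm t = 1"
    then have "t \<noteq> 0" by auto
    then show "(\<Sum>i\<in>I. \<Sum>j\<in>J. (c i * d j) * t powi (i + j)) = r t * s t"
      using * t by (simp add: tpoly_def sum_product power_int_add mult_ac)
  qed
qed

lemma circ_trig_real_polynomial_function:
  assumes "real_polynomial_function g"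
  shows "circ_trig (\<lambda>t. complex_of_real (g t))"
  using assms
proof induction
  case (linear f)
  \<comment> \<open>The coefficients come from \<open>f t = Re t * f 1 + Im t * f \<i>\<close> with
    \<open>Re t = (t + 1 / t) / 2\<close> and
    \<open>Im t = (t - 1 / t) / (2 * \<i>)\<close>.\<close>
  have "circ_trig (\<lambda>t. (of_real (f 1) / 2 + of_real (f \<i>) / (2 * \<i>)) * t powi 1
       + (of_real (f 1) / 2 - of_real (f \<i>) / (2 * \<i>)) * t powi (-1))"
    by (intro circ_trig_add circ_trig_monom)
  then show ?case
  proof (rule circ_trig_cong)
    fix t :: complex assume t: "norm t = 1"
    have eq: "t = Re t *\<^sub>R 1 + Im t *\<^sub>R \<i>" by (simp add: complex_eq_iff)
    have "f t = Re t * f 1 + Im t * f \<i>"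
      using arg_cong[OF eq, of f] bounded_linear.linear[OF linear]
      by (simp only: linear_add linear_scale real_scaleR_def)
    then show "(of_real (f 1) / 2 + of_real (f \<i>) / (2 * \<i>)) * t powi 1
       + (of_real (f 1) / 2 - of_real (f \<i>) / (2 * \<i>)) * t powi (-1) = complex_of_real (f t)"
      unfolding power_int_minus power_int_1_right inverse_circle[OF t]
      by (simp add: complex_eq_iff Re_divide_numeral Im_divide_numeral)
  qed
next
  case (const c)
  show ?case by (rule circ_trig_const)
next
  case (add f g)
  then show ?case by (simp add: circ_trig_add)
next
  case (mult f g)
  then show ?case by (simp add: circ_trig_mult)
qed

text \<open>Stone--Weierstrass for real polynomials in the two coordinates, which keeps the
  approximant real on the circle. Positivity of approximants is essential for M. Riesz's
  inequality.\<close>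

lemma trig_approx_real:
  fixes f :: "complex \<Rightarrow> real"
  assumes "continuous_on (sphere 0 1) f" "0 < e"
  shows "\<exists>I c. finite I \<and> (\<forall>t\<in>sphere 0 1. tpoly I c t \<in> \<real> \<and> \<bar>f t - Re (tpoly I c t)\<bar> < e)"
proof -
  obtain g where g: "real_polynomial_function g" "\<And>t. t \<in> sphere 0 1 \<Longrightarrow> \<bar>f t - g t\<bar> < e"
    using Stone_Weierstrass_real_polynomial_function[OF compact_sphere assms] by blast
  obtain I c where "finite I" "\<forall>t\<in>sphere 0 1. complex_of_real (g t) = tpoly I c t"
    using circ_trig_real_polynomial_function[OF g(1)] unfolding circ_trig_def by blast
  with g(2) show ?thesis by (intro exI[of _ I] exI[of _ c]) (metis Re_complex_of_real Reals_of_real)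
qed

lemma trig_approx:
  fixes f :: "complex \<Rightarrow> complex"
  assumes f: "continuous_on (sphere 0 1) f" and "0 < e"
  shows "\<exists>I c. finite I \<and> (\<forall>t\<in>sphere 0 1. norm (f t - tpoly I c t) < e)"
proof -
  obtain I c where 1: "finite I" "\<forall>t\<in>sphere 0 1. tpoly I c t \<in> \<real> \<and> \<bar>Re (f t) - Re (tpoly I c t)\<bar> < e/2"
    using trig_approx_real[of "\<lambda>t. Re (f t)" "e/2"] assms by (auto intro: continuous_intros)
  obtain J d where 2: "finite J" "\<forall>t\<in>sphere 0 1. tpoly J d t \<in> \<real> \<and> \<bar>Im (f t) - Re (tpoly J d t)\<bar> < e/2"
    using trig_approx_real[of "\<lambda>t. Im (f t)" "e/2"] assms by (auto intro: continuous_intros)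
  obtain K g where 3: "finite K" "tpoly K g = (\<lambda>t. tpoly I c t + tpoly J (\<lambda>k. \<i> * d k) t)"
    using tpoly_add[OF 1(1) 2(1)] by blast
  have "norm (f t - tpoly K g t) < e" if t: "t \<in> sphere 0 1" for t
  proof -
    have r: "Im (tpoly I c t) = 0" "Im (tpoly J d t) = 0"
      using 1(2) 2(2) t by (auto simp: complex_is_Real_iff)
    have k: "tpoly K g t = tpoly I c t + \<i> * tpoly J d t" by (simp add: 3(2) tpoly_scale)
    have "norm (f t - tpoly K g t) \<le> \<bar>Re (f t - tpoly K g t)\<bar> + \<bar>Im (f t - tpoly K g t)\<bar>"
      by (rule cmod_le)
    also have "\<dots> < e" using 1(2) 2(2) t by (fastforce simp: k r)
    finally show ?thesis .
  qed
  with 3(1) show ?thesis by blast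
qed

section \<open>Lebesgue spaces on the circle\<close>

text \<open>The analysis is carried out for Borel functions; \<open>Lp_iff\<close>,
  \<open>Lp_norm_eq\<close> and \<open>fourier_eq\<close> transfer it to classes modulo null
  sets.\<close>

definition p_int :: "real \<Rightarrow> (complex \<Rightarrow> complex) \<Rightarrow> bool" where
  "p_int p f \<longleftrightarrow> f \<in> borel_measurable borel \<and> integrable \<mu> (\<lambda>t. norm (f t) powr p)"

definition p_norm :: "real \<Rightarrow> (complex \<Rightarrow> complex) \<Rightarrow> real" where
  "p_norm p f = (integral\<^sup>L \<mu> (\<lambda>t. norm (f t) powr p)) powr (1 / p)"

lemma p_int_borel [dest]: "p_int p f \<Longrightarrow> f \<in> borel_measurable borel"
  by (simp add: p_int_def)

lemma p_norm_nonneg [simp]: "p_norm p f \<ge> 0"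
  by (simp add: p_norm_def)

lemma p_norm_powr:
  assumes "p > 0"
  shows "p_norm p f powr p = integral\<^sup>L \<mu> (\<lambda>t. norm (f t) powr p)"
  using assms by (simp add: p_norm_def powr_powr integral_nonneg_AE)

lemma p_norm_le_iff:
  assumes "p > 0" "C \<ge> 0"
  shows "p_norm p f \<le> C \<longleftrightarrow> integral\<^sup>L \<mu> (\<lambda>t. norm (f t) powr p) \<le> C powr p"
proof -
  have "p_norm p f \<le> C \<longleftrightarrow> p_norm p f powr p \<le> C powr p"
  proof
    assume "p_norm p f \<le> C"
    then show "p_norm p f powr p \<le> C powr p" using assms by (intro powr_mono2) auto
  next
    assume *: "p_norm p f powr p \<le> C powr p"
    show "p_norm p f \<le> C"
    proof (rule ccontr)
      assume "\<not> p_norm p f \<le> C"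
      then have "C powr p < p_norm p f powr p" using assms by (intro powr_less_mono2) auto
      with * show False by simp
    qed
  qed
  then show ?thesis using assms(1) by (simp only: p_norm_powr)
qed

lemma p_norm_cong_AE:
  assumes "f \<in> borel_measurable borel" "g \<in> borel_measurable borel" "AE t in \<mu>. f t = g t"
  shows "p_norm p f = p_norm p g"
proof -
  have "integral\<^sup>L \<mu> (\<lambda>t. norm (f t) powr p) = integral\<^sup>L \<mu> (\<lambda>t. norm (g t) powr p)"
    using assms by (intro integral_cong_AE) auto
  then show ?thesis by (simp add: p_norm_def)
qed

lemma p_norm_mono:
  assumes "p_int p g" "f \<in> borel_measurable borel" "AE t in \<mu>. norm (f t) \<le> norm (g t)" "p > 0"
  shows "p_int p f" "p_norm p f \<le> p_norm p g"
proof -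
  have le: "AE t in \<mu>. norm (f t) powr p \<le> norm (g t) powr p"
    using assms(3) by eventually_elim (use assms(4) in \<open>auto intro: powr_mono2\<close>)
  show *: "p_int p f" unfolding p_int_def
  proof
    show "integrable \<mu> (\<lambda>t. norm (f t) powr p)"
      by (rule Bochner_Integration.integrable_bound[where f = "\<lambda>t. norm (g t) powr p"])
        (use assms le in \<open>auto simp: p_int_def\<close>)
  qed fact
  have "integral\<^sup>L \<mu> (\<lambda>t. norm (f t) powr p) \<le> integral\<^sup>L \<mu> (\<lambda>t. norm (g t) powr p)"
    using assms * le by (intro integral_mono_AE) (auto simp: p_int_def)
  then show "p_norm p f \<le> p_norm p g"
    unfolding p_norm_def using assms by (intro powr_mono2) (auto simp: integral_nonneg_AE)
qed

lemma p_norm_zero [simp]: "p_norm p (\<lambda>t. 0) = 0"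
  by (simp add: p_norm_def)

lemma p_int_const: "p_int p (\<lambda>t. z)"
  by (simp add: p_int_def)

lemma p_norm_const: "p > 0 \<Longrightarrow> p_norm p (\<lambda>t. z) = norm z"
  by (simp add: p_norm_def powr_powr circle.prob_space[simplified])

lemma p_norm_eq_0_iff:
  assumes "p_int p f" "p > 0"
  shows "p_norm p f = 0 \<longleftrightarrow> (AE t in \<mu>. f t = 0)"
proof -
  have "p_norm p f = 0 \<longleftrightarrow> integral\<^sup>L \<mu> (\<lambda>t. norm (f t) powr p) = 0"
    by (simp add: p_norm_def)
  also have "\<dots> \<longleftrightarrow> (AE t in \<mu>. norm (f t) powr p = 0)"
    using assms by (intro integral_nonneg_eq_0_iff_AE) (auto simp: p_int_def)
  finally show ?thesis by simp
qed

lemma p_int_scale: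
  assumes "p_int p f"
  shows "p_int p (\<lambda>t. z * f t)"
proof -
  have [measurable]: "f \<in> borel_measurable borel" using assms by auto
  have "(\<lambda>t. z * f t) \<in> borel_measurable borel" by measurable
  with assms show ?thesis by (simp add: p_int_def norm_mult powr_mult)
qed

lemma p_norm_scale:
  assumes "p > 0"
  shows "p_norm p (\<lambda>t. z * f t) = norm z * p_norm p f"
  using assms by (simp add: p_norm_def norm_mult powr_mult powr_powr integral_nonneg_AE)

lemma p_int_mult_bounded:
  assumes "p_int p f" "g \<in> borel_measurable borel" "AE t in \<mu>. norm (g t) \<le> C" "p > 0"
  shows "p_int p (\<lambda>t. g t * f t)" "p_norm p (\<lambda>t. g t * f t) \<le> C * p_norm p f"
proof -
  have [measurable]: "f \<in> borel_measurable borel" "g \<in> borel_measurable borel" using assms by auto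
  \<comment> \<open>A negative bound would fail at every point, whereas a probability measure has no
    almost everywhere false statement.\<close>
  have C: "C \<ge> 0"
  proof (rule ccontr)
    assume "\<not> C \<ge> 0"
    have "AE t in \<mu>. False"
      using assms(3)
    proof eventually_elim
      case (elim t)
      then show False using \<open>\<not> C \<ge> 0\<close> norm_ge_zero[of "g t"] by linarith
    qed
    then show False by (simp add: AE_circle_measure_False)
  qed
  have le: "AE t in \<mu>. norm (g t * f t) \<le> norm (of_real C * f t)"
    using assms(3) by eventually_elim (use C in \<open>auto simp: norm_mult intro!: mult_right_mono\<close>)
  note * = p_norm_mono[OF p_int_scale[OF assms(1)] _ le assms(4)]
  show "p_int p (\<lambda>t. g t * f t)" by (rule *) measurable
  show "p_norm p (\<lambda>t. g t * f t) \<le> C * p_norm p f"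
    using *(2) assms(4) C by (simp add: p_norm_scale)
qed

lemma p_int_bounded:
  assumes "g \<in> borel_measurable borel" "AE t in \<mu>. norm (g t) \<le> C" "p > 0"
  shows "p_int p g" "p_norm p g \<le> C"
  using p_int_mult_bounded[OF p_int_const[of p 1] assms] assms by (auto simp: p_norm_const)

lemma p_int_continuous:
  assumes "f \<in> borel_measurable borel" "continuous_on (sphere 0 1) f" "p > 0"
  shows "p_int p f"
proof -
  have "compact (f ` sphere 0 1)"
    by (intro compact_continuous_image assms) auto
  then obtain B where B: "\<And>t. t \<in> sphere 0 1 \<Longrightarrow> norm (f t) \<le> B"
    by (meson bounded_iff compact_imp_bounded image_eqI)
  have "AE t in \<mu>. norm (f t) \<le> B"
    using AE_circle_norm by eventually_elim (auto intro: B)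
  with assms show ?thesis by (intro p_int_bounded)
qed

lemma p_int_tpoly: "p > 0 \<Longrightarrow> p_int p (tpoly I c)"
  by (intro p_int_continuous tpoly_borel continuous_on_tpoly)

lemma powr_add_le:
  fixes a b :: real
  assumes "a \<ge> 0" "b \<ge> 0" "p > 0"
  shows "(a + b) powr p \<le> 2 powr p * (a powr p + b powr p)"
proof -
  have "(a + b) powr p \<le> (2 * max a b) powr p" using assms by (intro powr_mono2) auto
  also have "\<dots> = 2 powr p * max a b powr p" using assms by (simp add: powr_mult)
  also have "\<dots> \<le> 2 powr p * (a powr p + b powr p)"
    by (intro mult_left_mono) (auto simp: max_def)
  finally show ?thesis .
qed

lemma p_int_add:
  assumes "p_int p f" "p_int p g" "p > 0"
  shows "p_int p (\<lambda>t. f t + g t)"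
proof -
  have [measurable]: "f \<in> borel_measurable borel" "g \<in> borel_measurable borel" using assms by auto
  have "integrable \<mu> (\<lambda>t. norm (f t + g t) powr p)"
  proof (rule Bochner_Integration.integrable_bound)
    show "integrable \<mu> (\<lambda>t. 2 powr p * (norm (f t) powr p + norm (g t) powr p))"
      using assms by (auto simp: p_int_def)
    have "norm (f t + g t) powr p \<le> 2 powr p * (norm (f t) powr p + norm (g t) powr p)" for t
    proof -
      have "norm (f t + g t) powr p \<le> (norm (f t) + norm (g t)) powr p"
        using assms by (intro powr_mono2 norm_triangle_ineq) auto
      also have "\<dots> \<le> 2 powr p * (norm (f t) powr p + norm (g t) powr p)"
        using assms by (intro powr_add_le) auto
      finally show ?thesis .
    qed
    then show "AE t in \<mu>. norm (norm (f t + g t) powr p) \<le> norm (2 powr p * (norm (f t) powr p + norm (g t) powr p))"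
      by (auto intro!: AE_I2 order_trans[OF _ abs_ge_self])
  qed measurable
  then show ?thesis by (simp add: p_int_def)
qed

lemma p_int_diff:
  assumes "p_int p f" "p_int p g" "p > 0"
  shows "p_int p (\<lambda>t. f t - g t)"
  using p_int_add[OF assms(1) p_int_scale[OF assms(2), of "-1"] assms(3)] by simp

lemma holder_circle:
  assumes pq: "p > 1" "q > 1" "1/p + 1/q = 1" and f: "p_int p f" and g: "p_int q g"
  shows "integrable \<mu> (\<lambda>t. f t * g t)"
    and "integral\<^sup>L \<mu> (\<lambda>t. norm (f t * g t)) \<le> p_norm p f * p_norm q g"
proof -
  have [measurable]: "f \<in> borel_measurable borel" "g \<in> borel_measurable borel" using f g by auto
  have young: "norm (f t * g t) \<le> norm (f t) powr p / p + norm (g t) powr q / q" for f g :: "complex \<Rightarrow> complex" and t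
    unfolding norm_mult using pq by (intro Youngs_inequality) auto
  have int: "integrable \<mu> (\<lambda>t. norm (f t) powr p / p + norm (g t) powr q / q)"
    if "p_int p f" "p_int q g" for f g
    using that by (auto simp: p_int_def)
  show i: "integrable \<mu> (\<lambda>t. f t * g t)"
    by (rule Bochner_Integration.integrable_bound[OF int[OF f g]])
      (auto intro!: AE_I2 order_trans[OF young abs_ge_self])
  let ?A = "p_norm p f" and ?B = "p_norm q g"
  show "integral\<^sup>L \<mu> (\<lambda>t. norm (f t * g t)) \<le> ?A * ?B"
  proof (cases "?A = 0 \<or> ?B = 0")
    case True
    then have "AE t in \<mu>. norm (f t * g t) = 0"
    proof
      assume "?A = 0"
      then have "AE t in \<mu>. f t = 0" using f pq by (subst (asm) p_norm_eq_0_iff) auto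
      then show ?thesis by eventually_elim simp
    next
      assume "?B = 0"
      then have "AE t in \<mu>. g t = 0" using g pq by (subst (asm) p_norm_eq_0_iff) auto
      then show ?thesis by eventually_elim simp
    qed
    then have "integral\<^sup>L \<mu> (\<lambda>t. norm (f t * g t)) = integral\<^sup>L \<mu> (\<lambda>t. 0)"
      by (intro integral_cong_AE) auto
    then show ?thesis by simp
  next
    case False
    then have AB: "?A > 0" "?B > 0" by (auto simp: less_le)
    define f' g' where "f' = (\<lambda>t. of_real (1 / ?A) * f t)" and "g' = (\<lambda>t. of_real (1 / ?B) * g t)"
    have f': "p_int p f'" and g': "p_int q g'"
      unfolding f'_def g'_def using f g by (intro p_int_scale; simp)+
    have 1: "p_norm p f' = 1" "p_norm q g' = 1"
      unfolding f'_def g'_def using AB pq by (subst p_norm_scale; simp add: norm_divide)+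
    have "integral\<^sup>L \<mu> (\<lambda>t. norm (f' t * g' t))
        \<le> integral\<^sup>L \<mu> (\<lambda>t. norm (f' t) powr p / p + norm (g' t) powr q / q)"
    proof (rule integral_mono_AE)
      have "(\<lambda>t. f' t * g' t) = (\<lambda>t. of_real (1/(?A * ?B)) * (f t * g t))"
        by (simp add: f'_def g'_def)
      then show "integrable \<mu> (\<lambda>t. norm (f' t * g' t))"
        using i by (auto intro!: integrable_norm)
    qed (use int[OF f' g'] in \<open>auto intro!: AE_I2 young\<close>)
    also have "\<dots> = p_norm p f' powr p / p + p_norm q g' powr q / q"
      using f' g' pq by (simp add: p_norm_powr p_int_def)
    also have "\<dots> = 1" using pq 1 by simp
    finally have "integral\<^sup>L \<mu> (\<lambda>t. norm (f t * g t) / (?A * ?B)) \<le> 1"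
      using AB by (simp add: f'_def g'_def norm_mult norm_divide)
    then show ?thesis using AB by (simp add: field_simps)
  qed
qed

lemma conj_exponent:
  assumes "p > 1" shows "conj_exponent p > 1" "1 / p + 1 / conj_exponent p = 1"
  using assms by (auto simp: conj_exponent_def field_simps)

text \<open>Hoelder's inequality against the constant 1, whose norm is 1 because
  \<open>\<mu>\<close> has total mass 1.\<close>

lemma L1_le_p_norm:
  assumes "p > 1" "p_int p f"
  shows "integrable \<mu> f" "integral\<^sup>L \<mu> (\<lambda>t. norm (f t)) \<le> p_norm p f"
    "norm (integral\<^sup>L \<mu> f) \<le> p_norm p f"
proof -
  note c = conj_exponent[OF assms(1)]
  note h = holder_circle[OF assms(1) c assms(2) p_int_const[of _ 1]]
  show 1: "integrable \<mu> f" using h by simp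
  show 2: "integral\<^sup>L \<mu> (\<lambda>t. norm (f t)) \<le> p_norm p f"
    using h(2) c by (simp add: p_norm_const)
  show "norm (integral\<^sup>L \<mu> f) \<le> p_norm p f"
    using integral_norm_bound[of \<mu> f] 2 by linarith
qed

text \<open>For positive arguments this is convexity of the power; if one argument is 0 it reduces
  to \<open>s powr p \<le> s\<close> on the unit interval.\<close>

lemma powr_convex_comb:
  fixes x y \<theta> p :: real
  assumes "p \<ge> 1" "x \<ge> 0" "y \<ge> 0" "0 \<le> \<theta>" "\<theta> \<le> 1"
  shows "(\<theta> * x + (1 - \<theta>) * y) powr p \<le> \<theta> * x powr p + (1 - \<theta>) * y powr p"
proof -
  have le: "s powr p \<le> s" if "0 \<le> s" "s \<le> 1" for s :: real
  proof (cases "s = 0")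
    case False
    with that assms powr_mono'[of 1 p s] show ?thesis by simp
  qed auto
  consider "x = 0" | "y = 0" | "x > 0" "y > 0" using assms by linarith
  then show ?thesis
  proof cases
    case 1
    then show ?thesis using le[of "1 - \<theta>"] assms by (auto simp: powr_mult intro!: mult_right_mono)
  next
    case 2
    then show ?thesis using le[of \<theta>] assms by (auto simp: powr_mult intro!: mult_right_mono)
  next
    case 3
    have "((1 - \<theta>) * y + \<theta> * x) powr p \<le> (1 - \<theta>) * y powr p + \<theta> * x powr p"
      using convex_onD[OF powr_convex[OF assms(1)], of \<theta> y x] 3 assms by simp
    then show ?thesis by (simp add: add.commute)
  qed
qed

lemma minkowski_circle:
  assumes p: "p \<ge> 1" and f: "p_int p f" and g: "p_int p g"
  shows "p_norm p (\<lambda>t. f t + g t) \<le> p_norm p f + p_norm p g"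
proof -
  have [measurable]: "f \<in> borel_measurable borel" "g \<in> borel_measurable borel" using f g by auto
  let ?A = "p_norm p f" and ?B = "p_norm p g"
  have p0: "p > 0" using p by simp
  consider "?A = 0" | "?B = 0" | "?A > 0" "?B > 0" by (metis less_le p_norm_nonneg)
  then show ?thesis
  proof cases
    case 1
    then have "AE t in \<mu>. f t = 0" using f p by (subst (asm) p_norm_eq_0_iff) auto
    then have "p_norm p (\<lambda>t. f t + g t) = ?B" by (intro p_norm_cong_AE) auto
    then show ?thesis by simp
  next
    case 2
    then have "AE t in \<mu>. g t = 0" using g p by (subst (asm) p_norm_eq_0_iff) auto
    then have "p_norm p (\<lambda>t. f t + g t) = ?A" by (intro p_norm_cong_AE) auto
    then show ?thesis by simp
  next
    case 3
    \<comment> \<open>Weights proportional to the two norms turn \<open>f + g\<close> into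
      \<open>?A + ?B\<close> times a convex combination of the normalised functions.\<close>
    define \<theta> where "\<theta> = ?A / (?A + ?B)"
    have \<theta>: "0 \<le> \<theta>" "\<theta> \<le> 1" "1 - \<theta> = ?B / (?A + ?B)"
      using 3 by (auto simp: \<theta>_def field_simps)
    have pt: "norm (f t + g t) powr p \<le> (?A + ?B) powr p * (\<theta> * (norm (f t) powr p / ?A powr p) + (1 - \<theta>) * (norm (g t) powr p / ?B powr p))" for t
    proof -
      have "norm (f t + g t) \<le> norm (f t) + norm (g t)" by (rule norm_triangle_ineq)
      also have "\<dots> = (?A + ?B) * (\<theta> * (norm (f t) / ?A) + (1 - \<theta>) * (norm (g t) / ?B))"
      proof -
        have "(?A + ?B) * (\<theta> * (norm (f t) / ?A)) = norm (f t)" "(?A + ?B) * ((1 - \<theta>) * (norm (g t) / ?B)) = norm (g t)"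
          unfolding \<theta>(3) unfolding \<theta>_def using 3 by simp_all
        then show ?thesis by (simp only: distrib_left)
      qed
      finally have "norm (f t + g t) powr p \<le> ((?A + ?B) * (\<theta> * (norm (f t) / ?A) + (1 - \<theta>) * (norm (g t) / ?B))) powr p"
        using p by (intro powr_mono2) auto
      also have "\<dots> = (?A + ?B) powr p * (\<theta> * (norm (f t) / ?A) + (1 - \<theta>) * (norm (g t) / ?B)) powr p"
        using 3 \<theta> by (intro powr_mult; simp)
      also have "\<dots> \<le> (?A + ?B) powr p * (\<theta> * (norm (f t) / ?A) powr p + (1 - \<theta>) * (norm (g t) / ?B) powr p)"
        using 3 \<theta> p by (intro mult_left_mono powr_convex_comb) auto
      finally show ?thesis using 3 by (simp add: powr_divide)
    qed
    have "integral\<^sup>L \<mu> (\<lambda>t. norm (f t + g t) powr p)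
        \<le> integral\<^sup>L \<mu> (\<lambda>t. (?A + ?B) powr p * (\<theta> * (norm (f t) powr p / ?A powr p) + (1 - \<theta>) * (norm (g t) powr p / ?B powr p)))"
    proof (rule integral_mono_AE)
      show "integrable \<mu> (\<lambda>t. norm (f t + g t) powr p)"
        using p_int_add[OF f g p0] by (simp add: p_int_def)
    qed (use f g pt in \<open>auto simp: p_int_def\<close>)
    also have "\<dots> = (?A + ?B) powr p * (\<theta> * (?A powr p / ?A powr p) + (1 - \<theta>) * (?B powr p / ?B powr p))"
      using f g unfolding p_norm_powr[OF p0] by (simp add: p_int_def)
    also have "\<dots> = (?A + ?B) powr p" using 3 by simp
    finally show ?thesis using p0 by (subst p_norm_le_iff) auto
  qed
qed

lemma p_norm_diff_commute: "p_norm p (\<lambda>t. f t - g t) = p_norm p (\<lambda>t. g t - f t)"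
  by (simp add: p_norm_def norm_minus_commute)

lemma minkowski_diff:
  assumes "p \<ge> 1" "p_int p f" "p_int p g" "p_int p h"
  shows "p_norm p (\<lambda>t. f t - h t) \<le> p_norm p (\<lambda>t. f t - g t) + p_norm p (\<lambda>t. g t - h t)"
  using minkowski_circle[OF assms(1) p_int_diff[OF assms(2,3)] p_int_diff[OF assms(3,4)]] assms(1) by simp

lemma p_norm_dominated:
  assumes p: "p > 0" and w: "p_int p w"
    and m: "\<And>k. h k \<in> borel_measurable borel" and lim: "AE t in \<mu>. (\<lambda>k. h k t) \<longlonglongrightarrow> 0"
    and le: "\<And>k::nat. AE t in \<mu>. norm (h k t) \<le> norm (w t)"
  shows "(\<lambda>k. p_norm p (h k)) \<longlonglongrightarrow> 0"
proof -
  have "(\<lambda>k. integral\<^sup>L \<mu> (\<lambda>t. norm (h k t) powr p)) \<longlonglongrightarrow> integral\<^sup>L \<mu> (\<lambda>t. 0::real)"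
  proof (rule integral_dominated_convergence[where w = "\<lambda>t. norm (w t) powr p"])
    show "integrable \<mu> (\<lambda>t. norm (w t) powr p)" using w by (simp add: p_int_def)
    show "AE t in \<mu>. (\<lambda>k. norm (h k t) powr p) \<longlonglongrightarrow> 0"
      using lim
    proof eventually_elim
      case (elim t)
      then have "(\<lambda>k. norm (h k t)) \<longlonglongrightarrow> 0" by (rule tendsto_norm_zero)
      then have "(\<lambda>k. norm (h k t) powr p) \<longlonglongrightarrow> 0 powr p"
        using p by (intro tendsto_powr') auto
      then show ?case by simp
    qed
    show "AE t in \<mu>. norm (norm (h k t) powr p) \<le> norm (w t) powr p" for k
      using le[of k] by eventually_elim (use p in \<open>auto intro!: powr_mono2\<close>)
  qed (use m in auto)
  then have "(\<lambda>k. integral\<^sup>L \<mu> (\<lambda>t. norm (h k t) powr p) powr (1/p)) \<longlonglongrightarrow> 0 powr (1/p)"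
    using p by (intro tendsto_powr') (auto simp: integral_nonneg_AE)
  then show ?thesis by (simp add: p_norm_def)
qed

text \<open>Serves for limits of norm-bounded sequences for which no dominating function is at
  hand.\<close>

lemma p_norm_fatou:
  assumes p: "p > 0" and C: "C \<ge> 0"
    and f: "\<And>k. p_int p (f k)" and g: "g \<in> borel_measurable borel"
    and le: "\<And>k::nat. p_norm p (f k) \<le> C"
    and lim: "AE t in \<mu>. (\<lambda>k. f k t) \<longlonglongrightarrow> g t"
  shows "p_int p g" "p_norm p g \<le> C"
proof -
  have [measurable]: "\<And>k. f k \<in> borel_measurable borel" "g \<in> borel_measurable borel" using f g by auto
  have fk: "(\<integral>\<^sup>+t. ennreal (norm (f k t) powr p) \<partial>\<mu>) \<le> ennreal (C powr p)" for k
  proof -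
    have "(\<integral>\<^sup>+t. ennreal (norm (f k t) powr p) \<partial>\<mu>) = ennreal (integral\<^sup>L \<mu> (\<lambda>t. norm (f k t) powr p))"
      using f by (intro nn_integral_eq_integral) (auto simp: p_int_def)
    then show ?thesis using le[of k] p C by (simp add: p_norm_le_iff)
  qed
  have "(\<integral>\<^sup>+t. ennreal (norm (g t) powr p) \<partial>\<mu>) = (\<integral>\<^sup>+t. liminf (\<lambda>k. ennreal (norm (f k t) powr p)) \<partial>\<mu>)"
  proof (rule nn_integral_cong_AE, use lim in eventually_elim)
    case (elim t)
    then have "(\<lambda>k. norm (f k t) powr p) \<longlonglongrightarrow> norm (g t) powr p"
      using p by (intro tendsto_powr' tendsto_norm) auto
    then have "(\<lambda>k. ennreal (norm (f k t) powr p)) \<longlonglongrightarrow> ennreal (norm (g t) powr p)"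
      by (intro tendsto_ennrealI)
    then show ?case by (intro lim_imp_Liminf[symmetric]) auto
  qed
  also have "\<dots> \<le> liminf (\<lambda>k. \<integral>\<^sup>+t. ennreal (norm (f k t) powr p) \<partial>\<mu>)"
    by (intro nn_integral_liminf) simp
  also have "\<dots> \<le> liminf (\<lambda>k::nat. ennreal (C powr p))"
    by (intro Liminf_mono always_eventually allI fk)
  also have "\<dots> = ennreal (C powr p)" by (simp add: Liminf_const)
  finally have fin: "(\<integral>\<^sup>+t. ennreal (norm (g t) powr p) \<partial>\<mu>) \<le> ennreal (C powr p)" .
  then have "integrable \<mu> (\<lambda>t. norm (g t) powr p)"
    by (intro integrableI_bounded) (auto simp: less_top[symmetric] top_unique)
  then show pg: "p_int p g" using g by (simp add: p_int_def)
  have "ennreal (integral\<^sup>L \<mu> (\<lambda>t. norm (g t) powr p)) \<le> ennreal (C powr p)"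
    using fin pg by (subst nn_integral_eq_integral[symmetric]) (auto simp: p_int_def)
  then show "p_norm p g \<le> C"
    using p C by (simp add: p_norm_le_iff)
qed

section \<open>Density of the trigonometric polynomials and uniqueness of measures\<close>

definition p_approx :: "real \<Rightarrow> (complex \<Rightarrow> complex) \<Rightarrow> bool" where
  "p_approx p f \<longleftrightarrow> p_int p f \<and> (\<forall>e>0. \<exists>I c. finite I \<and> p_norm p (\<lambda>t. f t - tpoly I c t) < e)"

lemma p_approx_continuous:
  assumes f [measurable]: "f \<in> borel_measurable borel" and c: "continuous_on (sphere 0 1) f" and p: "p \<ge> 1"
  shows "p_approx p f"
  unfolding p_approx_def
proof (intro conjI allI impI)
  show "p_int p f" using assms by (intro p_int_continuous) auto
  fix e :: real assume e: "e > 0"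
  obtain I c where I: "finite I" "\<forall>t\<in>sphere 0 1. norm (f t - tpoly I c t) < e/2"
    using trig_approx[OF c, of "e/2"] e by auto
  have "p_norm p (\<lambda>t. f t - tpoly I c t) \<le> e/2"
  proof (rule p_int_bounded(2))
    show "AE t in \<mu>. norm (f t - tpoly I c t) \<le> e/2"
      using AE_circle_norm by eventually_elim (use I(2) in \<open>auto intro: less_imp_le\<close>)
  qed (use p in auto)
  with e I show "\<exists>I c. finite I \<and> p_norm p (\<lambda>t. f t - tpoly I c t) < e"
    by (intro exI[of _ I] exI[of _ c]) auto
qed

lemma p_approx_add:
  assumes "p_approx p f" "p_approx p g" "p \<ge> 1"
  shows "p_approx p (\<lambda>t. f t + g t)"
  unfolding p_approx_def
proof (intro conjI allI impI)
  have fg: "p_int p f" "p_int p g" using assms by (auto simp: p_approx_def)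
  then show "p_int p (\<lambda>t. f t + g t)" using assms by (intro p_int_add) auto
  fix e :: real assume e: "e > 0"
  obtain I c where I: "finite I" "p_norm p (\<lambda>t. f t - tpoly I c t) < e/2"
    using assms(1) e unfolding p_approx_def by (meson half_gt_zero)
  obtain J d where J: "finite J" "p_norm p (\<lambda>t. g t - tpoly J d t) < e/2"
    using assms(2) e unfolding p_approx_def by (meson half_gt_zero)
  obtain K h where K: "finite K" "tpoly K h = (\<lambda>t. tpoly I c t + tpoly J d t)"
    using tpoly_add[OF I(1) J(1)] by blast
  have "p_norm p (\<lambda>t. (f t - tpoly I c t) + (g t - tpoly J d t)) \<le> p_norm p (\<lambda>t. f t - tpoly I c t) + p_norm p (\<lambda>t. g t - tpoly J d t)"
    using assms(3) fg by (intro minkowski_circle p_int_diff p_int_tpoly) auto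
  also have "\<dots> < e" using I J by simp
  finally have "p_norm p (\<lambda>t. (f t + g t) - tpoly K h t) < e"
    by (simp add: K(2) algebra_simps)
  with K(1) show "\<exists>I c. finite I \<and> p_norm p (\<lambda>t. f t + g t - tpoly I c t) < e" by blast
qed

lemma p_approx_scale:
  assumes "p_approx p f" "p \<ge> 1"
  shows "p_approx p (\<lambda>t. z * f t)"
  unfolding p_approx_def
proof (intro conjI allI impI)
  show "p_int p (\<lambda>t. z * f t)" using assms by (auto simp: p_approx_def intro: p_int_scale)
  fix e :: real assume e: "e > 0"
  then have "e / (norm z + 1) > 0" by (simp add: add_nonneg_pos)
  then obtain I c where I: "finite I" "p_norm p (\<lambda>t. f t - tpoly I c t) < e / (norm z + 1)"
    using assms(1) unfolding p_approx_def by meson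
  have "p_norm p (\<lambda>t. z * f t - tpoly I (\<lambda>k. z * c k) t) = norm z * p_norm p (\<lambda>t. f t - tpoly I c t)"
    using assms(2) by (subst p_norm_scale[symmetric]) (auto simp: tpoly_scale right_diff_distrib)
  also have "\<dots> \<le> (norm z + 1) * p_norm p (\<lambda>t. f t - tpoly I c t)"
    by (intro mult_right_mono) auto
  also have "\<dots> < e" using I(2) by (simp add: pos_less_divide_eq add_nonneg_pos mult.commute)
  finally show "\<exists>I c. finite I \<and> p_norm p (\<lambda>t. z * f t - tpoly I c t) < e" using I(1) by blast
qed

lemma p_approx_sum:
  assumes "\<And>i. i \<in> A \<Longrightarrow> p_approx p (f i)" "p \<ge> 1"
  shows "p_approx p (\<lambda>t. \<Sum>i\<in>A. f i t)"
proof -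
  have "p_approx p (\<lambda>t. 0)" using assms(2) by (intro p_approx_continuous) auto
  then show ?thesis using assms
    by (induction A rule: infinite_finite_induct) (auto intro: p_approx_add)
qed

lemma p_approx_limit:
  assumes f: "p_int p f" and g: "\<And>k::nat. p_approx p (g k)" and p: "p \<ge> 1"
    and lim: "(\<lambda>k. p_norm p (\<lambda>t. f t - g k t)) \<longlonglongrightarrow> 0"
  shows "p_approx p f"
  unfolding p_approx_def
proof (intro conjI allI impI)
  fix e :: real assume e: "e > 0"
  obtain k where k: "p_norm p (\<lambda>t. f t - g k t) < e/2"
    using order_tendstoD(2)[OF lim, of "e/2"] e by (auto simp: eventually_sequentially)
  have gk: "p_int p (g k)" using g by (simp add: p_approx_def)
  obtain I c where I: "finite I" "p_norm p (\<lambda>t. g k t - tpoly I c t) < e/2"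
    using g e unfolding p_approx_def by (meson half_gt_zero)
  have "p_norm p (\<lambda>t. f t - tpoly I c t) \<le> p_norm p (\<lambda>t. f t - g k t) + p_norm p (\<lambda>t. g k t - tpoly I c t)"
    using p by (intro minkowski_diff f gk p_int_tpoly) auto
  also have "\<dots> < e" using k I by simp
  finally show "\<exists>I c. finite I \<and> p_norm p (\<lambda>t. f t - tpoly I c t) < e" using I(1) by blast
qed fact

lemma p_approx_dominated:
  assumes f: "p_int p f" and g: "\<And>k::nat. p_approx p (g k)" and p: "p \<ge> 1" and w: "p_int p w"
    and lim: "\<And>t. (\<lambda>k. g k t) \<longlonglongrightarrow> f t" and le: "\<And>k t. norm (f t - g k t) \<le> norm (w t)"
  shows "p_approx p f"
proof (rule p_approx_limit[OF f g p])
  have [measurable]: "\<And>k. g k \<in> borel_measurable borel" "f \<in> borel_measurable borel"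
    using f g by (auto simp: p_approx_def)
  show "(\<lambda>k. p_norm p (\<lambda>t. f t - g k t)) \<longlonglongrightarrow> 0"
  proof (rule p_norm_dominated[OF _ w])
    show "AE t in \<mu>. (\<lambda>k. f t - g k t) \<longlonglongrightarrow> 0"
      by (intro AE_I2) (metis lim tendsto_diff[OF tendsto_const] diff_self)
  qed (use p le in auto)
qed

text \<open>A continuous function equal to 1 on \<open>A\<close> that falls linearly with the
  distance from \<open>A\<close>; as \<open>k\<close> grows it decreases to the indicator of a
  nonempty closed set.\<close>

definition bump :: "complex set \<Rightarrow> nat \<Rightarrow> complex \<Rightarrow> complex" where
  "bump A k t = of_real (max 0 (1 - real k * infdist t A))"

lemma continuous_on_bump: "continuous_on S (bump A k)"
  unfolding bump_def by (intro continuous_intros continuous_on_infdist)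

lemma bump_borel [measurable]: "bump A k \<in> borel_measurable borel"
  by (intro borel_measurable_continuous_onI continuous_on_bump)

lemma bump_range: "0 \<le> Re (bump A k t)" "Re (bump A k t) \<le> 1" "norm (bump A k t) \<le> 1"
  using infdist_nonneg[of t A] by (auto simp: bump_def)

lemma bump_tendsto:
  assumes "closed A" "A \<noteq> {}"
  shows "(\<lambda>k. bump A k t) \<longlonglongrightarrow> of_real (indicator A t)"
proof (cases "t \<in> A")
  case True
  then show ?thesis by (simp add: bump_def)
next
  case False
  then have pos: "infdist t A > 0"
    using assms by (metis in_closed_iff_infdist_zero infdist_nonneg less_le)
  have "eventually (\<lambda>k. bump A k t = 0) sequentially"
  proof (rule eventually_sequentiallyI[of "nat \<lceil>1 / infdist t A\<rceil>"])
    fix k assume "k \<ge> nat \<lceil>1 / infdist t A\<rceil>"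
    then have "real k \<ge> 1 / infdist t A" by linarith
    then have "real k * infdist t A \<ge> 1" using pos by (simp add: field_simps)
    then show "bump A k t = 0" by (simp add: bump_def)
  qed
  then show ?thesis using False by (simp add: tendsto_eventually)
qed

text \<open>Dynkin's argument: the sets with approximable indicator contain the closed sets and are
  stable under complements and countable disjoint unions.\<close>

lemma p_approx_indicator:
  assumes p: "p \<ge> 1" and A: "A \<in> sets borel"
  shows "p_approx p (\<lambda>t. of_real (indicator A t))"
proof -
  have int: "p_int p (\<lambda>t. of_real (indicator A t))" if "A \<in> sets borel" for A
    using that p by (intro p_int_bounded[where C = 1]) (auto simp: indicator_def)
  have sig: "A \<in> sigma_sets UNIV (Collect closed)"
    using A by (simp add: borel_eq_closed)
  have "Int_stable (Collect closed :: complex set set)" "Collect closed \<subseteq> Pow (UNIV :: complex set)"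
    by (auto simp: Int_stable_def)
  then show ?thesis
    using sig
  proof (induction A rule: sigma_sets_induct_disjoint)
    case (basic A)
    then have A: "closed A" by simp
    show ?case
    \<comment> \<open>The distance to the empty set is 0 by convention, so the bumps of the empty
      set would be constantly 1.\<close>
    proof (cases "A = {}")
      case True
      then show ?thesis using p by (auto intro: p_approx_continuous)
    next
      case False
      show ?thesis
      proof (rule p_approx_dominated[OF int _ p p_int_const[of p 1]])
        show "(\<lambda>k. bump A k t) \<longlonglongrightarrow> of_real (indicator A t)" for t
          by (rule bump_tendsto[OF A False])
        show "p_approx p (bump A k)" for k
          by (intro p_approx_continuous continuous_on_bump p) simp
        show "norm (of_real (indicator A t) - bump A k t) \<le> norm (1::complex)" for k t
        proof -
          have "of_real (indicator A t) - bump A k t = complex_of_real (indicator A t - max 0 (1 - real k * infdist t A))"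
            by (simp add: bump_def)
          then have "norm (of_real (indicator A t) - bump A k t) = \<bar>indicator A t - max 0 (1 - real k * infdist t A)\<bar>"
            by (simp only: norm_of_real)
          also have "\<dots> \<le> 1"
            using infdist_nonneg[of t A] by (auto simp: indicator_def max_def)
          finally show ?thesis by simp
        qed
      qed (use A in auto)
    qed
  next
    case empty show ?case using p by (auto intro: p_approx_continuous)
  next
    case (compl A)
    have "p_approx p (\<lambda>t. 1 + (-1) * of_real (indicator A t))"
      using compl p by (intro p_approx_add p_approx_scale) (auto intro: p_approx_continuous)
    moreover have "(\<lambda>t. 1 + (-1) * of_real (indicator A t)) = (\<lambda>t. complex_of_real (indicator (UNIV - A) t))"
      by (auto simp: indicator_def)
    ultimately show ?case by simp
  next
    case (union A)
    have Ab: "A i \<in> sets borel" for i using union(2) by (auto simp: borel_eq_closed)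
    \<comment> \<open>Disjointness makes every partial sum an indicator, which is why the constant 1
      dominates the error below.\<close>
    have eq: "(\<Sum>i<k. complex_of_real (indicator (A i) t)) = of_real (indicator (\<Union>i<k. A i) t)" for k t
      using union(1) by (subst indicator_UN_disjoint) (auto simp: disjoint_family_on_def)
    show ?case
    proof (rule p_approx_dominated[OF int _ p p_int_const[of p 1]])
      show "p_approx p (\<lambda>t. \<Sum>i<k. complex_of_real (indicator (A i) t))" for k
        using union(3) p by (intro p_approx_sum) auto
      show "(\<lambda>k. \<Sum>i<k. complex_of_real (indicator (A i) t)) \<longlonglongrightarrow> of_real (indicator (\<Union>i. A i) t)" for t
        unfolding eq by (intro tendsto_of_real LIMSEQ_indicator_UN)
      show "norm (of_real (indicator (\<Union>i. A i) t) - (\<Sum>i<k. complex_of_real (indicator (A i) t))) \<le> norm (1::complex)" for k t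
        unfolding eq by (auto simp: indicator_def)
    qed (use Ab in auto)
  qed
qed

lemma trig_dense:
  assumes p: "p \<ge> 1" and f: "p_int p f"
  shows "p_approx p f"
proof -
  have [measurable]: "f \<in> borel_measurable borel" using f by auto
  obtain F where F: "\<And>i. simple_function borel (F i)" "\<And>t. (\<lambda>i. F i t) \<longlonglongrightarrow> f t"
      "\<And>i t. norm (F i t) \<le> 2 * norm (f t)"
    using borel_measurable_implies_sequence_metric[of f borel 0] by auto
  show ?thesis
  \<comment> \<open>The simple functions satisfy \<open>norm (F k t) \<le> 2 * norm (f t)\<close>;
    hence \<open>3 * f\<close> dominates the error.\<close>
  proof (rule p_approx_dominated[OF f _ p p_int_scale[OF f, of 3] F(2)])
    show "norm (f t - F k t) \<le> norm (3 * f t)" for k t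
      using norm_triangle_ineq4[of "f t" "F k t"] F(3)[of k t] by (simp add: norm_mult)
    fix i
    have fin: "finite (range (F i))" using F(1)[of i] by (simp add: simple_function_def)
    have "p_approx p (\<lambda>t. \<Sum>y\<in>range (F i). y * of_real (indicator (F i -` {y}) t))"
    proof (intro p_approx_sum p_approx_scale p_approx_indicator p)
      fix y
      show "F i -` {y} \<in> sets borel"
        using F(1)[of i] by (metis simple_functionD(2) Int_UNIV_right space_borel)
    qed
    moreover have "(\<Sum>y\<in>range (F i). y * of_real (indicator (F i -` {y}) t)) = F i t" for t
    proof -
      have "(\<Sum>y\<in>range (F i). y * of_real (indicator (F i -` {y}) t)) = (\<Sum>y\<in>range (F i). if y = F i t then y else 0)"
        by (intro sum.cong) (auto simp: indicator_def)
      also have "\<dots> = F i t" using fin by (subst sum.delta) auto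
      finally show ?thesis .
    qed
    ultimately show "p_approx p (F i)" by simp
  qed
qed

text \<open>Equal moments give equal integrals of trigonometric polynomials, then of continuous
  functions by uniform approximation, then equal measures of closed sets through the bumps; closed
  sets form an intersection-stable generator. The lemma is meant for the image of arc length under
  \<open>alpha\<close>.\<close>

lemma circle_measure_eqI:
  assumes fin: "finite_measure \<nu>" and sets: "sets \<nu> = sets borel" and circ: "AE t in \<nu>. norm t = 1"
    and mom: "\<And>k::int. integral\<^sup>L \<nu> (\<lambda>t. t powi k) = (if k = 0 then 1 else 0)"
  shows "\<nu> = \<mu>"
proof -
  interpret \<nu>: finite_measure \<nu> by fact
  have m [simp]: "measurable \<nu> N = measurable borel N" for N
    by (rule measurable_cong_sets) (simp_all add: sets)
  have space [simp]: "space \<nu> = UNIV" using sets_eq_imp_space_eq[OF sets] by simp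
  have int: "integrable \<nu> f" if [measurable]: "f \<in> borel_measurable borel" and "continuous_on (sphere 0 1) f" for f :: "complex \<Rightarrow> complex"
  proof -
    have "compact (f ` sphere 0 1)"
      by (intro compact_continuous_image that) auto
    then obtain B where B: "\<And>t. t \<in> sphere 0 1 \<Longrightarrow> norm (f t) \<le> B"
      by (meson bounded_iff compact_imp_bounded image_eqI)
    show ?thesis
    proof (rule \<nu>.integrable_const_bound[where B = B])
      show "AE t in \<nu>. norm (f t) \<le> B"
        using circ by eventually_elim (auto intro: B)
    qed simp
  qed
  have tp: "integral\<^sup>L \<nu> (tpoly I c) = integral\<^sup>L \<mu> (tpoly I c)" for I c
  proof -
    have "integral\<^sup>L \<nu> (tpoly I c) = (\<Sum>k\<in>I. c k * integral\<^sup>L \<nu> (\<lambda>t. t powi k))"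
      unfolding tpoly_def by (subst Bochner_Integration.integral_sum)
        (auto intro!: int continuous_on_powi_sphere continuous_on_mult continuous_on_const)
    moreover have "integral\<^sup>L \<mu> (tpoly I c) = (\<Sum>k\<in>I. c k * integral\<^sup>L \<mu> (\<lambda>t. t powi k))"
      unfolding tpoly_def by (subst Bochner_Integration.integral_sum)
        (auto intro!: continuous_on_circle_integrable continuous_on_powi_sphere continuous_on_mult continuous_on_const)
    ultimately show ?thesis by (simp add: mom integral_powi)
  qed
  have cont: "integral\<^sup>L \<nu> f = integral\<^sup>L \<mu> f"
    if f [measurable]: "f \<in> borel_measurable borel" and c: "continuous_on (sphere 0 1) f" for f :: "complex \<Rightarrow> complex"
  proof -
    \<comment> \<open>The uniform error is paid once for \<open>\<nu>\<close> and once for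
      \<open>\<mu>\<close>, which has mass 1.\<close>
    define L where "L = measure \<nu> UNIV + 1"
    have L: "L > 0" by (simp add: L_def add_nonneg_pos)
    have "norm (integral\<^sup>L \<nu> f - integral\<^sup>L \<mu> f) \<le> e" if e: "e > 0" for e
    proof -
      obtain I c where I: "\<forall>t\<in>sphere 0 1. norm (f t - tpoly I c t) < e / L"
        using trig_approx[OF c, of "e / L"] e L by auto
      let ?g = "\<lambda>t. f t - tpoly I c t"
      have gm: "?g \<in> borel_measurable borel" by measurable
      have gc: "continuous_on (sphere 0 1) ?g" by (intro continuous_intros c continuous_on_tpoly)
      have "norm (integral\<^sup>L \<nu> ?g) \<le> integral\<^sup>L \<nu> (\<lambda>t. norm (?g t))" by (rule integral_norm_bound)
      also have "\<dots> \<le> integral\<^sup>L \<nu> (\<lambda>t. e / L)"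
      proof (rule integral_mono_AE)
        show "AE t in \<nu>. norm (?g t) \<le> e / L"
          using circ by eventually_elim (use I in \<open>auto intro: less_imp_le\<close>)
      qed (use int[OF gm gc] in auto)
      finally have 1: "norm (integral\<^sup>L \<nu> ?g) \<le> measure \<nu> UNIV * (e / L)" by simp
      have "norm (integral\<^sup>L \<mu> ?g) \<le> integral\<^sup>L \<mu> (\<lambda>t. norm (?g t))" by (rule integral_norm_bound)
      also have "\<dots> \<le> integral\<^sup>L \<mu> (\<lambda>t. e / L)"
      proof (rule integral_mono_AE)
        show "AE t in \<mu>. norm (?g t) \<le> e / L"
          using AE_circle_norm by eventually_elim (use I in \<open>auto intro: less_imp_le\<close>)
      qed (use continuous_on_circle_integrable[OF gm gc] in auto)
      finally have 2: "norm (integral\<^sup>L \<mu> ?g) \<le> e / L" by (simp add: circle.prob_space[simplified])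
      have "integral\<^sup>L \<nu> f - integral\<^sup>L \<mu> f = integral\<^sup>L \<nu> ?g - integral\<^sup>L \<mu> ?g"
        using tp[of I c] int[OF f c] int[OF tpoly_borel continuous_on_tpoly]
          continuous_on_circle_integrable[OF f c] continuous_on_circle_integrable[OF tpoly_borel continuous_on_tpoly]
        by simp
      then have "norm (integral\<^sup>L \<nu> f - integral\<^sup>L \<mu> f) \<le> norm (integral\<^sup>L \<nu> ?g) + norm (integral\<^sup>L \<mu> ?g)"
        by (metis norm_triangle_ineq4)
      also have "\<dots> \<le> measure \<nu> UNIV * (e / L) + e / L" using 1 2 by simp
      also have "\<dots> = L * (e / L)" by (simp only: L_def distrib_right mult_1)
      also have "\<dots> = e" using L by simp
      finally show ?thesis .
    qed
    then have "norm (integral\<^sup>L \<nu> f - integral\<^sup>L \<mu> f) \<le> 0 + e" if "e > 0" for e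
      using that by simp
    then have "norm (integral\<^sup>L \<nu> f - integral\<^sup>L \<mu> f) \<le> 0"
      by (rule field_le_epsilon)
    then show ?thesis by simp
  qed
  have closed: "emeasure \<nu> A = emeasure \<mu> A" if A: "closed A" for A
  proof (cases "A = {}")
    case False
    have A' [measurable]: "A \<in> sets borel" using A by simp
    have l1: "(\<lambda>k. integral\<^sup>L \<nu> (bump A k)) \<longlonglongrightarrow> integral\<^sup>L \<nu> (\<lambda>t. complex_of_real (indicator A t))"
      by (rule integral_dominated_convergence[where w = "\<lambda>_. 1"])
        (auto intro!: AE_I2 bump_tendsto A False bump_range(3))
    have l2: "(\<lambda>k. integral\<^sup>L \<mu> (bump A k)) \<longlonglongrightarrow> integral\<^sup>L \<mu> (\<lambda>t. complex_of_real (indicator A t))"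
      by (rule integral_dominated_convergence[where w = "\<lambda>_. 1"])
        (auto intro!: AE_I2 bump_tendsto A False bump_range(3))
    have "integral\<^sup>L \<nu> (\<lambda>t. complex_of_real (indicator A t)) = integral\<^sup>L \<mu> (\<lambda>t. complex_of_real (indicator A t))"
      using LIMSEQ_unique[OF l1[unfolded cont[OF bump_borel continuous_on_bump]] l2] .
    then have "measure \<nu> A = measure \<mu> A"
      by (simp del: of_real_indicator)
    then show ?thesis
      by (simp add: \<nu>.emeasure_eq_measure circle.emeasure_eq_measure)
  qed simp
  show ?thesis
  proof (rule measure_eqI_generator_eq[where E = "Collect closed" and \<Omega> = UNIV and A = "\<lambda>_. UNIV"])
    show "sets \<nu> = sigma_sets UNIV (Collect closed)" "sets \<mu> = sigma_sets UNIV (Collect closed)"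
      using sets by (simp_all add: borel_eq_closed)
  qed (auto simp: closed Int_stable_def)
qed

section \<open>M. Riesz's theorem\<close>

text \<open>Away from \<open>pi / 2\<close> the cosine is bounded below and the first term wins.
  Near \<open>pi / 2\<close> the angle \<open>p * \<theta>\<close> lies between
  \<open>pi / 2\<close> and \<open>pi\<close>, so its cosine is negative and the second term wins;
  staying below \<open>pi\<close> is where \<open>p \<le> 2\<close> enters.\<close>

lemma cos_powr_ineq:
  fixes p :: real
  assumes p: "1 < p" "p \<le> 2"
  obtains A B :: real where "A \<ge> 0" "B \<ge> 0" "\<And>\<theta>. \<bar>\<theta>\<bar> \<le> pi/2 \<Longrightarrow> 1 \<le> A * cos \<theta> powr p - B * cos (p * \<theta>)"
proof -
  \<comment> \<open>The midpoint of \<open>pi / (2 * p)\<close>, where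
    \<open>cos (p * \<theta>)\<close> changes sign, and \<open>pi / 2\<close>.\<close>
  define \<theta>0 where "\<theta>0 = pi * (1 + 1/p) / 4"
  define x where "x = pi * (1/p)"
  have x: "0 < x" "x < pi" using p by (auto simp: x_def pos_divide_less_eq)
  have "\<theta>0 = (pi + x) / 4" by (simp add: \<theta>0_def x_def distrib_left)
  with x have t0: "0 < \<theta>0" "\<theta>0 < pi/2" by auto
  have pt0: "p * \<theta>0 = pi * (p + 1) / 4" using p by (simp add: \<theta>0_def field_simps)
  have pt1: "pi/2 < p * \<theta>0" "p * \<theta>0 \<le> pi" unfolding pt0 using p pi_gt_zero by (auto simp: field_simps)
  define \<delta> where "\<delta> = - cos (p * \<theta>0)"
  have \<delta>: "\<delta> > 0" using cos_monotone_0_pi[of "pi/2" "p * \<theta>0"] pt1 pi_gt_zero by (simp add: \<delta>_def)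
  have c0: "cos \<theta>0 > 0" using t0 by (intro cos_gt_zero) auto
  \<comment> \<open>With \<open>B = 1 / \<delta>\<close> the second term costs at most
    \<open>1 / \<delta>\<close> on the first interval, and \<open>A\<close> is chosen to give
    exactly \<open>1 + 1 / \<delta>\<close> at \<open>\<theta>0\<close>.\<close>
  define A where "A = (1 + 1/\<delta>) / cos \<theta>0 powr p"
  have A: "A \<ge> 0" using \<delta> by (simp add: A_def)
  have main: "1 \<le> A * cos \<theta> powr p - 1/\<delta> * cos (p * \<theta>)" if \<theta>: "0 \<le> \<theta>" "\<theta> \<le> pi/2" for \<theta>
  proof (cases "\<theta> \<le> \<theta>0")
    case True
    have "cos \<theta>0 \<le> cos \<theta>" using True \<theta> t0 by (intro cos_monotone_0_pi_le) auto
    then have "cos \<theta>0 powr p \<le> cos \<theta> powr p" using c0 p by (intro powr_mono2) auto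
    then have "A * cos \<theta>0 powr p \<le> A * cos \<theta> powr p" using A by (rule mult_left_mono)
    moreover have "A * cos \<theta>0 powr p = 1 + 1/\<delta>" using c0 by (simp add: A_def)
    moreover have "1/\<delta> * cos (p * \<theta>) \<le> 1/\<delta> * 1" using \<delta> by (intro mult_left_mono) auto
    ultimately show ?thesis by linarith
  next
    case False
    have "p * \<theta> \<le> 2 * (pi/2)" using p \<theta> by (intro mult_mono) auto
    moreover have "p * \<theta>0 \<le> p * \<theta>" using False p by simp
    ultimately have "cos (p * \<theta>) \<le> cos (p * \<theta>0)"
      using p t0 by (intro cos_monotone_0_pi_le) auto
    then have "1/\<delta> * cos (p * \<theta>) \<le> 1/\<delta> * (- \<delta>)" using \<delta> by (intro mult_left_mono) (auto simp: \<delta>_def)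
    then have "1/\<delta> * cos (p * \<theta>) \<le> -1" using \<delta> by simp
    moreover have "A * cos \<theta> powr p \<ge> 0" using A by simp
    ultimately show ?thesis by linarith
  qed
  show ?thesis
  proof
    show "1 \<le> A * cos \<theta> powr p - 1/\<delta> * cos (p * \<theta>)" if "\<bar>\<theta>\<bar> \<le> pi/2" for \<theta>
      using main[of "\<bar>\<theta>\<bar>"] that by (cases "\<theta> \<ge> 0") auto
  qed (use A \<delta> in auto)
qed

text \<open>The inequality for the angle of \<open>w\<close>, multiplied by
  \<open>norm w powr p\<close>. Its last term is the real part of the holomorphic power of
  \<open>w\<close>, whose circle integral is a value at the centre.\<close>

lemma right_halfplane_powr_ineq:
  fixes p :: real
  assumes p: "1 < p" "p \<le> 2"
  obtains A B :: real where "A \<ge> 0" "B \<ge> 0"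
    "\<And>w. Re w > 0 \<Longrightarrow> norm w powr p \<le> A * Re w powr p - B * Re (exp (of_real p * Ln w))"
proof -
  obtain A B :: real where AB: "A \<ge> 0" "B \<ge> 0" "\<And>\<theta>. \<bar>\<theta>\<bar> \<le> pi/2 \<Longrightarrow> 1 \<le> A * cos \<theta> powr p - B * cos (p * \<theta>)"
    using cos_powr_ineq[OF p] by blast
  show ?thesis
  proof
    fix w :: complex assume w: "Re w > 0"
    then have w0: "w \<noteq> 0" by auto
    define \<theta> where "\<theta> = Im (Ln w)"
    have \<theta>: "\<bar>\<theta>\<bar> < pi/2" using w Re_Ln_pos_lt[OF w0] by (simp add: \<theta>_def)
    have "w = exp (Ln w)" using w0 by simp
    also have "\<dots> = of_real (exp (Re (Ln w))) * cis \<theta>" by (simp add: exp_eq_polar \<theta>_def)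
    also have "exp (Re (Ln w)) = norm w" using w0 by simp
    finally have "Re w = Re (of_real (norm w) * cis \<theta>)" by simp
    then have Rew: "Re w = norm w * cos \<theta>" by simp
    have "exp (of_real p * Ln w) = of_real (exp (p * Re (Ln w))) * cis (p * \<theta>)"
      by (simp add: exp_eq_polar \<theta>_def)
    then have Reh: "Re (exp (of_real p * Ln w)) = norm w powr p * cos (p * \<theta>)"
      using w0 by (simp add: powr_def)
    have "norm w powr p * 1 \<le> norm w powr p * (A * cos \<theta> powr p - B * cos (p * \<theta>))"
      using AB(3)[of \<theta>] \<theta> by (intro mult_left_mono) auto
    also have "\<dots> = A * Re w powr p - B * Re (exp (of_real p * Ln w))"
      unfolding Reh unfolding Rew using \<theta> by (subst powr_mult) (auto simp: algebra_simps cos_ge_zero)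
    finally show "norm w powr p \<le> A * Re w powr p - B * Re (exp (of_real p * Ln w))" by simp
  qed (use AB in auto)
qed

section \<open>Fourier coefficients and Riesz's bound for positive polynomials\<close>

definition fcoef :: "(complex \<Rightarrow> complex) \<Rightarrow> int \<Rightarrow> complex" where
  "fcoef f n = integral\<^sup>L \<mu> (\<lambda>t. f t * t powi (- n))"

lemma fcoef_tpoly:
  assumes "finite I"
  shows "fcoef (tpoly I c) n = (if n \<in> I then c n else 0)"
proof -
  have "fcoef (tpoly I c) n = integral\<^sup>L \<mu> (\<lambda>t. \<Sum>k\<in>I. c k * t powi (k - n))"
    unfolding fcoef_def
  proof (intro integral_cong_AE)
    show "AE t in \<mu>. tpoly I c t * t powi (- n) = (\<Sum>k\<in>I. c k * t powi (k - n))"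
      using AE_circle_nonzero
      by eventually_elim (simp add: tpoly_def sum_distrib_right power_int_diff power_int_minus divide_inverse mult.assoc)
  qed auto
  also have "\<dots> = (\<Sum>k\<in>I. c k * integral\<^sup>L \<mu> (\<lambda>t. t powi (k - n)))"
    by (subst Bochner_Integration.integral_sum)
      (auto intro!: continuous_on_circle_integrable continuous_on_powi_sphere continuous_on_mult continuous_on_const)
  also have "\<dots> = (\<Sum>k\<in>I. if k = n then c k else 0)"
    by (intro sum.cong) (auto simp: integral_powi)
  also have "\<dots> = (if n \<in> I then c n else 0)" using assms by (subst sum.delta) auto
  finally show ?thesis .
qed

lemma powi_circle_minus: "norm t = 1 \<Longrightarrow> t powi (- k) = cnj (t powi k)"
  using inverse_circle[of t] by (metis complex_cnj_power_int power_int_inverse power_int_minus)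

lemma norm_powi_circle: "norm (t :: complex) = 1 \<Longrightarrow> norm (t powi k) = 1"
  by (simp add: norm_power_int)

lemma integrable_mult_powi:
  assumes "integrable \<mu> f"
  shows "integrable \<mu> (\<lambda>t. f t * t powi k)"
proof (rule Bochner_Integration.integrable_bound[OF assms])
  have [measurable]: "f \<in> borel_measurable borel" using borel_measurable_integrable[OF assms] by simp
  show "(\<lambda>t. f t * t powi k) \<in> borel_measurable \<mu>" by simp
  show "AE t in \<mu>. norm (f t * t powi k) \<le> norm (f t)"
    using AE_circle_norm by eventually_elim (simp add: norm_mult norm_powi_circle)
qed

lemma norm_fcoef_le:
  assumes "p > 1" "p_int p f"
  shows "norm (fcoef f n) \<le> p_norm p f"
proof -
  have [measurable]: "f \<in> borel_measurable borel" using assms by auto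
  have "norm (fcoef f n) \<le> integral\<^sup>L \<mu> (\<lambda>t. norm (f t * t powi (- n)))"
    unfolding fcoef_def by (rule integral_norm_bound)
  also have "\<dots> = integral\<^sup>L \<mu> (\<lambda>t. norm (f t))"
  proof (intro integral_cong_AE)
    show "AE t in \<mu>. norm (f t * t powi (- n)) = norm (f t)"
      using AE_circle_norm by eventually_elim (simp add: norm_mult norm_powi_circle)
  qed auto
  also have "\<dots> \<le> p_norm p f" using L1_le_p_norm[OF assms] by simp
  finally show ?thesis .
qed

lemma fcoef_diff:
  assumes "integrable \<mu> f" "integrable \<mu> g"
  shows "fcoef (\<lambda>t. f t - g t) n = fcoef f n - fcoef g n"
  unfolding fcoef_def using integrable_mult_powi[OF assms(1)] integrable_mult_powi[OF assms(2)]
  by (simp add: left_diff_distrib)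

lemma trig_real_symmetric_coeffs:
  assumes fin: "finite I" and re: "\<And>t. norm t = 1 \<Longrightarrow> tpoly I c t \<in> \<real>"
  shows "fcoef (tpoly I c) (- n) = cnj (fcoef (tpoly I c) n)"
proof -
  have "fcoef (tpoly I c) (- n) = integral\<^sup>L \<mu> (\<lambda>t. cnj (tpoly I c t * t powi (- n)))"
    unfolding fcoef_def
  proof (intro integral_cong_AE)
    show "AE t in \<mu>. tpoly I c t * t powi (- (- n)) = cnj (tpoly I c t * t powi (- n))"
      using AE_circle_norm
    proof eventually_elim
      case (elim t)
      show ?case using re[OF elim] powi_circle_minus[OF elim, of n]
        by (simp add: Reals_cnj_iff)
    qed
  qed auto
  also have "\<dots> = cnj (fcoef (tpoly I c) n)"
    unfolding fcoef_def by (rule Bochner_Integration.integral_cnj)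
  finally show ?thesis .
qed

lemma positive_trig_bound:
  fixes p :: real
  assumes p: "1 < p" "p \<le> 2"
  obtains C where "C \<ge> 0" "\<And>I c. finite I \<Longrightarrow> (\<And>t. norm t = 1 \<Longrightarrow> tpoly I c t \<in> \<real> \<and> Re (tpoly I c t) > 0) \<Longrightarrow>
     p_norm p (tpoly {k\<in>I. 0 \<le> k} c) \<le> C * p_norm p (tpoly I c)"
proof -
  obtain A B :: real where AB: "A \<ge> 0" "B \<ge> 0"
    "\<And>w. Re w > 0 \<Longrightarrow> norm w powr p \<le> A * Re w powr p - B * Re (exp (of_real p * Ln w))"
    using right_halfplane_powr_ineq[OF p] by blast
  \<comment> \<open>Half of the bound for \<open>F\<close> plus half of the bound 1 for the constant
    term \<open>d 0\<close>.\<close>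
  define C where "C = (A powr (1/p) + 1) / 2"
  show ?thesis
  proof
    show "C \<ge> 0" by (simp add: C_def)
    fix I c assume fin: "finite I" and pos: "\<And>t. norm t = 1 \<Longrightarrow> tpoly I c t \<in> \<real> \<and> Re (tpoly I c t) > 0"
    define q where "q = tpoly I c"
    define d where "d = fcoef q"
    have dI: "d k = (if k \<in> I then c k else 0)" for k unfolding d_def q_def by (rule fcoef_tpoly[OF fin])
    have sym: "d (- k) = cnj (d k)" for k
      unfolding d_def q_def by (rule trig_real_symmetric_coeffs[OF fin]) (use pos in auto)
    define N where "N = Max (insert 0 ((\<lambda>k. nat \<bar>k\<bar>) ` I))"
    have "nat \<bar>k\<bar> \<le> N" if "k \<in> I" for k
      unfolding N_def using fin that by (intro Max_ge) auto
    then have N: "I \<subseteq> {- int N..int N}" by fastforce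
    define a where "a = (\<lambda>z. \<Sum>k=1..N. d (int k) * z ^ k)"
    \<comment> \<open>The coefficients of \<open>q\<close> are Hermitian, so the negative
      frequencies contribute the conjugate of \<open>a\<close>; doubling \<open>a\<close> therefore
      restores the real part \<open>q\<close>.\<close>
    define F where "F = (\<lambda>z. d 0 + 2 * a z)"
    have qa: "q t = d 0 + a t + cnj (a t)" if t: "norm t = 1" for t
    proof -
      have "q t = (\<Sum>k\<in>{- int N..int N}. d k * t powi k)"
        unfolding q_def tpoly_extend[OF finite_atLeastAtMost_int N] by (simp add: tpoly_def dI)
      also have "{- int N..int N} = insert 0 (int ` {1..N} \<union> (\<lambda>k. - int k) ` {1..N})"
      proof (intro set_eqI iffI)
        fix k assume k: "k \<in> {- int N..int N}"
        consider "k = 0" | "k > 0" | "k < 0" by linarith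
        then show "k \<in> insert 0 (int ` {1..N} \<union> (\<lambda>k. - int k) ` {1..N})"
        proof cases
          case 2 then show ?thesis using k by (auto intro!: image_eqI[of _ _ "nat k"])
        next
          case 3 then show ?thesis using k by (auto intro!: image_eqI[of _ "\<lambda>k. - int k" "nat (-k)"])
        qed simp
      qed auto
      also have "(\<Sum>k\<in>\<dots>. d k * t powi k) = d 0 + ((\<Sum>k\<in>int ` {1..N}. d k * t powi k) + (\<Sum>k\<in>(\<lambda>k. - int k) ` {1..N}. d k * t powi k))"
        by (subst sum.insert) (auto intro!: sum.union_disjoint)
      also have "(\<Sum>k\<in>int ` {1..N}. d k * t powi k) = a t"
        by (subst sum.reindex) (auto simp: a_def)
      also have "(\<Sum>k\<in>(\<lambda>k. - int k) ` {1..N}. d k * t powi k) = cnj (a t)"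
        by (subst sum.reindex) (auto simp: a_def inj_on_def sym powi_circle_minus[OF t])
      finally show ?thesis by simp
    qed
    have d0: "Im (d 0) = 0" using sym[of 0] by (metis complex_cnj_cancel_iff minus_zero Reals_cnj_iff complex_is_Real_iff)
    have ReF: "q t = of_real (Re (F t))" "Re (F t) > 0" if t: "norm t = 1" for t
    proof -
      have "Re (F t) = Re (q t)" "Im (q t) = 0" using qa[OF t] d0 by (auto simp: F_def)
      then show "q t = of_real (Re (F t))" "Re (F t) > 0" using pos[OF t] by (auto simp: complex_eq_iff q_def)
    qed
    have holF: "F holomorphic_on S" for S unfolding F_def a_def by (intro holomorphic_intros)
    have contF: "continuous_on S F" for S using holF[of S] by (rule holomorphic_on_imp_continuous_on)
    have Fb [measurable]: "F \<in> borel_measurable borel"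
      by (intro borel_measurable_continuous_onI contF)
    \<comment> \<open>The minimum principle for the real part, in the form of the maximum modulus
      principle for \<open>exp (- F z)\<close>.\<close>
    have ReF_ball: "Re (F z) > 0" if z: "z \<in> cball 0 1" for z
    proof -
      have "compact (sphere (0::complex) 1)" "sphere (0::complex) 1 \<noteq> {}" by auto
      moreover have "continuous_on (sphere 0 1) (\<lambda>t. Re (F t))" by (intro continuous_intros contF)
      ultimately obtain t0 where t0: "t0 \<in> sphere 0 1" "\<And>t. t \<in> sphere 0 1 \<Longrightarrow> Re (F t0) \<le> Re (F t)"
        using continuous_attains_inf by metis
      have "norm (exp (- F z)) \<le> exp (- Re (F t0))"
      proof (rule maximum_modulus_frontier[of "\<lambda>z. exp (- F z)" "cball 0 1"])
        show "(\<lambda>z. exp (- F z)) holomorphic_on interior (cball 0 1)"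
          by (intro holomorphic_intros holF)
        show "continuous_on (closure (cball 0 1)) (\<lambda>z. exp (- F z))"
          by (intro continuous_intros contF)
        show "norm (exp (- F w)) \<le> exp (- Re (F t0))" if "w \<in> frontier (cball 0 1)" for w
          using t0(2)[of w] that by (simp add: norm_exp_eq_Re)
      qed (use z in auto)
      then show ?thesis using ReF(2)[of t0] t0(1) by (simp add: norm_exp_eq_Re)
    qed
    \<comment> \<open>The value 0 off the closed disc makes \<open>h\<close> Borel on the whole
      plane, where \<open>F\<close> may meet the branch cut of the logarithm.\<close>
    define h where "h = (\<lambda>z. if z \<in> cball 0 1 then exp (of_real p * Ln (F z)) else 0)"
    have notR: "F z \<notin> \<real>\<^sub>\<le>\<^sub>0" if "z \<in> cball 0 1" for z
      using ReF_ball[OF that] by (auto simp: complex_nonpos_Reals_iff)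
    have contE: "continuous_on (cball 0 1) (\<lambda>z. exp (of_real p * Ln (F z)))"
      by (intro continuous_intros contF) (use notR in auto)
    have hb [measurable]: "h \<in> borel_measurable borel"
      unfolding h_def by (intro borel_measurable_continuous_on_if contE) auto
    have hc: "continuous_on (cball 0 1) h"
      using contE by (rule continuous_on_eq) (auto simp: h_def)
    have "integral\<^sup>L \<mu> h = h 0"
    proof (rule circle_mean_value[OF hb hc])
      have "(\<lambda>z. exp (of_real p * Ln (F z))) holomorphic_on ball 0 1"
        by (intro holomorphic_intros holF) (use notR in auto)
      then show "h holomorphic_on ball 0 1"
        by (rule holomorphic_transform) (auto simp: h_def)
    qed
    \<comment> \<open>The value \<open>F 0 = d 0\<close> is real and positive, so its principal
      power is positive as well.\<close>
    moreover have "Re (h 0) \<ge> 0"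
    proof -
      have "F 0 = d 0" by (simp add: F_def a_def)
      then have "F 0 = of_real (Re (d 0))" "Re (d 0) > 0" using d0 ReF_ball[of 0] by (auto simp: complex_eq_iff)
      then have "Ln (F 0) = of_real (ln (Re (d 0)))" by (simp add: Ln_of_real)
      then have "exp (of_real p * Ln (F 0)) = of_real (exp (p * ln (Re (d 0))))"
        by (metis exp_of_real of_real_mult)
      then show ?thesis by (simp add: h_def)
    qed
    moreover have hint: "integrable \<mu> h"
      by (intro continuous_on_circle_integrable hb continuous_on_subset[OF hc]) auto
    ultimately have Rh: "integral\<^sup>L \<mu> (\<lambda>t. Re (h t)) \<ge> 0" by simp
    have qp: "p_int p q" unfolding q_def using p by (intro p_int_tpoly) auto
    have Fp: "p_int p F" using p by (intro p_int_continuous contF) auto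
    have "integral\<^sup>L \<mu> (\<lambda>t. norm (F t) powr p) \<le> integral\<^sup>L \<mu> (\<lambda>t. A * norm (q t) powr p - B * Re (h t))"
    proof (rule integral_mono_AE)
      show "AE t in \<mu>. norm (F t) powr p \<le> A * norm (q t) powr p - B * Re (h t)"
        using AE_circle_norm
      proof eventually_elim
        case (elim t)
        then show ?case using AB(3)[OF ReF(2)[OF elim]] ReF[OF elim] by (simp add: h_def)
      qed
    qed (use qp Fp hint in \<open>auto simp: p_int_def\<close>)
    also have "\<dots> \<le> A * integral\<^sup>L \<mu> (\<lambda>t. norm (q t) powr p)"
      using qp hint Rh AB(2) by (simp add: p_int_def)
    also have "\<dots> = (A powr (1/p) * p_norm p q) powr p"
      using p AB(1) by (simp add: powr_mult powr_powr p_norm_powr)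
    finally have nF: "p_norm p F \<le> A powr (1/p) * p_norm p q"
      using p by (subst p_norm_le_iff) auto
    have "p_norm p (tpoly {k\<in>I. 0 \<le> k} c) = p_norm p (\<lambda>t. (1/2) * (F t + d 0))"
    proof (rule p_norm_cong_AE)
      show "AE t in \<mu>. tpoly {k\<in>I. 0 \<le> k} c t = (1/2) * (F t + d 0)"
        using AE_circle_norm
      proof eventually_elim
        case (elim t)
        have "tpoly {k\<in>I. 0 \<le> k} c t = (\<Sum>k\<in>int ` {0..N}. d k * t powi k)"
          unfolding tpoly_def
        proof (rule sum.mono_neutral_cong_left)
          show "{k \<in> I. 0 \<le> k} \<subseteq> int ` {0..N}"
          proof
            fix k assume "k \<in> {k \<in> I. 0 \<le> k}"
            then show "k \<in> int ` {0..N}" using N by (intro image_eqI[of _ _ "nat k"]) auto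
          qed
        qed (auto simp: dI)
        also have "\<dots> = (\<Sum>k=0..N. d (int k) * t ^ k)"
          by (subst sum.reindex) auto
        also have "\<dots> = d 0 + a t"
          unfolding a_def by (subst sum.atLeast_Suc_atMost) auto
        finally show ?case by (simp add: F_def)
      qed
    qed auto
    also have "\<dots> = 1/2 * p_norm p (\<lambda>t. F t + d 0)" using p by (subst p_norm_scale) auto
    also have "\<dots> \<le> 1/2 * (p_norm p F + norm (d 0))"
      using minkowski_circle[of p F "\<lambda>t. d 0"] p Fp by (simp add: p_int_const p_norm_const)
    also have "\<dots> \<le> 1/2 * (A powr (1/p) * p_norm p q + p_norm p q)"
      using nF norm_fcoef_le[OF p(1) qp, of 0] by (simp add: d_def)
    also have "\<dots> = C * p_norm p q" by (simp add: C_def field_simps)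
    finally show "p_norm p (tpoly {k\<in>I. 0 \<le> k} c) \<le> C * p_norm p (tpoly I c)" by (simp add: q_def)
  qed
qed

text \<open>The comparison of the \<open>L1\<close> norm with the norm of exponent
  \<open>2 / p\<close>, applied to \<open>norm (f t) powr p\<close>.\<close>

lemma p_norm_mono_exponent:
  assumes p: "1 < p" "p \<le> 2" and f: "p_int 2 f"
  shows "p_norm p f \<le> p_norm 2 f"
proof (cases "p = 2")
  case False
  with p have p2: "p < 2" by simp
  have [measurable]: "f \<in> borel_measurable borel" using f by auto
  define g where "g = (\<lambda>t. complex_of_real (norm (f t) powr p))"
  have gb [measurable]: "g \<in> borel_measurable borel" unfolding g_def by measurable
  have ng: "norm (g t) powr (2/p) = norm (f t) powr 2" for t
    using p by (simp add: g_def powr_powr)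
  have gint: "p_int (2/p) g" using f unfolding p_int_def ng by simp
  have "integral\<^sup>L \<mu> (\<lambda>t. norm (g t)) \<le> p_norm (2/p) g"
    using p p2 by (intro L1_le_p_norm gint) auto
  also have "p_norm (2/p) g = p_norm 2 f powr p"
    unfolding p_norm_def ng using p by (simp add: powr_powr)
  finally have "integral\<^sup>L \<mu> (\<lambda>t. norm (f t) powr p) \<le> p_norm 2 f powr p" by (simp add: g_def)
  then show ?thesis using p by (subst p_norm_le_iff) auto
qed simp

lemma parseval_tpoly:
  assumes "finite I"
  shows "p_norm 2 (tpoly I c) = sqrt (\<Sum>k\<in>I. (norm (c k))\<^sup>2)"
proof -
  have "complex_of_real (integral\<^sup>L \<mu> (\<lambda>t. norm (tpoly I c t) powr 2))
      = integral\<^sup>L \<mu> (\<lambda>t. complex_of_real (norm (tpoly I c t) powr 2))"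
    by (rule integral_complex_of_real[symmetric])
  also have "\<dots> = integral\<^sup>L \<mu> (\<lambda>t. \<Sum>k\<in>I. cnj (c k) * (tpoly I c t * t powi (- k)))"
  proof (intro integral_cong_AE)
    show "AE t in \<mu>. complex_of_real (norm (tpoly I c t) powr 2) = (\<Sum>k\<in>I. cnj (c k) * (tpoly I c t * t powi (- k)))"
      using AE_circle_norm
    proof eventually_elim
      case (elim t)
      have "complex_of_real (norm (tpoly I c t) powr 2) = tpoly I c t * cnj (tpoly I c t)"
        by (simp add: complex_norm_square[symmetric])
      also have "cnj (tpoly I c t) = (\<Sum>k\<in>I. cnj (c k) * t powi (- k))"
        by (simp add: tpoly_def powi_circle_minus[OF elim])
      finally show ?case by (simp add: sum_distrib_left mult_ac)
    qed
  qed auto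
  also have "\<dots> = (\<Sum>k\<in>I. cnj (c k) * fcoef (tpoly I c) k)"
    unfolding fcoef_def
    by (subst Bochner_Integration.integral_sum)
      (auto intro!: integrable_mult_right integrable_mult_powi continuous_on_circle_integrable continuous_on_tpoly)
  also have "\<dots> = (\<Sum>k\<in>I. complex_of_real ((norm (c k))\<^sup>2))"
    using assms by (intro sum.cong) (auto simp: fcoef_tpoly complex_norm_square mult.commute simp del: of_real_power)
  also have "\<dots> = of_real (\<Sum>k\<in>I. (norm (c k))\<^sup>2)" by simp
  finally have "integral\<^sup>L \<mu> (\<lambda>t. norm (tpoly I c t) powr 2) = (\<Sum>k\<in>I. (norm (c k))\<^sup>2)"
    by (simp only: of_real_eq_iff)
  then show ?thesis by (simp add: p_norm_def powr_half_sqrt sum_nonneg)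
qed

definition apart :: "int set \<Rightarrow> int set" where "apart I = {k\<in>I. 0 \<le> k}"

lemma apart_subset: "apart I \<subseteq> I" by (auto simp: apart_def)

lemma finite_apart [simp]: "finite I \<Longrightarrow> finite (apart I)"
  by (simp add: apart_def)

lemma p_norm_2_apart:
  assumes "finite I"
  shows "p_norm 2 (tpoly (apart I) c) \<le> p_norm 2 (tpoly I c)"
  unfolding parseval_tpoly[OF assms] parseval_tpoly[OF finite_apart[OF assms]]
  using assms by (intro real_sqrt_le_mono sum_mono2 apart_subset) auto

lemma tpoly_apart_extend:
  assumes "finite K" "I \<subseteq> K"
  shows "tpoly (apart I) c = tpoly (apart K) (\<lambda>k. if k \<in> I then c k else 0)"
proof -
  have "apart I \<subseteq> apart K" using assms by (auto simp: apart_def)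
  then have "tpoly (apart I) c = tpoly (apart K) (\<lambda>k. if k \<in> apart I then c k else 0)"
    using assms by (intro tpoly_extend) auto
  also have "\<dots> = tpoly (apart K) (\<lambda>k. if k \<in> I then c k else 0)"
    by (auto simp: tpoly_def fun_eq_iff apart_def intro!: sum.cong)
  finally show ?thesis .
qed

lemma p_norm_apart_add:
  assumes "p \<ge> 1" "finite I"
  shows "p_norm p (tpoly (apart I) (\<lambda>k. c k + d k)) \<le> p_norm p (tpoly (apart I) c) + p_norm p (tpoly (apart I) d)"
proof -
  have "tpoly (apart I) (\<lambda>k. c k + d k) = (\<lambda>t. tpoly (apart I) c t + tpoly (apart I) d t)"
    by (simp add: fun_eq_iff tpoly_def distrib_right sum.distrib)
  then show ?thesis
    using minkowski_circle[OF assms(1) p_int_tpoly p_int_tpoly, of "apart I" c "apart I" d] assms by simp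
qed

lemma p_norm_apart_scale:
  assumes "p > 0"
  shows "p_norm p (tpoly (apart I) (\<lambda>k. z * c k)) = norm z * p_norm p (tpoly (apart I) c)"
  using p_norm_scale[OF assms, of z "tpoly (apart I) c"] by (simp add: tpoly_scale)

section \<open>The bound for arbitrary trigonometric polynomials\<close>

lemma nonneg_trig_approx:
  assumes w: "continuous_on (sphere 0 1) w" "\<And>t. t \<in> sphere 0 1 \<Longrightarrow> w t \<ge> 0" and \<delta>: "\<delta> > 0"
  obtains I c where "finite I" "\<And>t. norm t = 1 \<Longrightarrow> tpoly I c t \<in> \<real> \<and> Re (tpoly I c t) > 0"
    "\<And>t. norm t = 1 \<Longrightarrow> norm (tpoly I c t - of_real (w t)) \<le> \<delta>"
proof -
  have "continuous_on (sphere 0 1) (\<lambda>t. w t + \<delta>/2)" by (intro continuous_intros w)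
  then obtain I c where I: "finite I" "\<forall>t\<in>sphere 0 1. tpoly I c t \<in> \<real> \<and> \<bar>w t + \<delta>/2 - Re (tpoly I c t)\<bar> < \<delta>/2"
    using trig_approx_real[of "\<lambda>t. w t + \<delta>/2" "\<delta>/2"] \<delta> by auto
  show ?thesis
  proof
    fix t :: complex assume t: "norm t = 1"
    have *: "tpoly I c t \<in> \<real>" "\<bar>w t + \<delta>/2 - Re (tpoly I c t)\<bar> < \<delta>/2" using I(2) t by auto
    have "w t \<ge> 0" using w(2) t by simp
    then show "tpoly I c t \<in> \<real> \<and> Re (tpoly I c t) > 0" using * by (auto simp: abs_if split: if_splits)
    have "tpoly I c t - of_real (w t) = of_real (Re (tpoly I c t) - w t)"
      using * by (auto simp: complex_eq_iff complex_is_Real_iff)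
    then have "norm (tpoly I c t - of_real (w t)) = \<bar>Re (tpoly I c t) - w t\<bar>" by (simp only: norm_of_real)
    also have "\<dots> \<le> \<delta>" using * by (auto simp: abs_if split: if_splits)
    finally show "norm (tpoly I c t - of_real (w t)) \<le> \<delta>" .
  qed (use I in auto)
qed

text \<open>The positive and negative parts of the real and imaginary parts of \<open>q\<close> are
  continuous but no trigonometric polynomials. Each is replaced by a positive trigonometric
  polynomial close to it, to which the positive case applies. What is left is a trigonometric
  polynomial of small supremum, and its analytic part is small in \<open>L2\<close> by Parseval,
  hence small in \<open>Lp\<close> for \<open>p \<le> 2\<close>.\<close>

lemma riesz_trig_small:
  fixes p :: real
  assumes p: "1 < p" "p \<le> 2"
  obtains C where "C \<ge> 0" "\<And>I c. finite I \<Longrightarrow> p_norm p (tpoly (apart I) c) \<le> C * p_norm p (tpoly I c)"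
proof -
  obtain C where C: "C \<ge> 0" "\<And>I c. finite I \<Longrightarrow> (\<And>t. norm t = 1 \<Longrightarrow> tpoly I c t \<in> \<real> \<and> Re (tpoly I c t) > 0) \<Longrightarrow>
     p_norm p (tpoly (apart I) c) \<le> C * p_norm p (tpoly I c)"
    using positive_trig_bound[OF p] unfolding apart_def by blast
  have p1: "p \<ge> 1" "p > 0" using p by auto
  \<comment> \<open>Used for the four parts of \<open>q\<close>, with \<open>f\<close> equal to
    \<open>q\<close> itself, since each part is bounded by \<open>norm (q t)\<close>.\<close>
  have one: "\<exists>K d. finite K \<and> (\<forall>t\<in>sphere 0 1. norm (tpoly K d t - of_real (w t)) \<le> \<delta>)
      \<and> p_norm p (tpoly (apart K) d) \<le> C * (p_norm p f + \<delta>)"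
    if w: "continuous_on (sphere 0 1) w" "\<And>t. t \<in> sphere 0 1 \<Longrightarrow> w t \<ge> 0" "\<And>t. t \<in> sphere 0 1 \<Longrightarrow> w t \<le> norm (f t)"
      and f: "p_int p f" and \<delta>: "\<delta> > 0" for w f \<delta>
  proof -
    obtain K d where K: "finite K" "\<And>t. norm t = 1 \<Longrightarrow> tpoly K d t \<in> \<real> \<and> Re (tpoly K d t) > 0"
      "\<And>t. norm t = 1 \<Longrightarrow> norm (tpoly K d t - of_real (w t)) \<le> \<delta>"
      using nonneg_trig_approx[OF w(1,2) \<delta>] by blast
    have [measurable]: "f \<in> borel_measurable borel" using f by auto
    define g where "g = (\<lambda>t. complex_of_real (norm (f t)) + of_real \<delta>)"
    have fn: "p_int p (\<lambda>t. complex_of_real (norm (f t)))" using f by (simp add: p_int_def)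
    have g: "p_int p g" unfolding g_def by (intro p_int_add fn p_int_const p1)
    have "p_norm p (tpoly K d) \<le> p_norm p g"
    proof (rule p_norm_mono(2)[OF g tpoly_borel _ p1(2)])
      show "AE t in \<mu>. norm (tpoly K d t) \<le> norm (g t)"
        using AE_circle_norm
      proof eventually_elim
        case (elim t)
        have "norm (tpoly K d t) \<le> norm (complex_of_real (w t)) + norm (tpoly K d t - of_real (w t))"
          using norm_triangle_ineq[of "of_real (w t)" "tpoly K d t - of_real (w t)"] by simp
        also have "\<dots> \<le> norm (f t) + \<delta>" using K(3)[OF elim] w(2,3)[of t] elim by simp
        also have "\<dots> = norm (g t)" using \<delta> unfolding g_def by (simp flip: of_real_add)
        finally show ?case .
      qed
    qed
    also have "\<dots> \<le> p_norm p (\<lambda>t. complex_of_real (norm (f t))) + p_norm p (\<lambda>t. of_real \<delta>)"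
      unfolding g_def by (intro minkowski_circle p1 fn p_int_const)
    also have "\<dots> = p_norm p f + \<delta>" using \<delta> p1 by (simp add: p_norm_const) (simp add: p_norm_def)
    finally have "p_norm p (tpoly K d) \<le> p_norm p f + \<delta>" .
    then have "C * p_norm p (tpoly K d) \<le> C * (p_norm p f + \<delta>)" using C(1) by (rule mult_left_mono)
    then show ?thesis using K C(2)[OF K(1,2)] by (intro exI[of _ K] exI[of _ d]) (auto intro: order_trans)
  qed
  show ?thesis
  proof
    show "4 * C \<ge> 0" using C by simp
    fix I c assume fin: "finite (I :: int set)"
    define q where "q = tpoly I c"
    have q: "p_int p q" unfolding q_def by (intro p_int_tpoly p1)
    have cq: "continuous_on (sphere 0 1) q" unfolding q_def by (rule continuous_on_tpoly)
    have main: "p_norm p (tpoly (apart I) c) \<le> 4 * C * p_norm p q + (4 * C + 4) * \<delta>" if \<delta>: "\<delta> > 0" for \<delta>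
    proof -
      have le: "max 0 (Re z) \<le> norm z" "max 0 (- Re z) \<le> norm z" "max 0 (Im z) \<le> norm z" "max 0 (- Im z) \<le> norm z" for z
        using abs_Re_le_cmod[of z] abs_Im_le_cmod[of z] by auto
      have cont: "continuous_on (sphere 0 1) (\<lambda>t. max 0 (Re (q t)))" "continuous_on (sphere 0 1) (\<lambda>t. max 0 (- Re (q t)))"
        "continuous_on (sphere 0 1) (\<lambda>t. max 0 (Im (q t)))" "continuous_on (sphere 0 1) (\<lambda>t. max 0 (- Im (q t)))"
        by (intro continuous_on_max continuous_on_const continuous_on_minus continuous_on_Re continuous_on_Im cq)+
      obtain K1 d1 where 1: "finite K1" "\<forall>t\<in>sphere 0 1. norm (tpoly K1 d1 t - of_real (max 0 (Re (q t)))) \<le> \<delta>"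
          "p_norm p (tpoly (apart K1) d1) \<le> C * (p_norm p q + \<delta>)"
        using one[of "\<lambda>t. max 0 (Re (q t))", OF cont(1) _ _ q \<delta>] le by auto
      obtain K2 d2 where 2: "finite K2" "\<forall>t\<in>sphere 0 1. norm (tpoly K2 d2 t - of_real (max 0 (- Re (q t)))) \<le> \<delta>"
          "p_norm p (tpoly (apart K2) d2) \<le> C * (p_norm p q + \<delta>)"
        using one[of "\<lambda>t. max 0 (- Re (q t))", OF cont(2) _ _ q \<delta>] le by auto
      obtain K3 d3 where 3: "finite K3" "\<forall>t\<in>sphere 0 1. norm (tpoly K3 d3 t - of_real (max 0 (Im (q t)))) \<le> \<delta>"
          "p_norm p (tpoly (apart K3) d3) \<le> C * (p_norm p q + \<delta>)"
        using one[of "\<lambda>t. max 0 (Im (q t))", OF cont(3) _ _ q \<delta>] le by auto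
      obtain K4 d4 where 4: "finite K4" "\<forall>t\<in>sphere 0 1. norm (tpoly K4 d4 t - of_real (max 0 (- Im (q t)))) \<le> \<delta>"
          "p_norm p (tpoly (apart K4) d4) \<le> C * (p_norm p q + \<delta>)"
        using one[of "\<lambda>t. max 0 (- Im (q t))", OF cont(4) _ _ q \<delta>] le by auto
      \<comment> \<open>A common index set lets all analytic parts be compared through coefficient
        functions alone.\<close>
      define K where "K = I \<union> K1 \<union> K2 \<union> K3 \<union> K4"
      have K: "finite K" "I \<subseteq> K" "K1 \<subseteq> K" "K2 \<subseteq> K" "K3 \<subseteq> K" "K4 \<subseteq> K"
        using fin 1 2 3 4 by (auto simp: K_def)
      define e0 where "e0 k = (if k \<in> I then c k else 0)" for k
      define e1 where "e1 k = (if k \<in> K1 then d1 k else 0)" for k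
      define e2 where "e2 k = (if k \<in> K2 then d2 k else 0)" for k
      define e3 where "e3 k = (if k \<in> K3 then d3 k else 0)" for k
      define e4 where "e4 k = (if k \<in> K4 then d4 k else 0)" for k
      have E: "tpoly I c = tpoly K e0" "tpoly K1 d1 = tpoly K e1" "tpoly K2 d2 = tpoly K e2" "tpoly K3 d3 = tpoly K e3" "tpoly K4 d4 = tpoly K e4"
        unfolding e0_def e1_def e2_def e3_def e4_def using K by (auto intro!: tpoly_extend)
      have EA: "tpoly (apart I) c = tpoly (apart K) e0" "tpoly (apart K1) d1 = tpoly (apart K) e1" "tpoly (apart K2) d2 = tpoly (apart K) e2"
          "tpoly (apart K3) d3 = tpoly (apart K) e3" "tpoly (apart K4) d4 = tpoly (apart K) e4"
        unfolding e0_def e1_def e2_def e3_def e4_def using K by (auto intro!: tpoly_apart_extend)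
      \<comment> \<open>The coefficients of \<open>q\<close> minus those of the combination of the
        four approximants.\<close>
      define r where "r k = e0 k + ((- 1) * e1 k + (e2 k + ((- \<i>) * e3 k + \<i> * e4 k)))" for k
      have rt: "tpoly K r t = q t - (tpoly K e1 t - tpoly K e2 t + \<i> * tpoly K e3 t - \<i> * tpoly K e4 t)" for t
        unfolding q_def E(1) by (simp add: tpoly_def r_def sum_distrib_left sum_subtractf sum.distrib algebra_simps sum_negf)
      have nr: "norm (tpoly K r t) \<le> 4 * \<delta>" if t: "norm t = 1" for t
      proof -
        let ?z = "q t"
        have z: "?z = of_real (max 0 (Re ?z)) - of_real (max 0 (- Re ?z)) + \<i> * of_real (max 0 (Im ?z)) - \<i> * of_real (max 0 (- Im ?z))"
          by (auto simp: complex_eq_iff max_def)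
        have "tpoly K r t = - (tpoly K e1 t - of_real (max 0 (Re ?z))) + (tpoly K e2 t - of_real (max 0 (- Re ?z)))
           - \<i> * (tpoly K e3 t - of_real (max 0 (Im ?z))) + \<i> * (tpoly K e4 t - of_real (max 0 (- Im ?z)))"
          unfolding rt by (subst z) (simp add: algebra_simps)
        also have "norm \<dots> \<le> norm (tpoly K e1 t - of_real (max 0 (Re ?z))) + norm (tpoly K e2 t - of_real (max 0 (- Re ?z)))
           + norm (tpoly K e3 t - of_real (max 0 (Im ?z))) + norm (tpoly K e4 t - of_real (max 0 (- Im ?z)))"
        proof -
          have "norm (- a + b - \<i> * c + \<i> * d) \<le> norm a + norm b + norm c + norm d" for a b c d :: complex
            using norm_triangle_ineq[of "- a + b - \<i> * c" "\<i> * d"] norm_triangle_ineq4[of "- a + b" "\<i> * c"]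
              norm_triangle_ineq[of "- a" b] by (simp add: norm_mult)
          then show ?thesis .
        qed
        also have "\<dots> \<le> \<delta> + \<delta> + \<delta> + \<delta>"
          using 1(2) 2(2) 3(2) 4(2) t by (intro add_mono) (auto simp: E)
        finally show ?thesis by simp
      qed
      \<comment> \<open>The detour through \<open>L2\<close> turns the uniform bound for
        \<open>r\<close> into a bound for its analytic part.\<close>
      have "p_norm p (tpoly (apart K) r) \<le> p_norm 2 (tpoly (apart K) r)"
        by (intro p_norm_mono_exponent p p_int_tpoly) simp
      also have "\<dots> \<le> p_norm 2 (tpoly K r)" by (rule p_norm_2_apart[OF K(1)])
      also have "\<dots> \<le> 4 * \<delta>"
      proof (rule p_int_bounded(2))
        show "AE t in \<mu>. norm (tpoly K r t) \<le> 4 * \<delta>"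
          using AE_circle_norm by eventually_elim (rule nr)
      qed auto
      finally have r: "p_norm p (tpoly (apart K) r) \<le> 4 * \<delta>" .
      have "e0 = (\<lambda>k. r k + (1 * e1 k + ((- 1) * e2 k + (\<i> * e3 k + (- \<i>) * e4 k))))"
        by (simp add: r_def fun_eq_iff)
      then have "p_norm p (tpoly (apart K) e0) \<le> p_norm p (tpoly (apart K) r) + (p_norm p (tpoly (apart K) e1)
        + (p_norm p (tpoly (apart K) e2) + (p_norm p (tpoly (apart K) e3) + p_norm p (tpoly (apart K) e4))))"
        using p_norm_apart_add[OF p1(1) K(1), of r "\<lambda>k. 1 * e1 k + ((- 1) * e2 k + (\<i> * e3 k + (- \<i>) * e4 k))"]
          p_norm_apart_add[OF p1(1) K(1), of "\<lambda>k. 1 * e1 k" "\<lambda>k. (- 1) * e2 k + (\<i> * e3 k + (- \<i>) * e4 k)"]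
          p_norm_apart_add[OF p1(1) K(1), of "\<lambda>k. (- 1) * e2 k" "\<lambda>k. \<i> * e3 k + (- \<i>) * e4 k"]
          p_norm_apart_add[OF p1(1) K(1), of "\<lambda>k. \<i> * e3 k" "\<lambda>k. (- \<i>) * e4 k"]
        unfolding p_norm_apart_scale[OF p1(2)] by simp
      also have "\<dots> \<le> 4 * \<delta> + (C * (p_norm p q + \<delta>) + (C * (p_norm p q + \<delta>) + (C * (p_norm p q + \<delta>) + C * (p_norm p q + \<delta>))))"
        using r 1(3) 2(3) 3(3) 4(3) unfolding EA by (intro add_mono)
      finally show ?thesis by (simp add: EA algebra_simps)
    qed
    have "p_norm p (tpoly (apart I) c) \<le> 4 * C * p_norm p q"
    proof (rule field_le_epsilon)
      fix e :: real assume e: "e > 0"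
      have "(4 * C + 4) * (e / (4 * C + 4)) = e" using C(1) by (simp add: add_nonneg_pos)
      moreover have "e / (4 * C + 4) > 0" using C(1) e by (simp add: add_nonneg_pos)
      ultimately show "p_norm p (tpoly (apart I) c) \<le> 4 * C * p_norm p q + e" using main by metis
    qed
    then show "p_norm p (tpoly (apart I) c) \<le> 4 * C * p_norm p (tpoly I c)" by (simp add: q_def)
  qed
qed

lemma integral_tpoly_mult:
  assumes I: "finite I" and J: "finite J"
  shows "integral\<^sup>L \<mu> (\<lambda>t. tpoly I c t * tpoly J d t) = (\<Sum>j\<in>J. if - j \<in> I then c (- j) * d j else 0)"
proof -
  have "integral\<^sup>L \<mu> (\<lambda>t. tpoly I c t * tpoly J d t)
      = integral\<^sup>L \<mu> (\<lambda>t. \<Sum>j\<in>J. d j * (tpoly I c t * t powi (- (- j))))"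
    by (intro arg_cong[where f = "integral\<^sup>L \<mu>"] ext)
       (simp add: tpoly_def[of J] sum_distrib_left mult_ac)
  also have "\<dots> = (\<Sum>j\<in>J. d j * fcoef (tpoly I c) (- j))"
    unfolding fcoef_def
    by (subst Bochner_Integration.integral_sum)
      (auto intro!: integrable_mult_right integrable_mult_powi continuous_on_circle_integrable continuous_on_tpoly)
  also have "\<dots> = (\<Sum>j\<in>J. if - j \<in> I then c (- j) * d j else 0)"
    by (intro sum.cong) (auto simp: fcoef_tpoly[OF I])
  finally show ?thesis .
qed

lemma p_norm_cnj: "p_norm p (\<lambda>t. cnj (f t)) = p_norm p f"
  by (simp add: p_norm_def)

lemma cnj_tpoly:
  assumes "norm t = 1"
  shows "cnj (tpoly I c t) = tpoly (uminus ` I) (\<lambda>k. cnj (c (- k))) t"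
proof -
  have "cnj (tpoly I c t) = (\<Sum>k\<in>I. cnj (c k) * t powi (- k))"
    by (simp add: tpoly_def powi_circle_minus[OF assms])
  also have "\<dots> = tpoly (uminus ` I) (\<lambda>k. cnj (c (- k))) t"
    unfolding tpoly_def by (subst sum.reindex) auto
  finally show ?thesis .
qed

text \<open>For \<open>p > 2\<close> the analytic part \<open>g\<close> is tested against the
  extremal function \<open>w\<close> of Hoelder's inequality, for which
  \<open>g t * w t = norm (g t) powr p\<close> and the \<open>q\<close>-norm is
  \<open>G powr (p - 1)\<close>. The projection is moved to the other factor, where the conjugate
  exponent is at most 2.\<close>

lemma riesz_trig:
  fixes p :: real
  assumes p: "1 < p"
  obtains C where "C \<ge> 0" "\<And>I c. finite I \<Longrightarrow> p_norm p (tpoly (apart I) c) \<le> C * p_norm p (tpoly I c)"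
proof (cases "p \<le> 2")
  case True
  then show ?thesis using riesz_trig_small[OF p] that by blast
next
  case False
  then have p2: "p > 2" by simp
  define q where "q = conj_exponent p"
  have q: "q > 1" "1/p + 1/q = 1" using conj_exponent[OF p] by (auto simp: q_def)
  have q2: "q \<le> 2" using p2 by (simp add: q_def conj_exponent_def field_simps)
  have pq: "(p - 1) * q = p" using p by (simp add: q_def conj_exponent_def)
  obtain C where C: "C \<ge> 0" "\<And>I c. finite I \<Longrightarrow> p_norm q (tpoly (apart I) c) \<le> C * p_norm q (tpoly I c)"
    using riesz_trig_small[OF q(1) q2] by blast
  show ?thesis
  proof
    fix I c assume fin: "finite (I :: int set)"
    define f where "f = tpoly I c"
    define g where "g = tpoly (apart I) c"
    have fp: "p_int p f" and gp: "p_int p g" unfolding f_def g_def using p by (auto intro!: p_int_tpoly)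
    have gm [measurable]: "g \<in> borel_measurable borel" unfolding g_def by simp
    define w where "w = (\<lambda>t. complex_of_real (norm (g t) powr (p - 2)) * cnj (g t))"
    have wb [measurable]: "w \<in> borel_measurable borel" unfolding w_def by measurable
    have cw: "continuous_on (sphere 0 1) w"
      unfolding w_def g_def
      by (intro continuous_on_mult continuous_on_of_real continuous_on_cnj continuous_on_tpoly continuous_on_powr' continuous_on_norm continuous_on_const)
        (use p2 in auto)
    have nw: "norm (w t) = norm (g t) powr (p - 1)" for t
      using powr_add[of "norm (g t)" "p - 2" 1] by (cases "g t = 0") (auto simp: w_def norm_mult)
    have gw: "g t * w t = of_real (norm (g t) powr p)" for t
    proof (cases "g t = 0")
      case False
      have "g t * w t = of_real (norm (g t) powr (p - 2)) * (g t * cnj (g t))" by (simp add: w_def)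
      also have "g t * cnj (g t) = of_real (norm (g t) powr 2)" by (simp add: complex_norm_square[symmetric])
      also have "of_real (norm (g t) powr (p - 2)) * complex_of_real (norm (g t) powr 2) = of_real (norm (g t) powr p)"
        unfolding of_real_mult[symmetric] powr_add[symmetric] by simp
      finally show ?thesis .
    qed simp
    define G where "G = p_norm p g"
    have Gp: "G powr p = integral\<^sup>L \<mu> (\<lambda>t. norm (g t) powr p)" unfolding G_def using p by (intro p_norm_powr) auto
    have wq: "p_int q w" by (rule p_int_continuous[OF wb cw]) (use q in auto)
    have "p_norm q w = (G powr p) powr (1/q)"
      unfolding p_norm_def nw Gp powr_powr pq ..
    also have "\<dots> = G powr (p - 1)"
    proof -
      have "p * (1/q) = p - 1" using pq q by (simp add: field_simps)
      then show ?thesis by (simp add: powr_powr)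
    qed
    finally have nwq: "p_norm q w = G powr (p - 1)" .
    \<comment> \<open>The extremal function is not a trigonometric polynomial, so it is replaced by
      one with uniform error \<open>\<delta>\<close>; the terms with \<open>\<delta>\<close>
      disappear in the limit.\<close>
    have main: "G powr p \<le> C * p_norm p f * G powr (p - 1) + (C * p_norm p f + G) * \<delta>" if \<delta>: "\<delta> > 0" for \<delta>
    proof -
      obtain J d where J: "finite J" "\<forall>t\<in>sphere 0 1. norm (w t - tpoly J d t) < \<delta>"
        using trig_approx[OF cw \<delta>] by blast
      let ?r = "tpoly J d"
      have rq: "p_int q ?r" using q by (intro p_int_tpoly) auto
      have AEd: "AE t in \<mu>. norm (w t - ?r t) \<le> \<delta>"
        using AE_circle_norm by eventually_elim (use J in \<open>auto intro: less_imp_le\<close>)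
      have dq: "p_int q (\<lambda>t. w t - ?r t)" "p_norm q (\<lambda>t. w t - ?r t) \<le> \<delta>"
        using p_int_bounded[of "\<lambda>t. w t - ?r t" \<delta> q] AEd q by auto
      have "p_norm q ?r \<le> p_norm q (\<lambda>t. - (w t - ?r t)) + p_norm q w"
        using minkowski_circle[of q "\<lambda>t. - (w t - ?r t)" w] p_int_scale[OF dq(1), of "-1"] wq q by simp
      also have "p_norm q (\<lambda>t. - (w t - ?r t)) = p_norm q (\<lambda>t. w t - ?r t)"
        by (simp add: p_norm_def norm_minus_commute)
      finally have nr: "p_norm q ?r \<le> \<delta> + G powr (p - 1)" using dq(2) nwq by simp
      \<comment> \<open>The part of \<open>r\<close> with non-positive frequencies is the conjugate of the analytic part of the conjugate of \<open>r\<close>.\<close>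
      define J' where "J' = {j\<in>J. j \<le> 0}"
      let ?s = "tpoly J' d"
      have J': "finite J'" using J by (simp add: J'_def)
      have "p_norm q ?s = p_norm q (\<lambda>t. cnj (?s t))" by (simp add: p_norm_cnj)
      also have "\<dots> = p_norm q (tpoly (apart (uminus ` J)) (\<lambda>k. cnj (d (- k))))"
      proof (rule p_norm_cong_AE)
        have im: "uminus ` J' = apart (uminus ` J)" by (auto simp: J'_def apart_def)
        show "AE t in \<mu>. cnj (?s t) = tpoly (apart (uminus ` J)) (\<lambda>k. cnj (d (- k))) t"
          using AE_circle_norm by eventually_elim (simp add: cnj_tpoly im)
      qed measurable
      also have "\<dots> \<le> C * p_norm q (tpoly (uminus ` J) (\<lambda>k. cnj (d (- k))))"
        using J by (intro C(2)) auto
      also have "p_norm q (tpoly (uminus ` J) (\<lambda>k. cnj (d (- k)))) = p_norm q (\<lambda>t. cnj (?r t))"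
      proof (rule p_norm_cong_AE)
        show "AE t in \<mu>. tpoly (uminus ` J) (\<lambda>k. cnj (d (- k))) t = cnj (?r t)"
          using AE_circle_norm by eventually_elim (simp add: cnj_tpoly)
      qed measurable
      also have "\<dots> = p_norm q ?r" by (rule p_norm_cnj)
      finally have ns: "p_norm q ?s \<le> C * (\<delta> + G powr (p - 1))"
        using nr C(1) by (meson mult_left_mono order_trans)
      \<comment> \<open>Only pairs of opposite frequencies contribute, so cutting \<open>f\<close>
        to frequencies at least 0 has the same effect as cutting \<open>?r\<close> to frequencies at
        most 0.\<close>
      have "integral\<^sup>L \<mu> (\<lambda>t. g t * ?r t) = (\<Sum>j\<in>J. if - j \<in> apart I then c (- j) * d j else 0)"
        unfolding g_def using fin J by (intro integral_tpoly_mult) auto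
      also have "\<dots> = (\<Sum>j\<in>J'. if - j \<in> I then c (- j) * d j else 0)"
        by (rule sum.mono_neutral_cong_right) (use J in \<open>auto simp: J'_def apart_def\<close>)
      also have "\<dots> = integral\<^sup>L \<mu> (\<lambda>t. f t * ?s t)"
        unfolding f_def using fin J' by (intro integral_tpoly_mult[symmetric]) auto
      finally have eq: "integral\<^sup>L \<mu> (\<lambda>t. g t * ?r t) = integral\<^sup>L \<mu> (\<lambda>t. f t * ?s t)" .
      have "norm (integral\<^sup>L \<mu> (\<lambda>t. f t * ?s t)) \<le> integral\<^sup>L \<mu> (\<lambda>t. norm (f t * ?s t))"
        by (rule integral_norm_bound)
      also have "\<dots> \<le> p_norm p f * p_norm q ?s"
        using p q by (intro holder_circle fp p_int_tpoly) auto
      also have "\<dots> \<le> p_norm p f * (C * (\<delta> + G powr (p - 1)))" using ns by (intro mult_left_mono) auto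
      finally have 1: "norm (integral\<^sup>L \<mu> (\<lambda>t. g t * ?r t)) \<le> p_norm p f * (C * (\<delta> + G powr (p - 1)))"
        unfolding eq .
      have "norm (integral\<^sup>L \<mu> (\<lambda>t. g t * (w t - ?r t))) \<le> integral\<^sup>L \<mu> (\<lambda>t. norm (g t * (w t - ?r t)))"
        by (rule integral_norm_bound)
      also have "\<dots> \<le> p_norm p g * p_norm q (\<lambda>t. w t - ?r t)"
        using p q by (intro holder_circle gp dq) auto
      also have "\<dots> \<le> G * \<delta>" unfolding G_def using dq by (intro mult_left_mono) auto
      finally have 2: "norm (integral\<^sup>L \<mu> (\<lambda>t. g t * (w t - ?r t))) \<le> G * \<delta>" .
      have i1: "integrable \<mu> (\<lambda>t. g t * ?r t)" using p q by (intro holder_circle(1)[OF _ _ _ gp rq])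
      have i2: "integrable \<mu> (\<lambda>t. g t * (w t - ?r t))" using p q by (intro holder_circle(1)[OF _ _ _ gp dq(1)])
      have "complex_of_real (G powr p) = integral\<^sup>L \<mu> (\<lambda>t. g t * w t)"
        unfolding Gp gw by simp
      also have "\<dots> = integral\<^sup>L \<mu> (\<lambda>t. g t * ?r t + g t * (w t - ?r t))"
        by (simp add: algebra_simps)
      also have "\<dots> = integral\<^sup>L \<mu> (\<lambda>t. g t * ?r t) + integral\<^sup>L \<mu> (\<lambda>t. g t * (w t - ?r t))"
        by (rule Bochner_Integration.integral_add[OF i1 i2])
      finally have eqn: "complex_of_real (G powr p) = integral\<^sup>L \<mu> (\<lambda>t. g t * ?r t) + integral\<^sup>L \<mu> (\<lambda>t. g t * (w t - ?r t))" .
      have "norm (complex_of_real (G powr p)) \<le> p_norm p f * (C * (\<delta> + G powr (p - 1))) + G * \<delta>"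
        unfolding eqn
        using norm_triangle_ineq[of "integral\<^sup>L \<mu> (\<lambda>t. g t * ?r t)" "integral\<^sup>L \<mu> (\<lambda>t. g t * (w t - ?r t))"] 1 2
        by linarith
      then show ?thesis by (simp add: algebra_simps)
    qed
    have le: "G powr p \<le> C * p_norm p f * G powr (p - 1)"
    proof (rule field_le_epsilon)
      fix e :: real assume e: "e > 0"
      let ?D = "C * p_norm p f + G + 1"
      have D: "?D > 0" "C * p_norm p f + G \<ge> 0" using C(1) by (auto simp: G_def add_nonneg_pos)
      have "G powr p \<le> C * p_norm p f * G powr (p - 1) + (C * p_norm p f + G) * (e / ?D)"
        using D e by (intro main) auto
      also have "(C * p_norm p f + G) * (e / ?D) \<le> ?D * (e / ?D)" using D e by (intro mult_right_mono) auto
      also have "?D * (e / ?D) = e" using D by simp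
      finally show "G powr p \<le> C * p_norm p f * G powr (p - 1) + e" by simp
    qed
    have "G \<le> C * p_norm p f"
    proof (cases "G = 0")
      case True
      then show ?thesis using C(1) by simp
    next
      case False
      then have G: "G > 0" using p_norm_nonneg[of p g] by (simp add: G_def less_le)
      have "G powr p = G * G powr (p - 1)" using G powr_add[of G 1 "p - 1"] by simp
      with le have "G * G powr (p - 1) \<le> C * p_norm p f * G powr (p - 1)" by simp
      then show ?thesis using G by (simp add: mult_le_cancel_right)
    qed
    then show "p_norm p (tpoly (apart I) c) \<le> C * p_norm p (tpoly I c)" by (simp add: G_def f_def g_def)
  qed fact
qed

section \<open>Completeness and the projection on Lebesgue spaces\<close>

lemma LIMSEQ_norm_bound:
  fixes f :: "nat \<Rightarrow> 'a::real_normed_vector"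
  assumes "\<And>m. norm (f m - l) \<le> B m" "B \<longlonglongrightarrow> 0"
  shows "f \<longlonglongrightarrow> l"
  by (rule LIM_zero_cancel, rule Lim_null_comparison[OF _ assms(2)]) (simp add: assms(1))

text \<open>The Riesz--Fischer argument: the increments are summable in \<open>L1\<close>, so the
  telescoping series converges absolutely almost everywhere, and Fatou's lemma carries the norm
  bounds to the limit.\<close>

lemma p_norm_cauchy_limit:
  assumes p: "p > 1" and g: "\<And>k::nat. p_int p (g k)"
    and B: "B \<ge> 0" and d: "\<And>k. p_norm p (\<lambda>t. g (Suc k) t - g k t) \<le> B * (1/2)^k"
  obtains h where "p_int p h" "\<And>m. p_norm p (\<lambda>t. h t - g m t) \<le> 2 * B * (1/2)^m"
proof -
  have [measurable]: "g k \<in> borel_measurable borel" for k using g by auto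
  have "(\<integral>\<^sup>+t. (\<Sum>k. ennreal (norm (g (Suc k) t - g k t))) \<partial>\<mu>) = (\<Sum>k. \<integral>\<^sup>+t. ennreal (norm (g (Suc k) t - g k t)) \<partial>\<mu>)"
    by (intro nn_integral_suminf) simp
  also have "\<dots> \<le> (\<Sum>k. ennreal (B * (1/2)^k))"
  proof (intro suminf_le summableI)
    fix k
    have i: "p_int p (\<lambda>t. g (Suc k) t - g k t)" using p by (intro p_int_diff g) auto
    have "(\<integral>\<^sup>+t. ennreal (norm (g (Suc k) t - g k t)) \<partial>\<mu>) = ennreal (integral\<^sup>L \<mu> (\<lambda>t. norm (g (Suc k) t - g k t)))"
      using L1_le_p_norm(1)[OF p i] by (intro nn_integral_eq_integral) auto
    also have "\<dots> \<le> ennreal (B * (1/2)^k)"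
      using L1_le_p_norm(2)[OF p i] d[of k] by (intro ennreal_leI) linarith
    finally show "(\<integral>\<^sup>+t. ennreal (norm (g (Suc k) t - g k t)) \<partial>\<mu>) \<le> ennreal (B * (1/2)^k)" .
  qed
  also have "\<dots> < \<infinity>"
    using B by (subst suminf_ennreal2) (auto intro!: summable_mult summable_geometric)
  finally have "AE t in \<mu>. (\<Sum>k. ennreal (norm (g (Suc k) t - g k t))) \<noteq> \<infinity>"
    by (intro nn_integral_PInf_AE) auto
  then have conv: "AE t in \<mu>. convergent (\<lambda>k. g k t)"
  proof eventually_elim
    case (elim t)
    then have "summable (\<lambda>k. norm (g (Suc k) t - g k t))" by (intro summable_suminf_not_top) auto
    then have "summable (\<lambda>k. g (Suc k) t - g k t)" by (rule summable_norm_cancel)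
    then have "convergent (\<lambda>n. \<Sum>k<n. g (Suc k) t - g k t)" by (simp add: summable_iff_convergent)
    moreover have "(\<lambda>n. \<Sum>k<n. g (Suc k) t - g k t) = (\<lambda>n. g n t - g 0 t)"
      by (intro ext sum_lessThan_telescope[of "\<lambda>k. g k t"])
    ultimately have "convergent (\<lambda>n. g n t - g 0 t)" by (simp only:)
    then have "convergent (\<lambda>n. (g n t - g 0 t) + g 0 t)" by (intro convergent_add convergent_const)
    then show ?case by simp
  qed
  define h where "h = (\<lambda>t. lim (\<lambda>k. g k t))"
  have hm [measurable]: "h \<in> borel_measurable borel" unfolding h_def by (rule borel_measurable_lim_metric) simp
  have hl: "AE t in \<mu>. (\<lambda>k. g k t) \<longlonglongrightarrow> h t"
    using conv by eventually_elim (simp add: h_def convergent_LIMSEQ_iff)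
  \<comment> \<open>The exact partial sum of the geometric series, the form that passes through the
    induction.\<close>
  have dm: "p_norm p (\<lambda>t. g (m + k) t - g m t) \<le> 2 * B * (1/2)^m * (1 - (1/2)^k)" for m k
  proof (induction k)
    case (Suc k)
    have "p_norm p (\<lambda>t. g (m + Suc k) t - g m t) \<le> p_norm p (\<lambda>t. g (Suc (m + k)) t - g (m + k) t) + p_norm p (\<lambda>t. g (m + k) t - g m t)"
      using minkowski_diff[of p "g (m + Suc k)" "g (m + k)" "g m"] p g by simp
    also have "\<dots> \<le> B * (1/2)^(m + k) + 2 * B * (1/2)^m * (1 - (1/2)^k)" using Suc d[of "m + k"] by simp
    also have "\<dots> = 2 * B * (1/2)^m * (1 - (1/2)^Suc k)" by (simp add: power_add field_simps)
    finally show ?case .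
  qed simp
  have F: "p_int p (\<lambda>t. h t - g m t)" "p_norm p (\<lambda>t. h t - g m t) \<le> 2 * B * (1/2)^m" for m
  proof -
    have *: "p > 0" "2 * B * (1/2)^m \<ge> 0" using p B by auto
    have i: "p_int p (\<lambda>t. g (m + k) t - g m t)" for k using p by (intro p_int_diff g) auto
    have le: "p_norm p (\<lambda>t. g (m + k) t - g m t) \<le> 2 * B * (1/2)^m" for k
      using dm[of m k] mult_left_mono[of "1 - (1/2)^k" 1 "2 * B * (1/2)^m"] B by simp
    have l: "AE t in \<mu>. (\<lambda>k. g (m + k) t - g m t) \<longlonglongrightarrow> h t - g m t"
      using hl
    proof eventually_elim
      case (elim t)
      then have "(\<lambda>k. g (k + m) t) \<longlonglongrightarrow> h t" by (rule LIMSEQ_ignore_initial_segment)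
      then show ?case by (intro tendsto_diff tendsto_const) (simp add: add.commute)
    qed
    show "p_int p (\<lambda>t. h t - g m t)" "p_norm p (\<lambda>t. h t - g m t) \<le> 2 * B * (1/2)^m"
      using p_norm_fatou[OF * i _ le l] by auto
  qed
  have "p_int p (\<lambda>t. (h t - g 0 t) + g 0 t)" using p by (intro p_int_add F g) auto
  then have "p_int p h" by simp
  with F show ?thesis using that by blast
qed

text \<open>Trigonometric polynomials converge to \<open>f\<close> at a geometric rate; by the
  polynomial bound their analytic parts form a Cauchy sequence. The limit has the right Fourier
  coefficients because each coefficient is bounded by the norm.\<close>

theorem riesz_projection:
  fixes p :: real
  assumes p: "1 < p"
  obtains C where "C \<ge> 0" "\<And>f. p_int p f \<Longrightarrow>
    \<exists>g. p_int p g \<and> (\<forall>n. fcoef g n = (if n \<ge> 0 then fcoef f n else 0)) \<and> p_norm p g \<le> C * p_norm p f"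
proof -
  obtain C where C: "C \<ge> 0" "\<And>I c. finite I \<Longrightarrow> p_norm p (tpoly (apart I) c) \<le> C * p_norm p (tpoly I c)"
    using riesz_trig[OF p] by blast
  have p1: "p \<ge> 1" "p > 0" using p by auto
  show ?thesis
  proof
    show "C \<ge> 0" by fact
    fix f assume f: "p_int p f"
    have "\<forall>k::nat. \<exists>I c. finite I \<and> p_norm p (\<lambda>t. f t - tpoly I c t) < (1/2)^k"
      using trig_dense[OF p1(1) f] by (simp add: p_approx_def)
    then obtain I c where I: "\<And>k. finite (I k)" "\<And>k. p_norm p (\<lambda>t. f t - tpoly (I k) (c k) t) < (1/2)^k"
      by metis
    define r where "r k = tpoly (I k) (c k)" for k
    define g where "g k = tpoly (apart (I k)) (c k)" for k
    have rp: "p_int p (r k)" and gp: "p_int p (g k)" for k unfolding r_def g_def by (intro p_int_tpoly p1)+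
    have rf: "p_norm p (\<lambda>t. f t - r k t) \<le> (1/2)^k" for k using I(2)[of k] by (simp add: r_def)
    \<comment> \<open>Consecutive approximants of \<open>f\<close> differ by at most twice the
      current error, and the polynomial bound costs the factor \<open>C\<close>.\<close>
    have nd: "p_norm p (\<lambda>t. g (Suc k) t - g k t) \<le> (2 * C) * (1/2)^k" for k
    proof -
      define K where "K = I k \<union> I (Suc k)"
      have K: "finite K" "I k \<subseteq> K" "I (Suc k) \<subseteq> K" using I by (auto simp: K_def)
      define a where "a n = (if n \<in> I (Suc k) then c (Suc k) n else 0) - (if n \<in> I k then c k n else 0)" for n
      have "g (Suc k) t - g k t = tpoly (apart K) a t" for t
        unfolding g_def tpoly_apart_extend[OF K(1,2)] tpoly_apart_extend[OF K(1,3)]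
        by (simp add: tpoly_def a_def sum_subtractf left_diff_distrib)
      moreover have "r (Suc k) t - r k t = tpoly K a t" for t
        unfolding r_def tpoly_extend[OF K(1,2)] tpoly_extend[OF K(1,3)]
        by (simp add: tpoly_def a_def sum_subtractf left_diff_distrib)
      ultimately have "p_norm p (\<lambda>t. g (Suc k) t - g k t) \<le> C * p_norm p (\<lambda>t. r (Suc k) t - r k t)"
        using C(2)[OF K(1), of a] by simp
      also have "p_norm p (\<lambda>t. r (Suc k) t - r k t) \<le> p_norm p (\<lambda>t. r (Suc k) t - f t) + p_norm p (\<lambda>t. f t - r k t)"
        by (intro minkowski_diff rp f p1)
      also have "\<dots> \<le> (1/2)^k + (1/2)^k"
      proof (rule add_mono)
        have "(1/2::real)^Suc k \<le> (1/2)^k" by simp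
        then show "p_norm p (\<lambda>t. r (Suc k) t - f t) \<le> (1/2)^k" using rf[of "Suc k"] unfolding p_norm_diff_commute[of p "r (Suc k)" f] by linarith
      qed (rule rf)
      finally show ?thesis using C(1) by (simp add: mult_left_mono)
    qed
    obtain h where h: "p_int p h" "\<And>m. p_norm p (\<lambda>t. h t - g m t) \<le> 2 * (2 * C) * (1/2)^m"
      using p_norm_cauchy_limit[OF p gp _ nd] C(1) by auto
    have z: "(\<lambda>m. K * (1/2)^m) \<longlonglongrightarrow> 0" for K :: real
      using tendsto_mult_left[OF LIMSEQ_power_zero[of "1/2::real"], of K] by simp
    note il = L1_le_p_norm(1)[OF p]
    show "\<exists>g. p_int p g \<and> (\<forall>n. fcoef g n = (if n \<ge> 0 then fcoef f n else 0)) \<and> p_norm p g \<le> C * p_norm p f"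
    proof (intro exI[of _ h] conjI allI)
      show "p_int p h" by fact
      fix n
      have 1: "(\<lambda>m. fcoef (g m) n) \<longlonglongrightarrow> fcoef h n"
      proof (rule LIMSEQ_norm_bound[where B = "\<lambda>m. 2 * (2 * C) * (1/2)^m"])
        show "norm (fcoef (g m) n - fcoef h n) \<le> 2 * (2 * C) * (1/2)^m" for m
        proof -
          have "norm (fcoef (\<lambda>t. h t - g m t) n) \<le> p_norm p (\<lambda>t. h t - g m t)"
            by (intro norm_fcoef_le p p_int_diff h gp p1)
          also have "fcoef (\<lambda>t. h t - g m t) n = fcoef h n - fcoef (g m) n" by (intro fcoef_diff il h gp)
          finally show ?thesis using h(2)[of m] by (simp add: norm_minus_commute)
        qed
      qed (rule z)
      have 2: "(\<lambda>m. fcoef (r m) n) \<longlonglongrightarrow> fcoef f n"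
      proof (rule LIMSEQ_norm_bound[where B = "\<lambda>m. 1 * (1/2)^m"])
        show "norm (fcoef (r m) n - fcoef f n) \<le> 1 * (1/2)^m" for m
        proof -
          have "norm (fcoef (\<lambda>t. f t - r m t) n) \<le> p_norm p (\<lambda>t. f t - r m t)"
            by (intro norm_fcoef_le p p_int_diff f rp p1)
          also have "fcoef (\<lambda>t. f t - r m t) n = fcoef f n - fcoef (r m) n" by (intro fcoef_diff il f rp)
          finally show ?thesis using rf[of m] by (simp add: norm_minus_commute)
        qed
      qed (rule z)
      have "fcoef (g m) n = (if n \<ge> 0 then fcoef (r m) n else 0)" for m
        using I(1)[of m] by (simp add: g_def r_def fcoef_tpoly apart_def)
      then show "fcoef h n = (if n \<ge> 0 then fcoef f n else 0)"
        using 1 2 by (auto intro: LIMSEQ_unique split: if_splits)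
    next
      \<comment> \<open>Four of the five \<open>C\<close> come from the distance of \<open>h\<close>
        to \<open>g m\<close>, the fifth from the distance of \<open>r m\<close> to
        \<open>f\<close>.\<close>
      have "p_norm p h \<le> C * p_norm p f + (5 * C) * (1/2)^m" for m
      proof -
        have "p_norm p h \<le> p_norm p (\<lambda>t. h t - g m t) + p_norm p (g m)"
          using minkowski_circle[OF p1(1) p_int_diff[OF h(1) gp[of m] p1(2)] gp[of m]] by simp
        also have "p_norm p (g m) \<le> C * p_norm p (r m)" unfolding g_def r_def by (rule C(2)[OF I(1)])
        finally have 3: "p_norm p h \<le> p_norm p (\<lambda>t. h t - g m t) + C * p_norm p (r m)" by simp
        have "p_norm p (r m) \<le> p_norm p (\<lambda>t. r m t - f t) + p_norm p f"
          using minkowski_circle[OF p1(1) p_int_diff[OF rp[of m] f p1(2)] f] by simp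
        also have "\<dots> \<le> (1/2)^m + p_norm p f" using rf[of m] by (simp add: p_norm_diff_commute)
        finally have "C * p_norm p (r m) \<le> C * ((1/2)^m + p_norm p f)" using C(1) by (rule mult_left_mono)
        then show ?thesis using 3 h(2)[of m] by (simp add: algebra_simps)
      qed
      moreover have "(\<lambda>m. C * p_norm p f + (5 * C) * (1/2)^m) \<longlonglongrightarrow> C * p_norm p f + 0"
        by (intro tendsto_add tendsto_const z)
      ultimately show "p_norm p h \<le> C * p_norm p f"
        by (intro LIMSEQ_le_const[of "\<lambda>m. C * p_norm p f + (5 * C) * (1/2)^m"]) auto
    qed
  qed
qed

section \<open>The Hahn--Banach theorem for seminorms\<close>

text \<open>The value 0 outside \<open>V\<close> makes functionals that agree on \<open>V\<close>
  equal, so that minimality can be expressed by pointwise comparison. An inequality suffices for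
  positive factors, since the factor \<open>1 / r\<close> gives the converse.\<close>

definition sublinear_on :: "(complex \<Rightarrow> 'a \<Rightarrow> 'a) \<Rightarrow> 'a::ab_group_add set \<Rightarrow> ('a \<Rightarrow> real) \<Rightarrow> bool" where
  "sublinear_on s V q \<longleftrightarrow> (\<forall>x\<in>V. \<forall>y\<in>V. q (x + y) \<le> q x + q y)
     \<and> (\<forall>r>0. \<forall>x\<in>V. q (s (of_real r) x) \<le> r * q x) \<and> (\<forall>x. x \<notin> V \<longrightarrow> q x = 0)"

context
  fixes s :: "complex \<Rightarrow> 'a::ab_group_add \<Rightarrow> 'a" and V :: "'a set"
  assumes vs: "vector_space s" and V: "module.subspace s V"
begin

interpretation vector_space s by (rule vs)

lemma V_closed: "0 \<in> V" "x \<in> V \<Longrightarrow> y \<in> V \<Longrightarrow> x + y \<in> V" "x \<in> V \<Longrightarrow> s z x \<in> V" "x \<in> V \<Longrightarrow> - x \<in> V"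
  "x \<in> V \<Longrightarrow> y \<in> V \<Longrightarrow> x - y \<in> V"
  using V by (auto simp: subspace_0 subspace_add subspace_scale subspace_neg subspace_diff)

lemma sublinear_on_0:
  assumes "sublinear_on s V q"
  shows "q 0 = 0"
proof -
  have le: "q 0 \<le> r * q 0" if "r > 0" for r
    using assms that V_closed(1) scale_zero_right unfolding sublinear_on_def by metis
  show ?thesis using le[of 2] le[of "1/2"] by simp
qed

lemma sublinear_on_neg:
  assumes "sublinear_on s V q" "x \<in> V"
  shows "- q (- x) \<le> q x"
proof -
  have "q (x + - x) \<le> q x + q (- x)" using assms V_closed(4) unfolding sublinear_on_def by blast
  then show ?thesis using sublinear_on_0[OF assms(1)] by simp
qed

text \<open>The largest sublinear functional below \<open>q\<close> whose value at \<open>- y\<close> is at most \<open>- q y\<close>.\<close>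

definition sublinear_shift :: "('a \<Rightarrow> real) \<Rightarrow> 'a \<Rightarrow> 'a \<Rightarrow> real" where
  "sublinear_shift q y x = (if x \<in> V then INF t\<in>{0..}. q (x + s (of_real t) y) - t * q y else 0)"

lemma sublinear_shift:
  assumes q: "sublinear_on s V q" and y: "y \<in> V"
  shows "sublinear_on s V (sublinear_shift q y)" and "sublinear_shift q y x \<le> q x"
    and "sublinear_shift q y (- y) \<le> - q y"
proof -
  let ?f = "\<lambda>x t. q (x + s (of_real t) y) - t * q y"
  have add: "q (x + z) \<le> q x + q z" if "x \<in> V" "z \<in> V" for x z
    using q that unfolding sublinear_on_def by blast
  have hom: "q (s (of_real r) x) \<le> r * q x" if "r \<ge> 0" "x \<in> V" for r x
    using q that sublinear_on_0[OF q] unfolding sublinear_on_def by (cases "r = 0") auto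
  \<comment> \<open>A lower bound independent of \<open>t\<close>, without which the infimum would
    carry no information.\<close>
  have lower: "- q (- x) \<le> ?f x t" if "x \<in> V" "t \<ge> 0" for x t
  proof -
    have "s (of_real (1 + t)) y = (x + s (of_real t) y) + (y - x)" by (simp add: scale_left_distrib)
    have "t * q y \<le> q (s (of_real t) y)"
    proof (cases "t = 0")
      case False
      then have "q (s (of_real (1/t)) (s (of_real t) y)) \<le> 1/t * q (s (of_real t) y)"
        using that y by (intro hom V_closed) auto
      then show ?thesis using False that by (simp add: field_simps)
    qed (simp add: sublinear_on_0[OF q])
    also have "q (s (of_real t) y) \<le> q (x + s (of_real t) y) + q (- x)"
      using add[of "x + s (of_real t) y" "- x"] that y V_closed by simp
    finally show ?thesis by simp
  qed
  have bdd: "bdd_below (?f x ` {0..})" if "x \<in> V" for x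
    using lower[OF that] by (intro bdd_belowI2[of _ "- q (- x)"]) auto
  have le: "sublinear_shift q y x \<le> ?f x t" if "x \<in> V" "t \<ge> 0" for x t
    unfolding sublinear_shift_def using that by (auto intro!: cINF_lower bdd)
  show "sublinear_shift q y x \<le> q x" for x
  proof (cases "x \<in> V")
    case True
    then show ?thesis using le[of x 0] by simp
  next
    case False
    then show ?thesis using q by (simp add: sublinear_shift_def sublinear_on_def)
  qed
  show "sublinear_shift q y (- y) \<le> - q y"
    using le[of "- y" 1] y V_closed(4) sublinear_on_0[OF q] by simp
  show "sublinear_on s V (sublinear_shift q y)"
    unfolding sublinear_on_def
  proof (intro conjI ballI allI impI)
    fix x z assume xz: "x \<in> V" "z \<in> V"
    \<comment> \<open>The two infima are approached one after the other: parameters \<open>u\<close>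
      for \<open>x\<close> and \<open>t\<close> for \<open>z\<close> yield the parameter
      \<open>u + t\<close> for \<open>x + z\<close>.\<close>
    have "sublinear_shift q y (x + z) - sublinear_shift q y x \<le> sublinear_shift q y z"
    proof -
      have 1: "sublinear_shift q y (x + z) - ?f z t \<le> ?f x u" if t: "t \<ge> 0" "u \<ge> 0" for t u
      proof -
        have "sublinear_shift q y (x + z) \<le> ?f (x + z) (u + t)" using xz t V_closed by (intro le) auto
        also have "(x + z) + s (of_real (u + t)) y = (x + s (of_real u) y) + (z + s (of_real t) y)"
          by (simp add: scale_left_distrib)
        also have "q \<dots> \<le> q (x + s (of_real u) y) + q (z + s (of_real t) y)"
          using xz y V_closed by (intro add) auto
        finally show ?thesis by (simp add: algebra_simps)
      qed
      have 2: "sublinear_shift q y (x + z) - ?f z t \<le> sublinear_shift q y x" if "t \<ge> 0" for t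
        using xz 1 that unfolding sublinear_shift_def[of q y x] by (simp, intro cINF_greatest) auto
      have "sublinear_shift q y (x + z) - sublinear_shift q y x \<le> ?f z t" if "t \<ge> 0" for t
        using 2[OF that] by linarith
      then show ?thesis
        using xz unfolding sublinear_shift_def[of q y z] by (simp, intro cINF_greatest) auto
    qed
    then show "sublinear_shift q y (x + z) \<le> sublinear_shift q y x + sublinear_shift q y z" by simp
  next
    fix r :: real and x assume r: "r > 0" and x: "x \<in> V"
    have "sublinear_shift q y (s (of_real r) x) / r \<le> ?f x t" if t: "t \<ge> 0" for t
    proof -
      have "sublinear_shift q y (s (of_real r) x) \<le> ?f (s (of_real r) x) (r * t)"
        using x r t V_closed by (intro le) auto
      also have "s (of_real r) x + s (of_real (r * t)) y = s (of_real r) (x + s (of_real t) y)"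
        by (simp add: scale_right_distrib)
      also have "q \<dots> \<le> r * q (x + s (of_real t) y)"
        using r x y V_closed by (intro hom) auto
      finally show ?thesis using r by (simp add: field_simps)
    qed
    then have "sublinear_shift q y (s (of_real r) x) / r \<le> sublinear_shift q y x"
      using x unfolding sublinear_shift_def[of q y x] by (simp, intro cINF_greatest) auto
    then show "sublinear_shift q y (s (of_real r) x) \<le> r * sublinear_shift q y x"
      using r by (simp add: field_simps)
  qed (simp add: sublinear_shift_def)
qed

text \<open>Zorn's lemma: the pointwise infimum of a chain is again sublinear, and it is finite
  because every member is at least \<open>- q0 (- x)\<close> at \<open>x\<close>.\<close>

lemma minimal_sublinear:
  assumes q0: "sublinear_on s V q0"
  obtains q where "sublinear_on s V q" "\<And>x. q x \<le> q0 x"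
    "\<And>q'. sublinear_on s V q' \<Longrightarrow> (\<And>x. q' x \<le> q x) \<Longrightarrow> q' = q"
proof -
  define A where "A = {q. sublinear_on s V q \<and> (\<forall>x. q x \<le> q0 x)}"
  have "\<exists>m\<in>A. \<forall>a\<in>A. m \<ge> a \<longrightarrow> a = m"
  proof (rule predicate_Zorn)
    show "partial_order_on A (relation_of (\<ge>) A)" by (rule partial_order_on_relation_ofI) auto
    fix C assume C: "C \<in> Chains (relation_of (\<ge>) A)"
    have CA: "C \<subseteq> A" using C by (rule Chains_relation_of)
    have chain: "a \<ge> b \<or> b \<ge> a" if "a \<in> C" "b \<in> C" for a b
      using C that by (auto simp: Chains_def relation_of_def)
    show "\<exists>u\<in>A. \<forall>a\<in>C. a \<ge> u"
    proof (cases "C = {}")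
      case True
      then show ?thesis using q0 by (auto simp: A_def intro!: bexI[of _ q0])
    next
      case ne: False
      define u where "u x = (INF q\<in>C. q x)" for x
      have sub: "sublinear_on s V q" "q x \<le> q0 x" if "q \<in> C" for q x using that CA by (auto simp: A_def)
      have bdd: "bdd_below ((\<lambda>q. q x) ` C)" for x
      proof (cases "x \<in> V")
        case True
        show ?thesis
        proof (rule bdd_belowI2)
          fix q assume "q \<in> C"
          then show "- q0 (- x) \<le> q x" using sublinear_on_neg[OF sub(1) True, of q] sub(2)[of q "- x"] by linarith
        qed
      next
        case False
        then have "q x = 0" if "q \<in> C" for q using sub(1)[OF that] by (simp add: sublinear_on_def)
        then show ?thesis by (intro bdd_belowI2[of _ 0]) (metis order_refl)
      qed
      have le: "u x \<le> q x" if "q \<in> C" for q x unfolding u_def using that by (intro cINF_lower bdd)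
      have ge: "m \<le> u x" if "\<And>q. q \<in> C \<Longrightarrow> m \<le> q x" for m x unfolding u_def using ne that by (intro cINF_greatest)
      have "sublinear_on s V u"
        unfolding sublinear_on_def
      proof (intro conjI ballI allI impI)
        fix x y assume xy: "x \<in> V" "y \<in> V"
        \<comment> \<open>Subadditivity of the infimum rests on the chain property: the smaller of
          two members estimates both summands at once.\<close>
        have 1: "u (x + y) - q' y \<le> q x" if q: "q \<in> C" "q' \<in> C" for q q'
        proof -
          obtain r where r: "r \<in> C" "r \<le> q" "r \<le> q'" using chain[OF q] q by (metis order_refl)
          have "u (x + y) \<le> r (x + y)" using r by (intro le)
          also have "\<dots> \<le> r x + r y" using sub(1)[OF r(1)] xy by (simp add: sublinear_on_def)
          also have "\<dots> \<le> q x + q' y" using r by (intro add_mono) (auto simp: le_fun_def)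
          finally show ?thesis by simp
        qed
        have "u (x + y) - u x \<le> q' y" if "q' \<in> C" for q'
        proof -
          have "u (x + y) - q' y \<le> u x" by (rule ge) (rule 1[OF _ that])
          then show ?thesis by linarith
        qed
        then have "u (x + y) - u x \<le> u y" by (rule ge)
        then show "u (x + y) \<le> u x + u y" by linarith
      next
        fix r :: real and x assume r: "r > 0" and x: "x \<in> V"
        have "u (s (of_real r) x) / r \<le> q x" if q: "q \<in> C" for q
        proof -
          have "u (s (of_real r) x) \<le> q (s (of_real r) x)" using q by (rule le)
          also have "\<dots> \<le> r * q x" using sub(1)[OF q] r x by (simp add: sublinear_on_def)
          finally show ?thesis using r by (simp add: field_simps)
        qed
        then have "u (s (of_real r) x) / r \<le> u x" by (rule ge)
        then show "u (s (of_real r) x) \<le> r * u x" using r by (simp add: field_simps)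
      next
        fix x assume x: "x \<notin> V"
        have "q x = 0" if "q \<in> C" for q using sub(1)[OF that] x by (simp add: sublinear_on_def)
        then have "u x = (INF q\<in>C. 0)" unfolding u_def by (intro INF_cong) auto
        then show "u x = 0" using ne by simp
      qed
      moreover have "u x \<le> q0 x" for x using ne le sub(2) by (meson equals0I order_trans)
      ultimately have "u \<in> A" by (simp add: A_def)
      then show ?thesis using le by (auto simp: le_fun_def)
    qed
  qed
  then obtain m where m: "m \<in> A" "\<And>a. a \<in> A \<Longrightarrow> m \<ge> a \<Longrightarrow> a = m" by blast
  show ?thesis
  proof
    show "sublinear_on s V m" "m x \<le> q0 x" for x using m(1) by (auto simp: A_def)
    fix q' assume *: "sublinear_on s V q'" "\<And>x. q' x \<le> m x"
    have "q' x \<le> q0 x" for x using *(2)[of x] m(1) by (auto simp: A_def intro: order_trans)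
    then show "q' = m" using * by (intro m(2)) (auto simp: A_def le_fun_def)
  qed
qed

text \<open>A minimal sublinear \<open>q\<close> coincides with each of its shifts, so
  \<open>q (- y) = - q y\<close>, and oddness with subadditivity gives real linearity. The complex
  functional is \<open>q x - \<i> * q (s \<i> x)\<close>. The factor 2 is the price of estimating
  its two parts separately; only boundedness matters later.\<close>

theorem hahn_banach_seminorm:
  fixes N :: "'a \<Rightarrow> real"
  assumes N: "\<And>x y. x \<in> V \<Longrightarrow> y \<in> V \<Longrightarrow> N (x + y) \<le> N x + N y"
    "\<And>z x. x \<in> V \<Longrightarrow> N (s z x) = norm z * N x"
    and x0: "x0 \<in> V" "N x0 > 0"
  obtains l where "\<And>x y. x \<in> V \<Longrightarrow> y \<in> V \<Longrightarrow> l (x + y) = l x + l y"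
    "\<And>z x. x \<in> V \<Longrightarrow> l (s z x) = z * l x" "\<And>x. x \<in> V \<Longrightarrow> norm (l x) \<le> 2 * N x"
    "l x0 \<noteq> 0" "\<And>x. x \<notin> V \<Longrightarrow> l x = 0"
proof -
  define N' where "N' x = (if x \<in> V then N x else 0)" for x
  have "sublinear_on s V N'"
    using N V_closed by (auto simp: sublinear_on_def N'_def)
  note sh = sublinear_shift[OF this x0(1)]
  \<comment> \<open>Minimising below the shift at \<open>x0\<close> instead of below the seminorm
    itself forces \<open>q (- x0) \<le> - N x0\<close>, hence a nonzero value at
    \<open>x0\<close>.\<close>
  obtain q where q: "sublinear_on s V q" "\<And>x. q x \<le> sublinear_shift N' x0 x"
    and min: "\<And>q'. sublinear_on s V q' \<Longrightarrow> (\<And>x. q' x \<le> q x) \<Longrightarrow> q' = q"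
    using minimal_sublinear[OF sh(1)] by blast
  have odd: "q (- y) = - q y" if y: "y \<in> V" for y
  proof -
    have "sublinear_shift q y = q" using sublinear_shift[OF q(1) y] by (intro min) auto
    then have "q (- y) \<le> - q y" using sublinear_shift(3)[OF q(1) y] by simp
    then show ?thesis using sublinear_on_neg[OF q(1) y] by simp
  qed
  have add: "q (x + y) = q x + q y" if xy: "x \<in> V" "y \<in> V" for x y
  proof (rule antisym)
    show "q (x + y) \<le> q x + q y" using q(1) xy by (simp add: sublinear_on_def)
    have "q (- x + - y) \<le> q (- x) + q (- y)" using q(1) xy V_closed unfolding sublinear_on_def by blast
    moreover have "- x + - y = - (x + y)" by simp
    ultimately show "q x + q y \<le> q (x + y)"
      using odd[of x] odd[of y] odd[of "x + y"] xy V_closed by simp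
  qed
  have pos: "q (s (of_real r) x) = r * q x" if r: "r > 0" and x: "x \<in> V" for r x
  proof (rule antisym)
    show "q (s (of_real r) x) \<le> r * q x" using q(1) r x by (simp add: sublinear_on_def)
    have "q (s (of_real (1/r)) (s (of_real r) x)) \<le> 1/r * q (s (of_real r) x)"
      using q(1) r x V_closed(3) unfolding sublinear_on_def by (meson zero_less_divide_1_iff)
    then show "r * q x \<le> q (s (of_real r) x)" using r by (simp add: field_simps)
  qed
  have hom: "q (s (of_real r) x) = r * q x" if x: "x \<in> V" for r x
  proof -
    consider "r = 0" | "r > 0" | "r < 0" by linarith
    then show ?thesis
    proof cases
      case 1 then show ?thesis using sublinear_on_0[OF q(1)] by simp
    next
      case 2 then show ?thesis using pos x by simp
    next
      case 3
      have "q (s (of_real r) x) = q (- s (of_real (- r)) x)" by simp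
      also have "\<dots> = - ((- r) * q x)" using 3 x V_closed by (subst odd) (auto simp: pos simp del: of_real_minus)
      finally show ?thesis by simp
    qed
  qed
  have leN: "\<bar>q x\<bar> \<le> N x" if x: "x \<in> V" for x
  proof -
    have "q y \<le> N y" if "y \<in> V" for y using q(2)[of y] sh(2)[of y] that by (simp add: N'_def)
    from this[OF x] this[OF V_closed(4)[OF x]] show ?thesis
      using odd[OF x] N(2)[OF x, of "-1"] by simp
  qed
  have qx0: "q x0 \<noteq> 0"
  proof -
    have "q (- x0) \<le> - N x0" using q(2)[of "- x0"] sh(3) x0 by (simp add: N'_def)
    then show ?thesis using odd[OF x0(1)] x0(2) by simp
  qed
  have q0: "q x = 0" if "x \<notin> V" for x using q(1) that by (simp add: sublinear_on_def)
  define l where "l x = (if x \<in> V then complex_of_real (q x) - \<i> * of_real (q (s \<i> x)) else 0)" for x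
  show ?thesis
  proof
    show ladd: "l (x + y) = l x + l y" if "x \<in> V" "y \<in> V" for x y
      using that V_closed by (simp add: l_def add scale_right_distrib algebra_simps)
    show "l (s z x) = z * l x" if x: "x \<in> V" for z x
    proof -
      have lr: "l (s (of_real r) x) = of_real r * l x" if "x \<in> V" for r x
      proof -
        have "s \<i> (s (of_real r) x) = s (of_real r) (s \<i> x)" by (simp add: mult.commute)
        then show ?thesis using that V_closed by (simp add: l_def hom algebra_simps del: scale_scale)
      qed
      have li: "l (s \<i> x) = \<i> * l x"
      proof -
        have "s \<i> (s \<i> x) = - x" by simp
        then show ?thesis using x V_closed odd[OF x] by (simp add: l_def algebra_simps del: scale_scale)
      qed
      have "s z x = s (of_real (Re z)) x + s (of_real (Im z)) (s \<i> x)"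
        by (simp add: scale_left_distrib[symmetric] complex_eq_iff mult.commute)
      then have "l (s z x) = of_real (Re z) * l x + of_real (Im z) * (\<i> * l x)"
        using x V_closed by (simp add: ladd lr li del: scale_scale)
      also have "\<dots> = (of_real (Re z) + \<i> * of_real (Im z)) * l x" by (simp add: algebra_simps)
      finally show ?thesis by (simp add: complex_eq[symmetric])
    qed
    show "norm (l x) \<le> 2 * N x" if x: "x \<in> V" for x
    proof -
      have "norm (l x) \<le> norm (complex_of_real (q x)) + norm (\<i> * complex_of_real (q (s \<i> x)))"
        using x norm_triangle_ineq4[of "of_real (q x)" "\<i> * complex_of_real (q (s \<i> x))"] by (simp add: l_def)
      also have "\<dots> = \<bar>q x\<bar> + \<bar>q (s \<i> x)\<bar>" by (simp add: norm_mult)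
      also have "\<dots> \<le> N x + N (s \<i> x)" using x V_closed by (intro add_mono leN) auto
      also have "\<dots> = 2 * N x" using N(2)[OF x, of \<i>] by simp
      finally show ?thesis .
    qed
    have "Re (l x0) = q x0" using x0 by (simp add: l_def)
    then show "l x0 \<noteq> 0" using qx0 by auto
    show "l x = 0" if "x \<notin> V" for x using that by (simp add: l_def)
  qed
qed

end

section \<open>Classes of functions on the circle\<close>

abbreviation "rep \<equiv> rep_circ_fun"

lemma rep_borel [measurable, simp]: "rep f \<in> borel_measurable borel"
  using Quotient3_rep_reflp[OF Quotient3_circ_fun, of f] by (simp add: eq_ae_def)

lemma abs_rep [simp]: "abs_circ_fun (rep f) = f"
  by (rule Quotient3_abs_rep[OF Quotient3_circ_fun])

lemma circ_eq_iff: "f = g \<longleftrightarrow> (AE t in \<mu>. rep f t = rep g t)"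
  using Quotient3_rel_rep[OF Quotient3_circ_fun, of f g] by (simp add: eq_ae_def)

lemma rep_abs_AE:
  assumes "F \<in> borel_measurable borel"
  shows "AE t in \<mu>. rep (abs_circ_fun F) t = F t"
proof -
  have "eq_ae F F" using assms by (simp add: eq_ae_def)
  then have "eq_ae (rep (abs_circ_fun F)) F"
    by (rule Quotient3_rep_abs[OF Quotient3_circ_fun])
  then show ?thesis by (simp add: eq_ae_def)
qed

lemma rep_0: "AE t in \<mu>. rep 0 t = 0"
  using rep_abs_AE[of "\<lambda>_. 0"] by (simp add: zero_circ_fun_def)

lemma rep_1: "AE t in \<mu>. rep 1 t = 1"
  using rep_abs_AE[of "\<lambda>_. 1"] by (simp add: one_circ_fun_def)

lemma rep_add: "AE t in \<mu>. rep (f + g) t = rep f t + rep g t"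
  using rep_abs_AE[of "\<lambda>t. rep f t + rep g t"] by (simp add: plus_circ_fun_def)

lemma rep_diff: "AE t in \<mu>. rep (f - g) t = rep f t - rep g t"
  using rep_abs_AE[of "\<lambda>t. rep f t - rep g t"] by (simp add: minus_circ_fun_def)

lemma rep_mult: "AE t in \<mu>. rep (f * g) t = rep f t * rep g t"
  using rep_abs_AE[of "\<lambda>t. rep f t * rep g t"] by (simp add: times_circ_fun_def)

lemma rep_scaleC: "AE t in \<mu>. rep (z *\<^sub>C f) t = z * rep f t"
  using rep_abs_AE[of "\<lambda>t. z * rep f t"] by (simp add: scaleC_def)

lemma rep_inverse: "AE t in \<mu>. rep (inverse f) t = inverse (rep f t)"
  using rep_abs_AE[of "\<lambda>t. inverse (rep f t)"] by (simp add: inverse_circ_fun_def)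

lemma rep_tvar: "AE t in \<mu>. rep tvar t = t"
  using rep_abs_AE[of "\<lambda>t. t"] by (simp add: tvar_def)

lemma scaleC_mult_left [simp]: "(z *\<^sub>C f) * g = z *\<^sub>C (f * g)"
  by transfer (auto simp: eq_ae_def mult_ac)

lemma scaleC_mult_right [simp]: "f * (z *\<^sub>C g) = z *\<^sub>C (f * g)"
  by transfer (auto simp: eq_ae_def mult_ac)

lemma circ_inverse_mult: "inverse (f * g :: circ_fun) = inverse f * inverse g"
  by transfer (auto simp: eq_ae_def)

lemma circ_inverse_inverse [simp]: "inverse (inverse f :: circ_fun) = f"
  by transfer (auto simp: eq_ae_def)

lemma circ_inverse_1 [simp]: "inverse (1 :: circ_fun) = 1"
  by transfer (auto simp: eq_ae_def)

lemma circ_inverse_power: "inverse (f ^ n :: circ_fun) = inverse f ^ n"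
  by (induction n) (simp_all add: circ_inverse_mult)

lemma circ_mult_eq_1:
  assumes "f * g = (1 :: circ_fun)"
  shows "g = inverse f"
  using assms
  by transfer (auto simp: eq_ae_def inverse_unique elim!: eventually_mono)

lemma circ_unit_inverse:
  assumes "f dvd (1 :: circ_fun)"
  shows "f * inverse f = 1" "inverse f * f = 1"
proof -
  obtain g where "f * g = 1" using assms by (metis dvdE)
  then show "f * inverse f = 1" using circ_mult_eq_1 by metis
  then show "inverse f * f = 1" by (simp add: mult.commute)
qed

lemma circ_unit_cancel: "f dvd (1 :: circ_fun) \<Longrightarrow> f * g = f * h \<longleftrightarrow> g = h"
  by (metis circ_unit_inverse(2) mult.assoc mult_1)

lemma circ_unit_inverse_dvd: "f dvd (1 :: circ_fun) \<Longrightarrow> inverse f dvd 1"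
  by (metis circ_unit_inverse(2) dvd_triv_left)

lemma tvar_unit: "tvar dvd 1"
proof -
  have "tvar * inverse tvar = 1"
    by transfer (use AE_circle_nonzero in \<open>auto simp: eq_ae_def elim!: eventually_mono\<close>)
  then show ?thesis by (metis dvd_triv_left)
qed

lemmas tvar_inverse [simp] = circ_unit_inverse[OF tvar_unit]

lemma Linf_iff: "f \<in> Linf \<longleftrightarrow> (\<exists>C. AE t in \<mu>. norm (rep f t) \<le> C)"
  by (simp add: Linf_def in_Linf_def)

lemma Linf_abs:
  assumes "F \<in> borel_measurable borel" "\<And>t. norm t = 1 \<Longrightarrow> norm (F t) \<le> C"
  shows "abs_circ_fun F \<in> Linf"
proof -
  have "AE t in \<mu>. norm (rep (abs_circ_fun F) t) \<le> C"
    using rep_abs_AE[OF assms(1)] AE_circle_norm by eventually_elim (simp add: assms(2))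
  then show ?thesis by (auto simp: Linf_iff)
qed

lemma Linf_mult: "f \<in> Linf \<Longrightarrow> g \<in> Linf \<Longrightarrow> f * g \<in> Linf"
proof -
  assume "f \<in> Linf" "g \<in> Linf"
  then obtain C D where "AE t in \<mu>. norm (rep f t) \<le> C" "AE t in \<mu>. norm (rep g t) \<le> D"
    by (auto simp: Linf_iff)
  then have "AE t in \<mu>. norm (rep (f * g) t) \<le> C * D"
    using rep_mult[of f g]
  proof eventually_elim
    case (elim t)
    have "norm (rep f t) * norm (rep g t) \<le> C * D"
      using elim order_trans[OF norm_ge_zero elim(1)] by (intro mult_mono) auto
    then show ?case by (simp only: elim(3) norm_mult)
  qed
  then show ?thesis unfolding Linf_iff by blast
qed

lemma Linf_1 [simp]: "1 \<in> Linf"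
  unfolding one_circ_fun_def by (rule Linf_abs[where C = 1]) auto

lemma Linf_power: "f \<in> Linf \<Longrightarrow> f ^ n \<in> Linf"
  by (induction n) (auto intro: Linf_mult)

lemma Linf_tvar [simp]: "tvar \<in> Linf"
  unfolding tvar_def map_fun_def id_def by (rule Linf_abs[where C = 1]) auto

lemma Linf_inverse_tvar [simp]: "inverse tvar \<in> Linf"
proof -
  have "AE t in \<mu>. norm (rep (inverse tvar) t) \<le> 1"
    using rep_inverse[of tvar] rep_tvar AE_circle_norm by eventually_elim (simp add: norm_inverse)
  then show ?thesis by (auto simp: Linf_iff)
qed

lemma Linf_invertibleD:
  assumes "Linf_invertible f"
  shows "f \<in> Linf" "f dvd 1" "inverse f \<in> Linf"
proof -
  obtain g where g: "f \<in> Linf" "g \<in> Linf" "f * g = 1" using assms by (auto simp: Linf_invertible_def)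
  then show "f \<in> Linf" "f dvd 1" "inverse f \<in> Linf"
    using circ_mult_eq_1[OF g(3)] by (metis dvd_triv_left)+
qed

lemma Lp_iff: "f \<in> Lp p \<longleftrightarrow> p_int p (rep f)"
  by (simp add: Lp_def in_Lp_def p_int_def)

lemma Lp_norm_eq: "Lp_norm p f = p_norm p (rep f)"
  by (simp add: Lp_norm_def p_norm_def)

lemma fourier_eq: "fourier f n = fcoef (rep f) n"
  by (simp add: fourier_def fcoef_def)

lemma p_int_cong_AE:
  assumes "p_int p f" "g \<in> borel_measurable borel" "AE t in \<mu>. g t = f t"
  shows "p_int p g"
proof -
  have [measurable]: "f \<in> borel_measurable borel" "g \<in> borel_measurable borel" using assms by auto
  have "integrable \<mu> (\<lambda>t. norm (f t) powr p) \<longleftrightarrow> integrable \<mu> (\<lambda>t. norm (g t) powr p)"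
    using assms(3) by (intro integrable_cong_AE) auto
  then show ?thesis using assms by (simp add: p_int_def)
qed

lemma fcoef_cong_AE:
  assumes [measurable]: "f \<in> borel_measurable borel" "g \<in> borel_measurable borel" and "AE t in \<mu>. f t = g t"
  shows "fcoef f n = fcoef g n"
  unfolding fcoef_def using assms(3) by (intro integral_cong_AE) auto

lemma abs_in_Lp:
  assumes "p_int p F" "p > 0"
  shows "abs_circ_fun F \<in> Lp p" "Lp_norm p (abs_circ_fun F) = p_norm p F" "fourier (abs_circ_fun F) n = fcoef F n"
proof -
  have F [measurable]: "F \<in> borel_measurable borel" using assms by auto
  show "abs_circ_fun F \<in> Lp p" unfolding Lp_iff by (rule p_int_cong_AE[OF assms(1) rep_borel rep_abs_AE[OF F]])
  show "Lp_norm p (abs_circ_fun F) = p_norm p F" unfolding Lp_norm_eq by (rule p_norm_cong_AE[OF _ _ rep_abs_AE]) simp_all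
  show "fourier (abs_circ_fun F) n = fcoef F n" unfolding fourier_eq by (rule fcoef_cong_AE[OF _ _ rep_abs_AE]) simp_all
qed

lemma Lp_norm_nonneg [simp]: "Lp_norm p f \<ge> 0" by (simp add: Lp_norm_eq)

lemma fourier_tvar_mult: "fourier (tvar * f) n = fourier f (n - 1)"
proof -
  have "fourier (tvar * f) n = integral\<^sup>L \<mu> (\<lambda>t. rep f t * t powi (- (n - 1)))"
    unfolding fourier_eq fcoef_def
  proof (intro integral_cong_AE)
    show "AE t in \<mu>. rep (tvar * f) t * t powi (- n) = rep f t * t powi (- (n - 1))"
      using rep_mult[of tvar f] rep_tvar AE_circle_nonzero
    proof eventually_elim
      case (elim t)
      have "t powi (- (n - 1)) = t powi (- n) * t"
        using elim(3) power_int_add_1[of t "- n"] by simp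
      then show ?case using elim by simp
    qed
  qed auto
  then show ?thesis by (simp add: fourier_eq fcoef_def)
qed

lemma fourier_inverse_tvar_mult: "fourier (inverse tvar * f) n = fourier f (n + 1)"
  using fourier_tvar_mult[of "inverse tvar * f" "n + 1"] by (simp flip: mult.assoc)

lemma fourier_tvar_power_mult: "fourier (tvar ^ k * f) n = fourier f (n - int k)"
  by (induction k arbitrary: n) (simp_all add: mult.assoc fourier_tvar_mult algebra_simps)

lemma fourier_scaleC: "fourier (z *\<^sub>C f) n = z * fourier f n"
proof -
  have "fourier (z *\<^sub>C f) n = fcoef (\<lambda>t. z * rep f t) n"
    unfolding fourier_eq by (rule fcoef_cong_AE[OF _ _ rep_scaleC]) measurable
  then show ?thesis by (simp add: fourier_eq fcoef_def mult.assoc)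
qed

lemma fourier_uminus: "fourier (- f) n = - fourier f n"
  using fourier_scaleC[of "-1" f n] by simp

lemma fourier_1: "fourier 1 n = (if n = 0 then 1 else 0)"
proof -
  have "fourier 1 n = fcoef (\<lambda>t. 1) n"
    unfolding fourier_eq by (rule fcoef_cong_AE[OF _ _ rep_1]) measurable
  then show ?thesis by (simp add: fcoef_def integral_powi)
qed

lemma fourier_0 [simp]: "fourier 0 n = 0"
  using fourier_scaleC[of 0 1 n] by simp

lemma fourier_tvar_power: "fourier (tvar ^ k) n = (if n = int k then 1 else 0)"
  using fourier_tvar_power_mult[of k 1 n] by (auto simp: fourier_1)

text \<open>The range of \<open>proj_Q p\<close>. In contrast to \<open>Hp_bar p\<close> it excludes
  the constants, so that \<open>Lp p\<close> is the direct sum of \<open>Hp p\<close> and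
  \<open>Hm p\<close>.\<close>

definition Hm :: "real \<Rightarrow> circ_fun set" where
  "Hm p = {f \<in> Lp p. \<forall>n\<ge>0. fourier f n = 0}"

section \<open>Lebesgue and Hardy spaces of classes\<close>

context
  fixes p :: real
  assumes p: "1 < p"
begin

lemma p_pos: "p > 0" "p \<ge> 1" using p by auto

lemma Lp_add: "f \<in> Lp p \<Longrightarrow> g \<in> Lp p \<Longrightarrow> f + g \<in> Lp p"
  unfolding Lp_iff by (rule p_int_cong_AE[OF p_int_add rep_borel rep_add]) (auto simp: p_pos)

lemma Lp_scaleC: "f \<in> Lp p \<Longrightarrow> z *\<^sub>C f \<in> Lp p"
  unfolding Lp_iff by (rule p_int_cong_AE[OF p_int_scale rep_borel rep_scaleC])

lemma Lp_0 [simp]: "0 \<in> Lp p"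
  unfolding Lp_iff by (rule p_int_cong_AE[OF p_int_const rep_borel rep_0])

lemma Lp_uminus: "f \<in> Lp p \<Longrightarrow> - f \<in> Lp p"
  using Lp_scaleC[of f "-1"] by simp

lemma Lp_diff: "f \<in> Lp p \<Longrightarrow> g \<in> Lp p \<Longrightarrow> f - g \<in> Lp p"
  using Lp_add[of f "- g"] Lp_uminus[of g] by simp

lemma Lp_norm_triangle: "f \<in> Lp p \<Longrightarrow> g \<in> Lp p \<Longrightarrow> Lp_norm p (f + g) \<le> Lp_norm p f + Lp_norm p g"
  unfolding Lp_iff Lp_norm_eq
  by (subst p_norm_cong_AE[OF _ _ rep_add]) (auto intro!: minkowski_circle p_pos)

lemma Lp_norm_scaleC: "Lp_norm p (z *\<^sub>C f) = norm z * Lp_norm p f"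
  unfolding Lp_norm_eq by (subst p_norm_cong_AE[OF _ _ rep_scaleC]) (auto simp: p_norm_scale p_pos)

lemma Lp_norm_minus_commute: "Lp_norm p (f - g) = Lp_norm p (g - f)"
  using Lp_norm_scaleC[of "-1" "f - g"] by simp

lemma Lp_norm_eq_0: "f \<in> Lp p \<Longrightarrow> Lp_norm p f = 0 \<longleftrightarrow> f = 0"
  unfolding Lp_iff Lp_norm_eq circ_eq_iff
  by (subst p_norm_eq_0_iff) (use rep_0 p_pos in \<open>auto elim: eventually_elim2\<close>)

lemma Lp_norm_0 [simp]: "Lp_norm p 0 = 0" using Lp_norm_eq_0[of 0] by simp

lemma Lp_mult_Linf:
  assumes "a \<in> Linf" "f \<in> Lp p"
  shows "a * f \<in> Lp p"
proof -
  obtain C where C: "AE t in \<mu>. norm (rep a t) \<le> C" using assms(1) by (auto simp: Linf_iff)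
  show ?thesis
    unfolding Lp_iff
    by (rule p_int_cong_AE[OF p_int_mult_bounded(1)[OF _ rep_borel C p_pos(1)] rep_borel rep_mult])
      (use assms(2) in \<open>simp add: Lp_iff\<close>)
qed

lemma Linf_in_Lp: "a \<in> Linf \<Longrightarrow> a \<in> Lp p"
proof -
  assume "a \<in> Linf"
  then obtain C where "AE t in \<mu>. norm (rep a t) \<le> C" by (auto simp: Linf_iff)
  then show ?thesis unfolding Lp_iff by (intro p_int_bounded(1)[where C = C]) (auto simp: p_pos)
qed

lemma Lp_integrable: "f \<in> Lp p \<Longrightarrow> integrable \<mu> (rep f)"
  unfolding Lp_iff using L1_le_p_norm(1)[OF p] by blast

lemma fourier_add: "f \<in> Lp p \<Longrightarrow> g \<in> Lp p \<Longrightarrow> fourier (f + g) n = fourier f n + fourier g n"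
proof -
  assume *: "f \<in> Lp p" "g \<in> Lp p"
  have "fourier (f + g) n = fcoef (\<lambda>t. rep f t + rep g t) n"
    unfolding fourier_eq by (rule fcoef_cong_AE[OF _ _ rep_add]) measurable
  then show ?thesis
    using integrable_mult_powi[OF Lp_integrable[OF *(1)]] integrable_mult_powi[OF Lp_integrable[OF *(2)]]
    by (simp add: fourier_eq fcoef_def distrib_right)
qed

lemma fourier_diff: "f \<in> Lp p \<Longrightarrow> g \<in> Lp p \<Longrightarrow> fourier (f - g) n = fourier f n - fourier g n"
  using fourier_add[of f "- g" n] Lp_uminus[of g] by (simp add: fourier_uminus)

lemma norm_fourier_le: "f \<in> Lp p \<Longrightarrow> norm (fourier f n) \<le> Lp_norm p f"
  unfolding Lp_iff fourier_eq Lp_norm_eq by (rule norm_fcoef_le[OF p])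

text \<open>With \<open>w\<close> the conjugate phase of \<open>F\<close>, the integral of
  \<open>norm (F t)\<close> is that of \<open>F t * w t\<close>. Approximating the bounded
  \<open>w\<close> in the conjugate exponent by trigonometric polynomials, which pair to 0 with
  \<open>F\<close>, shows that it is arbitrarily small.\<close>

lemma fourier_unique_0:
  assumes f: "f \<in> Lp p" and z: "\<And>n. fourier f n = 0"
  shows "f = 0"
proof -
  define F where "F = rep f"
  have F [measurable]: "F \<in> borel_measurable borel" and Fp: "p_int p F" using f by (auto simp: F_def Lp_iff)
  define q where "q = conj_exponent p"
  have q: "q > 1" "1/p + 1/q = 1" using conj_exponent[OF p] by (auto simp: q_def)
  define w where "w t = (if F t = 0 then 0 else cnj (F t) / of_real (norm (F t)))" for t
  have wb [measurable]: "w \<in> borel_measurable borel" unfolding w_def by measurable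
  have Fw: "F t * w t = of_real (norm (F t))" for t
    by (simp add: w_def complex_norm_square[symmetric] power2_eq_square del: of_real_power)
  have wq: "p_int q w" by (rule p_int_bounded(1)[where C = 1]) (use q in \<open>auto simp: w_def norm_divide\<close>)
  have le: "integral\<^sup>L \<mu> (\<lambda>t. norm (F t)) \<le> p_norm p F * e" if e: "e > 0" for e
  proof -
    obtain I c where I: "finite I" "p_norm q (\<lambda>t. w t - tpoly I c t) < e"
      using trig_dense[of q w] q wq e by (auto simp: p_approx_def)
    have tq: "p_int q (tpoly I c)" "p_int q (\<lambda>t. w t - tpoly I c t)" using q wq by (auto intro!: p_int_tpoly p_int_diff)
    have "integral\<^sup>L \<mu> (\<lambda>t. F t * tpoly I c t) = (\<Sum>k\<in>I. c k * integral\<^sup>L \<mu> (\<lambda>t. F t * t powi (- (- k))))"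
      unfolding tpoly_def sum_distrib_left
      using integrable_mult_powi[OF Lp_integrable[OF f]]
      by (subst Bochner_Integration.integral_sum) (auto simp: F_def mult.left_commute[of _ "c _"])
    also have "\<dots> = (\<Sum>k\<in>I. c k * fourier f (- k))"
      by (simp only: fourier_eq fcoef_def F_def)
    finally have 0: "integral\<^sup>L \<mu> (\<lambda>t. F t * tpoly I c t) = 0" by (simp add: z)
    note h = holder_circle[OF p q Fp tq(2)]
    have "complex_of_real (integral\<^sup>L \<mu> (\<lambda>t. norm (F t))) = integral\<^sup>L \<mu> (\<lambda>t. F t * tpoly I c t + F t * (w t - tpoly I c t))"
      unfolding distrib_left[symmetric] by (simp add: Fw)
    also have "\<dots> = integral\<^sup>L \<mu> (\<lambda>t. F t * (w t - tpoly I c t))"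
      using holder_circle(1)[OF p q Fp tq(1)] h(1) 0 by (subst Bochner_Integration.integral_add) auto
    finally have "norm (complex_of_real (integral\<^sup>L \<mu> (\<lambda>t. norm (F t)))) \<le> integral\<^sup>L \<mu> (\<lambda>t. norm (F t * (w t - tpoly I c t)))"
      by (simp only: integral_norm_bound)
    also have "\<dots> \<le> p_norm p F * p_norm q (\<lambda>t. w t - tpoly I c t)" by (rule h(2))
    also have "\<dots> \<le> p_norm p F * e" using I by (intro mult_left_mono) auto
    finally show ?thesis by (simp add: integral_nonneg_AE)
  qed
  have "integral\<^sup>L \<mu> (\<lambda>t. norm (F t)) \<le> 0"
  proof (rule field_le_epsilon)
    fix e :: real assume e: "e > 0"
    have "integral\<^sup>L \<mu> (\<lambda>t. norm (F t)) \<le> p_norm p F * (e / (p_norm p F + 1))"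
      using e by (intro le) (simp add: add_nonneg_pos)
    also have "\<dots> \<le> (p_norm p F + 1) * (e / (p_norm p F + 1))"
      using e by (intro mult_right_mono) (auto simp: add_nonneg_pos)
    also have "\<dots> = e" using p_norm_nonneg[of p F] by (simp add: add_nonneg_eq_0_iff)
    finally show "integral\<^sup>L \<mu> (\<lambda>t. norm (F t)) \<le> 0 + e" by simp
  qed
  then have "integral\<^sup>L \<mu> (\<lambda>t. norm (F t)) = 0" by (simp add: antisym integral_nonneg_AE)
  then have "AE t in \<mu>. norm (F t) = 0"
    using Lp_integrable[OF f] by (subst (asm) integral_nonneg_eq_0_iff_AE) (auto simp: F_def)
  then show ?thesis unfolding circ_eq_iff using rep_0 by eventually_elim (simp add: F_def)
qed

lemma fourier_unique:
  assumes "f \<in> Lp p" "g \<in> Lp p" "\<And>n. fourier f n = fourier g n"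
  shows "f = g"
  using fourier_unique_0[of "f - g"] assms Lp_diff by (simp add: fourier_diff)

text \<open>Existence from M. Riesz's theorem and uniqueness of Fourier coefficients justify the
  definite description in \<open>proj_P\<close>; the norm bound is kept for the density of
  polynomials.\<close>

lemma riesz_circ:
  obtains C where "C \<ge> 0" "\<And>f. f \<in> Lp p \<Longrightarrow> proj_P p f \<in> Lp p \<and>
    (\<forall>n. fourier (proj_P p f) n = (if n \<ge> 0 then fourier f n else 0)) \<and> Lp_norm p (proj_P p f) \<le> C * Lp_norm p f"
proof -
  obtain C where C: "C \<ge> 0" "\<And>f. p_int p f \<Longrightarrow>
    \<exists>g. p_int p g \<and> (\<forall>n. fcoef g n = (if n \<ge> 0 then fcoef f n else 0)) \<and> p_norm p g \<le> C * p_norm p f"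
    using riesz_projection[OF p] by blast
  show ?thesis
  proof
    fix f assume f: "f \<in> Lp p"
    obtain g where g: "p_int p g" "\<And>n. fcoef g n = (if n \<ge> 0 then fcoef (rep f) n else 0)"
      "p_norm p g \<le> C * p_norm p (rep f)"
      using C(2)[of "rep f"] f unfolding Lp_iff by auto
    note ag = abs_in_Lp[OF g(1) p_pos(1)]
    have G: "abs_circ_fun g \<in> Lp p \<and> (\<forall>n. fourier (abs_circ_fun g) n = (if n \<ge> 0 then fourier f n else 0))"
      using ag by (simp add: g(2) fourier_eq)
    then have "proj_P p f = abs_circ_fun g"
      unfolding proj_P_def by (intro the_equality) (auto intro!: fourier_unique)
    then show "proj_P p f \<in> Lp p \<and> (\<forall>n. fourier (proj_P p f) n = (if n \<ge> 0 then fourier f n else 0)) \<and> Lp_norm p (proj_P p f) \<le> C * Lp_norm p f"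
      using G ag g(3) by (simp add: Lp_norm_eq)
  qed (rule C(1))
qed

lemma proj_P:
  assumes "f \<in> Lp p"
  shows "proj_P p f \<in> Lp p" "fourier (proj_P p f) n = (if n \<ge> 0 then fourier f n else 0)"
  using riesz_circ assms by metis+

lemma proj_P_eqI:
  assumes "f \<in> Lp p" "g \<in> Lp p" "\<And>n. fourier g n = (if n \<ge> 0 then fourier f n else 0)"
  shows "proj_P p f = g"
  using proj_P[OF assms(1)] assms by (intro fourier_unique) auto

lemma proj_P_Hp: "f \<in> Lp p \<Longrightarrow> proj_P p f \<in> Hp p"
  by (simp add: Hp_def proj_P)

lemma proj_Q_Hm: "f \<in> Lp p \<Longrightarrow> proj_Q p f \<in> Hm p"
  by (simp add: Hm_def proj_Q_def proj_P Lp_diff fourier_diff)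

lemma proj_P_add: "f \<in> Lp p \<Longrightarrow> g \<in> Lp p \<Longrightarrow> proj_P p (f + g) = proj_P p f + proj_P p g"
  by (rule proj_P_eqI) (auto simp: proj_P Lp_add fourier_add)

lemma proj_P_scaleC: "f \<in> Lp p \<Longrightarrow> proj_P p (z *\<^sub>C f) = z *\<^sub>C proj_P p f"
  by (rule proj_P_eqI) (auto simp: proj_P Lp_scaleC fourier_scaleC)

lemma proj_P_diff: "f \<in> Lp p \<Longrightarrow> g \<in> Lp p \<Longrightarrow> proj_P p (f - g) = proj_P p f - proj_P p g"
  by (rule proj_P_eqI) (auto simp: proj_P Lp_diff fourier_diff)

lemma proj_P_id: "f \<in> Hp p \<Longrightarrow> proj_P p f = f"
  by (rule proj_P_eqI) (auto simp: Hp_def)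

lemma proj_P_Hm: "f \<in> Hm p \<Longrightarrow> proj_P p f = 0"
  by (rule proj_P_eqI) (auto simp: Hm_def)

lemma proj_Q_id: "f \<in> Hm p \<Longrightarrow> proj_Q p f = f"
  by (simp add: proj_Q_def proj_P_Hm)

lemma proj_P_eq_0_iff: "f \<in> Lp p \<Longrightarrow> proj_P p f = 0 \<longleftrightarrow> f \<in> Hm p"
  using proj_Q_Hm[of f] proj_P_Hm[of f] by (auto simp: proj_Q_def)

lemma Hp_Lp: "f \<in> Hp p \<Longrightarrow> f \<in> Lp p" by (simp add: Hp_def)
lemma Hm_Lp: "f \<in> Hm p \<Longrightarrow> f \<in> Lp p" by (simp add: Hm_def)

lemma Hp_subspace: "circ.subspace (Hp p)"
  by (auto simp: circ.subspace_def Hp_def Lp_add Lp_scaleC fourier_add fourier_scaleC)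

lemma Hm_subspace: "circ.subspace (Hm p)"
  by (auto simp: circ.subspace_def Hm_def Lp_add Lp_scaleC fourier_add fourier_scaleC)

lemma Hp_Hm_0: "f \<in> Hp p \<Longrightarrow> f \<in> Hm p \<Longrightarrow> f = 0"
  using proj_P_id proj_P_Hm by metis

lemma tvar_power_Hp [simp]: "tvar ^ k \<in> Hp p"
  by (auto simp: Hp_def fourier_tvar_power intro!: Linf_in_Lp Linf_power)

lemma tvar_power_mult_Hp: "f \<in> Hp p \<Longrightarrow> tvar ^ k * f \<in> Hp p"
  by (auto simp: Hp_def fourier_tvar_power_mult intro!: Lp_mult_Linf Linf_power)

text \<open>The projection fixes \<open>f\<close> and turns a nearby trigonometric polynomial into
  an ordinary one, at the cost of its norm bound.\<close>

lemma polynomials_dense: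
  assumes f: "f \<in> Hp p" and e: "e > 0"
  shows "\<exists>g\<in>circ.span (range (\<lambda>k::nat. tvar ^ k)). Lp_norm p (f - g) < e"
proof -
  obtain C where C: "C \<ge> 0" "\<And>f. f \<in> Lp p \<Longrightarrow> Lp_norm p (proj_P p f) \<le> C * Lp_norm p f"
    using riesz_circ by metis
  have "e / (C + 1) > 0" using e C by simp
  then obtain I c where I: "finite I" "p_norm p (\<lambda>t. rep f t - tpoly I c t) < e / (C + 1)"
    using trig_dense[of p "rep f"] f p by (auto simp: p_approx_def Hp_def Lp_iff)
  define r where "r = abs_circ_fun (tpoly I c)"
  have tp: "p_int p (tpoly J d)" for J d by (rule p_int_tpoly[OF p_pos(1)])
  have r: "r \<in> Lp p" "\<And>n. fourier r n = (if n \<in> I then c n else 0)"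
    using abs_in_Lp[OF tp p_pos(1)] by (auto simp: r_def fcoef_tpoly[OF I(1)])
  define g where "g = (\<Sum>k\<in>apart I. c k *\<^sub>C tvar ^ nat k)"
  have gs: "g \<in> circ.span (range (\<lambda>k::nat. tvar ^ k))"
    unfolding g_def by (intro circ.span_sum circ.span_scale circ.span_base) auto
  have gL: "(\<Sum>k\<in>J. c k *\<^sub>C tvar ^ nat k) \<in> Lp p \<and> fourier (\<Sum>k\<in>J. c k *\<^sub>C tvar ^ nat k) n = (\<Sum>k\<in>J. c k * (if n = int (nat k) then 1 else 0))" if "finite J" for J n
    using that
    by (induction J) (auto simp: fourier_add Lp_add Lp_scaleC Hp_Lp fourier_scaleC fourier_tvar_power)
  have "fourier g n = (if n \<ge> 0 then fourier r n else 0)" for n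
  proof -
    have "fourier g n = (\<Sum>k\<in>apart I. c k * (if n = int (nat k) then 1 else 0))"
      unfolding g_def using gL I(1) by simp
    also have "\<dots> = (\<Sum>k\<in>apart I. if k = n then c k else 0)"
      by (intro sum.cong) (auto simp: apart_def)
    also have "\<dots> = (if n \<in> apart I then c n else 0)" using I(1) by (subst sum.delta) auto
    finally show ?thesis by (auto simp: r(2) apart_def)
  qed
  then have Pr: "proj_P p r = g" using r(1) gL[of "apart I"] I(1) by (intro proj_P_eqI) (auto simp: g_def)
  have "Lp_norm p (f - r) = p_norm p (\<lambda>t. rep f t - tpoly I c t)"
    unfolding Lp_norm_eq r_def
  proof (rule p_norm_cong_AE)
    show "AE t in \<mu>. rep (f - abs_circ_fun (tpoly I c)) t = rep f t - tpoly I c t"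
      using rep_diff[of f "abs_circ_fun (tpoly I c)"] rep_abs_AE[OF tpoly_borel[of I c]] by eventually_elim simp
  qed measurable
  then have fr: "Lp_norm p (f - r) < e / (C + 1)" using I(2) by simp
  have "f - g = proj_P p (f - r)" using f r(1) by (simp add: proj_P_diff Hp_Lp proj_P_id Pr)
  then have "Lp_norm p (f - g) \<le> C * Lp_norm p (f - r)" using C(2) f r(1) by (simp add: Lp_diff Hp_Lp)
  also have "\<dots> \<le> (C + 1) * Lp_norm p (f - r)" by (intro mult_right_mono) auto
  also have "\<dots> < e" using fr C(1) by (simp add: field_simps)
  finally show ?thesis using gs by blast
qed

end

section \<open>The shift\<close>

lemma chi_eq: "chi \<beta> = (1 / lam \<beta>) *\<^sub>C (cnj \<beta> *\<^sub>C tvar - 1)"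
  by transfer (auto simp: eq_ae_def)

lemma AE_alpha:
  assumes "1 < norm \<beta>" "AE t in \<mu>. P t"
  shows "AE t in \<mu>. P (alpha \<beta> t)"
proof -
  obtain N where N: "N \<in> null_sets \<mu>" "{t. \<not> P t} \<subseteq> N"
    using assms(2) by (auto simp: eventually_ae_filter)
  have "{t. \<not> P (alpha \<beta> t)} \<subseteq> alpha \<beta> -` N" using N(2) by auto
  then show ?thesis using alpha_vimage_null[OF assms(1) N(1)] by (auto simp: eventually_ae_filter)
qed

lemma bounded_geometric_eq_0:
  fixes z :: complex
  assumes z: "norm z > 1" and rec: "\<And>j::nat. v (Suc j) = z * v j" and bd: "\<And>j. norm (v j) \<le> C"
  shows "v j = 0"
proof (rule ccontr)
  assume nz: "v j \<noteq> 0"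
  have "v (j + i) = z ^ i * v j" for i
    by (induction i) (simp_all add: rec)
  then have le: "norm z ^ i * norm (v j) \<le> C" for i
    using bd[of "j + i"] by (simp add: norm_mult norm_power)
  obtain i where "C / norm (v j) < norm z ^ i" using real_arch_pow[OF z] by blast
  then show False using le[of i] nz by (simp add: divide_less_eq)
qed

context
  fixes \<beta> :: complex
  assumes \<beta>: "1 < norm \<beta>"
begin

lemma lam_nonzero: "lam \<beta> \<noteq> 0"
proof -
  have "1 < (norm \<beta>)\<^sup>2" using \<beta> by (simp add: one_less_power)
  then show ?thesis by (simp add: lam_def)
qed

lemma lam_sq: "lam \<beta> * lam \<beta> = 1 - \<beta> * cnj \<beta>"
proof -
  have "1 < (norm \<beta>)\<^sup>2" using \<beta> by (simp add: one_less_power)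
  then have "sqrt ((norm \<beta>)\<^sup>2 - 1) * sqrt ((norm \<beta>)\<^sup>2 - 1) = (norm \<beta>)\<^sup>2 - 1" by simp
  then have "complex_of_real (sqrt ((norm \<beta>)\<^sup>2 - 1)) * complex_of_real (sqrt ((norm \<beta>)\<^sup>2 - 1)) = of_real ((norm \<beta>)\<^sup>2 - 1)"
    by (simp only: of_real_mult[symmetric])
  moreover have "lam \<beta> * lam \<beta> = - (complex_of_real (sqrt ((norm \<beta>)\<^sup>2 - 1)) * complex_of_real (sqrt ((norm \<beta>)\<^sup>2 - 1)))"
    by (simp add: lam_def algebra_simps)
  ultimately have "lam \<beta> * lam \<beta> = - of_real ((norm \<beta>)\<^sup>2 - 1)" by simp
  also have "of_real ((norm \<beta>)\<^sup>2 - 1) = \<beta> * cnj \<beta> - 1"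
    unfolding of_real_diff complex_norm_square by simp
  finally show ?thesis by simp
qed

text \<open>The numerator of \<open>alpha \<beta>\<close>. Its zero lies outside the closed disc and
  that of \<open>chi \<beta>\<close> inside, so division by \<open>lin\<close> keeps
  \<open>Hp p\<close> while division by \<open>chi \<beta>\<close> keeps
  \<open>Hm p\<close>.\<close>

definition lin :: circ_fun where "lin = tvar - \<beta> *\<^sub>C 1"

lemma norm_denom_ge: "norm t = 1 \<Longrightarrow> norm (cnj \<beta> * t - 1) \<ge> norm \<beta> - 1"
  using norm_triangle_ineq2[of "cnj \<beta> * t" 1] by (simp add: norm_mult)

lemma norm_denom_le: "norm t = 1 \<Longrightarrow> norm (cnj \<beta> * t - 1) \<le> norm \<beta> + 1"
  using norm_triangle_ineq4[of "cnj \<beta> * t" 1] by (simp add: norm_mult)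

lemma norm_lin_ge: "norm t = 1 \<Longrightarrow> norm (t - \<beta>) \<ge> norm \<beta> - 1"
  using norm_triangle_ineq3[of t \<beta>] by simp

lemma rep_chi: "AE t in \<mu>. rep (chi \<beta>) t = (cnj \<beta> * t - 1) / lam \<beta>"
  using rep_abs_AE[of "\<lambda>t. (cnj \<beta> * t - 1) / lam \<beta>"] by (simp add: chi_def)

lemma rep_lin: "AE t in \<mu>. rep lin t = t - \<beta>"
  unfolding lin_def
  using rep_diff[of tvar "\<beta> *\<^sub>C 1"] rep_scaleC[of \<beta> 1] rep_1 rep_tvar
  by eventually_elim simp

lemma chi_Linf: "chi \<beta> \<in> Linf"
proof -
  have "AE t in \<mu>. norm (rep (chi \<beta>) t) \<le> (norm \<beta> + 1) / norm (lam \<beta>)"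
    using rep_chi AE_circle_norm
    by eventually_elim (use norm_denom_le in \<open>simp add: norm_divide divide_right_mono\<close>)
  then show ?thesis unfolding Linf_iff by blast
qed

lemma inverse_chi_Linf: "inverse (chi \<beta>) \<in> Linf"
proof -
  have "AE t in \<mu>. norm (rep (inverse (chi \<beta>)) t) \<le> norm (lam \<beta>) / (norm \<beta> - 1)"
    using rep_chi rep_inverse[of "chi \<beta>"] AE_circle_norm
  proof eventually_elim
    case (elim t)
    then show ?case using norm_denom_ge[OF elim(3)] \<beta>
      by (simp add: norm_inverse norm_divide) (intro frac_le, auto)
  qed
  then show ?thesis unfolding Linf_iff by blast
qed

lemma chi_unit: "chi \<beta> dvd 1"
proof -
  have "chi \<beta> * inverse (chi \<beta>) = 1"
    unfolding circ_eq_iff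
    using rep_chi rep_inverse[of "chi \<beta>"] AE_circle_norm rep_1 rep_mult[of "chi \<beta>" "inverse (chi \<beta>)"]
  proof eventually_elim
    case (elim t)
    then show ?case using lam_nonzero alpha_denom_nonzero[OF \<beta> elim(3)] by simp
  qed
  then show ?thesis by (metis dvd_triv_left)
qed

lemma lin_unit: "lin dvd 1"
proof -
  have "lin * inverse lin = 1"
    unfolding circ_eq_iff
    using rep_lin rep_inverse[of lin] AE_circle_norm rep_1 rep_mult[of lin "inverse lin"]
  proof eventually_elim
    case (elim t)
    have "t - \<beta> \<noteq> 0" using norm_lin_ge[OF elim(3)] \<beta> by auto
    then show ?case using elim by simp
  qed
  then show ?thesis by (metis dvd_triv_left)
qed

lemma lin_Linf: "lin \<in> Linf"
proof -
  have "AE t in \<mu>. norm (rep lin t) \<le> 1 + norm \<beta>"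
    using rep_lin AE_circle_norm by eventually_elim (metis norm_triangle_ineq4)
  then show ?thesis unfolding Linf_iff by blast
qed

lemma inverse_lin_Linf: "inverse lin \<in> Linf"
proof -
  have "AE t in \<mu>. norm (rep (inverse lin) t) \<le> inverse (norm \<beta> - 1)"
    using rep_lin rep_inverse[of lin] AE_circle_norm
  proof eventually_elim
    case (elim t)
    show ?case using norm_lin_ge[OF elim(3)] \<beta>
      unfolding elim(1,2) norm_inverse by (intro le_imp_inverse_le) auto
  qed
  then show ?thesis unfolding Linf_iff by blast
qed

lemma fourier_lin_mult: "1 < p \<Longrightarrow> u \<in> Lp p \<Longrightarrow> fourier (lin * u) k = fourier u (k - 1) - \<beta> * fourier u k"
  using fourier_diff[of p "tvar * u" "\<beta> *\<^sub>C u" k] Lp_mult_Linf[of p tvar u] Lp_scaleC[of p u \<beta>]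
  by (simp add: lin_def left_diff_distrib fourier_tvar_mult fourier_scaleC)

lemma fourier_chi_mult: "1 < p \<Longrightarrow> u \<in> Lp p \<Longrightarrow>
    fourier (chi \<beta> * u) k = (cnj \<beta> * fourier u (k - 1) - fourier u k) / lam \<beta>"
  using fourier_diff[of p "cnj \<beta> *\<^sub>C (tvar * u)" u k] Lp_mult_Linf[of p tvar u] Lp_scaleC[of p "tvar * u" "cnj \<beta>"]
  by (simp add: chi_eq left_diff_distrib fourier_tvar_mult fourier_scaleC)

lemma chi_mult_Hp: "1 < p \<Longrightarrow> f \<in> Hp p \<Longrightarrow> chi \<beta> * f \<in> Hp p"
  by (auto simp: Hp_def fourier_chi_mult intro!: Lp_mult_Linf chi_Linf)

text \<open>The Fourier coefficients of \<open>u = f / (t - \<beta>)\<close> satisfy a geometric recursion on the negative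
  integers and are bounded, hence vanish there; similarly below for division by \<open>\<chi>\<close>.\<close>

lemma inverse_lin_mult_Hp:
  assumes p: "1 < p" and f: "f \<in> Hp p"
  shows "inverse lin * f \<in> Hp p"
proof -
  define u where "u = inverse lin * f"
  have u: "u \<in> Lp p" unfolding u_def using p f by (intro Lp_mult_Linf inverse_lin_Linf) (auto simp: Hp_def)
  have fu: "f = lin * u" by (simp add: u_def circ_unit_inverse[OF lin_unit] flip: mult.assoc)
  have rec: "fourier u (k - 1) = \<beta> * fourier u k" if "k < 0" for k
    using f that fourier_lin_mult[OF p u, of k] by (simp add: Hp_def flip: fu)
  have z: "fourier u (- 1 - int j) = 0" for j
  proof (rule bounded_geometric_eq_0[OF \<beta>, where v = "\<lambda>j. fourier u (- 1 - int j)" and C = "Lp_norm p u"])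
    show "fourier u (- 1 - int (Suc j)) = \<beta> * fourier u (- 1 - int j)" for j
      using rec[of "- 1 - int j"] by (simp add: algebra_simps)
  qed (rule norm_fourier_le[OF p u])
  have "fourier u n = 0" if "n < 0" for n
    using z[of "nat (- 1 - n)"] that by simp
  with u show ?thesis by (simp add: Hp_def u_def)
qed

lemma fourier_inverse_chi_mult:
  assumes p: "1 < p" and f: "f \<in> Lp p" and m: "\<And>k. k \<ge> m \<Longrightarrow> fourier f k = 0" and n: "n \<ge> m - 1"
  shows "fourier (inverse (chi \<beta>) * f) n = 0"
proof -
  define u where "u = inverse (chi \<beta>) * f"
  have u: "u \<in> Lp p" unfolding u_def using p f by (intro Lp_mult_Linf inverse_chi_Linf)
  have fu: "f = chi \<beta> * u" by (simp add: u_def circ_unit_inverse[OF chi_unit] flip: mult.assoc)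
  have rec: "fourier u k = cnj \<beta> * fourier u (k - 1)" if "k \<ge> m" for k
    using m[OF that] fourier_chi_mult[OF p u, of k] lam_nonzero by (simp flip: fu)
  have "fourier u (m - 1 + int j) = 0" for j
  proof (rule bounded_geometric_eq_0[where z = "cnj \<beta>" and v = "\<lambda>j. fourier u (m - 1 + int j)" and C = "Lp_norm p u"])
    show "fourier u (m - 1 + int (Suc j)) = cnj \<beta> * fourier u (m - 1 + int j)" for j
      using rec[of "m + int j"] by (simp add: algebra_simps)
  qed (use \<beta> norm_fourier_le[OF p u] in auto)
  from this[of "nat (n - m + 1)"] show ?thesis using n by (simp add: u_def)
qed

text \<open>Division by \<open>chi \<beta>\<close> lowers the highest possible frequency by one,
  which leaves room for one factor \<open>tvar\<close> or \<open>lin\<close>.\<close>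

lemma inverse_chi_mult_Hm:
  assumes p: "1 < p" and f: "f \<in> Hm p"
  shows "inverse (chi \<beta>) * f \<in> Hm p" "tvar * (inverse (chi \<beta>) * f) \<in> Hm p" "lin * (inverse (chi \<beta>) * f) \<in> Hm p"
proof -
  have fL: "f \<in> Lp p" using f by (simp add: Hm_def)
  have L: "inverse (chi \<beta>) * f \<in> Lp p" using fL p by (intro Lp_mult_Linf inverse_chi_Linf)
  have z: "fourier (inverse (chi \<beta>) * f) n = 0" if "n \<ge> -1" for n
    using f that by (intro fourier_inverse_chi_mult[OF p fL, of 0]) (auto simp: Hm_def)
  show "inverse (chi \<beta>) * f \<in> Hm p" "tvar * (inverse (chi \<beta>) * f) \<in> Hm p" "lin * (inverse (chi \<beta>) * f) \<in> Hm p"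
    using L z p by (auto simp: Hm_def fourier_tvar_mult fourier_lin_mult intro!: Lp_mult_Linf lin_Linf)
qed

text \<open>The point is the zero of \<open>chi \<beta>\<close> in the disc. Writing
  \<open>f\<close> as \<open>chi \<beta> * u\<close> makes the power series of \<open>f\<close> at
  this point telescope, and only the coefficient of \<open>u\<close> at -1 survives; in effect it is
  the residue of \<open>f / chi\<close>.\<close>

lemma disc_ext_inverse_cnj:
  assumes p: "1 < p" and f: "f \<in> Hp p"
  shows "disc_ext f (1 / cnj \<beta>) = cnj \<beta> / lam \<beta> * fourier (inverse (chi \<beta>) * f) (-1)"
proof -
  define u where "u = inverse (chi \<beta>) * f"
  have fL: "f \<in> Lp p" using f by (simp add: Hp_def)
  have u: "u \<in> Lp p" unfolding u_def using p fL by (intro Lp_mult_Linf inverse_chi_Linf)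
  have fu: "f = chi \<beta> * u" by (simp add: u_def circ_unit_inverse[OF chi_unit] flip: mult.assoc)
  define z where "z = 1 / cnj \<beta>"
  have b0: "cnj \<beta> \<noteq> 0" using \<beta> by auto
  define v where "v k = fourier u (int k - 1) * z ^ k" for k :: nat
  have vlim: "v \<longlonglongrightarrow> 0"
  proof (rule LIMSEQ_norm_bound)
    show "norm (v m - 0) \<le> Lp_norm p u * norm z ^ m" for m
      using norm_fourier_le[OF p u, of "int m - 1"] by (simp add: v_def norm_mult norm_power mult_right_mono)
    have "norm z < 1" using \<beta> by (simp add: z_def norm_divide divide_less_eq)
    then show "(\<lambda>m. Lp_norm p u * norm z ^ m) \<longlonglongrightarrow> 0"
      using tendsto_mult_left[OF LIMSEQ_power_zero[of "norm z"], of "Lp_norm p u"] by simp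
  qed
  have ff: "fourier f (int k) = (cnj \<beta> * fourier u (int k - 1) - fourier u (int k)) / lam \<beta>" for k
    unfolding fu by (rule fourier_chi_mult[OF p u])
  have bz: "cnj \<beta> * (z * y) = y" for y using b0 by (simp add: z_def)
  have "fourier f (int k) * z ^ k = cnj \<beta> / lam \<beta> * (v k - v (Suc k))" for k
  proof -
    have "cnj \<beta> * (v k - v (Suc k)) = cnj \<beta> * fourier u (int k - 1) * z ^ k - fourier u (int k) * (cnj \<beta> * (z * z ^ k))"
      by (simp add: v_def right_diff_distrib mult_ac)
    also have "\<dots> = (cnj \<beta> * fourier u (int k - 1) - fourier u (int k)) * z ^ k"
      unfolding bz by (simp add: left_diff_distrib)
    finally show ?thesis by (simp add: ff)
  qed
  moreover have "(\<lambda>k. cnj \<beta> / lam \<beta> * (v k - v (Suc k))) sums (cnj \<beta> / lam \<beta> * (v 0 - 0))"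
    by (intro sums_mult telescope_sums' vlim)
  ultimately have "(\<lambda>k. fourier f (int k) * z ^ k) sums (cnj \<beta> / lam \<beta> * v 0)" by simp
  then show ?thesis by (simp add: disc_ext_def z_def v_def u_def sums_unique[symmetric])
qed

text \<open>The modulus of the derivative of \<open>alpha \<beta>\<close> on the circle, a Poisson
  kernel.\<close>

definition alpha_density :: "complex \<Rightarrow> real" where
  "alpha_density t = ((norm \<beta>)\<^sup>2 - 1) / (norm (cnj \<beta> * t - 1))\<^sup>2"

lemma alpha_density_borel [measurable]: "alpha_density \<in> borel_measurable borel"
  unfolding alpha_density_def by measurable

lemma alpha_density_nonneg: "alpha_density t \<ge> 0"
  using \<beta> one_less_power[of "norm \<beta>" 2] by (simp add: alpha_density_def)

lemma alpha_density_ge: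
  assumes "norm t = 1"
  shows "alpha_density t \<ge> ((norm \<beta>)\<^sup>2 - 1) / (norm \<beta> + 1)\<^sup>2"
  unfolding alpha_density_def
  using norm_denom_le[OF assms] norm_denom_ge[OF assms] \<beta> one_less_power[of "norm \<beta>" 2]
  by (intro divide_left_mono power_mono mult_pos_pos zero_less_power) auto

text \<open>On the circle conjugation is inversion, so the density becomes a rational function of
  \<open>t\<close> and its integrals become Fourier coefficients.\<close>

lemma alpha_density_eq:
  assumes t: "norm t = 1"
  shows "complex_of_real (alpha_density t) = lam \<beta> * lam \<beta> * t / ((t - \<beta>) * (cnj \<beta> * t - 1))"
proof -
  let ?d = "cnj \<beta> * t - 1"
  have tt: "t * cnj t = 1" using t by (simp add: complex_norm_square[symmetric])
  have d: "?d \<noteq> 0" by (rule alpha_denom_nonzero[OF \<beta> t])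
  have t0: "t \<noteq> 0" using t by auto
  have "t - \<beta> = - (t * cnj ?d)" using tt by (simp add: algebra_simps)
  then have "(t - \<beta>) * ?d = - t * (?d * cnj ?d)" by simp
  also have "?d * cnj ?d = of_real ((norm ?d)\<^sup>2)" by (rule complex_norm_square[symmetric])
  finally have "lam \<beta> * lam \<beta> * t / ((t - \<beta>) * ?d) = (\<beta> * cnj \<beta> - 1) / of_real ((norm ?d)\<^sup>2)"
    using t0 by (simp add: lam_sq minus_divide_left del: of_real_power)
  also have "\<beta> * cnj \<beta> - 1 = of_real ((norm \<beta>)\<^sup>2 - 1)"
    unfolding of_real_diff complex_norm_square by simp
  finally show ?thesis unfolding alpha_density_def of_real_divide by simp
qed

text \<open>For \<open>k = 0\<close> partial fractions reduce the integral to one coefficient of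
  \<open>1 / chi\<close>. For negative \<open>k\<close> the integrand is \<open>t\<close> times a
  function in \<open>Hp 2\<close>, with mean 0. Positive \<open>k\<close> follows by
  conjugation.\<close>

lemma alpha_moments:
  "integral\<^sup>L \<mu> (\<lambda>t. alpha_density t *\<^sub>R alpha \<beta> t powi k) = (if k = 0 then 1 else 0)"
proof -
  have p2: "(1::real) < 2" by simp
  have rl: "AE t in \<mu>. rep (inverse lin) t = inverse (t - \<beta>)"
    using rep_lin rep_inverse[of lin] by eventually_elim simp
  have rc: "AE t in \<mu>. rep (inverse (chi \<beta>)) t = lam \<beta> / (cnj \<beta> * t - 1)"
    using rep_chi rep_inverse[of "chi \<beta>"] by eventually_elim simp
  have I1: "fourier (inverse (chi \<beta>)) (-1) = lam \<beta> / cnj \<beta>"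
  proof -
    have L: "inverse (chi \<beta>) \<in> Lp 2" by (intro Linf_in_Lp inverse_chi_Linf) simp
    have "fourier (inverse (chi \<beta>)) 0 = 0"
      using fourier_inverse_chi_mult[of 2 1 1 0] by (simp add: fourier_1 Linf_in_Lp)
    moreover have "fourier (chi \<beta> * inverse (chi \<beta>)) 0 = 1"
      by (simp add: circ_unit_inverse[OF chi_unit] fourier_1)
    ultimately have "cnj \<beta> * fourier (inverse (chi \<beta>)) (-1) = lam \<beta>"
      using fourier_chi_mult[OF p2 L, of 0] lam_nonzero by simp
    moreover have "cnj \<beta> \<noteq> 0" using \<beta> by auto
    ultimately show ?thesis by (simp add: eq_divide_eq mult.commute)
  qed
  define D where "D = inverse lin * inverse (chi \<beta>)"
  have rD: "AE t in \<mu>. rep (tvar * D) t = t * (inverse (t - \<beta>) * (lam \<beta> / (cnj \<beta> * t - 1)))"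
    unfolding D_def
    using rep_mult[of tvar "inverse lin * inverse (chi \<beta>)"] rep_mult[of "inverse lin" "inverse (chi \<beta>)"] rl rc rep_tvar
    by eventually_elim simp
  have zero: "integral\<^sup>L \<mu> (\<lambda>t. alpha_density t *\<^sub>R alpha \<beta> t powi 0) = 1"
  proof -
    have 1: "integral\<^sup>L \<mu> (\<lambda>t. alpha_density t *\<^sub>R alpha \<beta> t powi 0) = fcoef (\<lambda>t. lam \<beta> * rep (tvar * D) t) 0"
      unfolding fcoef_def
    proof (intro integral_cong_AE)
      show "AE t in \<mu>. alpha_density t *\<^sub>R alpha \<beta> t powi 0 = lam \<beta> * rep (tvar * D) t * t powi (- 0)"
        using rD AE_circle_norm
      proof eventually_elim
        case (elim t)
        then show ?case using alpha_density_eq[OF elim(2)]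
          by (simp add: scaleR_conv_of_real divide_inverse mult_ac)
      qed
    qed auto
    also have "\<dots> = lam \<beta> * fourier (tvar * D) 0" by (simp add: fourier_eq fcoef_def mult.assoc)
    also have "fourier (tvar * D) 0 = fourier D (-1)" by (simp add: fourier_tvar_mult)
    \<comment> \<open>Partial fractions:
      \<open>lam \<beta> * chi \<beta> - cnj \<beta> * lin\<close> is the constant
      \<open>\<beta> * cnj \<beta> - 1\<close>.\<close>
    also have "D = (1 / (\<beta> * cnj \<beta> - 1)) *\<^sub>C (lam \<beta> *\<^sub>C inverse lin - cnj \<beta> *\<^sub>C inverse (chi \<beta>))"
    proof -
      have nz: "\<beta> * cnj \<beta> - 1 \<noteq> 0" using lam_sq lam_nonzero by (metis eq_iff_diff_eq_0 mult_eq_0_iff)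
      have "lam \<beta> *\<^sub>C chi \<beta> - cnj \<beta> *\<^sub>C lin = (\<beta> * cnj \<beta> - 1) *\<^sub>C 1"
        unfolding chi_eq lin_def using lam_nonzero
        by (simp add: circ.scale_right_diff_distrib circ.scale_left_diff_distrib mult.commute)
      then have "D * (lam \<beta> *\<^sub>C chi \<beta> - cnj \<beta> *\<^sub>C lin) = (\<beta> * cnj \<beta> - 1) *\<^sub>C D" by simp
      moreover have "D * (lam \<beta> *\<^sub>C chi \<beta> - cnj \<beta> *\<^sub>C lin) = lam \<beta> *\<^sub>C inverse lin - cnj \<beta> *\<^sub>C inverse (chi \<beta>)"
      proof -
        have "D * chi \<beta> = inverse lin" by (simp add: D_def mult.assoc circ_unit_inverse[OF chi_unit])
        moreover have "D * lin = inverse (chi \<beta>)"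
          by (simp add: D_def mult.assoc mult.commute[of "inverse (chi \<beta>)" lin])
             (simp add: circ_unit_inverse[OF lin_unit] flip: mult.assoc)
        ultimately show ?thesis by (simp add: right_diff_distrib)
      qed
      ultimately show ?thesis using nz by simp
    qed
    also have "fourier \<dots> (-1) = 1 / (\<beta> * cnj \<beta> - 1) * (lam \<beta> * fourier (inverse lin) (-1) - cnj \<beta> * fourier (inverse (chi \<beta>)) (-1))"
      by (subst fourier_scaleC, subst fourier_diff[OF p2])
        (simp_all add: fourier_scaleC Lp_scaleC[OF p2] Linf_in_Lp[OF p2] inverse_lin_Linf inverse_chi_Linf)
    also have "fourier (inverse lin) (-1) = 0"
      using inverse_lin_mult_Hp[OF p2, of 1] tvar_power_Hp[OF p2, of 0] by (simp add: Hp_def)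
    also have "lam \<beta> * (1 / (\<beta> * cnj \<beta> - 1) * (lam \<beta> * 0 - cnj \<beta> * fourier (inverse (chi \<beta>)) (-1))) = 1"
    proof -
      have "cnj \<beta> \<noteq> 0" using \<beta> by auto
      then have "lam \<beta> * (1 / (\<beta> * cnj \<beta> - 1) * (lam \<beta> * 0 - cnj \<beta> * fourier (inverse (chi \<beta>)) (-1))) = - (lam \<beta> * lam \<beta>) / (\<beta> * cnj \<beta> - 1)"
        unfolding I1 by simp
      also have "\<dots> = 1" unfolding lam_sq using lam_sq lam_nonzero by (metis divide_self mult_eq_0_iff minus_diff_eq neg_equal_0_iff_equal)
      finally show ?thesis .
    qed
    finally show ?thesis .
  qed
  have neg: "integral\<^sup>L \<mu> (\<lambda>t. alpha_density t *\<^sub>R alpha \<beta> t powi (- int (Suc k))) = 0" for k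
  proof -
    \<comment> \<open>Since \<open>1 / alpha\<close> is \<open>lam * chi / lin\<close>, one of its
      factors \<open>chi\<close> cancels the pole of the density in the disc; what remains has poles
      only at \<open>\<beta>\<close>, outside.\<close>
    define E where "E = inverse lin * ((chi \<beta> * inverse lin) ^ k * inverse lin)"
    have one: "1 \<in> Hp 2" using tvar_power_Hp[OF p2, of 0] by simp
    have "(chi \<beta> * inverse lin) ^ k * h \<in> Hp 2" if "h \<in> Hp 2" for h
      by (induction k) (use that in \<open>auto simp: mult.assoc intro!: chi_mult_Hp inverse_lin_mult_Hp\<close>)
    moreover have "inverse lin \<in> Hp 2" using inverse_lin_mult_Hp[OF p2 one] by simp
    ultimately have E: "E \<in> Hp 2" unfolding E_def by (intro inverse_lin_mult_Hp) auto
    have rp: "AE t in \<mu>. rep ((chi \<beta> * inverse lin) ^ k) t = ((cnj \<beta> * t - 1) / lam \<beta> * inverse (t - \<beta>)) ^ k"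
    proof (induction k)
      case 0
      then show ?case using rep_1 by simp
    next
      case (Suc k)
      show ?case
        unfolding power_Suc
        using Suc rep_mult[of "chi \<beta> * inverse lin" "(chi \<beta> * inverse lin) ^ k"] rep_mult[of "chi \<beta>" "inverse lin"] rep_chi rl
        by eventually_elim simp
    qed
    have rE: "AE t in \<mu>. rep (tvar * E) t = t * (inverse (t - \<beta>) * (((cnj \<beta> * t - 1) / lam \<beta> * inverse (t - \<beta>)) ^ k * inverse (t - \<beta>)))"
      unfolding E_def
      using rep_mult[of tvar "inverse lin * ((chi \<beta> * inverse lin) ^ k * inverse lin)"]
        rep_mult[of "inverse lin" "(chi \<beta> * inverse lin) ^ k * inverse lin"] rep_mult[of "(chi \<beta> * inverse lin) ^ k" "inverse lin"] rp rl rep_tvar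
      by eventually_elim simp
    have "integral\<^sup>L \<mu> (\<lambda>t. alpha_density t *\<^sub>R alpha \<beta> t powi (- int (Suc k)))
        = fcoef (\<lambda>t. lam \<beta> ^ Suc (Suc k) * rep (tvar * E) t) 0"
      unfolding fcoef_def
    proof (intro integral_cong_AE)
      show "AE t in \<mu>. alpha_density t *\<^sub>R alpha \<beta> t powi (- int (Suc k)) = lam \<beta> ^ Suc (Suc k) * rep (tvar * E) t * t powi (- 0)"
        using rE AE_circle_norm
      proof eventually_elim
        case (elim t)
        have d: "cnj \<beta> * t - 1 \<noteq> 0" "t - \<beta> \<noteq> 0" using alpha_denom_nonzero[OF \<beta> elim(2)] elim(2) \<beta> by auto
        have "alpha \<beta> t powi (- int (Suc k)) = ((cnj \<beta> * t - 1) * inverse (t - \<beta>)) ^ Suc k"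
        proof -
          have "inverse (alpha \<beta> t) = (cnj \<beta> * t - 1) * inverse (t - \<beta>)"
            by (simp add: alpha_def divide_inverse)
          then show ?thesis by (simp only: power_int_minus power_int_of_nat power_inverse[symmetric])
        qed
        then have "alpha_density t *\<^sub>R alpha \<beta> t powi (- int (Suc k)) = lam \<beta> * lam \<beta> * t * inverse (t - \<beta>) * inverse (cnj \<beta> * t - 1) * ((cnj \<beta> * t - 1) * inverse (t - \<beta>)) ^ Suc k"
          by (simp add: scaleR_conv_of_real alpha_density_eq[OF elim(2)] divide_inverse mult_ac)
        also have "\<dots> = lam \<beta> * lam \<beta> * t * inverse (t - \<beta>) * inverse (t - \<beta>) * ((cnj \<beta> * t - 1) * inverse (t - \<beta>)) ^ k"
          using d by simp
        also have "\<dots> = lam \<beta> ^ Suc (Suc k) * rep (tvar * E) t * t powi (- 0)"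
          unfolding elim(1) using lam_nonzero by (simp add: power_mult_distrib power_divide)
        finally show ?case .
      qed
    qed auto
    also have "\<dots> = lam \<beta> ^ Suc (Suc k) * fourier (tvar * E) 0" by (simp add: fourier_eq fcoef_def mult.assoc)
    also have "fourier (tvar * E) 0 = 0" using E by (simp add: fourier_tvar_mult Hp_def)
    finally show ?thesis by simp
  qed
  show ?thesis
  proof -
    consider "k = 0" | j where "k = - int (Suc j)" | j where "k = int (Suc j)"
      by (metis int_cases3 not0_implies_Suc of_nat_0_less_iff less_numeral_extra(3))
    then show ?thesis
    proof cases
      case 1 then show ?thesis using zero by simp
    next
      case 2 then show ?thesis using neg by simp
    next
      case (3 j)
      have "integral\<^sup>L \<mu> (\<lambda>t. alpha_density t *\<^sub>R alpha \<beta> t powi k) = integral\<^sup>L \<mu> (\<lambda>t. cnj (alpha_density t *\<^sub>R alpha \<beta> t powi (- int (Suc j))))"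
      proof (intro integral_cong_AE)
        show "AE t in \<mu>. alpha_density t *\<^sub>R alpha \<beta> t powi k = cnj (alpha_density t *\<^sub>R alpha \<beta> t powi (- int (Suc j)))"
          using AE_circle_norm by eventually_elim (simp only: 3 powi_circle_minus[OF norm_alpha[OF \<beta>]] scaleR_conv_of_real complex_cnj_mult complex_cnj_complex_of_real complex_cnj_cnj)
      qed (auto simp: power_int_def)
      also have "\<dots> = cnj (integral\<^sup>L \<mu> (\<lambda>t. alpha_density t *\<^sub>R alpha \<beta> t powi (- int (Suc j))))"
        by (rule Bochner_Integration.integral_cnj)
      finally show ?thesis using neg 3 by simp
    qed
  qed
qed

end

lemma circ_inverse_scaleC: "inverse (z *\<^sub>C f) = inverse z *\<^sub>C inverse f"
  by transfer (auto simp: eq_ae_def)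

lemma fourier_inverse_tvar_power_mult: "fourier (inverse tvar ^ k * f) n = fourier f (n + int k)"
proof (induction k arbitrary: n)
  case (Suc k)
  then show ?case by (simp add: mult.assoc fourier_inverse_tvar_mult add.assoc)
qed simp

section \<open>Change of variables and the operator J\<close>

context
  fixes \<beta> :: complex
  assumes \<beta>: "1 < norm \<beta>"
begin

text \<open>Arc length weighted by the density and transported by \<open>alpha \<beta>\<close> has
  the moments of arc length, which determine it.\<close>

lemma circle_measure_alpha:
  "distr (density \<mu> (\<lambda>t. ennreal (alpha_density \<beta> t))) borel (alpha \<beta>) = \<mu>"
proof (rule circle_measure_eqI)
  note [measurable] = alpha_density_borel[OF \<beta>]
  let ?D = "density \<mu> (\<lambda>t. ennreal (alpha_density \<beta> t))"
  have c: "continuous_on (sphere 0 1) (alpha_density \<beta>)"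
    unfolding alpha_density_def[OF \<beta>]
    using alpha_denom_nonzero[OF \<beta>] by (intro continuous_intros) auto
  have i: "integrable \<mu> (alpha_density \<beta>)"
    by (rule continuous_on_circle_integrable[OF _ c]) measurable
  show "finite_measure (distr ?D borel (alpha \<beta>))"
  proof (rule finite_measureI)
    have "emeasure (distr ?D borel (alpha \<beta>)) (space (distr ?D borel (alpha \<beta>))) = (\<integral>\<^sup>+t. ennreal (alpha_density \<beta> t) \<partial>\<mu>)"
      by (simp add: emeasure_distr emeasure_density)
    also have "\<dots> = ennreal (integral\<^sup>L \<mu> (alpha_density \<beta>))"
      using alpha_density_nonneg[OF \<beta>] by (intro nn_integral_eq_integral i) auto
    finally show "emeasure (distr ?D borel (alpha \<beta>)) (space (distr ?D borel (alpha \<beta>))) \<noteq> \<infinity>" by simp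
  qed
  show "AE t in distr ?D borel (alpha \<beta>). norm t = 1"
  proof (subst AE_distr_iff)
    show "AE t in ?D. norm (alpha \<beta> t) = 1"
      by (subst AE_density) (use AE_circle_norm norm_alpha[OF \<beta>] in \<open>auto elim!: eventually_mono\<close>)
  qed auto
  show "integral\<^sup>L (distr ?D borel (alpha \<beta>)) (\<lambda>t. t powi k) = (if k = 0 then 1 else 0)" for k
    using alpha_moments[OF \<beta>, of k] alpha_density_nonneg[OF \<beta>]
    by (subst integral_distr) (auto simp: integral_density)
qed simp

lemma integral_alpha:
  fixes f :: "complex \<Rightarrow> 'a::{banach,second_countable_topology}"
  assumes [measurable]: "f \<in> borel_measurable borel"
  shows "integral\<^sup>L \<mu> f = integral\<^sup>L \<mu> (\<lambda>t. alpha_density \<beta> t *\<^sub>R f (alpha \<beta> t))"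
    and "integrable \<mu> f \<longleftrightarrow> integrable \<mu> (\<lambda>t. alpha_density \<beta> t *\<^sub>R f (alpha \<beta> t))"
proof -
  note [measurable] = alpha_density_borel[OF \<beta>]
  let ?D = "density \<mu> (\<lambda>t. ennreal (alpha_density \<beta> t))"
  have "integral\<^sup>L \<mu> f = integral\<^sup>L (distr ?D borel (alpha \<beta>)) f" by (simp only: circle_measure_alpha)
  also have "\<dots> = integral\<^sup>L \<mu> (\<lambda>t. alpha_density \<beta> t *\<^sub>R f (alpha \<beta> t))"
    using alpha_density_nonneg[OF \<beta>] by (subst integral_distr) (auto simp: integral_density)
  finally show "integral\<^sup>L \<mu> f = integral\<^sup>L \<mu> (\<lambda>t. alpha_density \<beta> t *\<^sub>R f (alpha \<beta> t))" .
  have "integrable \<mu> f \<longleftrightarrow> integrable (distr ?D borel (alpha \<beta>)) f" by (simp only: circle_measure_alpha)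
  also have "\<dots> \<longleftrightarrow> integrable ?D (\<lambda>t. f (alpha \<beta> t))" by (subst integrable_distr_eq) auto
  also have "\<dots> \<longleftrightarrow> integrable \<mu> (\<lambda>t. alpha_density \<beta> t *\<^sub>R f (alpha \<beta> t))"
    using alpha_density_nonneg[OF \<beta>] by (subst integrable_density) auto
  finally show "integrable \<mu> f \<longleftrightarrow> integrable \<mu> (\<lambda>t. alpha_density \<beta> t *\<^sub>R f (alpha \<beta> t))" .
qed

lemma rep_comp_alpha: "AE t in \<mu>. rep (comp_alpha \<beta> f) t = rep f (alpha \<beta> t)"
  unfolding comp_alpha_def by (rule rep_abs_AE) measurable

lemma comp_alpha_mult: "comp_alpha \<beta> (f * g) = comp_alpha \<beta> f * comp_alpha \<beta> g"
  unfolding circ_eq_iff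
  using rep_comp_alpha[of "f * g"] rep_comp_alpha[of f] rep_comp_alpha[of g] rep_mult[of "comp_alpha \<beta> f" "comp_alpha \<beta> g"]
    AE_alpha[OF \<beta> rep_mult[of f g]]
  by eventually_elim simp

lemma comp_alpha_add: "comp_alpha \<beta> (f + g) = comp_alpha \<beta> f + comp_alpha \<beta> g"
  unfolding circ_eq_iff
  using rep_comp_alpha[of "f + g"] rep_comp_alpha[of f] rep_comp_alpha[of g] rep_add[of "comp_alpha \<beta> f" "comp_alpha \<beta> g"]
    AE_alpha[OF \<beta> rep_add[of f g]]
  by eventually_elim simp

lemma comp_alpha_scaleC: "comp_alpha \<beta> (z *\<^sub>C f) = z *\<^sub>C comp_alpha \<beta> f"
  unfolding circ_eq_iff
  using rep_comp_alpha[of "z *\<^sub>C f"] rep_comp_alpha[of f] rep_scaleC[of z "comp_alpha \<beta> f"]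
    AE_alpha[OF \<beta> rep_scaleC[of z f]]
  by eventually_elim simp

lemma comp_alpha_inverse: "comp_alpha \<beta> (inverse f) = inverse (comp_alpha \<beta> f)"
  unfolding circ_eq_iff
  using rep_comp_alpha[of "inverse f"] rep_comp_alpha[of f] rep_inverse[of "comp_alpha \<beta> f"]
    AE_alpha[OF \<beta> rep_inverse[of f]]
  by eventually_elim simp

lemma comp_alpha_1 [simp]: "comp_alpha \<beta> 1 = 1"
  unfolding circ_eq_iff
  using rep_comp_alpha[of 1] rep_1 AE_alpha[OF \<beta> rep_1]
  by eventually_elim simp

lemma comp_alpha_power: "comp_alpha \<beta> (f ^ k) = comp_alpha \<beta> f ^ k"
  by (induction k) (simp_all add: comp_alpha_mult)

lemma comp_alpha_comp_alpha [simp]: "comp_alpha \<beta> (comp_alpha \<beta> f) = f"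
  unfolding circ_eq_iff
  using rep_comp_alpha[of "comp_alpha \<beta> f"] AE_alpha[OF \<beta> rep_comp_alpha[of f]] AE_circle_norm
  by eventually_elim (simp add: alpha_alpha[OF \<beta>])

lemma comp_alpha_unit: "f dvd 1 \<Longrightarrow> comp_alpha \<beta> f dvd 1"
  using comp_alpha_mult[of f "inverse f"] by (metis circ_unit_inverse(1) comp_alpha_1 dvd_triv_left)

lemma comp_alpha_Linf: "f \<in> Linf \<Longrightarrow> comp_alpha \<beta> f \<in> Linf"
proof -
  assume "f \<in> Linf"
  then obtain C where C: "AE t in \<mu>. norm (rep f t) \<le> C" by (auto simp: Linf_iff)
  have "AE t in \<mu>. norm (rep (comp_alpha \<beta> f) t) \<le> C"
    using rep_comp_alpha[of f] AE_alpha[OF \<beta> C] by eventually_elim simp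
  then show ?thesis unfolding Linf_iff by blast
qed

text \<open>The substitution gives integrability with the density as weight, and the density is
  bounded away from 0 on the circle.\<close>

lemma comp_alpha_Lp:
  assumes f: "f \<in> Lp p" and p: "p > 0"
  shows "comp_alpha \<beta> f \<in> Lp p"
proof -
  note [measurable] = alpha_density_borel[OF \<beta>]
  define c where "c = ((norm \<beta>)\<^sup>2 - 1) / (norm \<beta> + 1)\<^sup>2"
  have c: "c > 0" unfolding c_def using \<beta> one_less_power[of "norm \<beta>" 2]
    by (intro divide_pos_pos zero_less_power) auto
  let ?g = "\<lambda>t. norm (rep f (alpha \<beta> t)) powr p"
  have "integrable \<mu> (\<lambda>t. norm (rep f t) powr p)" using f by (simp add: Lp_iff p_int_def)
  then have i: "integrable \<mu> (\<lambda>t. alpha_density \<beta> t *\<^sub>R ?g t)"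
    by (subst (asm) integral_alpha(2)) auto
  have "integrable \<mu> ?g"
  proof (rule Bochner_Integration.integrable_bound)
    show "integrable \<mu> (\<lambda>t. (1/c) * (alpha_density \<beta> t *\<^sub>R ?g t))" using i by (intro integrable_mult_right) auto
    show "AE t in \<mu>. norm (?g t) \<le> norm ((1/c) * (alpha_density \<beta> t *\<^sub>R ?g t))"
      using AE_circle_norm
    proof eventually_elim
      case (elim t)
      have "c * ?g t \<le> alpha_density \<beta> t * ?g t"
        using alpha_density_ge[OF \<beta> elim] by (intro mult_right_mono) (auto simp: c_def)
      then show ?case using c alpha_density_nonneg[OF \<beta>, of t] by (simp add: field_simps)
    qed
  qed measurable
  then have "p_int p (\<lambda>t. rep f (alpha \<beta> t))" by (simp add: p_int_def)
  then show ?thesis unfolding Lp_iff by (rule p_int_cong_AE[OF _ rep_borel rep_comp_alpha])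
qed

lemma comp_alpha_chi: "comp_alpha \<beta> (chi \<beta>) = inverse (chi \<beta>)"
  unfolding circ_eq_iff
  using rep_comp_alpha[of "chi \<beta>"] AE_alpha[OF \<beta> rep_chi[OF \<beta>]] rep_chi[OF \<beta>] rep_inverse[of "chi \<beta>"] AE_circle_norm
proof eventually_elim
  case (elim t)
  have d: "cnj \<beta> * t - 1 \<noteq> 0" by (rule alpha_denom_nonzero[OF \<beta> elim(5)])
  have l: "lam \<beta> \<noteq> 0" by (rule lam_nonzero[OF \<beta>])
  have "(cnj \<beta> * alpha \<beta> t - 1) * (cnj \<beta> * t - 1) = lam \<beta> * lam \<beta>"
    using d by (simp add: alpha_def lam_sq[OF \<beta>] left_diff_distrib) (simp add: algebra_simps)
  then have "(cnj \<beta> * alpha \<beta> t - 1) / lam \<beta> = lam \<beta> / (cnj \<beta> * t - 1)"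
    using d l by (simp add: frac_eq_eq)
  then show ?case using elim by simp
qed

lemma comp_alpha_tvar: "comp_alpha \<beta> tvar = (1 / lam \<beta>) *\<^sub>C (lin \<beta> * inverse (chi \<beta>))"
  unfolding circ_eq_iff
  using rep_comp_alpha[of tvar] AE_alpha[OF \<beta> rep_tvar] rep_chi[OF \<beta>] rep_inverse[of "chi \<beta>"] rep_lin[OF \<beta>]
    rep_scaleC[of "1 / lam \<beta>" "lin \<beta> * inverse (chi \<beta>)"] rep_mult[of "lin \<beta>" "inverse (chi \<beta>)"]
proof eventually_elim
  case (elim t)
  then show ?case using lam_nonzero[OF \<beta>] by (simp add: alpha_def)
qed

lemma J_alpha_mult: "J_alpha \<beta> (f * g) = comp_alpha \<beta> f * J_alpha \<beta> g"
  by (simp add: J_alpha_def comp_alpha_mult mult_ac)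

lemma J_alpha_J_alpha [simp]: "J_alpha \<beta> (J_alpha \<beta> f) = f"
  using circ_unit_inverse(2)[OF chi_unit[OF \<beta>]]
  by (simp add: J_alpha_def comp_alpha_mult comp_alpha_inverse comp_alpha_chi flip: mult.assoc)

lemma J_alpha_add: "J_alpha \<beta> (f + g) = J_alpha \<beta> f + J_alpha \<beta> g"
  by (simp add: J_alpha_def comp_alpha_add distrib_left)

lemma J_alpha_scaleC: "J_alpha \<beta> (z *\<^sub>C f) = z *\<^sub>C J_alpha \<beta> f"
  by (simp add: J_alpha_def comp_alpha_scaleC)

lemma J_alpha_uminus: "J_alpha \<beta> (- f) = - J_alpha \<beta> f"
  using J_alpha_scaleC[of "-1" f] by simp

lemma J_alpha_diff: "J_alpha \<beta> (f - g) = J_alpha \<beta> f - J_alpha \<beta> g"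
  using J_alpha_add[of f "- g"] by (simp add: J_alpha_uminus)

lemma J_alpha_0 [simp]: "J_alpha \<beta> 0 = 0"
  using J_alpha_scaleC[of 0 0] by simp

lemma J_alpha_Lp: "1 < p \<Longrightarrow> f \<in> Lp p \<Longrightarrow> J_alpha \<beta> f \<in> Lp p"
  unfolding J_alpha_def by (intro Lp_mult_Linf inverse_chi_Linf[OF \<beta>] comp_alpha_Lp) auto

text \<open>The change of variables in multiplicative form: on the circle the density is
  \<open>t / (chi * chi * alpha)\<close>.\<close>

lemma fourier_alpha:
  assumes p: "1 < p" and f: "f \<in> Lp p"
  shows "fourier (tvar * inverse (chi \<beta>) * inverse (chi \<beta>) * inverse (comp_alpha \<beta> tvar) * comp_alpha \<beta> f) 0 = fourier f 0"
proof -
  note [measurable] = alpha_density_borel[OF \<beta>]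
  have "fourier f 0 = integral\<^sup>L \<mu> (rep f)" by (simp add: fourier_eq fcoef_def)
  also have "\<dots> = integral\<^sup>L \<mu> (\<lambda>t. alpha_density \<beta> t *\<^sub>R rep f (alpha \<beta> t))"
    by (rule integral_alpha) simp
  also have "\<dots> = fcoef (rep (tvar * inverse (chi \<beta>) * inverse (chi \<beta>) * inverse (comp_alpha \<beta> tvar) * comp_alpha \<beta> f)) 0"
    unfolding fcoef_def
  proof (intro integral_cong_AE)
    show "AE t in \<mu>. alpha_density \<beta> t *\<^sub>R rep f (alpha \<beta> t) =
       rep (tvar * inverse (chi \<beta>) * inverse (chi \<beta>) * inverse (comp_alpha \<beta> tvar) * comp_alpha \<beta> f) t * t powi (- 0)"
      using rep_mult[of "tvar * inverse (chi \<beta>) * inverse (chi \<beta>) * inverse (comp_alpha \<beta> tvar)" "comp_alpha \<beta> f"] rep_mult[of "tvar * inverse (chi \<beta>) * inverse (chi \<beta>)" "inverse (comp_alpha \<beta> tvar)"]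
        rep_mult[of "tvar * inverse (chi \<beta>)" "inverse (chi \<beta>)"] rep_mult[of "tvar" "inverse (chi \<beta>)"] rep_tvar
        rep_comp_alpha[of f] rep_inverse[of "chi \<beta>"] rep_inverse[of "comp_alpha \<beta> tvar"] rep_comp_alpha[of tvar] AE_alpha[OF \<beta> rep_tvar] rep_chi[OF \<beta>] AE_circle_norm
    proof eventually_elim
      case (elim t)
      have d: "cnj \<beta> * t - 1 \<noteq> 0" by (rule alpha_denom_nonzero[OF \<beta> elim(12)])
      have "complex_of_real (alpha_density \<beta> t) = t * (lam \<beta> / (cnj \<beta> * t - 1)) * (lam \<beta> / (cnj \<beta> * t - 1)) * ((cnj \<beta> * t - 1) / (t - \<beta>))"
        unfolding alpha_density_eq[OF \<beta> elim(12)] using d by (simp add: mult_ac)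
      moreover have "rep (tvar * inverse (chi \<beta>) * inverse (chi \<beta>) * inverse (comp_alpha \<beta> tvar) * comp_alpha \<beta> f) t =
          t * (lam \<beta> / (cnj \<beta> * t - 1)) * (lam \<beta> / (cnj \<beta> * t - 1)) * ((cnj \<beta> * t - 1) / (t - \<beta>)) * rep f (alpha \<beta> t)"
        by (simp only: elim(1-11)) (simp add: alpha_def)
      ultimately show ?case by (simp only: scaleR_conv_of_real) simp
    qed
  qed measurable
  finally show ?thesis by (simp add: fourier_eq)
qed

lemma unit_products: "tvar * inverse tvar = 1" "(chi \<beta>) * inverse (chi \<beta>) = 1" "(comp_alpha \<beta> tvar) * inverse (comp_alpha \<beta> tvar) = 1" "lin \<beta> * inverse (lin \<beta>) = 1"
  using circ_unit_inverse(1)[OF chi_unit[OF \<beta>]] circ_unit_inverse(1)[OF comp_alpha_unit[OF tvar_unit]]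
    circ_unit_inverse(1)[OF lin_unit[OF \<beta>]] by auto

lemma inverse_A: "inverse (comp_alpha \<beta> tvar) = lam \<beta> *\<^sub>C (chi \<beta> * inverse (lin \<beta>))"
  by (simp add: comp_alpha_tvar circ_inverse_scaleC circ_inverse_mult mult.commute)

lemma scaleC_power: "(z *\<^sub>C f) ^ k = z ^ k *\<^sub>C (f ^ k)"
  by (induction k) simp_all

text \<open>A coefficient of \<open>J_alpha \<beta> f\<close> is a mean value, which the
  substitution \<open>alpha\<close> turns into the mean of \<open>tvar\<close> times an element of
  \<open>Hp p\<close>.\<close>

lemma J_alpha_Hp:
  assumes p: "1 < p" and f: "f \<in> Hp p"
  shows "J_alpha \<beta> f \<in> Hm p"
proof -
  have fL: "f \<in> Lp p" using f by (simp add: Hp_def)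
  have "fourier (J_alpha \<beta> f) n = 0" if n: "n \<ge> 0" for n
  proof -
    define k where "k = nat n"
    have k: "n = int k" using n by (simp add: k_def)
    define h where "h = (chi \<beta> * inverse (lin \<beta>)) ^ k * (inverse (lin \<beta>) * f)"
    have h: "h \<in> Hp p"
      unfolding h_def
      by (induction k) (use f p in \<open>auto simp: mult.assoc intro!: chi_mult_Hp[OF \<beta>] inverse_lin_mult_Hp[OF \<beta>]\<close>)
    \<comment> \<open>Found by solving for the function whose substituted integrand is
      \<open>inverse tvar ^ k * J_alpha \<beta> f\<close>. One of the \<open>Suc k\<close> factors
      \<open>1 / alpha\<close> contributes the \<open>chi\<close> that cancels
      \<open>inverse (chi \<beta>)\<close>.\<close>
    define g where "g = tvar * (inverse (chi \<beta>) * (inverse (comp_alpha \<beta> tvar) ^ Suc k * f))"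
    have "inverse (chi \<beta>) * (inverse (comp_alpha \<beta> tvar) ^ Suc k * f) = lam \<beta> ^ Suc k *\<^sub>C (((chi \<beta>) * inverse (chi \<beta>)) * h)"
      unfolding inverse_A scaleC_power h_def by (simp add: mult_ac)
    then have g: "g = tvar * (lam \<beta> ^ Suc k *\<^sub>C h)" by (simp add: g_def unit_products)
    then have gL: "g \<in> Lp p" using h p by (auto intro!: Lp_mult_Linf Lp_scaleC simp: Hp_def)
    have cg: "comp_alpha \<beta> g = (comp_alpha \<beta> tvar) * ((chi \<beta>) * ((inverse tvar * inverse tvar ^ k) * comp_alpha \<beta> f))"
      by (simp add: g_def comp_alpha_mult comp_alpha_inverse comp_alpha_power comp_alpha_chi)
    have "tvar * inverse (chi \<beta>) * inverse (chi \<beta>) * inverse (comp_alpha \<beta> tvar) * comp_alpha \<beta> g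
       = (tvar * inverse tvar) * ((chi \<beta>) * inverse (chi \<beta>)) * ((comp_alpha \<beta> tvar) * inverse (comp_alpha \<beta> tvar)) * (inverse tvar ^ k * (inverse (chi \<beta>) * comp_alpha \<beta> f))"
      unfolding cg by (simp only: mult_ac)
    also have "\<dots> = inverse tvar ^ k * J_alpha \<beta> f" by (simp only: unit_products mult_1 J_alpha_def)
    finally have "fourier (inverse tvar ^ k * J_alpha \<beta> f) 0 = fourier g 0" using fourier_alpha[OF p gL] by simp
    also have "fourier g 0 = 0" unfolding g using h by (simp add: fourier_tvar_mult fourier_scaleC Hp_def)
    finally show ?thesis by (simp add: fourier_inverse_tvar_power_mult k)
  qed
  then show ?thesis using J_alpha_Lp[OF p fL] by (simp add: Hm_def)
qed

text \<open>The mirror image: powers of \<open>alpha\<close>, that is of \<open>lin / chi\<close> up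
  to a constant, keep \<open>Hm p\<close>, and after division by \<open>chi\<close> there is still
  room for the factor \<open>tvar\<close>.\<close>

lemma J_alpha_Hm:
  assumes p: "1 < p" and f: "f \<in> Hm p"
  shows "J_alpha \<beta> f \<in> Hp p"
proof -
  have fL: "f \<in> Lp p" using f by (simp add: Hm_def)
  have "fourier (J_alpha \<beta> f) n = 0" if n: "n < 0" for n
  proof -
    define k where "k = nat (- n - 1)"
    have k: "n = - int (Suc k)" using n by (simp add: k_def)
    define h where "h = (lin \<beta> * inverse (chi \<beta>)) ^ k * f"
    have h: "h \<in> Hm p"
      unfolding h_def
      by (induction k) (use f p in \<open>auto simp: mult.assoc intro!: inverse_chi_mult_Hm(3)[OF \<beta>]\<close>)
    define g where "g = tvar * (inverse (chi \<beta>) * ((comp_alpha \<beta> tvar) ^ k * f))"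
    have g: "g = (1 / lam \<beta>) ^ k *\<^sub>C (tvar * (inverse (chi \<beta>) * h))"
      unfolding g_def comp_alpha_tvar scaleC_power h_def by (simp add: mult_ac)
    have hm: "tvar * (inverse (chi \<beta>) * h) \<in> Hm p" by (rule inverse_chi_mult_Hm(2)[OF \<beta> p h])
    then have gL: "g \<in> Lp p" unfolding g using p by (auto intro!: Lp_scaleC simp: Hm_def)
    have cg: "comp_alpha \<beta> g = (comp_alpha \<beta> tvar) * ((chi \<beta>) * (tvar ^ k * comp_alpha \<beta> f))"
      by (simp add: g_def comp_alpha_mult comp_alpha_inverse comp_alpha_power comp_alpha_chi)
    have "tvar * inverse (chi \<beta>) * inverse (chi \<beta>) * inverse (comp_alpha \<beta> tvar) * comp_alpha \<beta> g
       = ((chi \<beta>) * inverse (chi \<beta>)) * ((comp_alpha \<beta> tvar) * inverse (comp_alpha \<beta> tvar)) * ((tvar * tvar ^ k) * (inverse (chi \<beta>) * comp_alpha \<beta> f))"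
      unfolding cg by (simp only: mult_ac)
    also have "\<dots> = tvar ^ Suc k * J_alpha \<beta> f" by (simp only: unit_products mult_1 J_alpha_def power_Suc)
    finally have "fourier (tvar ^ Suc k * J_alpha \<beta> f) 0 = fourier g 0" using fourier_alpha[OF p gL] by simp
    also have "fourier g 0 = 0" unfolding g using hm by (simp add: fourier_scaleC Hm_def)
    finally show ?thesis unfolding fourier_tvar_power_mult by (simp add: k)
  qed
  then show ?thesis using J_alpha_Lp[OF p fL] by (simp add: Hp_def)
qed

text \<open>Evaluation at \<open>1 / cnj \<beta>\<close> is, up to a factor, the coefficient of
  \<open>f / chi\<close> at -1. Under \<open>J_alpha\<close> this functional becomes the plain
  coefficient at -1, which a factorization makes explicit; thus the signature is computed.\<close>

lemma fourier_inverse_chi_J_alpha: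
  assumes p: "1 < p" and f: "f \<in> Lp p"
  shows "fourier (inverse (chi \<beta>) * J_alpha \<beta> f) (-1) = fourier f (-1)"
proof -
  have gL: "tvar * f \<in> Lp p" using p f by (intro Lp_mult_Linf) auto
  have "tvar * inverse (chi \<beta>) * inverse (chi \<beta>) * inverse (comp_alpha \<beta> tvar) * comp_alpha \<beta> (tvar * f)
      = ((comp_alpha \<beta> tvar) * inverse (comp_alpha \<beta> tvar)) * (tvar * (inverse (chi \<beta>) * (inverse (chi \<beta>) * comp_alpha \<beta> f)))"
    unfolding comp_alpha_mult by (simp only: mult_ac)
  then have "tvar * inverse (chi \<beta>) * inverse (chi \<beta>) * inverse (comp_alpha \<beta> tvar) * comp_alpha \<beta> (tvar * f) = tvar * (inverse (chi \<beta>) * J_alpha \<beta> f)"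
    by (simp only: unit_products mult_1 J_alpha_def)
  then show ?thesis using fourier_alpha[OF p gL] by (simp add: fourier_tvar_mult)
qed

end

section \<open>Toeplitz operators of negative index\<close>

lemma sum_fun_apply: "(\<Sum>i\<in>A. F i) x = (\<Sum>i\<in>A. F i x)" for F :: "'i \<Rightarrow> 'a \<Rightarrow> 'b::comm_monoid_add"
  by (induction A rule: infinite_finite_induct) (auto simp: plus_fun_def zero_fun_def)

lemma funct_dim_0: "funct.dim {0} = 0"
  using funct.dim_span_eq_card_independent[OF funct.independent_empty] by (simp only: funct.span_empty card.empty)

lemma circ_dim_0: "circ.dim {0} = 0"
  using circ.dim_span_eq_card_independent[OF circ.independent_empty] by (simp only: circ.span_empty card.empty)

text \<open>Closedness expressed by positive distances, the form in which it feeds the Hahn--Banach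
  theorem.\<close>

definition separated_Hp :: "real \<Rightarrow> circ_fun set \<Rightarrow> bool" where
  "separated_Hp p R \<longleftrightarrow> (\<forall>x\<in>Hp p - R. \<exists>r>0. \<forall>y\<in>R. r \<le> Lp_norm p (x - y))"

definition monoms :: "nat \<Rightarrow> circ_fun set" where "monoms j = (\<lambda>k. tvar ^ k) ` {..<j}"

definition polys_below :: "real \<Rightarrow> nat \<Rightarrow> circ_fun set" where
  "polys_below p j = {f\<in>Hp p. \<forall>n\<ge>int j. fourier f n = 0}"

lemma finite_monoms [simp]: "finite (monoms j)" by (simp add: monoms_def)

context
  fixes p :: real
  assumes p: "1 < p"
begin

lemma Metric_space_Hp: "Metric_space (Hp p) (\<lambda>f g. Lp_norm p (f - g))"
proof
  show "Lp_norm p (f - g) = Lp_norm p (g - f)" for f g by (rule Lp_norm_minus_commute[OF p])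
  show "Lp_norm p (f - g) = 0 \<longleftrightarrow> f = g" if "f \<in> Hp p" "g \<in> Hp p" for f g
    using Lp_norm_eq_0[OF p Lp_diff[OF p]] that by (simp add: Hp_def)
  show "Lp_norm p (f - h) \<le> Lp_norm p (f - g) + Lp_norm p (g - h)" if "f \<in> Hp p" "g \<in> Hp p" "h \<in> Hp p" for f g h
    using Lp_norm_triangle[OF p Lp_diff[OF p] Lp_diff[OF p], of f g g h] that by (simp add: Hp_def)
qed simp

lemma closedin_imp_separated_Hp:
  assumes "closedin (Metric_space.mtopology (Hp p) (\<lambda>f g. Lp_norm p (f - g))) R"
  shows "separated_Hp p R"
proof -
  interpret Metric_space "Hp p" "\<lambda>f g. Lp_norm p (f - g)" by (rule Metric_space_Hp)
  show ?thesis
    using assms unfolding closedin_metric separated_Hp_def disjnt_iff mball_def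
    by (fastforce simp: not_less)
qed

lemma span_subset_Hp: "S \<subseteq> Hp p \<Longrightarrow> circ.span S \<subseteq> Hp p"
  by (rule circ.span_minimal[OF _ Hp_subspace[OF p]])

lemma Hp_closed: "0 \<in> Hp p" "f \<in> Hp p \<Longrightarrow> g \<in> Hp p \<Longrightarrow> f + g \<in> Hp p" "f \<in> Hp p \<Longrightarrow> z *\<^sub>C f \<in> Hp p"
  "f \<in> Hp p \<Longrightarrow> g \<in> Hp p \<Longrightarrow> f - g \<in> Hp p"
  using Hp_subspace[OF p] by (auto simp: circ.subspace_0 circ.subspace_add circ.subspace_scale circ.subspace_diff)

lemma Hm_closed: "0 \<in> Hm p" "f \<in> Hm p \<Longrightarrow> g \<in> Hm p \<Longrightarrow> f + g \<in> Hm p" "f \<in> Hm p \<Longrightarrow> z *\<^sub>C f \<in> Hm p"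
  "f \<in> Hm p \<Longrightarrow> g \<in> Hm p \<Longrightarrow> f - g \<in> Hm p"
  using Hm_subspace[OF p] by (auto simp: circ.subspace_0 circ.subspace_add circ.subspace_scale circ.subspace_diff)

text \<open>The seminorm is the distance to \<open>R\<close>: it vanishes on \<open>R\<close> and is
  positive at \<open>x0\<close>, and a functional bounded by it kills \<open>R\<close>.\<close>

lemma separating_functional:
  assumes R: "circ.subspace R" "R \<subseteq> Hp p" "separated_Hp p R" and x0: "x0 \<in> Hp p" "x0 \<notin> R"
  obtains l where "l \<in> Hp_dual p" "\<And>y. y \<in> R \<Longrightarrow> l y = 0" "l x0 = 1"
proof -
  define N where "N x = (INF y\<in>R. Lp_norm p (x - y))" for x
  have R0: "0 \<in> R" using R(1) by (rule circ.subspace_0)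
  have bdd: "bdd_below ((\<lambda>y. Lp_norm p (x - y)) ` R)" for x by (rule bdd_belowI2[of _ 0]) simp
  have Nle: "N x \<le> Lp_norm p (x - y)" if "y \<in> R" for x y unfolding N_def using that by (intro cINF_lower bdd)
  have Nge: "m \<le> N x" if "\<And>y. y \<in> R \<Longrightarrow> m \<le> Lp_norm p (x - y)" for m x
    unfolding N_def using R0 that by (intro cINF_greatest) auto
  have Lp: "x - y \<in> Lp p" if "x \<in> Hp p" "y \<in> R" for x y using that R(2) p by (auto simp: Hp_def intro!: Lp_diff)
  have N_add: "N (x + y) \<le> N x + N y" if xy: "x \<in> Hp p" "y \<in> Hp p" for x y
  proof -
    have 1: "N (x + y) - Lp_norm p (y - s) \<le> N x" if s: "s \<in> R" for s
    proof (rule Nge)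
      fix r assume r: "r \<in> R"
      have "N (x + y) \<le> Lp_norm p ((x + y) - (r + s))" using R(1) r s by (intro Nle circ.subspace_add)
      also have "(x + y) - (r + s) = (x - r) + (y - s)" by simp
      also have "Lp_norm p \<dots> \<le> Lp_norm p (x - r) + Lp_norm p (y - s)" by (intro Lp_norm_triangle p Lp xy r s)
      finally show "N (x + y) - Lp_norm p (y - s) \<le> Lp_norm p (x - r)" by simp
    qed
    have "N (x + y) - N x \<le> Lp_norm p (y - s)" if "s \<in> R" for s using 1[OF that] by linarith
    then have "N (x + y) - N x \<le> N y" by (rule Nge)
    then show ?thesis by simp
  qed
  have N_scale_le: "N (z *\<^sub>C x) \<le> norm z * N x" if z: "z \<noteq> 0" for z x
  proof -
    have "N (z *\<^sub>C x) / norm z \<le> N x"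
    proof (rule Nge)
      fix r assume r: "r \<in> R"
      have "N (z *\<^sub>C x) \<le> Lp_norm p (z *\<^sub>C x - z *\<^sub>C r)" using R(1) r by (intro Nle circ.subspace_scale)
      also have "\<dots> = norm z * Lp_norm p (x - r)" by (simp add: Lp_norm_scaleC[OF p] flip: circ.scale_right_diff_distrib)
      finally show "N (z *\<^sub>C x) / norm z \<le> Lp_norm p (x - r)" using z by (simp add: field_simps)
    qed
    then show ?thesis using z by (simp add: field_simps)
  qed
  have N0: "N 0 = 0" using Nle[OF R0, of 0] Nge[of 0 0] p by simp
  have N_scale: "N (z *\<^sub>C x) = norm z * N x" for z x
  proof (cases "z = 0")
    case False
    have "N x = N (inverse z *\<^sub>C (z *\<^sub>C x))" using False by simp
    also have "\<dots> \<le> norm (inverse z) * N (z *\<^sub>C x)" using False by (intro N_scale_le) simp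
    finally have "norm z * N x \<le> N (z *\<^sub>C x)" using False by (simp add: norm_divide inverse_eq_divide field_simps)
    with N_scale_le[OF False, of x] show ?thesis by simp
  qed (simp add: N0)
  have Nx0: "N x0 > 0"
  proof -
    obtain r where r: "r > 0" "\<And>y. y \<in> R \<Longrightarrow> r \<le> Lp_norm p (x0 - y)" using R(3) x0 unfolding separated_Hp_def by blast
    have "r \<le> N x0" by (rule Nge) (rule r(2))
    with r(1) show ?thesis by simp
  qed
  obtain l where l: "\<And>x y. x \<in> Hp p \<Longrightarrow> y \<in> Hp p \<Longrightarrow> l (x + y) = l x + l y"
    "\<And>z x. x \<in> Hp p \<Longrightarrow> l (z *\<^sub>C x) = z * l x" "\<And>x. x \<in> Hp p \<Longrightarrow> norm (l x) \<le> 2 * N x"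
    "l x0 \<noteq> 0" "\<And>x. x \<notin> Hp p \<Longrightarrow> l x = 0"
    using hahn_banach_seminorm[OF circ.vector_space_axioms Hp_subspace[OF p], of N x0] N_add N_scale x0(1) Nx0 by blast
  show ?thesis
  proof
    let ?l = "\<lambda>x. l x / l x0"
    show "?l \<in> Hp_dual p"
      unfolding Hp_dual_def
    proof (intro CollectI conjI ballI allI impI exI)
      fix f assume f: "f \<in> Hp p"
      have "norm (l f) \<le> 2 * Lp_norm p f" using l(3)[OF f] Nle[OF R0, of f] by simp
      then show "norm (l f / l x0) \<le> (2 / norm (l x0)) * Lp_norm p f" using l(4) by (simp add: norm_divide field_simps)
    qed (use l in \<open>auto simp: add_divide_distrib\<close>)
    show "l y / l x0 = 0" if y: "y \<in> R" for y
    proof -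
      have "N y \<le> 0" using Nle[OF y, of y] p by simp
      moreover have "norm (l y) \<le> 2 * N y" using y R(2) by (intro l(3)) auto
      ultimately have "norm (l y) \<le> 0" by linarith
      then show ?thesis by simp
    qed
    show "l x0 / l x0 = 1" using l(4) by simp
  qed
qed

text \<open>A bounded functional that kills \<open>R\<close> and takes the value 1 at
  \<open>v\<close> reads off the component along \<open>v\<close>; subtracting that component
  reduces a distance to the span to a distance to \<open>R\<close>.\<close>

lemma separated_Hp_insert:
  assumes R: "circ.subspace R" "R \<subseteq> Hp p" "separated_Hp p R" and v: "v \<in> Hp p"
  shows "separated_Hp p (circ.span (insert v R))"
proof (cases "v \<in> R")
  case True
  then have "circ.span (insert v R) = R" using R(1) by (simp add: insert_absorb circ.span_eq_iff)
  with R show ?thesis by simp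
next
  case False
  obtain l where l: "l \<in> Hp_dual p" "\<And>y. y \<in> R \<Longrightarrow> l y = 0" "l v = 1"
    using separating_functional[OF R v False] by blast
  obtain C where C: "\<And>f. f \<in> Hp p \<Longrightarrow> norm (l f) \<le> C * Lp_norm p f" using l(1) unfolding Hp_dual_def by blast
  have ladd: "l (f + g) = l f + l g" if "f \<in> Hp p" "g \<in> Hp p" for f g using l(1) that by (auto simp: Hp_dual_def)
  have lsc: "l (z *\<^sub>C f) = z * l f" if "f \<in> Hp p" for f z using l(1) that by (auto simp: Hp_dual_def)
  have span: "x \<in> circ.span (insert v R) \<longleftrightarrow> (\<exists>k. x - k *\<^sub>C v \<in> R)" for x
    using R(1) by (simp add: circ.span_breakdown_eq circ.span_eq_iff[THEN iffD2])
  \<comment> \<open>A bound for the norm of the map taking \<open>e\<close> to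
    \<open>e - l e *\<^sub>C v\<close>.\<close>
  define K where "K = 1 + \<bar>C\<bar> * Lp_norm p v"
  have K: "K > 0" by (simp add: K_def add_pos_nonneg)
  show ?thesis
    unfolding separated_Hp_def
  proof
    fix x assume x: "x \<in> Hp p - circ.span (insert v R)"
    have "x - l x *\<^sub>C v \<notin> R" using x span by blast
    moreover have "x - l x *\<^sub>C v \<in> Hp p" using x v by (intro Hp_closed) auto
    ultimately obtain r where r: "r > 0" "\<And>y. y \<in> R \<Longrightarrow> r \<le> Lp_norm p (x - l x *\<^sub>C v - y)"
      using R(3) unfolding separated_Hp_def by blast
    have "r / K \<le> Lp_norm p (x - y)" if y: "y \<in> circ.span (insert v R)" for y
    proof -
      obtain k where k: "y - k *\<^sub>C v \<in> R" using y span by blast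
      have yH: "y \<in> Hp p" using span_subset_Hp[of "insert v R"] R(2) v y by blast
      define e where "e = x - y"
      have eH: "e \<in> Hp p" unfolding e_def using x yH by (intro Hp_closed) auto
      have "l y = l ((y - k *\<^sub>C v) + k *\<^sub>C v)" by simp
      also have "\<dots> = k" using k R(2) v by (subst ladd) (auto simp: Hp_closed lsc l)
      finally have ly: "l y = k" .
      have "l x = l (e + y)" by (simp add: e_def)
      then have lx: "l x = l e + k" using ladd[OF eH yH] ly by simp
      have "x - l x *\<^sub>C v - (y - k *\<^sub>C v) = e + (- l e) *\<^sub>C v"
        by (simp add: e_def lx circ.scale_left_distrib)
      then have "r \<le> Lp_norm p (e + (- l e) *\<^sub>C v)" using r(2)[OF k] by simp
      also have "\<dots> \<le> Lp_norm p e + Lp_norm p ((- l e) *\<^sub>C v)"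
        using eH v p by (intro Lp_norm_triangle Lp_scaleC) (auto simp: Hp_def)
      also have "\<dots> = Lp_norm p e + norm (l e) * Lp_norm p v" by (simp add: Lp_norm_scaleC[OF p] del: circ.scale_minus_left)
      also have "\<dots> \<le> Lp_norm p e + (\<bar>C\<bar> * Lp_norm p e) * Lp_norm p v"
      proof -
        have "norm (l e) \<le> C * Lp_norm p e" by (rule C[OF eH])
        also have "\<dots> \<le> \<bar>C\<bar> * Lp_norm p e" by (intro mult_right_mono) auto
        finally show ?thesis by (intro add_left_mono mult_right_mono) auto
      qed
      also have "\<dots> = K * Lp_norm p e" by (simp add: K_def algebra_simps)
      finally show ?thesis using K by (simp add: e_def field_simps)
    qed
    moreover have "r / K > 0" using r K by simp
    ultimately show "\<exists>r>0. \<forall>y\<in>circ.span (insert v R). r \<le> Lp_norm p (x - y)" by blast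
  qed
qed

lemma separated_Hp_span:
  assumes R: "circ.subspace R" "R \<subseteq> Hp p" "separated_Hp p R" and S: "finite S" "S \<subseteq> Hp p"
  shows "separated_Hp p (circ.span (R \<union> S))"
  using S
proof (induction S rule: finite_induct)
  case empty
  then show ?case using R by (simp add: circ.span_eq_iff[THEN iffD2])
next
  case (insert v S)
  have "separated_Hp p (circ.span (insert v (circ.span (R \<union> S))))"
    using insert R(2) by (intro separated_Hp_insert span_subset_Hp) auto
  moreover have "circ.span (insert v (circ.span (R \<union> S))) = circ.span (R \<union> insert v S)"
  proof
    show "circ.span (insert v (circ.span (R \<union> S))) \<subseteq> circ.span (R \<union> insert v S)"
      by (intro circ.span_minimal circ.subspace_span insert_subsetI circ.span_mono) (auto intro: circ.span_base)
    show "circ.span (R \<union> insert v S) \<subseteq> circ.span (insert v (circ.span (R \<union> S)))"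
      by (intro circ.span_mono) (auto intro: circ.span_base)
  qed
  ultimately show ?case by simp
qed

lemma span_polynomials_eq_Hp:
  assumes S: "circ.subspace S" "S \<subseteq> Hp p" "separated_Hp p S" and poly: "\<And>k. tvar ^ k \<in> S"
  shows "S = Hp p"
proof (rule ccontr)
  assume "S \<noteq> Hp p"
  then obtain x where x: "x \<in> Hp p - S" using S(2) by blast
  obtain r where r: "r > 0" "\<And>y. y \<in> S \<Longrightarrow> r \<le> Lp_norm p (x - y)" using S(3) x unfolding separated_Hp_def by blast
  obtain g where g: "g \<in> circ.span (range (\<lambda>k::nat. tvar ^ k))" "Lp_norm p (x - g) < r"
    using polynomials_dense[OF p _ r(1)] x by blast
  have "circ.span (range (\<lambda>k::nat. tvar ^ k)) \<subseteq> S" using poly S(1) by (intro circ.span_minimal) auto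
  then show False using r(2)[of g] g by auto
qed

lemma monoms_Hp: "monoms j \<subseteq> Hp p"
  using p by (auto simp: monoms_def)

lemma fourier_sum_monoms:
  "finite A \<Longrightarrow> (\<Sum>k\<in>A. c k *\<^sub>C tvar ^ k) \<in> Hp p \<and> fourier (\<Sum>k\<in>A. c k *\<^sub>C tvar ^ k) n = (\<Sum>k\<in>A. if n = int k then c k else 0)"
proof (induction A rule: finite_induct)
  case (insert k A)
  have 1: "(c k *\<^sub>C tvar ^ k) \<in> Hp p" using p by (intro Hp_closed) auto
  then show ?case using insert by (auto simp: Hp_closed fourier_add[OF p] Hp_Lp[OF p] fourier_scaleC fourier_tvar_power)
qed (simp add: Hp_closed)

lemma polys_below_eq:
  assumes "f \<in> polys_below p j"
  shows "f = (\<Sum>k<j. fourier f (int k) *\<^sub>C tvar ^ k)"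
proof (rule fourier_unique[OF p])
  note s = fourier_sum_monoms[of "{..<j}" "\<lambda>k. fourier f (int k)"]
  show "(\<Sum>k<j. fourier f (int k) *\<^sub>C tvar ^ k) \<in> Lp p" using s by (simp add: Hp_def)
  fix n
  have "fourier (\<Sum>k<j. fourier f (int k) *\<^sub>C tvar ^ k) n = (\<Sum>k<j. if n = int k then fourier f (int k) else 0)" using s by simp
  also have "\<dots> = fourier f n"
  proof (cases "0 \<le> n \<and> n < int j")
    case True
    then have "(\<Sum>k<j. if n = int k then fourier f (int k) else 0) = (\<Sum>k<j. if k = nat n then fourier f n else 0)"
      by (intro sum.cong) auto
    then show ?thesis using True by (simp add: nat_less_iff)
  next
    case False
    then have "fourier f n = 0" using assms by (auto simp: polys_below_def Hp_def not_le not_less)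
    moreover have "(\<Sum>k<j. if n = int k then fourier f (int k) else 0) = 0" using False by (intro sum.neutral) auto
    ultimately show ?thesis by simp
  qed
  finally show "fourier f n = fourier (\<Sum>k<j. fourier f (int k) *\<^sub>C tvar ^ k) n" ..
qed (use assms in \<open>simp add: polys_below_def Hp_def\<close>)

lemma polys_below_eq_span: "polys_below p j = circ.span (monoms j)"
proof
  show "polys_below p j \<subseteq> circ.span (monoms j)"
  proof
    fix f assume "f \<in> polys_below p j"
    then have "f = (\<Sum>k<j. fourier f (int k) *\<^sub>C tvar ^ k)" by (rule polys_below_eq)
    also have "\<dots> \<in> circ.span (monoms j)"
      by (intro circ.span_sum circ.span_scale circ.span_base) (auto simp: monoms_def)
    finally show "f \<in> circ.span (monoms j)" .
  qed
  have "circ.subspace (polys_below p j)"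
    by (auto simp: circ.subspace_def polys_below_def Hp_closed fourier_add[OF p] Hp_Lp[OF p] fourier_scaleC)
  moreover have "monoms j \<subseteq> polys_below p j"
    using p by (auto simp: monoms_def polys_below_def fourier_tvar_power)
  ultimately show "circ.span (monoms j) \<subseteq> polys_below p j" by (intro circ.span_minimal)
qed

text \<open>The monomials below \<open>j\<close> are independent modulo \<open>R\<close>, and
  \<open>R\<close> stays closed after adding finitely many vectors. So each monomial can be
  separated from the span of \<open>R\<close> and the other monomials. For \<open>R\<close> the
  range of an operator this yields independent elements of its cokernel.\<close>

lemma dual_family:
  assumes R: "circ.subspace R" "R \<subseteq> Hp p" "separated_Hp p R" and disj: "R \<inter> polys_below p j = {0}"
  obtains l where "\<And>i. i < j \<Longrightarrow> l i \<in> Hp_dual p" "\<And>i y. i < j \<Longrightarrow> y \<in> R \<Longrightarrow> l i y = 0"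
    "\<And>i k. i < j \<Longrightarrow> k < j \<Longrightarrow> l i (tvar ^ k) = (if k = i then 1 else 0)"
proof -
  have "\<exists>l. l \<in> Hp_dual p \<and> (\<forall>y\<in>R. l y = 0) \<and> (\<forall>k<j. l (tvar ^ k) = (if k = i then 1 else 0))" if i: "i < j" for i
  proof -
    define S where "S = (\<lambda>k. tvar ^ k) ` ({..<j} - {i})"
    have S: "finite S" "S \<subseteq> Hp p" using p by (auto simp: S_def)
    have Si: "fourier y (int i) = 0 \<and> y \<in> polys_below p j" if "y \<in> circ.span S" for y
    proof -
      have "S \<subseteq> {y \<in> polys_below p j. fourier y (int i) = 0}"
        using p by (auto simp: S_def polys_below_def fourier_tvar_power)
      moreover have "circ.subspace {y \<in> polys_below p j. fourier y (int i) = 0}"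
        by (auto simp: circ.subspace_def polys_below_def Hp_closed fourier_add[OF p] Hp_Lp[OF p] fourier_scaleC)
      ultimately have "circ.span S \<subseteq> {y \<in> polys_below p j. fourier y (int i) = 0}" by (rule circ.span_minimal)
      then show ?thesis using that by blast
    qed
    have ti: "tvar ^ i \<in> polys_below p j" using i p by (auto simp: polys_below_def fourier_tvar_power)
    have "tvar ^ i \<notin> circ.span (R \<union> S)"
    proof
      assume "tvar ^ i \<in> circ.span (R \<union> S)"
      then obtain r e where re: "tvar ^ i = r + e" "r \<in> R" "e \<in> circ.span S"
        using R(1) by (auto simp: circ.span_Un circ.span_eq_iff[THEN iffD2])
      have "r = tvar ^ i - e" using re by simp
      also have "\<dots> \<in> polys_below p j" using ti Si[OF re(3)]
        unfolding polys_below_eq_span by (intro circ.span_diff) auto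
      finally have "r = 0" using re(2) disj by blast
      then have "fourier (tvar ^ i) (int i) = 0" using re Si[OF re(3)] by simp
      then show False by (simp add: fourier_tvar_power)
    qed
    then obtain l where l: "l \<in> Hp_dual p" "\<And>y. y \<in> circ.span (R \<union> S) \<Longrightarrow> l y = 0" "l (tvar ^ i) = 1"
      using separating_functional[OF circ.subspace_span span_subset_Hp separated_Hp_span[OF R S] tvar_power_Hp[OF p]] R(2) S(2)
      by blast
    show ?thesis
    proof (intro exI[of _ l] conjI ballI allI impI)
      fix k assume k: "k < j"
      show "l (tvar ^ k) = (if k = i then 1 else 0)"
      proof (cases "k = i")
        case False
        then have "tvar ^ k \<in> circ.span (R \<union> S)" using k by (intro circ.span_base) (auto simp: S_def)
        then show ?thesis using l(2) False by simp
      qed (use l in simp)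
    qed (use l in \<open>auto intro: circ.span_base\<close>)
  qed
  then obtain l where "\<And>i. i < j \<Longrightarrow> l i \<in> Hp_dual p \<and> (\<forall>y\<in>R. l i y = 0) \<and> (\<forall>k<j. l i (tvar ^ k) = (if k = i then 1 else 0))"
    by metis
  then show ?thesis using that by blast
qed

lemma dual_family_independent:
  assumes "\<And>i k. i < j \<Longrightarrow> k < j \<Longrightarrow> l i (tvar ^ k) = (if k = i then 1 else 0 :: complex)"
  shows "inj_on l {..<j}" "\<not> funct.dependent (l ` {..<j})"
proof -
  show inj: "inj_on l {..<j}"
  proof (rule inj_onI)
    fix i k assume ik: "i \<in> {..<j}" "k \<in> {..<j}" "l i = l k"
    then have "l i (tvar ^ i) = l k (tvar ^ i)" by simp
    then show "i = k" using assms[of i i] assms[of k i] ik by (auto split: if_splits)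
  qed
  show "\<not> funct.dependent (l ` {..<j})"
  proof
    assume "funct.dependent (l ` {..<j})"
    then obtain u where u: "\<exists>v\<in>l ` {..<j}. u v \<noteq> 0" "(\<Sum>v\<in>l ` {..<j}. scaleF (u v) v) = 0"
      by (auto simp: funct.dependent_finite)
    have "u (l i) = 0" if i: "i < j" for i
    proof -
      have "0 = (\<Sum>v\<in>l ` {..<j}. scaleF (u v) v) (tvar ^ i)" using u(2) by simp
      also have "\<dots> = (\<Sum>v\<in>l ` {..<j}. u v * v (tvar ^ i))" by (simp add: sum_fun_apply scaleF_def)
      also have "\<dots> = (\<Sum>k<j. u (l k) * l k (tvar ^ i))" by (simp add: sum.reindex[OF inj])
      also have "\<dots> = (\<Sum>k<j. if k = i then u (l i) else 0)" using i by (intro sum.cong) (auto simp: assms)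
      also have "\<dots> = u (l i)" using i by simp
      finally show ?thesis by simp
    qed
    with u(1) show False by auto
  qed
qed

section \<open>Coburn's dichotomy and the range for negative index\<close>

context
  fixes g :: circ_fun
  assumes g: "g \<in> Linf"
begin

lemma toeplitz_Hp: "f \<in> Lp p \<Longrightarrow> toeplitz p g f \<in> Hp p"
  unfolding toeplitz_def using p g by (intro proj_P_Hp Lp_mult_Linf)

lemma fourier_toeplitz: "f \<in> Lp p \<Longrightarrow> fourier (toeplitz p g f) n = (if n \<ge> 0 then fourier (g * f) n else 0)"
  unfolding toeplitz_def using p g by (intro proj_P Lp_mult_Linf)

lemma toeplitz_add: "f \<in> Lp p \<Longrightarrow> h \<in> Lp p \<Longrightarrow> toeplitz p g (f + h) = toeplitz p g f + toeplitz p g h"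
  unfolding toeplitz_def distrib_left using p g by (intro proj_P_add Lp_mult_Linf)

lemma toeplitz_diff: "f \<in> Lp p \<Longrightarrow> h \<in> Lp p \<Longrightarrow> toeplitz p g (f - h) = toeplitz p g f - toeplitz p g h"
  unfolding toeplitz_def right_diff_distrib using p g by (intro proj_P_diff Lp_mult_Linf)

lemma toeplitz_scaleC: "f \<in> Lp p \<Longrightarrow> toeplitz p g (z *\<^sub>C f) = z *\<^sub>C toeplitz p g f"
  unfolding toeplitz_def scaleC_mult_right using p g by (intro proj_P_scaleC Lp_mult_Linf)

lemma toeplitz_eq_0_iff: "f \<in> Lp p \<Longrightarrow> toeplitz p g f = 0 \<longleftrightarrow> g * f \<in> Hm p"
  unfolding toeplitz_def using p g by (intro proj_P_eq_0_iff Lp_mult_Linf)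

lemma toeplitz_0 [simp]: "toeplitz p g 0 = 0"
  using toeplitz_scaleC[of 0 0] p by simp

lemma toeplitz_range_subspace: "circ.subspace (toeplitz p g ` Hp p)"
  unfolding circ.subspace_def
proof (intro conjI ballI allI)
  show "0 \<in> toeplitz p g ` Hp p" using Hp_closed(1) by (intro image_eqI[of _ _ 0]) auto
  show "x + y \<in> toeplitz p g ` Hp p" if "x \<in> toeplitz p g ` Hp p" "y \<in> toeplitz p g ` Hp p" for x y
    using that by (auto simp: Hp_closed Hp_Lp[OF p] simp flip: toeplitz_add)
  show "z *\<^sub>C x \<in> toeplitz p g ` Hp p" if "x \<in> toeplitz p g ` Hp p" for x z
    using that by (auto simp: Hp_closed Hp_Lp[OF p] simp flip: toeplitz_scaleC)
qed

lemma toeplitz_range_Hp: "toeplitz p g ` Hp p \<subseteq> Hp p"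
  using toeplitz_Hp Hp_Lp[OF p] by auto

lemma coker_toeplitz: "l \<in> coker_Hp p (toeplitz p g) \<longleftrightarrow> l \<in> Hp_dual p \<and> (\<forall>f\<in>Hp p. l (toeplitz p g f) = 0)"
  by (auto simp: coker_Hp_def adjoint_Hp_def fun_eq_iff)

lemma coker_toeplitz_surj:
  assumes "toeplitz p g ` Hp p = Hp p"
  shows "coker_Hp p (toeplitz p g) = {0}"
proof (intro set_eqI iffI)
  fix l assume "l \<in> coker_Hp p (toeplitz p g)"
  then have l: "l \<in> Hp_dual p" "\<forall>f\<in>Hp p. l (toeplitz p g f) = 0" by (auto simp: coker_toeplitz)
  have "l y = 0" for y
  proof (cases "y \<in> Hp p")
    case True
    then show ?thesis using assms l(2) by (metis imageE)
  next
    case False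
    then show ?thesis using l(1) by (auto simp: Hp_dual_def)
  qed
  then show "l \<in> {0}" by (simp add: fun_eq_iff)
qed (auto simp: coker_toeplitz Hp_dual_def intro: exI[of _ 0])

text \<open>If \<open>g f\<close> has a top frequency \<open>k0\<close>, then \<open>T(g)(t\<^sup>i f)\<close> is a polynomial of degree exactly \<open>k0 + i\<close>
  (as soon as this is not negative), so the range contains all monomials modulo those below \<open>t\<^bsup>k0\<^esup>\<close>.
  For \<open>f\<close> in the kernel, \<open>k0 < 0\<close>; this gives Coburn's dichotomy.\<close>

lemma monomials_in_range_span:
  assumes f: "f \<in> Hp p" and top: "fourier (g * f) k0 \<noteq> 0" "\<And>k. k > k0 \<Longrightarrow> fourier (g * f) k = 0"
  shows "tvar ^ n \<in> circ.span (toeplitz p g ` Hp p \<union> monoms (nat k0))"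
proof (induction n rule: less_induct)
  case (less n)
  let ?S = "circ.span (toeplitz p g ` Hp p \<union> monoms (nat k0))"
  show ?case
  proof (cases "n < nat k0")
    case True
    then show ?thesis by (intro circ.span_base) (auto simp: monoms_def)
  next
    case False
    then have nk: "int n \<ge> k0" by linarith
    define i where "i = nat (int n - k0)"
    have i: "int i = int n - k0" using nk by (simp add: i_def)
    have tf: "tvar ^ i * f \<in> Hp p" using f p by (intro tvar_power_mult_Hp)
    define u where "u = toeplitz p g (tvar ^ i * f)"
    have uH: "u \<in> Hp p" unfolding u_def using tf by (intro toeplitz_Hp Hp_Lp[OF p])
    have uS: "u \<in> ?S" unfolding u_def using tf by (intro circ.span_base) auto
    have uf: "fourier u k = (if k \<ge> 0 then fourier (g * f) (k - int i) else 0)" for k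
    proof -
      have eq: "g * (tvar ^ i * f) = tvar ^ i * (g * f)" by (simp only: mult_ac)
      show ?thesis unfolding u_def fourier_toeplitz[OF Hp_Lp[OF p tf]] eq fourier_tvar_power_mult ..
    qed
    have "u \<in> polys_below p (Suc n)" using uH i top(2) by (auto simp: polys_below_def uf)
    then have "u = (\<Sum>k<n. fourier u (int k) *\<^sub>C tvar ^ k) + fourier u (int n) *\<^sub>C tvar ^ n"
      using polys_below_eq[of u "Suc n"] by simp
    then have "fourier u (int n) *\<^sub>C tvar ^ n = u - (\<Sum>k<n. fourier u (int k) *\<^sub>C tvar ^ k)" by (simp add: algebra_simps)
    also have "\<dots> \<in> ?S" using uS less by (intro circ.span_diff circ.span_sum circ.span_scale) auto
    finally have "inverse (fourier u (int n)) *\<^sub>C (fourier u (int n) *\<^sub>C tvar ^ n) \<in> ?S" by (rule circ.span_scale)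
    moreover have "fourier u (int n) \<noteq> 0" using top(1) i by (simp add: uf)
    ultimately show ?thesis by simp
  qed
qed

text \<open>Finitely many monomials added to a closed range give a closed subspace; it contains all
  polynomials, and these are dense.\<close>

lemma range_span_eq_Hp:
  assumes f: "f \<in> Hp p" and top: "fourier (g * f) k0 \<noteq> 0" "\<And>k. k > k0 \<Longrightarrow> fourier (g * f) k = 0"
    and cl: "separated_Hp p (toeplitz p g ` Hp p)"
  shows "circ.span (toeplitz p g ` Hp p \<union> monoms (nat k0)) = Hp p"
proof (rule span_polynomials_eq_Hp)
  show "separated_Hp p (circ.span (toeplitz p g ` Hp p \<union> monoms (nat k0)))"
    by (intro separated_Hp_span toeplitz_range_subspace toeplitz_range_Hp cl monoms_Hp finite_monoms)
  show "circ.span (toeplitz p g ` Hp p \<union> monoms (nat k0)) \<subseteq> Hp p"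
    using toeplitz_range_Hp monoms_Hp by (intro span_subset_Hp) auto
qed (intro circ.subspace_span monomials_in_range_span[OF f top])+

lemma top_frequency:
  assumes h: "h \<in> Lp p" "h \<noteq> 0" and K: "\<And>k. k \<ge> K \<Longrightarrow> fourier h k = 0"
  obtains k0 where "k0 < K" "fourier h k0 \<noteq> 0" "\<And>k. k > k0 \<Longrightarrow> fourier h k = 0"
proof -
  obtain k where k: "fourier h k \<noteq> 0" using fourier_unique_0[OF p h(1)] h(2) by blast
  have kK: "k < K" using K[of k] k by (cases "k < K") auto
  \<comment> \<open>Counts the steps down from the last admissible frequency \<open>K - 1\<close>,
    so the least number belongs to the top frequency.\<close>
  define i where "i = (LEAST i. fourier h (K - 1 - int i) \<noteq> 0)"
  have "fourier h (K - 1 - int (nat (K - 1 - k))) \<noteq> 0" using k kK by simp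
  then have 1: "fourier h (K - 1 - int i) \<noteq> 0" unfolding i_def by (rule LeastI[of "\<lambda>i. fourier h (K - 1 - int i) \<noteq> 0"])
  show ?thesis
  proof
    show "K - 1 - int i < K" by simp
    show "fourier h (K - 1 - int i) \<noteq> 0" by (rule 1)
    fix k' assume k': "k' > K - 1 - int i"
    show "fourier h k' = 0"
    proof (cases "k' \<ge> K")
      case False
      then have "nat (K - 1 - k') < i" using k' by linarith
      from not_less_Least[OF this[unfolded i_def]] show ?thesis using False by simp
    qed (rule K)
  qed
qed

theorem fredholm_negative_index:
  assumes gu: "g dvd 1" and fred: "fredholm_Hp p (toeplitz p g)" and ind: "index_Hp p (toeplitz p g) = - int m" and m: "m > 0"
  shows "\<And>f. f \<in> Hp p \<Longrightarrow> toeplitz p (inverse tvar ^ m * g) f = 0 \<Longrightarrow> f = 0"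
    and "\<And>y. y \<in> Hp p \<Longrightarrow> \<exists>f\<in>Hp p. toeplitz p (inverse tvar ^ m * g) f = y"
proof -
  let ?R = "toeplitz p g ` Hp p"
  have cl: "separated_Hp p ?R" using fred closedin_imp_separated_Hp by (simp add: fredholm_Hp_def)
  note R = toeplitz_range_subspace toeplitz_range_Hp cl
  have nz: "g * f \<noteq> 0" if "f \<noteq> 0" for f using circ_unit_cancel[OF gu, of f 0] that by simp
  have gL: "g * f \<in> Lp p" if "f \<in> Hp p" for f using that p g by (intro Lp_mult_Linf Hp_Lp)
  have spanR: "circ.span ?R = ?R" using R(1) by (simp add: circ.span_eq_iff)
  \<comment> \<open>A nonzero kernel element has only negative top frequency; then no monomial has
    to be added, the range is everything, the cokernel vanishes and the index cannot be
    negative.\<close>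
  have ker: "f = 0" if f: "f \<in> Hp p" "toeplitz p g f = 0" for f
  proof (rule ccontr)
    assume f0: "f \<noteq> 0"
    have "g * f \<in> Hm p" using f by (simp add: toeplitz_eq_0_iff Hp_Lp[OF p])
    then have z: "\<And>k. k \<ge> 0 \<Longrightarrow> fourier (g * f) k = 0" by (simp add: Hm_def)
    obtain k0 where k0: "k0 < 0" "fourier (g * f) k0 \<noteq> 0" "\<And>k. k > k0 \<Longrightarrow> fourier (g * f) k = 0"
      using top_frequency[OF gL[OF f(1)] nz[OF f0] z] by metis
    have "circ.span (?R \<union> monoms (nat k0)) = Hp p" by (rule range_span_eq_Hp[OF f(1) k0(2,3) cl])
    then have "?R = Hp p" using k0(1) spanR by (simp add: monoms_def)
    then have "coker_Hp p (toeplitz p g) = {0}" by (rule coker_toeplitz_surj)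
    moreover have "funct.dim {0} = 0" by (rule funct_dim_0)
    ultimately show False using ind m by (simp add: index_Hp_def)
  qed
  have "ker_Hp p (toeplitz p g) = {0}" using ker Hp_closed(1) by (auto simp: ker_Hp_def)
  moreover have "circ.dim {0} = 0" by (rule circ_dim_0)
  ultimately have dimc: "funct.dim (coker_Hp p (toeplitz p g)) = m" using ind by (simp add: index_Hp_def)
  have zin: "0 \<in> ?R \<inter> polys_below p j" for j
    using circ.subspace_0[OF R(1)] Hp_closed(1) by (auto simp: polys_below_def)
  \<comment> \<open>If the range contained no nonzero polynomial, there would be more independent
    functionals in the cokernel than a finite spanning set allows.\<close>
  have "\<exists>j. ?R \<inter> polys_below p j \<noteq> {0}"
  proof (rule ccontr)
    assume "\<not> ?thesis"
    then have disj: "?R \<inter> polys_below p j = {0}" for j by blast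
    obtain B where B: "finite B" "coker_Hp p (toeplitz p g) \<subseteq> funct.span B" using fred by (auto simp: fredholm_Hp_def)
    obtain l where l: "\<And>i. i < Suc (card B) \<Longrightarrow> l i \<in> Hp_dual p" "\<And>i y. i < Suc (card B) \<Longrightarrow> y \<in> ?R \<Longrightarrow> l i y = 0"
      "\<And>i k. i < Suc (card B) \<Longrightarrow> k < Suc (card B) \<Longrightarrow> l i (tvar ^ k) = (if k = i then 1 else 0)"
      using dual_family[OF R disj] by blast
    have "l ` {..<Suc (card B)} \<subseteq> funct.span B" using l(1,2) B(2) by (auto simp: coker_toeplitz)
    then have "card (l ` {..<Suc (card B)}) \<le> card B"
      using funct.independent_span_bound[OF B(1) dual_family_independent(2)[OF l(3)]] by blast
    then show False using dual_family_independent(1)[OF l(3)] by (simp add: card_image)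
  qed
  then obtain j where j: "?R \<inter> polys_below p j \<noteq> {0}" and least: "\<And>i. i < j \<Longrightarrow> ?R \<inter> polys_below p i = {0}"
    unfolding exists_least_iff[of "\<lambda>j. ?R \<inter> polys_below p j \<noteq> {0}"] by blast
  obtain f where f: "f \<in> Hp p" "toeplitz p g f \<in> polys_below p j" "toeplitz p g f \<noteq> 0"
    using j zin[of j] by blast
  have f0: "f \<noteq> 0" using f(3) by auto
  have ft: "fourier (g * f) k = fourier (toeplitz p g f) k" if "k \<ge> 0" for k
    using that f(1) by (simp add: fourier_toeplitz Hp_Lp[OF p])
  have z: "\<And>k. k \<ge> int j \<Longrightarrow> fourier (g * f) k = 0"
    using ft f(2) by (simp add: polys_below_def)
  obtain k0 where k0: "k0 < int j" "fourier (g * f) k0 \<noteq> 0" "\<And>k. k > k0 \<Longrightarrow> fourier (g * f) k = 0"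
    using top_frequency[OF gL[OF f(1)] nz[OF f0] z] by metis
  have j0: "j > 0"
  proof (rule ccontr)
    assume "\<not> j > 0"
    then have "toeplitz p g f \<in> Hm p" using f(2) by (auto simp: polys_below_def Hm_def Hp_def)
    then show False using f(2,3) Hp_Hm_0[OF p] by (auto simp: polys_below_def)
  qed
  \<comment> \<open>As \<open>polys_below p j\<close> stops short of degree \<open>j\<close>,
    minimality of \<open>j\<close> pins the degree to \<open>j - 1\<close>, and this number is the
    codimension \<open>M\<close>.\<close>
  have k0j: "nat k0 = j - 1"
  proof (rule ccontr)
    assume "nat k0 \<noteq> j - 1"
    then have lt: "k0 < int (j - 1)" using k0(1) j0 by linarith
    then have "toeplitz p g f \<in> polys_below p (j - 1)"
      using f(2) k0(3) by (auto simp: polys_below_def ft[symmetric])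
    then have "toeplitz p g f = 0" using least[of "j - 1"] j0 f(1) by auto
    with f(3) show False by simp
  qed
  define M where "M = j - 1"
  have total: "circ.span (?R \<union> monoms M) = Hp p" using range_span_eq_Hp[OF f(1) k0(2,3) cl] by (simp add: k0j M_def)
  have disj: "?R \<inter> polys_below p M = {0}" using least[of M] j0 by (simp add: M_def)
  obtain l where l: "\<And>i. i < M \<Longrightarrow> l i \<in> Hp_dual p" "\<And>i y. i < M \<Longrightarrow> y \<in> ?R \<Longrightarrow> l i y = 0"
    "\<And>i k. i < M \<Longrightarrow> k < M \<Longrightarrow> l i (tvar ^ k) = (if k = i then 1 else 0)"
    using dual_family[OF R disj] by blast
  \<comment> \<open>The biorthogonal functionals form a basis: a functional that kills the range is
    determined by its values on the \<open>M\<close> monomials, since these complement the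
    range.\<close>
  have "funct.dim (coker_Hp p (toeplitz p g)) = M"
  proof (rule funct.dim_unique)
    show "l ` {..<M} \<subseteq> coker_Hp p (toeplitz p g)" using l(1,2) by (auto simp: coker_toeplitz)
    show "\<not> funct.dependent (l ` {..<M})" by (rule dual_family_independent(2)[OF l(3)])
    show "card (l ` {..<M}) = M" using dual_family_independent(1)[OF l(3)] by (simp add: card_image)
    show "coker_Hp p (toeplitz p g) \<subseteq> funct.span (l ` {..<M})"
    proof
      fix k assume "k \<in> coker_Hp p (toeplitz p g)"
      then have k: "k \<in> Hp_dual p" "\<And>f. f \<in> Hp p \<Longrightarrow> k (toeplitz p g f) = 0" by (auto simp: coker_toeplitz)
      define k' where "k' = (\<Sum>i<M. scaleF (k (tvar ^ i)) (l i))"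
      have k'x: "k' x = (\<Sum>i<M. k (tvar ^ i) * l i x)" for x by (simp add: k'_def sum_fun_apply scaleF_def)
      have add: "k (x + y) = k x + k y" if "x \<in> Hp p" "y \<in> Hp p" for x y using k(1) that by (auto simp: Hp_dual_def)
      have sc: "k (z *\<^sub>C x) = z * k x" if "x \<in> Hp p" for x z using k(1) that by (auto simp: Hp_dual_def)
      have ladd: "l i (x + y) = l i x + l i y" if "i < M" "x \<in> Hp p" "y \<in> Hp p" for i x y using l(1)[of i] that by (auto simp: Hp_dual_def)
      have lsc: "l i (z *\<^sub>C x) = z * l i x" if "i < M" "x \<in> Hp p" for i x z using l(1)[of i] that by (auto simp: Hp_dual_def)
      define V where "V = {x\<in>Hp p. k x = k' x}"
      have k0: "k 0 = 0" using sc[of 0 0] Hp_closed(1) by simp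
      have l0: "l i 0 = 0" if "i < M" for i using lsc[OF that, of 0 0] Hp_closed(1) by simp
      have "circ.subspace V"
        unfolding circ.subspace_def V_def
        by (auto simp: Hp_closed add sc k'x ladd lsc k0 l0 distrib_left sum.distrib sum_distrib_left mult.left_commute)
      moreover have "?R \<union> monoms M \<subseteq> V"
      proof (intro Un_least subsetI)
        fix x assume x: "x \<in> ?R"
        then show "x \<in> V" using toeplitz_range_Hp l(2) k(2) by (auto simp: V_def k'x)
      next
        fix x assume "x \<in> monoms M"
        then obtain i where i: "i < M" "x = tvar ^ i" by (auto simp: monoms_def)
        have "k' x = (\<Sum>i'<M. if i' = i then k (tvar ^ i) else 0)"
          unfolding k'x i(2) by (rule sum.cong) (auto simp: l(3) i(1))
        then show "x \<in> V" using i p by (simp add: V_def)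
      qed
      ultimately have "circ.span (?R \<union> monoms M) \<subseteq> V" by (intro circ.span_minimal)
      then have on: "k x = k' x" if "x \<in> Hp p" for x using that unfolding total by (auto simp: V_def)
      have "k x = k' x" for x
      proof (cases "x \<in> Hp p")
        case False
        then have "k x = 0" "\<And>i. i < M \<Longrightarrow> l i x = 0" using k(1) l(1) by (auto simp: Hp_dual_def)
        then show ?thesis by (simp add: k'x)
      qed (rule on)
      then have "k = k'" by auto
      also have "k' \<in> funct.span (l ` {..<M})"
        unfolding k'_def by (intro funct.span_sum funct.span_scale funct.span_base) auto
      finally show "k \<in> funct.span (l ` {..<M})" .
    qed
  qed
  then have Mm: "M = m" using dimc by simp
  have invm: "inverse tvar ^ m \<in> Linf" by (intro Linf_power) simp
  \<comment> \<open>The hypothesis leaves \<open>g * f\<close> without frequencies from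
    \<open>m\<close> on, so \<open>T(g) f\<close> is a polynomial in the range below the least
    possible degree.\<close>
  show "f = 0" if f: "f \<in> Hp p" "toeplitz p (inverse tvar ^ m * g) f = 0" for f
  proof -
    have "inverse tvar ^ m * (g * f) \<in> Hm p"
      using f(2) proj_P_eq_0_iff[OF p Lp_mult_Linf[OF p invm gL[OF f(1)]]] by (simp add: toeplitz_def mult.assoc)
    then have "fourier (g * f) (n + int m) = 0" if "n \<ge> 0" for n
      using that by (simp add: Hm_def fourier_inverse_tvar_power_mult)
    from this[of "n - int m" for n] have "fourier (g * f) n = 0" if "n \<ge> int m" for n using that by simp
    then have "toeplitz p g f \<in> polys_below p M"
      using f(1) Mm by (auto simp: polys_below_def toeplitz_Hp Hp_Lp[OF p] fourier_toeplitz)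
    then have "toeplitz p g f = 0" using disj f(1) by blast
    then show ?thesis using ker f(1) by blast
  qed
  show "\<exists>f\<in>Hp p. toeplitz p (inverse tvar ^ m * g) f = y" if y: "y \<in> Hp p" for y
  proof -
    \<comment> \<open>Decomposing \<open>tvar ^ m * y\<close> instead of \<open>y\<close> pushes the
      polynomial summand to negative frequencies once the factor is removed again.\<close>
    have "tvar ^ m * y \<in> circ.span (?R \<union> monoms M)" unfolding total using y by (rule tvar_power_mult_Hp[OF p])
    then obtain r e where re: "tvar ^ m * y = r + e" "r \<in> ?R" "e \<in> circ.span (monoms M)"
      by (auto simp: circ.span_Un spanR)
    then obtain f where f: "f \<in> Hp p" "r = toeplitz p g f" by auto
    have e: "e \<in> polys_below p M" using re(3) by (simp add: polys_below_eq_span)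
    then have eL: "e \<in> Lp p" by (simp add: polys_below_def Hp_def)
    have rL: "r \<in> Lp p" using f toeplitz_Hp Hp_Lp[OF p] by auto
    have "toeplitz p (inverse tvar ^ m * g) f = y"
      unfolding toeplitz_def
    proof (rule proj_P_eqI[OF p])
      show "inverse tvar ^ m * g * f \<in> Lp p" unfolding mult.assoc by (intro Lp_mult_Linf p invm gL f)
      show "y \<in> Lp p" using y by (rule Hp_Lp[OF p])
      fix n
      show "fourier y n = (if n \<ge> 0 then fourier (inverse tvar ^ m * g * f) n else 0)"
      proof (cases "n \<ge> 0")
        case True
        have "fourier (inverse tvar ^ m * g * f) n = fourier (g * f) (n + int m)" by (simp add: mult.assoc fourier_inverse_tvar_power_mult)
        also have "\<dots> = fourier r (n + int m)" using True f by (simp add: fourier_toeplitz Hp_Lp[OF p])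
        also have "\<dots> = fourier (r + e) (n + int m)"
          using True e by (simp add: fourier_add[OF p rL eL] polys_below_def Mm)
        also have "\<dots> = fourier y n" by (simp flip: re(1) add: fourier_tvar_power_mult)
        finally show ?thesis using True by simp
      qed (use y in \<open>simp add: Hp_def\<close>)
    qed
    with f(1) show ?thesis by blast
  qed
qed

end

end

section \<open>Toeplitz plus Hankel operators\<close>

lemma circ_powi_of_nat: "(f :: circ_fun) powi int n = f ^ n"
  by (simp add: power_int_def)

lemma circ_powi_neg: "(f :: circ_fun) powi (- int n) = inverse f ^ n"
  by (cases "n = 0") (simp_all add: power_int_def)

lemma unit_power: "f dvd (1 :: circ_fun) \<Longrightarrow> f ^ n * inverse f ^ n = 1" "f dvd (1 :: circ_fun) \<Longrightarrow> inverse f ^ n * f ^ n = 1"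
  by (simp_all add: power_mult_distrib[symmetric] circ_unit_inverse)

lemma unit_nonzero: "f dvd (1 :: circ_fun) \<Longrightarrow> f \<noteq> 0"
  by (metis dvd_0_left_iff zero_neq_one)

context
  fixes p :: real and \<beta> :: complex
  assumes p: "1 < p" and \<beta>: "1 < norm \<beta>"
begin

lemma J_mult_inverse:
  assumes "d * comp_alpha \<beta> d = 1"
  shows "d * J_alpha \<beta> (d * f) = J_alpha \<beta> f"
  using assms by (simp add: J_alpha_mult[OF \<beta>] flip: mult.assoc)

text \<open>The image of a projection is its set of fixed points, and applying
  \<open>J_alpha\<close> to the fixed point equation gives the stated one. Membership in the kernel
  is automatic, since \<open>J_alpha\<close> sends \<open>Hp p\<close> into
  \<open>Hm p\<close>.\<close>

lemma im_P_alpha_sign_eq: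
  assumes d: "d \<in> Linf" "d * comp_alpha \<beta> d = 1" and \<epsilon>: "\<epsilon> * \<epsilon> = 1"
  shows "im_P_alpha_sign p \<beta> \<epsilon> d = {s \<in> Hp p. d * s = \<epsilon> *\<^sub>C J_alpha \<beta> s}"
proof (intro set_eqI iffI)
  have dL: "d * f \<in> Lp p" if "f \<in> Hp p" for f using that p d by (intro Lp_mult_Linf Hp_Lp)
  fix s assume "s \<in> im_P_alpha_sign p \<beta> \<epsilon> d"
  then obtain f where f: "f \<in> Hp p" "toeplitz p d f = 0" "s = P_alpha_sign p \<beta> \<epsilon> d f"
    by (auto simp: im_P_alpha_sign_def ker_Hp_def)
  have df: "d * f \<in> Hm p" using f d by (simp add: toeplitz_eq_0_iff[OF p] Hp_Lp[OF p])
  have s: "s = (1/2) *\<^sub>C (f + \<epsilon> *\<^sub>C J_alpha \<beta> (d * f))"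
    unfolding f(3) P_alpha_sign_def P_alpha_def by (simp add: proj_P_Hp[OF p] proj_P_id[OF p f(1)] proj_Q_id[OF p df])
  have "s \<in> Hp p" unfolding s using f(1) J_alpha_Hm[OF \<beta> p df] by (intro Hp_closed[OF p])
  moreover have "d * s = \<epsilon> *\<^sub>C J_alpha \<beta> s"
    unfolding s by (simp add: J_alpha_scaleC[OF \<beta>] J_alpha_add[OF \<beta>] J_alpha_J_alpha[OF \<beta>] distrib_left J_mult_inverse[OF d(2)]
        circ.scale_right_distrib \<epsilon> mult.left_commute[of \<epsilon>] mult.commute[of "1/2"] add.commute)
  ultimately show "s \<in> {s \<in> Hp p. d * s = \<epsilon> *\<^sub>C J_alpha \<beta> s}" by simp
next
  fix s assume "s \<in> {s \<in> Hp p. d * s = \<epsilon> *\<^sub>C J_alpha \<beta> s}"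
  then have s: "s \<in> Hp p" "d * s = \<epsilon> *\<^sub>C J_alpha \<beta> s" by auto
  have ds: "d * s \<in> Hm p" unfolding s(2) using s(1) by (intro Hm_closed[OF p] J_alpha_Hp[OF \<beta> p])
  have "toeplitz p d s = 0" using ds s(1) d by (simp add: toeplitz_eq_0_iff[OF p] Hp_Lp[OF p])
  moreover have "P_alpha_sign p \<beta> \<epsilon> d s = s"
  proof -
    have "P_alpha p \<beta> d s = J_alpha \<beta> (d * s)"
      unfolding P_alpha_def proj_P_id[OF p s(1)] proj_Q_id[OF p ds] ..
    then have "P_alpha p \<beta> d s = \<epsilon> *\<^sub>C s"
      unfolding s(2) by (simp add: J_alpha_scaleC[OF \<beta>] J_alpha_J_alpha[OF \<beta>])
    then have "P_alpha_sign p \<beta> \<epsilon> d s = (1/2) *\<^sub>C (s + s)" by (simp add: P_alpha_sign_def \<epsilon>)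
    also have "s + s = 2 *\<^sub>C s" using circ.scale_left_distrib[of 1 1 s] by simp
    finally show ?thesis by simp
  qed
  ultimately show "s \<in> im_P_alpha_sign p \<beta> \<epsilon> d"
    unfolding im_P_alpha_sign_def ker_Hp_def using s(1) by (intro image_eqI[of _ _ s]) auto
qed

lemma toeplitz_plus_hankel_eq:
  assumes "a \<in> Linf" "b \<in> Linf" "f \<in> Hp p"
  shows "toeplitz p a f + \<epsilon> *\<^sub>C hankel p \<beta> b f = proj_P p (a * f + \<epsilon> *\<^sub>C (b * J_alpha \<beta> f))"
proof -
  have J: "J_alpha \<beta> f \<in> Hm p" by (rule J_alpha_Hp[OF \<beta> p assms(3)])
  have L: "a * f \<in> Lp p" "b * J_alpha \<beta> f \<in> Lp p"
    by (intro Lp_mult_Linf p assms(1,2) Hp_Lp[OF p assms(3)] Hm_Lp[OF p J])+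
  show ?thesis
    unfolding toeplitz_def hankel_def proj_Q_id[OF p J]
    by (simp add: proj_P_add[OF p L(1) Lp_scaleC[OF p L(2)]] proj_P_scaleC[OF p L(2)])
qed

text \<open>Because \<open>J_alpha \<beta> f\<close> already lies in \<open>Hm p\<close>, a kernel
  element is one with \<open>a * f + \<epsilon> *\<^sub>C (b * J_alpha \<beta> f)\<close> in
  \<open>Hm p\<close>. Applying \<open>\<epsilon> J\<close> to this function produces
  \<open>s\<close> in \<open>Hp p\<close>, and the matching relation rewrites the link between
  \<open>f\<close> and \<open>s\<close> as two equations with the subordinated pair.\<close>

lemma kernel_toeplitz_plus_hankel:
  assumes a: "a \<in> Linf" "a dvd 1" and b: "b \<in> Linf" "b dvd 1"
    and match: "a * comp_alpha \<beta> a = b * comp_alpha \<beta> b" and \<epsilon>: "\<epsilon> * \<epsilon> = 1"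
  shows "ker_Hp p (\<lambda>f. toeplitz p a f + \<epsilon> *\<^sub>C hankel p \<beta> b f) =
    {f \<in> Hp p. \<exists>s\<in>Hp p. sub_d \<beta> a b * s = \<epsilon> *\<^sub>C J_alpha \<beta> s
       \<and> sub_c a b * f + \<epsilon> *\<^sub>C J_alpha \<beta> f = inverse (comp_alpha \<beta> a) * s}"
proof (intro set_eqI iffI)
  define a' b' where "a' = comp_alpha \<beta> a" and "b' = comp_alpha \<beta> b"
  have ua: "a * inverse a = 1" and ub: "b * inverse b = 1" and ua': "a' * inverse a' = 1"
    using circ_unit_inverse(1) a(2) b(2) comp_alpha_unit[OF \<beta> a(2)] by (auto simp: a'_def)
  fix f assume "f \<in> ker_Hp p (\<lambda>f. toeplitz p a f + \<epsilon> *\<^sub>C hankel p \<beta> b f)"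
  then have f: "f \<in> Hp p" and z: "proj_P p (a * f + \<epsilon> *\<^sub>C (b * J_alpha \<beta> f)) = 0"
    using toeplitz_plus_hankel_eq[OF a(1) b(1)] by (auto simp: ker_Hp_def)
  define h where "h = a * f + \<epsilon> *\<^sub>C (b * J_alpha \<beta> f)"
  have hL: "h \<in> Lp p" unfolding h_def
    by (intro Lp_add Lp_scaleC Lp_mult_Linf p a(1) b(1) Hp_Lp[OF p f] J_alpha_Lp[OF \<beta> p Hp_Lp[OF p f]])
  have hm: "h \<in> Hm p" using z hL proj_P_eq_0_iff[OF p hL] by (simp add: h_def)
  define s where "s = \<epsilon> *\<^sub>C J_alpha \<beta> h"
  have sH: "s \<in> Hp p" unfolding s_def using J_alpha_Hm[OF \<beta> p hm] by (intro Hp_closed[OF p])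
  have s: "s = \<epsilon> *\<^sub>C (a' * J_alpha \<beta> f) + b' * f"
    unfolding s_def h_def
    by (simp add: J_alpha_add[OF \<beta>] J_alpha_scaleC[OF \<beta>] J_alpha_mult[OF \<beta>] J_alpha_J_alpha[OF \<beta>] a'_def b'_def circ.scale_right_distrib \<epsilon>)
  have Js: "\<epsilon> *\<^sub>C J_alpha \<beta> s = h" by (simp add: s_def J_alpha_scaleC[OF \<beta>] J_alpha_J_alpha[OF \<beta>] \<epsilon>)
  have "sub_d \<beta> a b * s = \<epsilon> *\<^sub>C ((a' * inverse a') * (b * J_alpha \<beta> f)) + (b * b') * inverse a' * f"
    unfolding sub_d_def a'_def[symmetric] s by (simp add: distrib_left mult_ac)
  also have "(b * b') * inverse a' * f = (a' * inverse a') * (a * f)"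
    unfolding match[folded a'_def b'_def, symmetric] by (simp add: mult_ac)
  finally have 1: "sub_d \<beta> a b * s = \<epsilon> *\<^sub>C J_alpha \<beta> s" unfolding Js by (simp add: ua' h_def add.commute)
  have "inverse a' * s = \<epsilon> *\<^sub>C ((a' * inverse a') * J_alpha \<beta> f) + (inverse a' * b') * f"
    unfolding s by (simp add: distrib_left mult_ac)
  also have "inverse a' * b' = (b * b') * (inverse b * inverse a')" 
  proof -
    have "(b * b') * (inverse b * inverse a') = (b * inverse b) * (inverse a' * b')" by (simp only: mult_ac)
    then show ?thesis by (simp add: ub)
  qed
  also have "\<dots> = a * inverse b * (a' * inverse a')" unfolding match[folded a'_def b'_def, symmetric] by (simp add: mult_ac)
  finally have 2: "sub_c a b * f + \<epsilon> *\<^sub>C J_alpha \<beta> f = inverse (comp_alpha \<beta> a) * s"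
    by (simp add: ua' sub_c_def add.commute flip: a'_def)
  from f sH 1 2 show "f \<in> {f \<in> Hp p. \<exists>s\<in>Hp p. sub_d \<beta> a b * s = \<epsilon> *\<^sub>C J_alpha \<beta> s
       \<and> sub_c a b * f + \<epsilon> *\<^sub>C J_alpha \<beta> f = inverse (comp_alpha \<beta> a) * s}" by blast
next
  have ub: "b * inverse b = 1" using circ_unit_inverse(1) b(2) by auto
  fix f assume "f \<in> {f \<in> Hp p. \<exists>s\<in>Hp p. sub_d \<beta> a b * s = \<epsilon> *\<^sub>C J_alpha \<beta> s
       \<and> sub_c a b * f + \<epsilon> *\<^sub>C J_alpha \<beta> f = inverse (comp_alpha \<beta> a) * s}"
  then obtain s where f: "f \<in> Hp p" and s: "s \<in> Hp p" "sub_d \<beta> a b * s = \<epsilon> *\<^sub>C J_alpha \<beta> s"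
    "sub_c a b * f + \<epsilon> *\<^sub>C J_alpha \<beta> f = inverse (comp_alpha \<beta> a) * s" by blast
  \<comment> \<open>Multiplying the second equation by \<open>b\<close> restores
    \<open>a * f + \<epsilon> *\<^sub>C (b * J_alpha \<beta> f)\<close>, and the first equation
    places it in \<open>Hm p\<close>.\<close>
  have "b * (sub_c a b * f + \<epsilon> *\<^sub>C J_alpha \<beta> f) = (b * inverse b) * (a * f) + \<epsilon> *\<^sub>C (b * J_alpha \<beta> f)"
    by (simp add: sub_c_def distrib_left mult_ac)
  then have "a * f + \<epsilon> *\<^sub>C (b * J_alpha \<beta> f) = sub_d \<beta> a b * s" by (simp add: ub s(3) sub_d_def mult.assoc)
  also have "\<dots> \<in> Hm p" unfolding s(2) using s(1) by (intro Hm_closed[OF p] J_alpha_Hp[OF \<beta> p])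
  finally have "toeplitz p a f + \<epsilon> *\<^sub>C hankel p \<beta> b f = 0"
    by (simp add: toeplitz_plus_hankel_eq[OF a(1) b(1) f] proj_P_Hm[OF p])
  with f show "f \<in> ker_Hp p (\<lambda>f. toeplitz p a f + \<epsilon> *\<^sub>C hankel p \<beta> b f)" by (simp add: ker_Hp_def)
qed

text \<open>The equation says that \<open>f\<close> is fixed by the affine map taking
  \<open>h\<close> to \<open>\<epsilon> J (u - c h)\<close>. The condition on \<open>u\<close> makes
  this map an involution, so the midpoint of \<open>h\<close> and its image is fixed. The Toeplitz
  equation for \<open>h\<close> puts \<open>u - c h\<close> into \<open>Hm p\<close> and hence the
  image into \<open>Hp p\<close>.\<close>

lemma particular_solution:
  assumes c: "c \<in> Linf" "c * comp_alpha \<beta> c = 1" and \<epsilon>: "\<epsilon> * \<epsilon> = 1"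
    and u: "u \<in> Lp p" "c * J_alpha \<beta> u = \<epsilon> *\<^sub>C u" and h: "h \<in> Hp p" "toeplitz p c h = proj_P p u"
    and f: "f = (1/2) *\<^sub>C (h - \<epsilon> *\<^sub>C J_alpha \<beta> (proj_Q p (c * proj_P p h)) + \<epsilon> *\<^sub>C J_alpha \<beta> (proj_Q p u))"
  shows "f \<in> Hp p" "c * f + \<epsilon> *\<^sub>C J_alpha \<beta> f = u"
proof -
  have cL: "c * h \<in> Lp p" using c h p by (intro Lp_mult_Linf Hp_Lp)
  have QJ: "J_alpha \<beta> (proj_Q p v) \<in> Hp p" if "v \<in> Lp p" for v using that by (intro J_alpha_Hm[OF \<beta> p] proj_Q_Hm p)
  have Ph: "proj_P p h = h" by (rule proj_P_id[OF p h(1)])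
  show "f \<in> Hp p" unfolding f Ph by (intro Hp_closed[OF p] QJ h u cL)
  have "proj_Q p (c * h) - proj_Q p u = c * h - u"
    using h(2) by (simp add: proj_Q_def toeplitz_def)
  then have f': "f = (1/2) *\<^sub>C (h - \<epsilon> *\<^sub>C J_alpha \<beta> (c * h - u))"
    unfolding f Ph by (simp add: J_alpha_diff[OF \<beta>] circ.scale_right_diff_distrib algebra_simps flip: \<open>proj_Q p (c * h) - proj_Q p u = c * h - u\<close>)
  have 1: "c * J_alpha \<beta> (c * h - u) = J_alpha \<beta> h - \<epsilon> *\<^sub>C u"
    by (simp add: J_alpha_diff[OF \<beta>] right_diff_distrib J_mult_inverse[OF c(2)] u(2))
  have 2: "J_alpha \<beta> f = (1/2) *\<^sub>C (J_alpha \<beta> h - \<epsilon> *\<^sub>C (c * h - u))"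
    unfolding f' by (simp add: J_alpha_scaleC[OF \<beta>] J_alpha_diff[OF \<beta>, of h] J_alpha_J_alpha[OF \<beta>])
  have 3: "c * f = (1/2) *\<^sub>C (c * h - \<epsilon> *\<^sub>C J_alpha \<beta> h + u)"
    unfolding f' by (simp add: right_diff_distrib 1 circ.scale_right_diff_distrib circ.scale_right_distrib \<epsilon> algebra_simps)
  have 4: "\<epsilon> *\<^sub>C J_alpha \<beta> f = (1/2) *\<^sub>C (\<epsilon> *\<^sub>C J_alpha \<beta> h - (c * h - u))"
    unfolding 2 by (simp add: circ.scale_right_diff_distrib \<epsilon> mult.left_commute[of \<epsilon>] mult.commute[of "1/2"])
  have "c * f + \<epsilon> *\<^sub>C J_alpha \<beta> f = (1/2) *\<^sub>C (u + u)"
    unfolding 3 4 circ.scale_right_distrib[symmetric] by simp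
  also have "u + u = 2 *\<^sub>C u" using circ.scale_left_distrib[of 1 1 u] by simp
  finally show "c * f + \<epsilon> *\<^sub>C J_alpha \<beta> f = u" by simp
qed

section \<open>Bijective Toeplitz operators and index 0 or 1\<close>

definition bij_toeplitz :: "circ_fun \<Rightarrow> bool" where
  "bij_toeplitz g \<longleftrightarrow> (\<forall>f\<in>Hp p. toeplitz p g f = 0 \<longrightarrow> f = 0) \<and> (\<forall>y\<in>Hp p. \<exists>f\<in>Hp p. toeplitz p g f = y)"

text \<open>If \<open>w\<close> and its inverse preserve \<open>Hm p\<close>, then
  \<open>T(w g) = T(w) T(g)\<close>, and \<open>T(w)\<close> is invertible with inverse
  \<open>T(1 / w)\<close>.\<close>

lemma bij_toeplitz_mult:
  assumes w: "w \<in> Linf" "w dvd 1" "inverse w \<in> Linf"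
    and wm: "\<And>f. f \<in> Hm p \<Longrightarrow> w * f \<in> Hm p" "\<And>f. f \<in> Hm p \<Longrightarrow> inverse w * f \<in> Hm p"
    and g: "g \<in> Linf" "bij_toeplitz g"
  shows "bij_toeplitz (w * g)"
  unfolding bij_toeplitz_def
proof (intro conjI ballI impI)
  have wg: "w * g \<in> Linf" by (intro Linf_mult w g)
  note uw = circ_unit_inverse[OF w(2)]
  fix f assume f: "f \<in> Hp p" "toeplitz p (w * g) f = 0"
  then have "w * g * f \<in> Hm p" using toeplitz_eq_0_iff[OF p wg Hp_Lp[OF p]] by simp
  then have "inverse w * (w * g * f) \<in> Hm p" by (rule wm)
  then have "g * f \<in> Hm p" by (simp add: uw flip: mult.assoc)
  then have "toeplitz p g f = 0" using toeplitz_eq_0_iff[OF p g(1) Hp_Lp[OF p]] f(1) by simp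
  then show "f = 0" using g(2) f(1) by (simp add: bij_toeplitz_def)
next
  have wg: "w * g \<in> Linf" by (intro Linf_mult w g)
  note uw = circ_unit_inverse[OF w(2)]
  fix y assume y: "y \<in> Hp p"
  have wyL: "inverse w * y \<in> Lp p" using w y p by (intro Lp_mult_Linf Hp_Lp)
  then obtain f where f: "f \<in> Hp p" "toeplitz p g f = proj_P p (inverse w * y)"
    using g(2) proj_P_Hp[OF p] unfolding bij_toeplitz_def by blast
  have gfL: "g * f \<in> Lp p" using g f p by (intro Lp_mult_Linf Hp_Lp)
  define q where "q = proj_Q p (g * f) - proj_Q p (inverse w * y)"
  have q: "q \<in> Hm p" unfolding q_def by (intro Hm_closed[OF p] proj_Q_Hm p gfL wyL)
  have "g * f = inverse w * y + q" using f(2) by (simp add: q_def proj_Q_def toeplitz_def)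
  then have "w * g * f = y + w * q" by (simp add: mult.assoc distrib_left) (simp add: uw flip: mult.assoc)
  then have "toeplitz p (w * g) f = y"
    using y wm(1)[OF q] by (simp add: toeplitz_def proj_P_add[OF p] Hp_Lp[OF p] Hm_Lp[OF p] proj_P_id[OF p] proj_P_Hm[OF p])
  with f(1) show "\<exists>f\<in>Hp p. toeplitz p (w * g) f = y" by blast
qed

lemma toeplitz_tvar_power: "f \<in> Hp p \<Longrightarrow> toeplitz p (tvar ^ k) f = tvar ^ k * f"
  unfolding toeplitz_def by (intro proj_P_id p tvar_power_mult_Hp)

lemma toeplitz_shift:
  assumes g: "g \<in> Linf" and h: "h \<in> Hp p" and y: "y \<in> Hp p" and e: "toeplitz p (g * tvar ^ k) h = tvar ^ k * y"
  shows "toeplitz p g h = y"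
  unfolding toeplitz_def
proof (rule proj_P_eqI[OF p])
  show ghL: "g * h \<in> Lp p" using g h p by (intro Lp_mult_Linf Hp_Lp)
  show "y \<in> Lp p" using y by (rule Hp_Lp[OF p])
  fix n
  show "fourier y n = (if n \<ge> 0 then fourier (g * h) n else 0)"
  proof (cases "n \<ge> 0")
    case True
    have gk: "g * tvar ^ k \<in> Linf" using g by (intro Linf_mult Linf_power) auto
    have "fourier (g * h) n = fourier (tvar ^ k * (g * h)) (n + int k)" by (simp add: fourier_tvar_power_mult)
    also have "tvar ^ k * (g * h) = g * tvar ^ k * h" by (simp only: mult_ac)
    also have "fourier \<dots> (n + int k) = fourier (tvar ^ k * y) (n + int k)"
      using True fourier_toeplitz[OF p gk Hp_Lp[OF p h], of "n + int k"] e by simp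
    finally show ?thesis using True by (simp add: fourier_tvar_power_mult)
  qed (use y in \<open>simp add: Hp_def\<close>)
qed

text \<open>From \<open>T(g) = T(t ^ (- k)) T(g t ^ k)\<close> the inverse of the second factor,
  preceded by multiplication by \<open>t ^ k\<close>, is a right inverse. Its value at 0 is recorded
  because the maps \<open>\<phi>\<close> must send 0 to 0.\<close>

lemma toeplitz_rinv:
  assumes g: "g \<in> Linf" and ind: "index_Hp p (toeplitz p g) = int k" and bij: "bij_toeplitz (g * tvar ^ k)"
  shows "y \<in> Hp p \<Longrightarrow> toeplitz_rinv p g y \<in> Hp p" "y \<in> Hp p \<Longrightarrow> toeplitz p g (toeplitz_rinv p g y) = y"
    and "toeplitz_rinv p g 0 = 0"
proof -
  have gk: "g * tvar ^ k \<in> Linf" using g by (intro Linf_mult Linf_power) auto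
  have r: "toeplitz_rinv p g y = inv_into (Hp p) (toeplitz p (g * tvar ^ k)) (tvar ^ k * y)" if "y \<in> Hp p" for y
    using that by (simp add: toeplitz_rinv_def Let_def ind circ_powi_of_nat toeplitz_tvar_power)
  have im: "tvar ^ k * y \<in> toeplitz p (g * tvar ^ k) ` Hp p" if "y \<in> Hp p" for y
    using bij tvar_power_mult_Hp[OF p that, of k] unfolding bij_toeplitz_def by (metis imageI)
  show H: "toeplitz_rinv p g y \<in> Hp p" if "y \<in> Hp p" for y
    unfolding r[OF that] using im[OF that] by (rule inv_into_into)
  show "toeplitz p g (toeplitz_rinv p g y) = y" if "y \<in> Hp p" for y
  proof (rule toeplitz_shift[OF g H[OF that] that])
    show "toeplitz p (g * tvar ^ k) (toeplitz_rinv p g y) = tvar ^ k * y"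
      unfolding r[OF that] using im[OF that] by (rule f_inv_into_f)
  qed
  have "toeplitz p (g * tvar ^ k) (toeplitz_rinv p g 0) = 0"
    unfolding r[OF Hp_closed(1)[OF p]] using f_inv_into_f[OF im[OF Hp_closed(1)[OF p]]] by simp
  then show "toeplitz_rinv p g 0 = 0" using bij H[OF Hp_closed(1)[OF p]] by (auto simp: bij_toeplitz_def)
qed

lemma index_bij_toeplitz_0:
  assumes g: "g \<in> Linf" and bij: "bij_toeplitz g"
  shows "ker_Hp p (toeplitz p g) = {0}" "index_Hp p (toeplitz p g) = 0"
proof -
  show k: "ker_Hp p (toeplitz p g) = {0}"
    using bij Hp_closed(1)[OF p] toeplitz_0[OF p g] by (auto simp: ker_Hp_def bij_toeplitz_def)
  have "toeplitz p g ` Hp p = Hp p"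
    using bij toeplitz_range_Hp[OF p g] unfolding bij_toeplitz_def by (metis image_iff subsetI subset_antisym)
  then have "coker_Hp p (toeplitz p g) = {0}" by (rule coker_toeplitz_surj[OF p g])
  with k show "index_Hp p (toeplitz p g) = 0" by (simp only: index_Hp_def funct_dim_0 circ_dim_0)
qed

text \<open>Since \<open>T(g) (t f) = T(g t) f\<close>, the operator \<open>T(g)\<close> is
  bijective already on the functions of \<open>Hp p\<close> with mean 0, a subspace of codimension
  1. So it is onto and its kernel is a line.\<close>

lemma index_bij_toeplitz_1:
  assumes g: "g \<in> Linf" and bij: "bij_toeplitz (g * tvar)"
  shows "index_Hp p (toeplitz p g) = 1"
    and "\<And>z f. z \<in> ker_Hp p (toeplitz p g) \<Longrightarrow> z \<noteq> 0 \<Longrightarrow> f \<in> ker_Hp p (toeplitz p g) \<Longrightarrow> \<exists>w. f = w *\<^sub>C z"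
proof -
  have gt: "g * tvar \<in> Linf" using g by (intro Linf_mult) auto
  have tH: "tvar * f \<in> Hp p" if "f \<in> Hp p" for f using tvar_power_mult_Hp[OF p that, of 1] by simp
  have shift: "toeplitz p g (tvar * f) = toeplitz p (g * tvar) f" for f by (simp add: toeplitz_def mult.assoc)
  \<comment> \<open>A kernel element with mean 0 can be divided by \<open>tvar\<close> inside
    \<open>Hp p\<close>.\<close>
  have inj: "f = 0" if f: "f \<in> ker_Hp p (toeplitz p g)" "fourier f 0 = 0" for f
  proof -
    have fH: "f \<in> Hp p" "toeplitz p g f = 0" using f by (auto simp: ker_Hp_def)
    define h where "h = inverse tvar * f"
    have fh: "f = tvar * h" by (simp add: h_def flip: mult.assoc)
    have "fourier h n = 0" if "n < 0" for n
      using that fH(1) f(2) by (cases "n = -1") (auto simp: h_def fourier_inverse_tvar_mult Hp_def)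
    moreover have "h \<in> Lp p" unfolding h_def using p fH by (intro Lp_mult_Linf Hp_Lp) auto
    ultimately have hH: "h \<in> Hp p" by (simp add: Hp_def)
    have "toeplitz p (g * tvar) h = 0" using fH(2) shift fh by simp
    then have "h = 0" using bij hH by (simp add: bij_toeplitz_def)
    then show ?thesis by (simp add: fh)
  qed
  show one: "\<exists>w. f = w *\<^sub>C z" if z: "z \<in> ker_Hp p (toeplitz p g)" "z \<noteq> 0" and f: "f \<in> ker_Hp p (toeplitz p g)" for z f
  proof -
    have z0: "fourier z 0 \<noteq> 0" using inj z by blast
    define w where "w = fourier f 0 / fourier z 0"
    have H: "f \<in> Hp p" "z \<in> Hp p" "toeplitz p g f = 0" "toeplitz p g z = 0" using f z by (auto simp: ker_Hp_def)
    have wz: "w *\<^sub>C z \<in> Hp p" using H by (intro Hp_closed[OF p])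
    have "f - w *\<^sub>C z = 0"
    proof (rule inj)
      show "f - w *\<^sub>C z \<in> ker_Hp p (toeplitz p g)"
        using H wz by (simp add: ker_Hp_def Hp_closed[OF p] toeplitz_diff[OF p g] toeplitz_scaleC[OF p g] Hp_Lp[OF p])
      show "fourier (f - w *\<^sub>C z) 0 = 0"
        using H wz z0 by (simp add: fourier_diff[OF p] Hp_Lp[OF p] fourier_scaleC w_def)
    qed
    then show ?thesis by auto
  qed
  have oneH: "1 \<in> Hp p" using tvar_power_Hp[OF p, of 0] by simp
  \<comment> \<open>Correcting the constant 1 by \<open>tvar * f1\<close> gives a kernel element
    with mean 1, which is therefore nonzero.\<close>
  obtain f1 where f1: "f1 \<in> Hp p" "toeplitz p (g * tvar) f1 = toeplitz p g 1"
    using bij toeplitz_Hp[OF p g Hp_Lp[OF p oneH]] unfolding bij_toeplitz_def by blast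
  define z where "z = 1 - tvar * f1"
  have zk: "z \<in> ker_Hp p (toeplitz p g)"
    using tH[OF f1(1)] oneH f1(2) by (simp add: z_def ker_Hp_def Hp_closed[OF p] toeplitz_diff[OF p g] Hp_Lp[OF p] shift)
  have "fourier z 0 = 1"
    using f1(1) oneH tH[OF f1(1)] by (simp add: z_def fourier_diff[OF p] Hp_Lp[OF p] fourier_1 fourier_tvar_mult) (simp add: Hp_def)
  then have z0: "z \<noteq> 0" by auto
  have "circ.dim (ker_Hp p (toeplitz p g)) = 1"
  proof (rule circ.dim_unique[of "{z}"])
    show "ker_Hp p (toeplitz p g) \<subseteq> circ.span {z}"
      using one[OF zk z0] by (auto simp: circ.span_singleton)
    show "circ.independent {z}" using z0 by simp
  qed (use zk in auto)
  moreover have "toeplitz p g ` Hp p = Hp p"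
  proof
    show "Hp p \<subseteq> toeplitz p g ` Hp p"
    proof
      fix y assume "y \<in> Hp p"
      then obtain f where "f \<in> Hp p" "toeplitz p (g * tvar) f = y" using bij unfolding bij_toeplitz_def by blast
      then show "y \<in> toeplitz p g ` Hp p" using tH shift by (intro image_eqI[of _ _ "tvar * f"]) auto
    qed
  qed (rule toeplitz_range_Hp[OF p g])
  then have "coker_Hp p (toeplitz p g) = {0}" by (rule coker_toeplitz_surj[OF p g])
  ultimately show "index_Hp p (toeplitz p g) = 1" by (simp only: index_Hp_def funct_dim_0)
qed

text \<open>On the circle \<open>t / chi\<close> equals \<open>lam / (cnj \<beta> - 1 / t)\<close>:
  a function of \<open>1 / t\<close>, invertible among the bounded functions of non-positive
  frequencies. Its value at infinity \<open>lam / cnj \<beta>\<close> multiplies the coefficient at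
  -1.\<close>

lemma chi_shift:
  shows "tvar * inverse (chi \<beta>) \<in> Linf" "tvar * inverse (chi \<beta>) dvd 1" "inverse (tvar * inverse (chi \<beta>)) \<in> Linf"
    and "f \<in> Hm p \<Longrightarrow> tvar * inverse (chi \<beta>) * f \<in> Hm p" "f \<in> Hm p \<Longrightarrow> inverse (tvar * inverse (chi \<beta>)) * f \<in> Hm p"
    and "f \<in> Hm p \<Longrightarrow> fourier (tvar * inverse (chi \<beta>) * f) (-1) = lam \<beta> / cnj \<beta> * fourier f (-1)"
proof -
  have inv: "inverse (tvar * inverse (chi \<beta>)) = inverse tvar * chi \<beta>" by (simp add: circ_inverse_mult)
  show "tvar * inverse (chi \<beta>) \<in> Linf" by (intro Linf_mult inverse_chi_Linf[OF \<beta>]) auto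
  show "inverse (tvar * inverse (chi \<beta>)) \<in> Linf" unfolding inv by (intro Linf_mult chi_Linf[OF \<beta>]) auto
  have "tvar * inverse (chi \<beta>) * (inverse tvar * chi \<beta>) = (tvar * inverse tvar) * (inverse (chi \<beta>) * chi \<beta>)"
    by (simp only: mult_ac)
  also have "\<dots> = 1" by (simp add: circ_unit_inverse[OF chi_unit[OF \<beta>]])
  finally show "tvar * inverse (chi \<beta>) dvd 1" by (metis dvd_triv_left)
  show "tvar * inverse (chi \<beta>) * f \<in> Hm p" if "f \<in> Hm p" for f
    using inverse_chi_mult_Hm(2)[OF \<beta> p that] by (simp add: mult.assoc)
  show "inverse (tvar * inverse (chi \<beta>)) * f \<in> Hm p" if f: "f \<in> Hm p" for f
  proof -
    have fL: "f \<in> Lp p" using f by (rule Hm_Lp[OF p])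
    have L: "inverse tvar * (chi \<beta> * f) \<in> Lp p" by (intro Lp_mult_Linf p chi_Linf[OF \<beta>] fL) auto
    show ?thesis
      unfolding inv mult.assoc using L f by (auto simp: Hm_def fourier_inverse_tvar_mult fourier_chi_mult[OF \<beta> p])
  qed
  show "fourier (tvar * inverse (chi \<beta>) * f) (-1) = lam \<beta> / cnj \<beta> * fourier f (-1)" if f: "f \<in> Hm p" for f
  proof -
    define u where "u = inverse (chi \<beta>) * f"
    have u: "u \<in> Lp p" unfolding u_def using f by (intro Lp_mult_Linf p inverse_chi_Linf[OF \<beta>] Hm_Lp)
    have fu: "f = chi \<beta> * u" by (simp add: u_def circ_unit_inverse[OF chi_unit[OF \<beta>]] flip: mult.assoc)
    have u1: "fourier u (-1) = 0"
      unfolding u_def using f by (intro fourier_inverse_chi_mult[OF \<beta> p Hm_Lp[OF p], of _ 0]) (auto simp: Hm_def)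
    have "fourier f (-1) = cnj \<beta> * fourier u (-2) / lam \<beta>"
      using fourier_chi_mult[OF \<beta> p u, of "-1"] u1 by (simp flip: fu)
    moreover have "fourier (tvar * inverse (chi \<beta>) * f) (-1) = fourier u (-2)"
      by (simp add: mult.assoc fourier_tvar_mult flip: u_def)
    moreover have "cnj \<beta> \<noteq> 0" using \<beta> by auto
    ultimately show ?thesis using lam_nonzero[OF \<beta>] by simp
  qed
qed

lemma chi_shift_power:
  shows "(tvar * inverse (chi \<beta>)) ^ k \<in> Linf" "(tvar * inverse (chi \<beta>)) ^ k dvd 1" "inverse ((tvar * inverse (chi \<beta>)) ^ k) \<in> Linf"
    and "f \<in> Hm p \<Longrightarrow> (tvar * inverse (chi \<beta>)) ^ k * f \<in> Hm p" "f \<in> Hm p \<Longrightarrow> inverse ((tvar * inverse (chi \<beta>)) ^ k) * f \<in> Hm p"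
    and "f \<in> Hm p \<Longrightarrow> fourier ((tvar * inverse (chi \<beta>)) ^ k * f) (-1) = (lam \<beta> / cnj \<beta>) ^ k * fourier f (-1)"
proof -
  let ?w = "tvar * inverse (chi \<beta>)"
  show "?w ^ k \<in> Linf" "inverse (?w ^ k) \<in> Linf"
    unfolding circ_inverse_power by (intro Linf_power chi_shift)+
  show "?w ^ k dvd 1"
    using unit_power(1)[OF chi_shift(2), of k] by (metis dvd_triv_left)
  show m: "?w ^ k * f \<in> Hm p" if "f \<in> Hm p" for f k
    by (induction k) (use that in \<open>simp_all add: chi_shift(4) mult.assoc[of ?w]\<close>)
  show "inverse (?w ^ k) * f \<in> Hm p" if "f \<in> Hm p" for f
    unfolding circ_inverse_power by (induction k) (use that in \<open>simp_all add: chi_shift(5) mult.assoc[of "inverse ?w"]\<close>)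
  show "fourier (?w ^ k * f) (-1) = (lam \<beta> / cnj \<beta>) ^ k * fourier f (-1)" if f: "f \<in> Hm p" for f
  proof (induction k)
    case (Suc k)
    then show ?case using chi_shift(6)[OF m[OF f, of k]] by (simp only: power_Suc mult.assoc[of ?w "?w ^ k"] mult.assoc[of "lam \<beta> / cnj \<beta>"])
  qed simp
qed

end

section \<open>The signature and the kernel formula\<close>

lemma circ_unit_mult: "f dvd (1 :: circ_fun) \<Longrightarrow> g dvd 1 \<Longrightarrow> f * g dvd 1"
  using mult_dvd_mono[of f 1 g 1] by simp

lemma matching_subordinate:
  assumes \<beta>: "1 < norm \<beta>" and u: "a dvd 1" "b dvd 1" and match: "a * comp_alpha \<beta> a = b * comp_alpha \<beta> b"
  shows "sub_c a b * comp_alpha \<beta> (sub_c a b) = 1" "sub_d \<beta> a b * comp_alpha \<beta> (sub_d \<beta> a b) = 1"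
proof -
  have ab: "(a * comp_alpha \<beta> a) * inverse (a * comp_alpha \<beta> a) = 1" "(b * comp_alpha \<beta> b) * inverse (b * comp_alpha \<beta> b) = 1"
    using circ_unit_inverse(1)[OF u(1)] circ_unit_inverse(1)[OF u(2)]
      circ_unit_inverse(1)[OF comp_alpha_unit[OF \<beta> u(1)]] circ_unit_inverse(1)[OF comp_alpha_unit[OF \<beta> u(2)]]
    by (metis (no_types, lifting) circ_inverse_mult mult.assoc mult.commute mult_1)+
  have "sub_c a b * comp_alpha \<beta> (sub_c a b) = (a * comp_alpha \<beta> a) * inverse (b * comp_alpha \<beta> b)"
    by (simp add: sub_c_def comp_alpha_mult[OF \<beta>] comp_alpha_inverse[OF \<beta>] circ_inverse_mult mult_ac)
  then show "sub_c a b * comp_alpha \<beta> (sub_c a b) = 1" by (simp only: match ab)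
  have "sub_d \<beta> a b * comp_alpha \<beta> (sub_d \<beta> a b) = (b * comp_alpha \<beta> b) * inverse (a * comp_alpha \<beta> a)"
    by (simp add: sub_d_def comp_alpha_mult[OF \<beta>] comp_alpha_inverse[OF \<beta>] comp_alpha_comp_alpha[OF \<beta>] circ_inverse_mult mult_ac)
  then show "sub_d \<beta> a b * comp_alpha \<beta> (sub_d \<beta> a b) = 1" by (simp only: match[symmetric] ab)
qed

text \<open>The factorization shows that \<open>c' / c_+\<close> lies in \<open>Hm p\<close> with
  known coefficient at -1. Its image under \<open>J_alpha\<close> is again in the kernel, which is a
  line, and so equals \<open>\<sigma>\<close> times the inverse factor. Comparing the coefficient at
  -1 with the evaluation at \<open>1 / cnj \<beta>\<close> computes \<open>\<sigma>\<close>.\<close>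

lemma wiener_hopf_kernel:
  assumes p: "1 < p" and \<beta>: "1 < norm \<beta>"
    and c': "c' \<in> Linf" "c' * comp_alpha \<beta> c' = 1" "bij_toeplitz p (c' * tvar)"
    and cc: "c' = c * (inverse (chi \<beta>) ^ n * inverse (chi \<beta>) ^ n)"
    and ind: "index_Hp p (toeplitz p c) = 1 - 2 * int n" and n: "n > 0" and wh: "wiener_hopf p c gm gp"
  obtains \<sigma> where "\<sigma> * \<sigma> = 1" "inverse gp \<noteq> 0" "inverse gp \<in> ker_Hp p (toeplitz p c')"
    "c' * inverse gp = \<sigma> *\<^sub>C J_alpha \<beta> (inverse gp)"
    "(lam \<beta> / cnj \<beta>) powi (1 - 2 * int n) * disc_ext (inverse gp) (1 / cnj \<beta>) = \<sigma>"
proof -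
  define z where "z = inverse gp"
  have gp: "gp dvd 1" and zH: "z \<in> Hp p" and gm: "gm \<in> Hp_bar p" "fourier gm 0 = 1"
    and c: "c = gm * tvar powi (- index_Hp p (toeplitz p c)) * gp"
    using wh by (auto simp: wiener_hopf_def Let_def z_def)
  have z0: "z \<noteq> 0" unfolding z_def by (intro unit_nonzero circ_unit_inverse_dvd gp)
  define r where "r = lam \<beta> / cnj \<beta>"
  have r0: "r \<noteq> 0" using lam_nonzero[OF \<beta>] \<beta> by (auto simp: r_def)
  let ?x = "inverse (chi \<beta>)"
  \<comment> \<open>The normalisation of the minus factor at infinity becomes the coefficient 1 at
    frequency -1.\<close>
  define f0 where "f0 = inverse tvar * gm"
  have f0: "f0 \<in> Hm p" "fourier f0 (-1) = 1"
    using gm p by (auto simp: f0_def Hm_def Hp_bar_def fourier_inverse_tvar_mult intro!: Lp_mult_Linf)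
  define w where "w = c' * z"
  have w: "w = (tvar * ?x) ^ (2 * n) * f0"
  proof -
    \<comment> \<open>The exponent is odd; borrowing one factor \<open>tvar\<close> from
      \<open>f0\<close> makes it match the \<open>2 * n\<close> factors
      \<open>1 / chi\<close>.\<close>
    have e: "- index_Hp p (toeplitz p c) = int (2 * n - 1)" using ind n by simp
    have "c = gm * tvar ^ (2 * n - 1) * gp" using c unfolding e circ_powi_of_nat .
    then have "w = (gp * inverse gp) * (gm * tvar ^ (2 * n - 1) * (?x ^ n * ?x ^ n))"
      unfolding w_def cc z_def by (simp only: mult_ac)
    also have "\<dots> = (tvar * inverse tvar) * (gm * tvar ^ (2 * n - 1) * (?x ^ n * ?x ^ n))"
      by (simp only: circ_unit_inverse(1)[OF gp] tvar_inverse)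
    also have "\<dots> = (tvar * tvar ^ (2 * n - 1)) * (?x ^ n * ?x ^ n) * (inverse tvar * gm)" by (simp only: mult_ac)
    also have "tvar * tvar ^ (2 * n - 1) = tvar ^ (2 * n)" using n by (simp flip: power_Suc)
    also have "?x ^ n * ?x ^ n = ?x ^ (2 * n)" by (simp add: mult_2 power_add)
    finally show ?thesis by (simp add: power_mult_distrib f0_def)
  qed
  have wm: "w \<in> Hm p" unfolding w by (rule chi_shift_power(4)[OF p \<beta> f0(1)])
  have w1: "fourier w (-1) = r ^ (2 * n)" unfolding w chi_shift_power(6)[OF p \<beta> f0(1)] by (simp add: f0(2) r_def)
  have zk: "z \<in> ker_Hp p (toeplitz p c')"
    using wm zH by (simp add: ker_Hp_def toeplitz_eq_0_iff[OF p c'(1)] Hp_Lp[OF p] w_def)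
  have cJ: "c' * J_alpha \<beta> w = J_alpha \<beta> z" unfolding w_def by (rule J_mult_inverse[OF p \<beta> c'(2)])
  have JwH: "J_alpha \<beta> w \<in> Hp p" by (rule J_alpha_Hm[OF \<beta> p wm])
  have "J_alpha \<beta> w \<in> ker_Hp p (toeplitz p c')"
    using JwH J_alpha_Hp[OF \<beta> p zH] by (simp add: ker_Hp_def toeplitz_eq_0_iff[OF p c'(1)] Hp_Lp[OF p] cJ)
  then obtain \<sigma> where \<sigma>: "J_alpha \<beta> w = \<sigma> *\<^sub>C z"
    using index_bij_toeplitz_1(2)[OF p \<beta> c'(1,3) zk z0] by blast
  have wJ: "w = \<sigma> *\<^sub>C J_alpha \<beta> z"
    using arg_cong[OF \<sigma>, of "J_alpha \<beta>"] by (simp add: J_alpha_J_alpha[OF \<beta>] J_alpha_scaleC[OF \<beta>])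
  have Jz0: "J_alpha \<beta> z \<noteq> 0" using J_alpha_J_alpha[OF \<beta>, of z] J_alpha_0[OF \<beta>] z0 by auto
  have "J_alpha \<beta> z = \<sigma> *\<^sub>C w" using cJ unfolding \<sigma> by (simp add: w_def)
  then have "(\<sigma> * \<sigma>) *\<^sub>C J_alpha \<beta> z = 1 *\<^sub>C J_alpha \<beta> z" using wJ by simp
  then have ss: "\<sigma> * \<sigma> = 1" using Jz0 circ.scale_cancel_right by blast
  \<comment> \<open>The coefficient at -1 of \<open>w\<close>, known from the factorization, is
    carried by \<open>J_alpha\<close> to the functional that evaluates \<open>z\<close> at
    \<open>1 / cnj \<beta>\<close>.\<close>
  have "r ^ (2 * n) = fourier (?x * J_alpha \<beta> w) (-1)"
    using fourier_inverse_chi_J_alpha[OF \<beta> p Hm_Lp[OF p wm]] w1 by simp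
  also have "\<dots> = \<sigma> * fourier (?x * z) (-1)" unfolding \<sigma> by (simp add: fourier_scaleC)
  finally have "\<sigma> * r ^ (2 * n) = fourier (?x * z) (-1)" using ss by (simp flip: mult.assoc)
  then have D: "disc_ext z (1 / cnj \<beta>) = \<sigma> * r ^ (2 * n) / r"
    unfolding disc_ext_inverse_cnj[OF \<beta> p zH] by (simp add: r_def divide_inverse mult_ac)
  have "r powi (1 - 2 * int n) = r / r ^ (2 * n)"
    using r0 by (simp add: power_int_diff power_int_mult power_mult)
  then have "r powi (1 - 2 * int n) * disc_ext z (1 / cnj \<beta>) = \<sigma>" unfolding D using r0 by simp
  with ss z0 zk wJ show ?thesis using that[of \<sigma>] by (simp add: z_def w_def r_def)
qed

theorem theorem5p2:
  fixes p :: real and \<beta> \<epsilon> :: complex and a b c d :: circ_fun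
    and \<kappa>1 \<kappa>2 :: int and n :: nat
  assumes p: "1 < p"
    and \<beta>: "1 < norm \<beta>"
    and pair: "fredholm_matching_pair p \<beta> a b"
    and c: "c = sub_c a b"
    and d: "d = sub_d \<beta> a b"
    and \<kappa>1: "\<kappa>1 = index_Hp p (toeplitz p c)" "\<kappa>1 \<le> -1"
    and \<kappa>2: "\<kappa>2 = index_Hp p (toeplitz p d)" "\<kappa>2 \<ge> 1"
    and n: "0 \<le> 2 * int n + \<kappa>1" "2 * int n + \<kappa>1 \<le> 1"
    and \<epsilon>: "\<epsilon> \<in> {1, -1}"
  defines "\<phi> \<equiv> phi_alpha p \<beta> \<epsilon> (a * chi \<beta> powi (- int n)) (b * chi \<beta> powi (int n))"
    and "K \<equiv> ker_Hp p (\<lambda>f. toeplitz p a f + \<epsilon> *\<^sub>C hankel p \<beta> b f)"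
    and "Y \<equiv> toeplitz p (chi \<beta> powi (int n)) ` Hp p"
  shows "(odd \<kappa>1 \<longrightarrow> (\<forall>cm cp. wiener_hopf p c cm cp \<longrightarrow>
      (let U = {((1 - \<epsilon> * alpha_signature p \<beta> c) / 2 * w) *\<^sub>C inverse cp | w. w \<in> UNIV};
           V = \<phi> ` im_P_alpha_sign p \<beta> \<epsilon> d
       in U \<inter> V = {0} \<and>
          K = toeplitz p (chi \<beta> powi (- int n)) ` ({u + v | u v. u \<in> U \<and> v \<in> V} \<inter> Y))))
    \<and> (even \<kappa>1 \<longrightarrow>
      K = toeplitz p (chi \<beta> powi (- int n)) ` (\<phi> ` im_P_alpha_sign p \<beta> \<epsilon> d \<inter> Y))"
proof -
  have \<epsilon>\<epsilon>: "\<epsilon> * \<epsilon> = 1" using \<epsilon> by auto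
  define x xi where "x = chi \<beta>" and "xi = inverse (chi \<beta>)"
  have ux: "x dvd 1" and uxi: "x ^ n * xi ^ n = 1" "xi ^ n * x ^ n = 1" and xL: "x \<in> Linf" "xi \<in> Linf"
    using chi_unit[OF \<beta>] unit_power[OF chi_unit[OF \<beta>]] chi_Linf[OF \<beta>] inverse_chi_Linf[OF \<beta>] by (auto simp: x_def xi_def)
  have cx: "comp_alpha \<beta> x = xi" "comp_alpha \<beta> xi = x"
    by (simp_all add: x_def xi_def comp_alpha_chi[OF \<beta>] comp_alpha_inverse[OF \<beta>])
  have xH: "x ^ n * f \<in> Hp p" if "f \<in> Hp p" for f
    using that by (induction n) (auto simp: mult.assoc x_def intro!: chi_mult_Hp[OF \<beta> p])
  have aL: "a \<in> Linf" "b \<in> Linf" "Linf_invertible a" and match: "a * comp_alpha \<beta> a = b * comp_alpha \<beta> b"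
    and fred: "fredholm_Hp p (toeplitz p c)"
    using pair by (auto simp: fredholm_matching_pair_def matching_pair_def c)
  note ua = Linf_invertibleD[OF aL(3)]
  have uaa: "comp_alpha \<beta> a dvd 1" by (rule comp_alpha_unit[OF \<beta> ua(2)])
  have iaa: "inverse (comp_alpha \<beta> a) \<in> Linf"
    using comp_alpha_Linf[OF \<beta> ua(3)] by (simp add: comp_alpha_inverse[OF \<beta>])
  \<comment> \<open>The matching relation supplies an explicit bounded inverse of
    \<open>b\<close>.\<close>
  have binv: "b * (comp_alpha \<beta> b * (inverse a * inverse (comp_alpha \<beta> a))) = 1"
  proof -
    have "b * (comp_alpha \<beta> b * (inverse a * inverse (comp_alpha \<beta> a))) = (b * comp_alpha \<beta> b) * (inverse a * inverse (comp_alpha \<beta> a))"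
      by (simp only: mult_ac)
    also have "\<dots> = (a * inverse a) * (comp_alpha \<beta> a * inverse (comp_alpha \<beta> a))"
      unfolding match[symmetric] by (simp only: mult_ac)
    finally show ?thesis by (simp add: circ_unit_inverse[OF ua(2)] circ_unit_inverse[OF uaa])
  qed
  then have ub: "b dvd 1" by (metis dvd_triv_left)
  have ibL: "inverse b \<in> Linf"
    unfolding circ_mult_eq_1[OF binv, symmetric] by (intro Linf_mult comp_alpha_Linf[OF \<beta>] aL ua iaa)
  have cL: "c \<in> Linf" unfolding c sub_c_def by (intro Linf_mult aL ibL)
  have uc: "c dvd 1"
    unfolding c sub_c_def by (intro circ_unit_mult circ_unit_inverse_dvd ua(2) ub)

  \<comment> \<open>As \<open>alpha\<close> exchanges \<open>chi\<close> and \<open>1 / chi\<close>,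
    the added factors cancel in the matching relation and in \<open>d\<close>, while
    \<open>c\<close> acquires \<open>chi ^ (- 2 * n)\<close>.\<close>
  define a' b' where "a' = a * xi ^ n" and "b' = b * x ^ n"
  define c' where "c' = sub_c a' b'"
  define e where "e = inverse (comp_alpha \<beta> a')"
  have ab': "a * chi \<beta> powi (- int n) = a'" "b * chi \<beta> powi (int n) = b'"
    by (simp_all add: a'_def b'_def x_def xi_def circ_powi_neg circ_powi_of_nat)
  have a'L: "a' \<in> Linf" "b' \<in> Linf" unfolding a'_def b'_def by (intro Linf_mult Linf_power aL xL)+
  have ua': "a' dvd 1" "b' dvd 1"
    unfolding a'_def b'_def
    by (intro circ_unit_mult ua(2) ub dvdI[OF uxi(1)[symmetric]] dvdI[OF uxi(2)[symmetric]])+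
  have ca': "comp_alpha \<beta> a' = comp_alpha \<beta> a * x ^ n" and cb': "comp_alpha \<beta> b' = comp_alpha \<beta> b * xi ^ n"
    by (simp_all add: a'_def b'_def comp_alpha_mult[OF \<beta>] comp_alpha_power[OF \<beta>] cx)
  have match': "a' * comp_alpha \<beta> a' = b' * comp_alpha \<beta> b'"
  proof -
    have 1: "a' * comp_alpha \<beta> a' = (a * comp_alpha \<beta> a) * (x ^ n * xi ^ n)" unfolding ca' by (simp only: a'_def mult_ac)
    have 2: "b' * comp_alpha \<beta> b' = (b * comp_alpha \<beta> b) * (x ^ n * xi ^ n)" unfolding cb' by (simp only: b'_def mult_ac)
    show ?thesis unfolding 1 2 match ..
  qed
  note sub = matching_subordinate[OF \<beta> ua' match', folded c'_def]
  have ixn: "inverse (x ^ n) = xi ^ n" "inverse (xi ^ n) = x ^ n" by (simp_all add: circ_inverse_power x_def xi_def)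
  have d': "sub_d \<beta> a' b' = d"
  proof -
    have "sub_d \<beta> a' b' = (x ^ n * xi ^ n) * (b * inverse (comp_alpha \<beta> a))"
      unfolding sub_d_def ca' b'_def circ_inverse_mult ixn by (simp only: mult_ac)
    then show ?thesis by (simp add: uxi d sub_d_def)
  qed
  have c'c: "c' = c * (xi ^ n * xi ^ n)"
    unfolding c'_def sub_c_def a'_def b'_def circ_inverse_mult ixn c by (simp only: mult_ac)
  have c'L: "c' \<in> Linf" unfolding c'c by (intro Linf_mult Linf_power cL xL)
  have eL: "e \<in> Linf" unfolding e_def ca' circ_inverse_mult ixn by (intro Linf_mult Linf_power iaa xL)
  have dL: "d \<in> Linf" unfolding d sub_d_def by (intro Linf_mult aL iaa)
  have ue: "e dvd 1" unfolding e_def by (intro circ_unit_inverse_dvd comp_alpha_unit[OF \<beta>] ua')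

  define m where "m = nat (- \<kappa>1)"
  define k where "k = nat (2 * int n + \<kappa>1)"
  have mk: "m > 0" "\<kappa>1 = - int m" "2 * n = m + k" "k = 0 \<or> k = 1"
    using \<kappa>1(2) n by (auto simp: m_def k_def)
  have ind: "index_Hp p (toeplitz p c) = - int m" using \<kappa>1(1) mk(2) by simp
  have bij0: "bij_toeplitz p (inverse tvar ^ m * c)"
    using fredholm_negative_index[OF p cL uc fred ind mk(1)] by (auto simp: bij_toeplitz_def[OF p \<beta>])
  \<comment> \<open>Of the \<open>2 * n\<close> factors \<open>tvar\<close>, \<open>m\<close> cancel
    against \<open>inverse tvar ^ m\<close> and \<open>k\<close> remain.\<close>
  have "(tvar * xi) ^ (2 * n) * (inverse tvar ^ m * c) = c' * tvar ^ k"
  proof -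
    have "(tvar * xi) ^ (2 * n) = tvar ^ m * tvar ^ k * (xi ^ n * xi ^ n)"
      unfolding power_mult_distrib by (simp add: mk(3) power_add) (simp add: mult_2 power_add flip: mk(3) power_add)
    then have "(tvar * xi) ^ (2 * n) * (inverse tvar ^ m * c) = (tvar ^ m * inverse tvar ^ m) * (c' * tvar ^ k)"
      unfolding c'c by (simp only: mult_ac)
    then show ?thesis by (simp add: unit_power[OF tvar_unit])
  qed
  moreover have "bij_toeplitz p ((tvar * xi) ^ (2 * n) * (inverse tvar ^ m * c))"
    unfolding xi_def
    by (rule bij_toeplitz_mult[OF p \<beta> chi_shift_power(1-5)[OF p \<beta>] _ bij0]) (auto intro!: Linf_mult Linf_power cL)
  ultimately have bij: "bij_toeplitz p (c' * tvar ^ k)" by simp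
  have ind': "index_Hp p (toeplitz p c') = int k"
    using mk(4)
  proof
    assume "k = 0"
    then show ?thesis using bij index_bij_toeplitz_0(2)[OF p \<beta> c'L] by simp
  next
    assume "k = 1"
    then show ?thesis using bij index_bij_toeplitz_1(1)[OF p \<beta> c'L] by simp
  qed
  note rinv = toeplitz_rinv[OF p \<beta> c'L ind' bij]

  define S where "S = {s \<in> Hp p. d * s = \<epsilon> *\<^sub>C J_alpha \<beta> s}"
  define H where "H = {v \<in> Hp p. c' * v = - (\<epsilon> *\<^sub>C J_alpha \<beta> v)}"
  have dd: "d * comp_alpha \<beta> d = 1" using sub(2) by (simp add: d')
  have imP: "im_P_alpha_sign p \<beta> \<epsilon> d = S" unfolding S_def by (rule im_P_alpha_sign_eq[OF p \<beta> dL dd \<epsilon>\<epsilon>])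
  have \<phi>: "\<phi> s \<in> Hp p" "c' * \<phi> s + \<epsilon> *\<^sub>C J_alpha \<beta> (\<phi> s) = e * s" if s: "s \<in> S" for s
  proof -
    have sH: "s \<in> Hp p" and ds: "d * s = \<epsilon> *\<^sub>C J_alpha \<beta> s" using s by (auto simp: S_def)
    have esL: "e * s \<in> Lp p" using eL sH by (intro Lp_mult_Linf p Hp_Lp)
    have Js: "J_alpha \<beta> s = \<epsilon> *\<^sub>C (d * s)" unfolding ds by (simp add: \<epsilon>\<epsilon>)
    have "comp_alpha \<beta> e = inverse a'" by (simp add: e_def comp_alpha_inverse[OF \<beta>] comp_alpha_comp_alpha[OF \<beta>])
    \<comment> \<open>With \<open>c' = a' / b'\<close> and \<open>d = b' * e\<close> everything
      cancels; this is the compatibility condition of \<open>particular_solution\<close> for the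
      right-hand side \<open>e * s\<close>.\<close>
    then have "c' * J_alpha \<beta> (e * s) = \<epsilon> *\<^sub>C ((a' * inverse a') * (b' * inverse b') * (e * s))"
      unfolding J_alpha_mult[OF \<beta>] Js d'[symmetric] c'_def sub_c_def sub_d_def e_def[symmetric] by (simp add: mult_ac)
    then have ceq: "c' * J_alpha \<beta> (e * s) = \<epsilon> *\<^sub>C (e * s)" by (simp add: circ_unit_inverse[OF ua'(1)] circ_unit_inverse[OF ua'(2)])
    define h where "h = toeplitz_rinv p c' (toeplitz p e s)"
    have TeH: "toeplitz p e s \<in> Hp p" by (rule toeplitz_Hp[OF p eL Hp_Lp[OF p sH]])
    have h: "h \<in> Hp p" "toeplitz p c' h = proj_P p (e * s)"
      using rinv(1,2)[OF TeH] by (auto simp: h_def toeplitz_def)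
    have "\<phi> s = (1/2) *\<^sub>C (h - \<epsilon> *\<^sub>C J_alpha \<beta> (proj_Q p (c' * proj_P p h)) + \<epsilon> *\<^sub>C J_alpha \<beta> (proj_Q p (e * s)))"
      unfolding \<phi>_def phi_alpha_def ab' Let_def c'_def[symmetric] e_def[symmetric] h_def[symmetric] ..
    from particular_solution[OF p \<beta> c'L sub(1) \<epsilon>\<epsilon> esL ceq h this]
    show "\<phi> s \<in> Hp p" "c' * \<phi> s + \<epsilon> *\<^sub>C J_alpha \<beta> (\<phi> s) = e * s" by auto
  qed
  have S0: "0 \<in> S" using Hp_closed(1)[OF p] by (simp add: S_def J_alpha_0[OF \<beta>])
  \<comment> \<open>Needed for 0 to lie in the image of \<open>\<phi>\<close>, as the direct sum
    claims.\<close>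
  have \<phi>0: "\<phi> 0 = 0"
  proof -
    have "proj_P p 0 = 0" by (rule proj_P_id[OF p Hp_closed(1)[OF p]])
    then show ?thesis
      unfolding \<phi>_def phi_alpha_def ab' Let_def c'_def[symmetric]
      by (simp add: toeplitz_def rinv(3) proj_Q_def J_alpha_0[OF \<beta>])
  qed

  define K' where "K' = ker_Hp p (\<lambda>f. toeplitz p a' f + \<epsilon> *\<^sub>C hankel p \<beta> b' f)"
  have K'_iff: "f \<in> K' \<longleftrightarrow> f \<in> Hp p \<and> (\<exists>s\<in>S. c' * f + \<epsilon> *\<^sub>C J_alpha \<beta> f = e * s)" for f
    unfolding K'_def kernel_toeplitz_plus_hankel[OF p \<beta> a'L(1) ua'(1) a'L(2) ua'(2) match' \<epsilon>\<epsilon>] d' c'_def[symmetric] e_def[symmetric] S_def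
    by blast
  have K': "K' = {u + v | u v. u \<in> H \<and> v \<in> \<phi> ` S}"
  proof (intro set_eqI iffI)
    fix f assume "f \<in> K'"
    then obtain s where f: "f \<in> Hp p" and s: "s \<in> S" "c' * f + \<epsilon> *\<^sub>C J_alpha \<beta> f = e * s" by (auto simp: K'_iff)
    have "f - \<phi> s \<in> Hp p" using f \<phi>(1)[OF s(1)] by (intro Hp_closed[OF p])
    moreover have "c' * (f - \<phi> s) = - (\<epsilon> *\<^sub>C J_alpha \<beta> (f - \<phi> s))"
      using s(2) \<phi>(2)[OF s(1)] by (simp add: J_alpha_diff[OF \<beta>] circ.scale_right_diff_distrib algebra_simps)
    ultimately have "f - \<phi> s \<in> H" by (simp add: H_def)
    moreover have "f = (f - \<phi> s) + \<phi> s" by simp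
    ultimately show "f \<in> {u + v | u v. u \<in> H \<and> v \<in> \<phi> ` S}" using s(1) by blast
  next
    fix f assume "f \<in> {u + v | u v. u \<in> H \<and> v \<in> \<phi> ` S}"
    then obtain v s where f: "f = v + \<phi> s" "v \<in> H" "s \<in> S" by blast
    have v: "v \<in> Hp p" "c' * v = - (\<epsilon> *\<^sub>C J_alpha \<beta> v)" using f(2) by (auto simp: H_def)
    have "c' * f + \<epsilon> *\<^sub>C J_alpha \<beta> f = c' * \<phi> s + \<epsilon> *\<^sub>C J_alpha \<beta> (\<phi> s)"
      unfolding f(1) by (simp add: distrib_left v(2) J_alpha_add[OF \<beta>] circ.scale_right_distrib)
    then show "f \<in> K'" using v(1) \<phi>[OF f(3)] f by (auto simp: K'_iff intro: Hp_closed[OF p])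
  qed
  \<comment> \<open>The value \<open>\<phi> s\<close> determines \<open>e * s\<close> through the
    inhomogeneous equation, and on \<open>H\<close> the left-hand side of that equation
    vanishes.\<close>
  have direct: "H \<inter> \<phi> ` S = {0}"
  proof -
    have "y = 0" if y: "y \<in> H" "y \<in> \<phi> ` S" for y
    proof -
      obtain s where s: "s \<in> S" "y = \<phi> s" using y(2) by blast
      have "e * s = 0" using \<phi>(2)[OF s(1)] y(1) s(2) by (simp add: H_def)
      then have "s = 0" using circ_unit_cancel[OF ue, of s 0] by simp
      then show ?thesis using s(2) \<phi>0 by simp
    qed
    moreover have "0 \<in> H" using Hp_closed(1)[OF p] by (simp add: H_def J_alpha_0[OF \<beta>])
    moreover have "0 \<in> \<phi> ` S" using S0 \<phi>0 by (metis imageI)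
    ultimately show ?thesis by blast
  qed

  have Tx: "toeplitz p (x ^ n) f = x ^ n * f" if "f \<in> Hp p" for f
    unfolding toeplitz_def using xH[OF that] by (rule proj_P_id[OF p])
  have Txi: "toeplitz p (xi ^ n) (x ^ n * f) = f" if "f \<in> Hp p" for f
  proof -
    have "xi ^ n * (x ^ n * f) = f" by (simp add: uxi flip: mult.assoc)
    then show ?thesis unfolding toeplitz_def using proj_P_id[OF p that] by simp
  qed
  \<comment> \<open>In the first term \<open>xi ^ n\<close> from \<open>a'\<close> cancels
    \<open>x ^ n\<close>; in the second, \<open>J_alpha\<close> turns \<open>x ^ n\<close> into
    \<open>xi ^ n\<close>, which meets \<open>x ^ n\<close> from \<open>b'\<close>. So the functions
    to be projected are equal.\<close>
  have op: "x ^ n * f \<in> K' \<longleftrightarrow> f \<in> K" if f: "f \<in> Hp p" for f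
  proof -
    have "a' * (x ^ n * f) = (x ^ n * xi ^ n) * (a * f)" unfolding a'_def by (simp only: mult_ac)
    moreover have "b' * J_alpha \<beta> (x ^ n * f) = (x ^ n * xi ^ n) * (b * J_alpha \<beta> f)"
      unfolding b'_def J_alpha_mult[OF \<beta>] comp_alpha_power[OF \<beta>] cx by (simp only: mult_ac)
    ultimately show ?thesis
      using f xH[OF f] unfolding K'_def K_def ker_Hp_def
      by (simp add: toeplitz_plus_hankel_eq[OF p \<beta>] a'L aL uxi)
  qed
  have Ypow: "Y = (\<lambda>f. x ^ n * f) ` Hp p"
    unfolding Y_def circ_powi_of_nat x_def[symmetric] using Tx by (intro image_cong) auto
  have main: "K = toeplitz p (chi \<beta> powi (- int n)) ` (K' \<inter> Y)"
    unfolding circ_powi_neg xi_def[symmetric]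
  proof (intro set_eqI iffI)
    fix f assume f: "f \<in> K"
    then have fH: "f \<in> Hp p" by (simp add: K_def ker_Hp_def)
    then have "x ^ n * f \<in> K' \<inter> Y" using op f by (auto simp: Ypow)
    then show "f \<in> toeplitz p (xi ^ n) ` (K' \<inter> Y)" using Txi[OF fH] by (metis imageI)
  next
    fix f assume "f \<in> toeplitz p (xi ^ n) ` (K' \<inter> Y)"
    then obtain g where g: "g \<in> Hp p" "x ^ n * g \<in> K'" "f = toeplitz p (xi ^ n) (x ^ n * g)" by (auto simp: Ypow)
    then show "f \<in> K" using Txi[OF g(1)] op[OF g(1)] by simp
  qed

  have H_ker: "H \<subseteq> ker_Hp p (toeplitz p c')"
  proof
    fix v assume v: "v \<in> H"
    then have "c' * v = (- \<epsilon>) *\<^sub>C J_alpha \<beta> v" "v \<in> Hp p" by (auto simp: H_def)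
    moreover have "(- \<epsilon>) *\<^sub>C J_alpha \<beta> v \<in> Hm p" using v by (intro Hm_closed[OF p] J_alpha_Hp[OF \<beta> p]) (simp add: H_def)
    ultimately show "v \<in> ker_Hp p (toeplitz p c')" using toeplitz_eq_0_iff[OF p c'L Hp_Lp[OF p, of v]] by (simp add: ker_Hp_def)
  qed

  show ?thesis
  proof (intro conjI impI allI)
    assume "even \<kappa>1"
    \<comment> \<open>From \<open>2 * n = m + k\<close> the number \<open>k\<close> has the parity
      of \<open>\<kappa>1\<close>.\<close>
    then have k0: "k = 0" using mk by presburger
    have "ker_Hp p (toeplitz p c') = {0}" using index_bij_toeplitz_0(1)[OF p \<beta> c'L] bij k0 by simp
    then have "H = {0}" using H_ker direct by blast
    then have "K' = \<phi> ` S" unfolding K' by auto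
    then show "K = toeplitz p (chi \<beta> powi (- int n)) ` (\<phi> ` im_P_alpha_sign p \<beta> \<epsilon> d \<inter> Y)" using main imP by simp
  next
    fix cm cp assume "odd \<kappa>1" and wh: "wiener_hopf p c cm cp"
    then have k1: "k = 1" using mk by presburger
    have ind1: "index_Hp p (toeplitz p c) = 1 - 2 * int n" using ind mk(3) k1 by linarith
    have n0: "n > 0" using mk k1 by linarith
    have bij1: "bij_toeplitz p (c' * tvar)" using bij k1 by simp
    note whk = wiener_hopf_kernel[OF p \<beta> c'L sub(1) bij1 c'c[unfolded xi_def] ind1 n0]
    define z where "z = inverse cp"
    obtain \<sigma> where \<sigma>: "\<sigma> * \<sigma> = 1" "z \<noteq> 0" "z \<in> ker_Hp p (toeplitz p c')" "c' * z = \<sigma> *\<^sub>C J_alpha \<beta> z"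
      "(lam \<beta> / cnj \<beta>) powi (1 - 2 * int n) * disc_ext z (1 / cnj \<beta>) = \<sigma>"
      using whk[OF wh] unfolding z_def by blast
    have line: "\<exists>w. f = w *\<^sub>C z" if "f \<in> ker_Hp p (toeplitz p c')" for f
      by (rule index_bij_toeplitz_1(2)[OF p \<beta> c'L bij1 \<sigma>(3,2) that])
    have Jz0: "J_alpha \<beta> z \<noteq> 0" using J_alpha_J_alpha[OF \<beta>, of z] J_alpha_0[OF \<beta>] \<sigma>(2) by auto
    have sign: "alpha_signature p \<beta> c = \<sigma>"
      unfolding alpha_signature_def ind1
    \<comment> \<open>The definite description ranges over all factorizations, so uniqueness
      requires \<open>wiener_hopf_kernel\<close> for a second one. A scalar multiple of
      \<open>z\<close> satisfies the same homogeneous relation and yields the same sign.\<close>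
    proof (rule the_equality)
      show "\<exists>gm gp. wiener_hopf p c gm gp \<and> \<sigma> = (lam \<beta> / cnj \<beta>) powi (1 - 2 * int n) * disc_ext (inverse gp) (1 / cnj \<beta>)"
        using wh \<sigma>(5) unfolding z_def by blast
      fix \<tau> assume "\<exists>gm gp. wiener_hopf p c gm gp \<and> \<tau> = (lam \<beta> / cnj \<beta>) powi (1 - 2 * int n) * disc_ext (inverse gp) (1 / cnj \<beta>)"
      then obtain gm gp where gp: "wiener_hopf p c gm gp" "\<tau> = (lam \<beta> / cnj \<beta>) powi (1 - 2 * int n) * disc_ext (inverse gp) (1 / cnj \<beta>)" by blast
      obtain \<tau>' where \<tau>': "inverse gp \<noteq> 0" "inverse gp \<in> ker_Hp p (toeplitz p c')" "c' * inverse gp = \<tau>' *\<^sub>C J_alpha \<beta> (inverse gp)"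
        "(lam \<beta> / cnj \<beta>) powi (1 - 2 * int n) * disc_ext (inverse gp) (1 / cnj \<beta>) = \<tau>'"
        using whk[OF gp(1)] by blast
      obtain w where w: "inverse gp = w *\<^sub>C z" using line[OF \<tau>'(2)] by blast
      have w0: "w \<noteq> 0" using \<tau>'(1) w by auto
      have "(w * \<sigma>) *\<^sub>C J_alpha \<beta> z = (\<tau>' * w) *\<^sub>C J_alpha \<beta> z"
        using \<tau>'(3) \<sigma>(4) unfolding w by (simp add: J_alpha_scaleC[OF \<beta>])
      then have "w * \<sigma> = \<tau>' * w" using Jz0 circ.scale_cancel_right by blast
      then show "\<tau> = \<sigma>" using w0 gp(2) \<tau>'(4) by simp
    qed
    define U where "U = {((1 - \<epsilon> * alpha_signature p \<beta> c) / 2 * w) *\<^sub>C inverse cp | w. w \<in> UNIV}"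
    \<comment> \<open>A multiple \<open>w *\<^sub>C z\<close> lies in \<open>H\<close> iff
      \<open>w * \<sigma> = - (\<epsilon> * w)\<close>. The factor
      \<open>(1 - \<epsilon> * \<sigma>) / 2\<close> is 1 when
      \<open>\<sigma> = - \<epsilon>\<close> and 0 when \<open>\<sigma> = \<epsilon>\<close>, so it
      selects either the whole line or 0.\<close>
    have UH: "U = H"
    proof (intro set_eqI iffI)
      fix v assume "v \<in> U"
      then obtain w where w: "v = ((1 - \<epsilon> * \<sigma>) / 2 * w) *\<^sub>C z" by (auto simp: U_def sign z_def)
      define s where "s = (1 - \<epsilon> * \<sigma>) / 2 * w"
      have "(1 - \<epsilon> * \<sigma>) * \<sigma> = \<sigma> - \<epsilon> * (\<sigma> * \<sigma>)" "\<epsilon> * (1 - \<epsilon> * \<sigma>) = \<epsilon> - (\<epsilon> * \<epsilon>) * \<sigma>" by (simp_all add: algebra_simps)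
      then have "(1 - \<epsilon> * \<sigma>) * \<sigma> = - (\<epsilon> * (1 - \<epsilon> * \<sigma>))" by (simp add: \<sigma>(1) \<epsilon>\<epsilon>)
      moreover have "s * \<sigma> = ((1 - \<epsilon> * \<sigma>) * \<sigma>) * (w / 2)" "- (\<epsilon> * s) = (- (\<epsilon> * (1 - \<epsilon> * \<sigma>))) * (w / 2)"
        by (simp_all add: s_def)
      ultimately have ss: "s * \<sigma> = - (\<epsilon> * s)" by (simp only:)
      have "c' * v = (s * \<sigma>) *\<^sub>C J_alpha \<beta> z" unfolding w s_def[symmetric] by (simp add: \<sigma>(4))
      also have "\<dots> = - (\<epsilon> *\<^sub>C J_alpha \<beta> v)" unfolding w s_def[symmetric] ss by (simp add: J_alpha_scaleC[OF \<beta>])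
      finally show "v \<in> H" using \<sigma>(3) unfolding H_def w by (simp add: ker_Hp_def Hp_closed[OF p])
    next
      fix v assume v: "v \<in> H"
      then obtain w where w: "v = w *\<^sub>C z" using line H_ker by blast
      have "(w * \<sigma>) *\<^sub>C J_alpha \<beta> z = (- (\<epsilon> * w)) *\<^sub>C J_alpha \<beta> z"
        using v \<sigma>(4) unfolding H_def w by (simp add: J_alpha_scaleC[OF \<beta>])
      then have "w * \<sigma> = - (\<epsilon> * w)" using Jz0 circ.scale_cancel_right by blast
      then have "\<epsilon> * (w * \<sigma>) = - ((\<epsilon> * \<epsilon>) * w)" by simp
      then have "(1 - \<epsilon> * \<sigma>) / 2 * w = w" by (simp add: \<epsilon>\<epsilon> field_simps)
      then have "v = ((1 - \<epsilon> * alpha_signature p \<beta> c) / 2 * w) *\<^sub>C inverse cp" unfolding sign w z_def by simp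
      then show "v \<in> U" unfolding U_def by blast
    qed
    show "let U = {((1 - \<epsilon> * alpha_signature p \<beta> c) / 2 * w) *\<^sub>C inverse cp | w. w \<in> UNIV};
           V = \<phi> ` im_P_alpha_sign p \<beta> \<epsilon> d
       in U \<inter> V = {0} \<and> K = toeplitz p (chi \<beta> powi (- int n)) ` ({u + v | u v. u \<in> U \<and> v \<in> V} \<inter> Y)"
      unfolding Let_def U_def[symmetric] UH imP using direct main K' by simp
  qed
qed

end
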